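(* Let $T:\hat{\mathbb C}\to\hat{\mathbb C}$ be a rational function, and let $\mathbf K$ and $\mathbf L$ denote its Julia set and radial Julia set. Let $\delta=\mathrm{HD}(\mathbf L)$ and $k=\mathrm{TD}(\mathbf K)$, assume $k\ge1$ and $\mathcal H^\delta(\mathbf K\setminus\mathbf L)=0$. Then either $\delta>k$, or: if $k=1$, $\mathbf K$ is a generalized circle or an arc of a generalized circle; if $k=2$, $\mathbf K=\hat{\mathbb C}$.
   Context: $\mathcal H^s$ is $s$-dimensional Hausdorff measure (spherical metric), $\mathrm{HD}$ Hausdorff dimension, $\mathrm{TD}$ topological dimension. The Julia set is the complement of the largest open set on which the iterates $(T^n)_{n\ge0}$ form a normal family. The radial Julia set is the set of $p\in\hat{\mathbb C}$ for which there exist $\epsilon>0$ and $n_j\to\infty$ such that for each $j$ there is an inverse branch $\phi_j$ of $T^{n_j}$ defined on the spherical ball $B(T^{n_j}(p),\epsilon)$ with $\phi_j(T^{n_j}(p))=p$, and $\mathrm{diam}\,\phi_j(B(T^{n_j}(p),\epsilon))\to0$. A generalized circle is a round circle or a line (with $\infty$) in $\hat{\mathbb C}$. *)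

theory Defs
  imports "HOL-Analysis.Analysis" "HOL-Computational_Algebra.Polynomial"
begin

abbreviation riemann_sphere :: "(complex \<times> real) set" where
  "riemann_sphere \<equiv> sphere 0 1"

text \<open>Inverse stereographic projection; None plays the role of infinity.
  The metric used is the chordal metric (restriction of the Euclidean
  metric of R^3), bi-Lipschitz equivalent to the spherical metric.\<close>
definition stereo :: "complex option \<Rightarrow> complex \<times> real" where
  "stereo w = (case w of None \<Rightarrow> (0, 1)
     | Some z \<Rightarrow> (2 * z / complex_of_real (1 + (cmod z)\<^sup>2),
                  ((cmod z)\<^sup>2 - 1) / ((cmod z)\<^sup>2 + 1)))"

definition rat_fun :: "complex poly \<Rightarrow> complex poly \<Rightarrow> complex option \<Rightarrow> complex option" where
  "rat_fun p q w = (case w of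
     Some z \<Rightarrow> (if poly q z = 0 then None else Some (poly p z / poly q z))
   | None \<Rightarrow> (if degree p > degree q then None
              else if degree p = degree q then Some (lead_coeff p / lead_coeff q)
              else Some 0))"

definition sphere_map :: "complex poly \<Rightarrow> complex poly \<Rightarrow> complex \<times> real \<Rightarrow> complex \<times> real" where
  "sphere_map p q = stereo \<circ> rat_fun p q \<circ> inv_into UNIV stereo"

definition normal_iterates_on :: "('a::metric_space \<Rightarrow> 'a) \<Rightarrow> 'a set \<Rightarrow> bool" where
  "normal_iterates_on T U \<longleftrightarrow>
     (\<forall>m :: nat \<Rightarrow> nat. \<exists>r g. strict_mono r \<and>
        (\<forall>K. compact K \<and> K \<subseteq> U \<longrightarrow> uniform_limit K (\<lambda>j. (T ^^ m (r j))) g sequentially))"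

definition fatou_set :: "('a::metric_space \<Rightarrow> 'a) \<Rightarrow> 'a set \<Rightarrow> 'a set" where
  "fatou_set T X = {x \<in> X. \<exists>U. openin (top_of_set X) U \<and> x \<in> U \<and> normal_iterates_on T U}"

definition julia_set :: "('a::metric_space \<Rightarrow> 'a) \<Rightarrow> 'a set \<Rightarrow> 'a set" where
  "julia_set T X = X - fatou_set T X"

definition radial_julia_set :: "('a::metric_space \<Rightarrow> 'a) \<Rightarrow> 'a set \<Rightarrow> 'a set" where
  "radial_julia_set T X = {p \<in> X. \<exists>\<epsilon>>0. \<exists>n :: nat \<Rightarrow> nat. \<exists>\<phi> :: nat \<Rightarrow> 'a \<Rightarrow> 'a.
     strict_mono n \<and>
     (\<forall>j. continuous_on (X \<inter> ball ((T ^^ n j) p) \<epsilon>) (\<phi> j) \<and>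
          \<phi> j ` (X \<inter> ball ((T ^^ n j) p) \<epsilon>) \<subseteq> X \<and>
          (\<forall>y \<in> X \<inter> ball ((T ^^ n j) p) \<epsilon>. (T ^^ n j) (\<phi> j y) = y) \<and>
          \<phi> j ((T ^^ n j) p) = p) \<and>
     ((\<lambda>j. diameter (\<phi> j ` (X \<inter> ball ((T ^^ n j) p) \<epsilon>))) \<longlonglongrightarrow> 0)}"

definition haus_term :: "real \<Rightarrow> 'a::metric_space set \<Rightarrow> ennreal" where
  "haus_term s V = (if V = {} then 0 else if s = 0 then 1 else ennreal (diameter V powr s))"

definition haus_pre :: "'a::metric_space set \<Rightarrow> real \<Rightarrow> real \<Rightarrow> 'a set \<Rightarrow> ennreal" where
  "haus_pre X s d A = (INF U \<in> {U :: nat \<Rightarrow> 'a set. A \<subseteq> (\<Union>i. U i) \<and>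
       (\<forall>i. U i \<subseteq> X \<and> bounded (U i) \<and> diameter (U i) \<le> d)}. (\<Sum>i. haus_term s (U i)))"

definition hausdorff_measure :: "'a::metric_space set \<Rightarrow> real \<Rightarrow> 'a set \<Rightarrow> ennreal" where
  "hausdorff_measure X s A = (SUP d \<in> {0<..}. haus_pre X s d A)"

definition hausdorff_dim :: "'a::metric_space set \<Rightarrow> 'a set \<Rightarrow> real" where
  "hausdorff_dim X A = Inf {s. 0 \<le> s \<and> hausdorff_measure X s A = 0}"

text \<open>ind_le n X means ind X \<le> n - 1.\<close>
fun ind_le :: "nat \<Rightarrow> 'a::topological_space set \<Rightarrow> bool" where
  "ind_le 0 X = (X = {})"
| "ind_le (Suc n) X = (\<forall>x\<in>X. \<forall>V. openin (top_of_set X) V \<and> x \<in> V \<longrightarrow>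
      (\<exists>U. openin (top_of_set X) U \<and> x \<in> U \<and> U \<subseteq> V \<and> ind_le n (X \<inter> closure U - U)))"

definition has_top_dim :: "'a::topological_space set \<Rightarrow> int \<Rightarrow> bool" where
  "has_top_dim X k \<longleftrightarrow> k \<ge> -1 \<and> ind_le (nat (k + 1)) X \<and> (k \<ge> 0 \<longrightarrow> \<not> ind_le (nat k) X)"

definition gen_circle :: "complex option set \<Rightarrow> bool" where
  "gen_circle C \<longleftrightarrow>
     (\<exists>a r. r > 0 \<and> C = Some ` sphere a r) \<or>
     (\<exists>a b. b \<noteq> 0 \<and> C = insert None (Some ` {a + complex_of_real t * b | t. True}))"

end

theory Submission
  imports Defs "HOL-Complex_Analysis.Complex_Analysis" "HOL-Computational_Algebra.Field_as_Ring"
    "HOL-Computational_Algebra.Polynomial_Factorial" "HOL-Computational_Algebra.Fundamental_Theorem_Algebra"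
begin

text \<open>Assume that the dimension of the radial set L is at most k. If k = 2, the Julia set J has interior,
 because a planar set without interior has inductive dimension at most 1, and hence J is the sphere.

 Let k = 1. If L had infinite length, finitely many disjoint pullbacks of a disc would generate an iterated
 function system with limit set in L of dimension greater than 1; so J has finite length. Almost everywhere
 its upper density is at most 1, and blowing up by inverse branches of bounded distortion yields a
 conformal chart in which the length of J inside a set never exceeds the diameter of the set. There continua are
 segments, so some disc, parametrized by h on the unit disc, meets J exactly in the image of the diameter.
 Let w be a coordinate of the n-th iterate composed with h, with zero and pole at points of J. Its zeros and
 poles are real, so cnj (w (cnj z)) / w z is holomorphic and zero-free, with logarithm bounded in mean
 independently of n since arcs have bounded potential. It takes one value at very many points, namely at the
 preimages of a point of J, and is therefore almost constant. In the limit cross-ratios on J are real.\<close>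

section \<open>Hausdorff measure\<close>

text \<open>The dimension enters only through null sets: with HD(L) <= k, \<open>hm RS s\<close>
  vanishes on L for all s > k, and on K - L for s = k. For k = 1 the obstacle is that finite length
  alone gives no smoothness, and that length is not continuous under limits of maps. Two choices
  answer this. Density is taken over all closed bounded sets near a point, not over discs, since a
  bound of length by diameter for every compact set is what makes continua straight. And the
  rescaled branches are compared with their limit by relative errors of increments, which control
  lengths and diameters alike. A straight piece cannot simply be pushed forward, as iterates are not
  injective; the reflected quotient needs no parametrization of the whole of J. Its bound K depends
  only on the arcs in which the auxiliary zero and pole may lie, while the number of coincidences is
  at choice, so the error (exp (16 * K) + 1) / 3 ^ card X is as small as desired. The kernel d powr
  (-1/2) of the chordal distance serves because it dominates the logarithm and is integrable along
  an arc.\<close>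

abbreviation (input) "hm \<equiv> hausdorff_measure"
abbreviation (input) iff' (infixr "<->" 25) where "A <-> B \<equiv> A = (B::bool)"
abbreviation (input) "locunif U F g \<equiv> ALL K. compact K & K <= U --> uniform_limit K F g sequentially"
lemmas hol_cont = holomorphic_on_imp_continuous_on
lemmas compact_image = compact_continuous_image

lemma diameter_leI: assumes "0 <= d" "!!x y. x : S ==> y : S ==> dist x y <= d"
 shows "diameter S <= d" using assms by (auto simp: diameter_def intro!: cSUP_least)

lemma haus_term_mono: assumes "V <= W" "bounded W" "0 <= s" shows "haus_term s V <= haus_term s W"
proof (cases "V = {}")
 case True thus ?thesis by (simp add: haus_term_def)
next
 case False
 hence "W ~= {}" using assms by auto
 moreover have "diameter V powr s <= diameter W powr s"
  using assms by (intro powr_mono2 diameter_subset) (auto intro: diameter_ge_0 bounded_subset)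
 ultimately show ?thesis using False by (auto simp: haus_term_def intro: ennreal_leI)
qed

lemma haus_term_empty [simp]: "haus_term s {} = 0" by (simp add: haus_term_def)

lemma haus_term_pos: "s > 0 ==> bounded V ==> haus_term s V = ennreal (diameter V powr s)" by (auto simp: haus_term_def)

lemma haus_pre_leI: assumes "A <= (UN i. U i)" "!!i. U i <= X" "!!i. bounded (U i)" "!!i. diameter (U i) <= d"
 shows "haus_pre X s d A <= (\<Sum>i. haus_term s (U (i::nat)))"
 unfolding haus_pre_def by (rule INF_lower) (use assms in auto)

lemma haus_pre_obtain: assumes "haus_pre X s d A < c"
 obtains U :: "nat => 'a::metric_space set" where "A <= (UN i. U i)" "!!i. U i <= X"
  "!!i. bounded (U i)" "!!i. diameter (U i) <= d" "(\<Sum>i. haus_term s (U i)) < c"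
 using assms unfolding haus_pre_def INF_less_iff by blast

lemma haus_pre_greatest:
 assumes "!!U :: nat => 'a::metric_space set. A <= (UN i. U i) ==> (!!i. U i <= X) ==> (!!i. bounded (U i))
  ==> (!!i. diameter (U i) <= d) ==> c <= (\<Sum>i. haus_term s (U i))"
 shows "c <= haus_pre X s d A" unfolding haus_pre_def by (rule INF_greatest) (use assms in auto)

lemma haus_pre_mono: "A <= B ==> haus_pre X s d A <= haus_pre X s d B"
 unfolding haus_pre_def by (rule INF_superset_mono) auto

lemma haus_pre_antimono: "d <= d' ==> haus_pre X s d' A <= haus_pre X s d A"
 unfolding haus_pre_def by (rule INF_superset_mono) (auto intro: order_trans)

lemma haus_pre_le_measure: "d > 0 ==> haus_pre X s d A <= hm X s A"
 unfolding hausdorff_measure_def by (rule SUP_upper) auto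

lemma hm_least: "(!!d. d > 0 ==> haus_pre X s d A <= c) ==> hm X s A <= c"
 unfolding hausdorff_measure_def by (rule SUP_least) auto

text \<open>The premeasures grow as d decreases, so small d decide.\<close>

lemma hm_least': assumes "e > 0" "!!d. 0 < d ==> d < e ==> haus_pre X s d A <= c" shows "hm X s A <= c"
proof (rule hm_least)
 fix d :: real assume "d > 0"
 have "haus_pre X s d A <= haus_pre X s (min d (e/2)) A" by (rule haus_pre_antimono) auto
 also have "... <= c" using assms `d > 0` by auto
 finally show "haus_pre X s d A <= c" .
qed

lemma hm_mono: "A <= B ==> hm X s A <= hm X s B"
 unfolding hausdorff_measure_def by (intro SUP_mono') (rule haus_pre_mono)

lemma haus_pre_countable_subadditive: assumes "d > 0"
 shows "haus_pre X s d (UN i. A i) <= (\<Sum>i. haus_pre X s d (A (i::nat)))"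
proof (rule ennreal_le_epsilon)
 fix e :: real assume fin: "(\<Sum>i. haus_pre X s d (A i)) < top" and e: "0 < e"
 have "EX U. A i <= (UN j. U j) & (ALL j. U j <= X & bounded (U j) & diameter (U j) <= d) &
   (\<Sum>j. haus_term s (U (j::nat))) <= haus_pre X s d (A i) + ennreal (e * (1/2)^Suc i)" for i proof -
  have "haus_pre X s d (A i) < top" using fin ennreal_suminf_lessD by blast
  hence "haus_pre X s d (A i) < haus_pre X s d (A i) + ennreal (e * (1/2)^Suc i)"
   using e by (simp add: ennreal_zero_less_mult_iff less_top)
  then obtain U where "A i <= (UN i. U i)" "!!i. U i <= X" "!!i. bounded (U i)"
   "!!i. diameter (U i) <= d" "(\<Sum>i. haus_term s (U i)) < haus_pre X s d (A i) + ennreal (e * (1/2)^Suc i)"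
   by (rule haus_pre_obtain) auto
  thus ?thesis by (intro exI[of _ U]) auto
 qed
 then obtain U where U: "!!i. A i <= (UN j. U i j)" "!!i j. U i j <= X" "!!i j. bounded (U i j)"
   "!!i j. diameter (U i j) <= d"
   "!!i. (\<Sum>j. haus_term s (U i (j::nat))) <= haus_pre X s d (A i) + ennreal (e * (1/2)^Suc i)" by metis
 have "haus_pre X s d (UN i. A i) <= (\<Sum>k. haus_term s (case_prod U (prod_decode k)))" proof (rule haus_pre_leI)
  show "(UN i. A i) <= (UN k. case_prod U (prod_decode k))" proof
   fix x assume "x : (UN i. A i)"
   then obtain i j where "x : U i j" using U(1) by blast
   hence "x : case_prod U (prod_decode (prod_encode (i,j)))" by simp
   thus "x : (UN k. case_prod U (prod_decode k))" by (rule UN_I[OF UNIV_I])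
  qed
 qed (use U in \<open>auto split: prod.split\<close>)
 also have "... = (\<Sum>i. \<Sum>j. haus_term s (U i j))"
  using suminf_ennreal_2dimen[of "%i. (\<Sum>j. haus_term s (U i j))" "%p. haus_term s (case_prod U p)"]
  by (simp add: o_def)
 also have "... <= (\<Sum>i. haus_pre X s d (A i) + ennreal (e * (1/2)^Suc i))" by (intro suminf_le U) auto
 also have "... = (\<Sum>i. haus_pre X s d (A i)) + (\<Sum>i. ennreal (e * (1/2)^Suc i))"
  by (rule suminf_add[symmetric]) auto
 also have "(\<Sum>i. ennreal (e * (1/2)^Suc i)) = ennreal e" proof -
  have "(%i. e * (1/2)^Suc i) sums (e * 1)" by (intro sums_mult power_half_series)
  thus ?thesis using e by (subst suminf_ennreal_eq) auto
 qed
 finally show "haus_pre X s d (UN i. A i) <= (\<Sum>i. haus_pre X s d (A i)) + ennreal e" .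
qed

lemma hm_countable_subadditive: "hm X s (UN i. A i) <= (\<Sum>i. hm X s (A (i::nat)))"
proof (rule hm_least)
 fix d :: real assume "d > 0"
 hence "haus_pre X s d (UN i. A i) <= (\<Sum>i. haus_pre X s d (A i))" by (rule haus_pre_countable_subadditive)
 also have "... <= (\<Sum>i. hm X s (A i))" using `d > 0` by (intro suminf_le haus_pre_le_measure) auto
 finally show "haus_pre X s d (UN i. A i) <= ..." .
qed

lemma hm_empty [simp]: "hm X s {} = 0"
proof -
 have "hm X s {} <= 0" proof (rule hm_least)
  fix d :: real assume "d > 0"
  thus "haus_pre X s d {} <= 0" using haus_pre_leI[of "{}" "%_. {}" X d s] by simp
 qed
 thus ?thesis by simp
qed

lemma haus_pre_Un: assumes "d > 0" shows "haus_pre X s d (A Un B) <= haus_pre X s d A + haus_pre X s d B"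
proof -
 have e: "haus_pre X s d {} = 0" using haus_pre_le_measure[OF assms, of X s "{}"] by simp
 have "haus_pre X s d (UN i. (%i::nat. if i = 0 then A else if i = 1 then B else {}) i)
   <= (\<Sum>i. haus_pre X s d ((%i::nat. if i = 0 then A else if i = 1 then B else {}) i))"
  by (rule haus_pre_countable_subadditive[OF assms])
 also have "(UN i. (%i::nat. if i = 0 then A else if i = 1 then B else {}) i) = A Un B"
  by (auto split: if_splits intro: exI[of _ 0] exI[of _ "Suc 0"])
 also have "(\<Sum>i. haus_pre X s d ((%i::nat. if i = 0 then A else if i = 1 then B else {}) i))
   = (SUM i:{0,1::nat}. haus_pre X s d ((%i::nat. if i = 0 then A else if i = 1 then B else {}) i))"
  by (rule suminf_finite) (auto simp: e)
 finally show ?thesis by simp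
qed

lemma hm_Un: "hm X s (A Un B) <= hm X s A + hm X s B"
proof (rule hm_least)
 fix d :: real assume d: "d > 0"
 show "haus_pre X s d (A Un B) <= hm X s A + hm X s B"
  by (rule order_trans[OF haus_pre_Un[OF d]]) (intro add_mono haus_pre_le_measure d)
qed

lemma hm_null_UN: assumes "!!i::nat. hm X s (A i) = 0" shows "hm X s (UN i. A i) = 0"
 using hm_countable_subadditive[of X s A] assms by simp

lemma hm_null_UN_finite: assumes "finite I" "!!i. i : I ==> hm X s (A i) = 0"
 shows "hm X s (UN i:I. A i) = 0" using assms
proof (induction I rule: finite_induct)
 case (insert i I)
 have "hm X s (A i Un (UN i:I. A i)) <= 0" using hm_Un[of X s "A i" "(UN i:I. A i)"] insert by simp
 thus ?case by simp
qed simp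

lemma hm_finite_UN_finite: assumes "finite I" "!!i. i : I ==> hm X s (A i) < top"
 shows "hm X s (UN i:I. A i) < top" using assms
proof (induction I rule: finite_induct)
 case (insert i I)
 have "hm X s (A i Un (UN i:I. A i)) <= hm X s (A i) + hm X s (UN i:I. A i)" by (rule hm_Un)
 also have "... < top" using insert by (simp add: less_top)
 finally show ?case by simp
qed simp

lemma hm_countable_null: assumes "countable A" "s > 0" "A <= X" shows "hm X s A = 0"
proof -
 have "hm X s A <= 0" proof (rule hm_least)
  fix d :: real assume d: "d > 0"
  show "haus_pre X s d A <= 0" proof (cases "A = {}")
   case True thus ?thesis using haus_pre_le_measure[OF d, of X s "{}"] by simp
  next
   case False
   have "haus_pre X s d A <= (\<Sum>i. haus_term s {from_nat_into A i})"
    using False assms d from_nat_into[OF False] from_nat_into_surj[OF assms(1)] by (intro haus_pre_leI) (auto, metis)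
   also have "... = 0" using assms by (simp add: haus_term_pos)
   finally show ?thesis .
  qed
 qed
 thus ?thesis by simp
qed

lemma hm_lipschitz: fixes f :: "'a::metric_space => 'b::metric_space"
 assumes "C > 0" "s > 0" and lip: "!!x y. x : A ==> y : A ==> dist (f x) (f y) <= C * dist x y"
  and "A <= X" "f ` A <= Y" shows "hm Y s (f ` A) <= ennreal (C powr s) * hm X s A" proof (rule hm_least)
 fix d :: real assume d: "d > 0"
 have "haus_pre Y s d (f ` A) <= ennreal (C powr s) * haus_pre X s (d/C) A" proof -
  \<comment> \<open>The factor stands on the left so that the estimate holds cover by cover and
    passes to the infimum on the right.\<close>
  have "ennreal (1 / C powr s) * haus_pre Y s d (f ` A) <= haus_pre X s (d/C) A" proof (rule haus_pre_greatest)
   fix U :: "nat => 'a set"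
   assume U: "A <= (UN i. U i)" "!!i. U i <= X" "!!i. bounded (U i)" "!!i. diameter (U i) <= d/C"
   let ?V = "%i. f ` (U i Int A)"
   have D: "dist (f x) (f y) <= C * diameter (U i)" if "x : U i Int A" "y : U i Int A" for i x y
    using lip[of x y] that diameter_bounded_bound[OF U(3), of x i y] `C > 0`
    by (smt (verit, ccfv_SIG) IntD1 IntD2 mult_left_mono)
   have bd: "bounded (?V i)" for i unfolding bounded_two_points using D by (intro exI[of _ "C * diameter (U i)"]) auto
   have dm: "diameter (?V i) <= C * diameter (U i)" for i
    using D `C > 0` by (intro diameter_leI) (auto simp: diameter_ge_0 U(3))
   have "haus_pre Y s d (f ` A) <= (\<Sum>i. haus_term s (?V i))" proof (rule haus_pre_leI)
    show "f ` A <= (UN i. ?V i)" using U(1) by blast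
    show "diameter (?V i) <= d" for i using dm[of i] U(4)[of i] `C > 0` by (simp add: field_simps)
   qed (use bd assms(5) in auto)
   also have "... <= (\<Sum>i. ennreal (C powr s) * haus_term s (U i))" proof (intro suminf_le)
    fix i
    have "diameter (?V i) powr s <= (C * diameter (U i)) powr s"
     using assms(2) dm by (intro powr_mono2) (auto simp: diameter_ge_0 bd)
    also have "... = C powr s * diameter (U i) powr s" using `C > 0` by (simp add: powr_mult diameter_ge_0 U(3))
    finally show "haus_term s (?V i) <= ennreal (C powr s) * haus_term s (U i)"
     using assms(2) bd U(3) by (simp add: haus_term_pos ennreal_mult[symmetric] ennreal_leI)
   qed auto
   also have "... = ennreal (C powr s) * (\<Sum>i. haus_term s (U i))" by simp
   finally have "ennreal (1 / C powr s) * haus_pre Y s d (f ` A) <=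
     ennreal (1 / C powr s) * (ennreal (C powr s) * (\<Sum>i. haus_term s (U i)))" by (rule mult_left_mono) auto
   thus "ennreal (1 / C powr s) * haus_pre Y s d (f ` A) <= (\<Sum>i. haus_term s (U i))"
    using `C > 0` by (simp add: mult.assoc[symmetric] ennreal_mult[symmetric])
  qed
  hence "ennreal (C powr s) * (ennreal (1 / C powr s) * haus_pre Y s d (f ` A)) <= ennreal (C powr s) * haus_pre X s (d/C) A"
   by (rule mult_left_mono) auto
  thus ?thesis using `C > 0` by (simp add: mult.assoc[symmetric] ennreal_mult[symmetric])
 qed
 also have "... <= ennreal (C powr s) * hm X s A" using d `C > 0` by (intro mult_left_mono haus_pre_le_measure) auto
 finally show "haus_pre Y s d (f ` A) <= ennreal (C powr s) * hm X s A" .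
qed

text \<open>A set of diameter at most d < t meets at most one of A and B, so every fine cover of the
  union splits.\<close>

lemma haus_pre_separated: assumes sep: "!!x y. x : A ==> y : B ==> t <= dist x y" and "d < t" "0 <= s"
 shows "haus_pre X s d A + haus_pre X s d B <= haus_pre X s d (A Un B)"
proof (rule haus_pre_greatest)
 fix U :: "nat => 'a set"
 assume U: "A Un B <= (UN i. U i)" "!!i. U i <= X" "!!i. bounded (U i)" "!!i. diameter (U i) <= d"
 have one: "U i Int A = {} | U i Int B = {}" for i proof (rule ccontr)
  assume "~ ?thesis"
  then obtain x y where "x : U i" "x : A" "y : U i" "y : B" by blast
  hence "t <= dist x y" "dist x y <= diameter (U i)" using sep diameter_bounded_bound[OF U(3)] by auto
  thus False using U(4)[of i] `d < t` by linarith
 qed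
 have *: "haus_pre X s d C <= (\<Sum>i. haus_term s (U i Int C))" if "C <= A Un B" for C proof (rule haus_pre_leI)
  show "C <= (UN i. U i Int C)" using that U(1) by blast
  show "diameter (U i Int C) <= d" for i using diameter_subset[of "U i Int C" "U i"] U(3,4)[of i] by auto
 qed (use U in \<open>auto intro: bounded_subset\<close>)
 have "haus_pre X s d A + haus_pre X s d B <= (\<Sum>i. haus_term s (U i Int A)) + (\<Sum>i. haus_term s (U i Int B))"
  by (intro add_mono *) auto
 also have "... = (\<Sum>i. haus_term s (U i Int A) + haus_term s (U i Int B))" by (rule suminf_add) auto
 also have "... <= (\<Sum>i. haus_term s (U i))" proof (intro suminf_le)
  fix i show "haus_term s (U i Int A) + haus_term s (U i Int B) <= haus_term s (U i)"
   using one[of i] haus_term_mono[of "U i Int A" "U i" s] haus_term_mono[of "U i Int B" "U i" s] U(3)[of i] assms(3)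
   by auto
 qed auto
 finally show "haus_pre X s d A + haus_pre X s d B <= (\<Sum>i. haus_term s (U i))" .
qed

lemma hm_separated: assumes sep: "!!x y. x : A ==> y : B ==> t <= dist x y" and "0 < t" "0 <= s"
 shows "hm X s A + hm X s B <= hm X s (A Un B)"
proof -
 have "hm X s A + hm X s B = (SUP d\<in> {0<..}. haus_pre X s d A) + (SUP d\<in> {0<..}. haus_pre X s d B)"
  by (simp add: hausdorff_measure_def)
 also have "... = (SUP d\<in> {0<..}. haus_pre X s d A + haus_pre X s d B)"
 proof (rule SUP_add_directed_ennreal[symmetric])
  fix i j :: real assume "i : {0<..}" "j : {0<..}"
  thus "EX k:{0<..}. haus_pre X s i A + haus_pre X s j B <= haus_pre X s k A + haus_pre X s k B"
   by (intro bexI[of _ "min i j"] add_mono haus_pre_antimono) auto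
 qed
 also have "... <= hm X s (A Un B)" proof (rule SUP_least)
  fix d :: real assume "d : {0<..}"
  define d' where "d' = min d (t/2)"
  have "haus_pre X s d A + haus_pre X s d B <= haus_pre X s d' A + haus_pre X s d' B"
   by (intro add_mono haus_pre_antimono) (auto simp: d'_def)
  also have "... <= haus_pre X s d' (A Un B)" using assms by (intro haus_pre_separated[of _ _ t]) (auto simp: d'_def)
  also have "... <= hm X s (A Un B)" using assms `d : {0<..}` by (intro haus_pre_le_measure) (auto simp: d'_def)
  finally show "haus_pre X s d A + haus_pre X s d B <= hm X s (A Un B)" .
 qed
 finally show ?thesis .
qed

text \<open>Superadditivity without measurability of E: disjoint compact sets have positive
  distance, where \<open>hm_separated\<close> applies.\<close>

lemma hm_disjoint_compact_sum: fixes V :: "'i => 'a::heine_borel set"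
 assumes "finite I" "!!i. i : I ==> closed (V i)" "!!i. i : I ==> bounded (V i)"
  "!!i j. i : I ==> j : I ==> i ~= j ==> V i Int V j = {}" "0 <= s"
 shows "(SUM i:I. hm X s (E Int V i)) <= hm X s (E Int (UN i:I. V i))"
 using assms proof (induction I rule: finite_induct)
 case (insert i I)
 let ?W = "UN i:I. V i"
 have comp: "compact (V i)" "closed ?W" using insert by (auto simp: compact_eq_bounded_closed)
 have "V i Int ?W = {}" using insert by blast
 then obtain t where t: "t > 0" "!!x y. x : V i ==> y : ?W ==> t <= dist x y"
  using separate_compact_closed[OF comp] by blast
 have "(SUM i:insert i I. hm X s (E Int V i)) = hm X s (E Int V i) + (SUM i:I. hm X s (E Int V i))" using insert by simp
 also have "... <= hm X s (E Int V i) + hm X s (E Int ?W)" using insert by (intro add_left_mono insert.IH) auto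
 also have "... <= hm X s (E Int V i Un E Int ?W)" using t insert.prems by (intro hm_separated[of _ _ t]) auto
 also have "E Int V i Un E Int ?W = E Int (UN i:insert i I. V i)" by auto
 finally show ?case .
qed simp

lemma hm_null_exponent_mono: assumes "0 <= s" "s <= s'" "hm X s A = 0" shows "hm X s' A = 0"
proof -
 have "hm X s' A <= hm X s A" proof (rule hm_least'[of 1])
  fix d :: real assume d: "0 < d" "d < 1"
  have "haus_pre X s' d A <= haus_pre X s d A" proof (rule haus_pre_greatest)
   fix U :: "nat => 'a set"
   assume U: "A <= (UN i. U i)" "!!i. U i <= X" "!!i. bounded (U i)" "!!i. diameter (U i) <= d"
   have "haus_pre X s' d A <= (\<Sum>i. haus_term s' (U i))" using U by (intro haus_pre_leI) auto
   also have "... <= (\<Sum>i. haus_term s (U i))" proof (intro suminf_le)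
    fix i
    have D: "0 <= diameter (U i)" "diameter (U i) <= 1" using U(3,4)[of i] d by (auto simp: diameter_ge_0)
    hence "diameter (U i) powr s' <= diameter (U i) powr s" using assms by (intro powr_mono') auto
    \<comment> \<open>For \<open>s = 0\<close> a nonempty set contributes 1 instead of a power of
      its diameter, hence this second bound.\<close>
    moreover have "diameter (U i) powr s' <= 1" using D assms by (intro powr_le1) auto
    ultimately show "haus_term s' (U i) <= haus_term s (U i)"
     using assms by (auto simp: haus_term_def intro!: ennreal_leI)
   qed auto
   finally show "haus_pre X s' d A <= (\<Sum>i. haus_term s (U i))" .
  qed
  also have "... <= hm X s A" using d by (intro haus_pre_le_measure) auto
  finally show "haus_pre X s' d A <= hm X s A" .
 qed auto
 thus ?thesis using assms by simp
qed

text \<open>\<open>haus_term 0\<close> counts the nonempty sets of a cover. In degree one, where the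
  radial set has dimension 0, this turns the null hypothesis into an inclusion.\<close>

lemma hm_0_imp_empty: assumes "hm X 0 A = 0" shows "A = {}"
proof (rule ccontr)
 assume "A ~= {}"
 have "haus_pre X 0 1 A < 1" using haus_pre_le_measure[of 1 X 0 A] assms by (simp add: order_le_less_trans)
 then obtain U where U: "A <= (UN i. U i)" "(\<Sum>i. haus_term 0 (U (i::nat))) < 1" by (rule haus_pre_obtain)
 then obtain i where "U i ~= {}" using `A ~= {}` by blast
 hence "haus_term 0 (U i) = 1" by (simp add: haus_term_def)
 with ennreal_suminf_lessD[OF U(2), of i] show False by simp
qed

text \<open>A 1-Lipschitz function sends each covering set into an interval no longer than its
  diameter, and intervals covering {0..r} have total length at least r.\<close>

lemma hm_ge_interval: fixes g :: "'a::metric_space => real"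
 assumes lip: "!!x y. x : S ==> y : S ==> dist (g x) (g y) <= dist x y" and sub: "{0..r} <= g ` S"
 shows "ennreal r <= hm X 1 S"
proof -
 have "ennreal r <= haus_pre X 1 1 S" proof (rule haus_pre_greatest)
  fix U :: "nat => 'a set"
  assume U: "S <= (UN i. U i)" "!!i. U i <= X" "!!i. bounded (U i)" "!!i. diameter (U i) <= 1"
  have "EX a. g ` (U i Int S) <= {a..a + diameter (U i)}" for i proof (cases "U i Int S = {}")
   case False
   let ?G = "g ` (U i Int S)"
   have D: "\<bar>u - v\<bar> <= diameter (U i)" if uv: "u : ?G" "v : ?G" for u v proof -
    obtain x y where "x : U i Int S" "y : U i Int S" "u = g x" "v = g y" using uv by (elim imageE) blast
    thus ?thesis using lip[of x y] diameter_bounded_bound[OF U(3), of x i y] by (auto simp: dist_real_def)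
   qed
   obtain u0 where u0: "u0 : ?G" using False by blast
   have bdd: "bdd_below ?G" by (rule bdd_belowI[of _ "u0 - diameter (U i)"]) (use D[OF u0] in fastforce)
   have "?G <= {Inf ?G..Inf ?G + diameter (U i)}" proof
    fix v assume v: "v : ?G"
    have "v - diameter (U i) <= Inf ?G" using u0 D[OF v] by (intro cInf_greatest) (auto, fastforce)
    thus "v : {Inf ?G..Inf ?G + diameter (U i)}" using cInf_lower[OF v bdd] by auto
   qed
   thus ?thesis by blast
  qed auto
  then obtain a where a: "!!i. g ` (U i Int S) <= {a i..a i + diameter (U i)}" by metis
  have "{0..r} <= (UN i. {a i..a i + diameter (U i)})" proof
   fix y assume "y : {0..r}"
   then obtain x where "x : S" "y = g x" using sub by blast
   moreover then obtain i where "x : U i" using U(1) by blast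
   ultimately show "y : (UN i. {a i..a i + diameter (U i)})" using a[of i] by blast
  qed
  hence "emeasure lborel {0..r} <= emeasure lborel (UN i. {a i..a i + diameter (U i)})" by (intro emeasure_mono) auto
  also have "... <= (\<Sum>i. emeasure lborel {a i..a i + diameter (U i)})"
   by (intro emeasure_subadditive_countably) auto
  also have "... = (\<Sum>i. haus_term 1 (U i))" using U(3) by (simp add: haus_term_pos diameter_ge_0)
  finally show "ennreal r <= (\<Sum>i. haus_term 1 (U i))" by (cases "0 <= r") (auto simp: ennreal_neg)
 qed
 also have "... <= hm X 1 S" by (rule haus_pre_le_measure) auto
 finally show ?thesis .
qed

text \<open>A set lies in the disc about any of its points whose radius is its diameter, so a cover
  controls area up to the area \<open>c\<close> of the unit disc.\<close>

lemma hausdorff_2_null_imp_lebesgue_null: fixes S :: "complex set"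
 assumes "hm UNIV 2 S = 0" "S : sets borel" shows "emeasure lborel S = 0"
proof -
 define c where "c = unit_ball_vol 2"
 have *: "emeasure lborel S <= 0 + ennreal e" if "e > 0" for e proof -
  have cpos: "c > 0" by (simp add: c_def)
  have "haus_pre UNIV 2 1 S < ennreal (e / c)"
   using haus_pre_le_measure[of 1 UNIV 2 S] assms that cpos by (simp add: order_le_less_trans)
  then obtain U :: "nat => complex set" where U: "S <= (UN i. U i)" "!!i. bounded (U i)"
   "(\<Sum>i. haus_term 2 (U i)) < ennreal (e / c)" by (rule haus_pre_obtain) auto
  define u where "u i = (SOME x. x : U i)" for i
  have sub: "U i <= cball (u i) (diameter (U i))" for i proof
   fix x assume "x : U i"
   hence "u i : U i" unfolding u_def by (metis someI)
   thus "x : cball (u i) (diameter (U i))" using diameter_bounded_bound[OF U(2) _ `x : U i`] by simp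
  qed
  have "emeasure lborel S <= emeasure lborel (UN i. cball (u i) (diameter (U i)))" proof (intro emeasure_mono)
   show "S <= (UN i. cball (u i) (diameter (U i)))" using U(1) sub by (meson SUP_mono' order_trans)
  qed (auto intro!: sets.countable_UN)
  also have "... <= (\<Sum>i. emeasure lborel (cball (u i) (diameter (U i))))"
   by (intro emeasure_subadditive_countably) auto
  also have "... = (\<Sum>i. ennreal c * haus_term 2 (U i))" proof (intro arg_cong[of _ _ suminf] ext)
   fix i
   have D: "0 <= diameter (U i)" using U(2) by (simp add: diameter_ge_0)
   have "emeasure lborel (cball (u i) (diameter (U i))) = ennreal (c * diameter (U i) ^ 2)"
    using D by (simp add: emeasure_cball c_def)
   also have "... = ennreal c * haus_term 2 (U i)"
    using D U(2) cpos by (simp add: haus_term_pos ennreal_mult[symmetric])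
   finally show "emeasure lborel (cball (u i) (diameter (U i))) = ennreal c * haus_term 2 (U i)" .
  qed
  also have "... = ennreal c * (\<Sum>i. haus_term 2 (U i))" by simp
  also have "... <= ennreal c * ennreal (e / c)" using U(3) by (intro mult_left_mono) auto
  also have "... = ennreal e" using cpos that by (simp add: ennreal_mult[symmetric])
  finally show ?thesis by simp
 qed
 have "emeasure lborel S <= 0" by (rule ennreal_le_epsilon) (rule *)
 thus ?thesis by simp
qed

text \<open>Covers witnessing a null set can be taken finite and with positive diameters
 bounded below, since thickening by a small amount costs little.\<close>

lemma hausdorff_null_compact_finite_cover: fixes K :: "'a::heine_borel set"
 assumes "hm UNIV s K = 0" "compact K" "0 < s" "0 < e"
 obtains I :: "nat set" and U where "finite I" "K <= (UN i:I. U i)" "!!i. bounded (U i)"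
  "(SUM i:I. diameter (U i) powr s) < e" proof -
 have "haus_pre UNIV s 1 K < ennreal (e/2)"
  using haus_pre_le_measure[of 1 UNIV s K] assms by (simp add: order_le_less_trans)
 then obtain V :: "nat => 'a set" where V: "K <= (UN i. V i)" "!!i. bounded (V i)"
  "(\<Sum>i. haus_term s (V i)) < ennreal (e/2)" by (rule haus_pre_obtain) auto
 have "EX r>0. (diameter (V i) + 2 * r) powr s < diameter (V i) powr s + (e/2) * (1/2)^Suc i" for i proof -
  have D: "0 <= diameter (V i)" using V(2) by (simp add: diameter_ge_0)
  have "((%r. (diameter (V i) + 2 * r) powr s) \<longlongrightarrow> (diameter (V i) + 2 * 0) powr s) (at_right 0)"
  proof (cases "diameter (V i) = 0")
   case True
   have "continuous_on {0..} (%r::real. (2 * r) powr s)"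
    using `0 < s` by (intro continuous_on_powr' continuous_intros) auto
   hence "((%r::real. (2 * r) powr s) \<longlongrightarrow> (2 * 0) powr s) (at 0 within {0..})"
    unfolding continuous_on_def by (rule bspec) auto
   hence "((%r::real. (2 * r) powr s) \<longlongrightarrow> (2 * 0) powr s) (at 0 within {0<..})"
    by (rule tendsto_within_subset) auto
   thus ?thesis using True by simp
  next
   case False
   thus ?thesis by (intro tendsto_intros) auto
  qed
  hence "eventually (%r. (diameter (V i) + 2 * r) powr s < diameter (V i) powr s + (e/2) * (1/2)^Suc i) (at_right 0)"
   using `0 < e` by (intro order_tendstoD) auto
  hence "eventually (%r. r > 0 & (diameter (V i) + 2 * r) powr s < diameter (V i) powr s + (e/2) * (1/2)^Suc i) (at_right 0)"
   by (intro eventually_conj eventually_at_right_less) auto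
  thus ?thesis using eventually_happens trivial_limit_at_right_real by blast
 qed
 then obtain r where r: "!!i. r i > 0"
  "!!i. (diameter (V i) + 2 * r i) powr s < diameter (V i) powr s + (e/2) * (1/2)^Suc i" by metis
 define U where "U i = (UN x:V i. ball x (r i))" for i
 have opU: "open (U i)" for i by (auto simp: U_def)
 have DU: "dist x y <= diameter (V i) + 2 * r i" if "x : U i" "y : U i" for x y i proof -
  obtain x' y' where "x' : V i" "y' : V i" "dist x' x < r i" "dist y' y < r i"
   using `x : U i` `y : U i` by (auto simp: U_def)
  moreover have "dist x' y' <= diameter (V i)" using `x' : V i` `y' : V i` V(2) by (intro diameter_bounded_bound) auto
  moreover have "dist x y <= dist x' x + dist x' y' + dist y' y" by (smt (verit) dist_commute dist_triangle)
  ultimately show ?thesis by linarith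
 qed
 have D0: "0 <= diameter (V i)" for i using V(2) by (simp add: diameter_ge_0)
 have bU: "bounded (U i)" for i unfolding bounded_two_points using DU by blast
 have dU: "diameter (U i) <= diameter (V i) + 2 * r i" for i using DU D0[of i] r(1)[of i] by (intro diameter_leI) auto
 have "V i <= U i" for i using r(1)[of i] unfolding U_def by force
 hence "K <= (UN i:UNIV. U i)" using V(1) by (meson SUP_mono' order_trans)
 then obtain I where I: "finite I" "K <= (UN i:I. U i)" using compactE_image[OF assms(2), of UNIV U] opU by auto
 show thesis proof (rule that[OF I bU])
  have sumV: "(SUM i:I. diameter (V i) powr s) < e/2" proof -
   have "ennreal (SUM i:I. diameter (V i) powr s) = (SUM i:I. haus_term s (V i))"
    using V(2) `0 < s` by (simp add: haus_term_pos)
   also have "... <= (\<Sum>i. haus_term s (V i))" by (rule sum_le_suminf) (use I in auto)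
   also have "... < ennreal (e/2)" by (rule V(3))
   finally show ?thesis using `0 < e` by (simp add: ennreal_less_iff sum_nonneg)
  qed
  have "(SUM i:I. diameter (U i) powr s) <= (SUM i:I. diameter (V i) powr s + (e/2) * (1/2)^Suc i)"
  proof (rule sum_mono)
   fix i
   have "diameter (U i) powr s <= (diameter (V i) + 2 * r i) powr s"
    using dU bU `0 < s` by (intro powr_mono2) (auto simp: diameter_ge_0)
   thus "diameter (U i) powr s <= diameter (V i) powr s + (e/2) * (1/2)^Suc i" using r(2)[of i] by linarith
  qed
  also have "... = (SUM i:I. diameter (V i) powr s) + (e/2) * (SUM i:I. (1/2)^Suc i)"
   by (simp add: sum.distrib sum_distrib_left)
  also have "(SUM i:I. (1/2::real)^Suc i) <= 1" proof -
   have "(SUM i:I. (1/2::real)^Suc i) <= (\<Sum>i. (1/2)^Suc i)"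
    using power_half_series I(1) by (intro sum_le_suminf) (auto simp: sums_iff)
   thus ?thesis using power_half_series by (simp add: sums_iff)
  qed
  finally show "(SUM i:I. diameter (U i) powr s) < e" using sumV `0 < e` by auto
 qed
qed

section \<open>Limit sets of iterated function systems\<close>

text \<open>Induction on the number of covering sets replaces a mass distribution on L. If all
  covering sets have diameter below et, each meets the image of L under at most one g i. The sets
  meeting that image, pulled back by g i, cover L again, with the s-sum enlarged at most by the
  factor 1 / c i powr s; adding over i closes the induction.\<close>

lemma ifs_cover_bound: fixes g :: "'i => 'a::metric_space => 'a" and U :: "'k => 'a set"
 assumes I: "finite I" "2 <= card I" and L: "L ~= {}" "!!i. i : I ==> g i ` L <= L" and c: "!!i. i : I ==> 0 < c i"
   "!!i x y. i : I ==> x : L ==> y : L ==> c i * dist x y <= dist (g i x) (g i y)"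
  and sep: "!!i j x y. i : I ==> j : I ==> i ~= j ==> x : L ==> y : L ==> et <= dist (g i x) (g j y)"
  and "0 < et" "0 < s" and sum: "1 <= (SUM i:I. c i powr s)"
  and K: "finite K" "L <= (UN k:K. U k)" "!!k. k : K ==> bounded (U k)"
 shows "et powr s <= (SUM k:K. diameter (U k) powr s)" using K
proof (induction "card K" arbitrary: K U rule: less_induct)
 case less
 show ?case proof (cases "EX k:K. et <= diameter (U k)")
  case True
  then obtain k where k: "k : K" "et <= diameter (U k)" by blast
  have "et powr s <= diameter (U k) powr s" using k `0 < et` `0 < s` by (intro powr_mono2) auto
  also have "... <= (SUM k:K. diameter (U k) powr s)" using less.prems(1) k(1) by (intro member_le_sum) auto
  finally show ?thesis .
 next
  case False
  define Kf where "Kf i = {k : K. U k Int g i ` L ~= {}}" for i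
  have disj: "Kf i Int Kf j = {}" if "i : I" "j : I" "i ~= j" for i j proof (rule ccontr)
   assume "~ ?thesis"
   then obtain k x y where k: "k : K" "x : L" "y : L" "g i x : U k" "g j y : U k" by (auto simp: Kf_def)
   hence "et <= diameter (U k)"
    using sep[OF that k(2,3)] diameter_bounded_bound[OF less.prems(3)[OF k(1)] k(4,5)] by linarith
   with False k(1) show False by blast
  qed
  have ne: "Kf i ~= {}" if "i : I" for i proof -
   obtain x where "x : L" using L(1) by blast
   hence "g i x : L" using L(2) that by blast
   then obtain k where "k : K" "g i x : U k" using less.prems(2) by blast
   thus ?thesis using `x : L` by (auto simp: Kf_def)
  qed
  have fin: "finite (Kf i)" for i using less.prems(1) by (simp add: Kf_def)
  have part: "c i powr s * et powr s <= (SUM k:Kf i. diameter (U k) powr s)" if i: "i : I" for i proof -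
   \<comment> \<open>A second piece needs covering sets of its own, so those meeting the piece of i
     are strictly fewer than all.\<close>
   obtain j where j: "j : I" "j ~= i" proof -
    have "I ~= {i}" using I(2) by auto
    thus ?thesis using that i by blast
   qed
   have "Kf j <= K" by (auto simp: Kf_def)
   hence "Kf i ~= K" using disj[OF i j(1) j(2)[symmetric]] ne[OF j(1)] by blast
   hence "Kf i \<subset> K" by (auto simp: Kf_def)
   hence "card (Kf i) < card K" using less.prems(1) by (rule psubset_card_mono[rotated])
   define V where "V k = {x : L. g i x : U k}" for k
   have bV: "dist x y <= diameter (U k) / c i" if "k : K" "x : V k" "y : V k" for x y k proof -
    have "c i * dist x y <= dist (g i x) (g i y)" using c(2)[OF i] that by (auto simp: V_def)
    also have "... <= diameter (U k)" using that less.prems(3) by (intro diameter_bounded_bound) (auto simp: V_def)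
    finally show ?thesis using c(1)[OF i] by (simp add: field_simps)
   qed
   have "et powr s <= (SUM k:Kf i. diameter (V k) powr s)" proof (rule less.hyps[OF `card (Kf i) < card K` fin])
    show "L <= (UN k:Kf i. V k)" proof
     fix x assume x: "x : L"
     hence "g i x : L" using L(2) i by blast
     then obtain k where "k : K" "g i x : U k" using less.prems(2) by blast
     thus "x : (UN k:Kf i. V k)" using x by (auto simp: V_def Kf_def)
    qed
    show "bounded (V k)" if "k : Kf i" for k unfolding bounded_two_points using bV[of k] that unfolding Kf_def by blast
   qed
   also have "... <= (SUM k:Kf i. (diameter (U k) / c i) powr s)" proof (rule sum_mono)
    fix k assume "k : Kf i"
    hence k: "k : K" by (simp add: Kf_def)
    have "diameter (V k) <= diameter (U k) / c i"
     using bV[OF k] c(1)[OF i] less.prems(3)[OF k] by (intro diameter_leI) (auto simp: diameter_ge_0)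
    moreover have "bounded (V k)" unfolding bounded_two_points using bV[OF k] by blast
    ultimately show "diameter (V k) powr s <= (diameter (U k) / c i) powr s"
     using `0 < s` by (intro powr_mono2) (auto simp: diameter_ge_0)
   qed
   also have "... = (SUM k:Kf i. diameter (U k) powr s) / c i powr s"
    unfolding sum_divide_distrib by (intro sum.cong refl powr_divide)
   finally show ?thesis using c(1)[OF i] by (simp add: field_simps)
  qed
  have "et powr s <= (SUM i:I. c i powr s) * et powr s" using mult_right_mono[OF sum, of "et powr s"] by simp
  also have "... = (SUM i:I. c i powr s * et powr s)" by (simp add: sum_distrib_right)
  also have "... <= (SUM i:I. SUM k:Kf i. diameter (U k) powr s)" by (intro sum_mono part)
  also have "... = (SUM k:(UN i:I. Kf i). diameter (U k) powr s)"
   using disj fin I(1) by (intro sum.UNION_disjoint[symmetric]) auto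
  also have "... <= (SUM k:K. diameter (U k) powr s)" using less.prems(1) by (intro sum_mono2) (auto simp: Kf_def)
  finally show ?thesis .
 qed
qed

primrec ifs_level :: "('i => 'a => 'a) => 'i set => 'a set => nat => 'a set" where
 "ifs_level g I X 0 = X" | "ifs_level g I X (Suc n) = (UN i:I. g i ` ifs_level g I X n)"

text \<open>The limit set is compact, so if it were null it would have finite covers of arbitrarily
  small s-sum. \<open>ifs_cover_bound\<close> forbids sums below et powr s, where et bounds the
  distances between first-level pieces from below.\<close>

lemma ifs_attractor_positive_measure: fixes g :: "'i => 'a::heine_borel => 'a"
 assumes I: "finite I" "2 <= card I" and X: "compact X" "X ~= {}" "!!i. i : I ==> g i ` X <= X"
  and cont: "!!i. i : I ==> continuous_on X (g i)" and c: "!!i. i : I ==> 0 < c i"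
   "!!i x y. i : I ==> x : X ==> y : X ==> c i * dist x y <= dist (g i x) (g i y)"
  and disj: "!!i j. i : I ==> j : I ==> i ~= j ==> g i ` X Int g j ` X = {}"
  and "0 < s" and sum: "1 <= (SUM i:I. c i powr s)" shows "hm UNIV s (INT n. ifs_level g I X n) ~= 0" proof
 let ?L = "INT n. ifs_level g I X n"
 assume null: "hm UNIV s ?L = 0"
 have sub: "ifs_level g I X n <= X" for n proof (induction n)
  case (Suc n)
  thus ?case using X(3) by fastforce
 qed simp
 have comp: "compact (ifs_level g I X n)" for n proof (induction n)
  case (Suc n)
  have "compact (g i ` ifs_level g I X n)" if "i : I" for i
   by (intro compact_image Suc continuous_on_subset[OF cont[OF that] sub])
  thus ?case using I(1) by (auto intro!: compact_UN)
 qed (use X in auto)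
 have Ine: "I ~= {}" using I(2) by auto
 have ne: "ifs_level g I X n ~= {}" for n by (induction n) (use X(2) Ine in auto)
 have decr: "ifs_level g I X (Suc n) <= ifs_level g I X n" for n proof (induction n)
  case (Suc n)
  have "(UN i:I. g i ` ifs_level g I X (Suc n)) <= (UN i:I. g i ` ifs_level g I X n)"
   using Suc by (intro UN_mono image_mono) auto
  thus ?case by simp
 qed (use sub[of "Suc 0"] in simp)
 have "ifs_level g I X n <= ifs_level g I X m" if "m <= n" for m n
  by (rule lift_Suc_antimono_le[of "ifs_level g I X", OF decr that])
 hence Lne: "?L ~= {}" by (intro compact_nest comp ne) auto
 have Lc: "compact ?L" using comp by (intro compact_Inter) auto
 have LX: "?L <= X" using sub by (meson INT_lower UNIV_I order_trans)
 have Lg: "g i ` ?L <= ?L" if "i : I" for i proof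
  fix y assume "y : g i ` ?L"
  then obtain x where x: "x : ?L" "y = g i x" by blast
  have "y : ifs_level g I X n" for n proof -
   have "x : ifs_level g I X n" using x by blast
   hence "y : ifs_level g I X (Suc n)" using x that by auto
   thus ?thesis using decr by blast
  qed
  thus "y : ?L" by blast
 qed
 have "EX et>0. ALL i:I. ALL j:I. i ~= j --> (ALL x:X. ALL y:X. et <= dist (g i x) (g j y))" proof -
  have "EX e>0. ALL x:X. ALL y:X. e <= dist (g i x) (g j y)" if "i : I" "j : I" "i ~= j" for i j proof -
   have "compact (g i ` X)" "closed (g j ` X)"
    using compact_image[OF cont X(1)] that by (auto intro: compact_imp_closed)
   from separate_compact_closed[OF this disj[OF that]] show ?thesis by auto
  qed
  then obtain e where e: "!!i j. i : I ==> j : I ==> i ~= j ==> e i j > 0"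
   "!!i j x y. i : I ==> j : I ==> i ~= j ==> x : X ==> y : X ==> e i j <= dist (g i x) (g j y)" by metis
  define P where "P = insert (1::real) ((%(i,j). e i j) ` {(i,j). i : I & j : I & i ~= j})"
  have "finite {(i,j). i : I & j : I & i ~= j}" by (rule finite_subset[of _ "I \<times> I"]) (use I in auto)
  hence P: "finite P" by (simp add: P_def)
  have "Min P > 0" using P e(1) by (subst Min_gr_iff) (auto simp: P_def)
  moreover have le: "Min P <= e i j" if "i : I" "j : I" "i ~= j" for i j
   using that P by (intro Min_le) (auto simp: P_def)
  ultimately show ?thesis proof (intro exI[of _ "Min P"] conjI ballI impI)
   fix i j x y assume *: "i : I" "j : I" "i ~= j" "x : X" "y : X"
   show "Min P <= dist (g i x) (g j y)" by (rule order_trans[OF le[OF *(1-3)] e(2)[OF *]])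
  qed
 qed
 then obtain et where et: "et > 0" "!!i j x y. i : I ==> j : I ==> i ~= j ==> x : X ==> y : X ==> et <= dist (g i x) (g j y)"
  by metis
 have "0 < et powr s" using et by simp
 then obtain K :: "nat set" and U where K: "finite K" "?L <= (UN i:K. U i)" "!!i. bounded (U i)"
  "(SUM i:K. diameter (U i) powr s) < et powr s" using hausdorff_null_compact_finite_cover[OF null Lc `0 < s`] by blast
 have "et powr s <= (SUM i:K. diameter (U i) powr s)"
 proof (rule ifs_cover_bound[where g = g and I = I and L = ?L and c = c])
  show "c i * dist x y <= dist (g i x) (g i y)" if "i : I" "x : ?L" "y : ?L" for i x y
   by (rule c(2)) (use that LX in blast)+
  show "et <= dist (g i x) (g j y)" if "i : I" "j : I" "i ~= j" "x : ?L" "y : ?L" for i j x y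
   by (rule et(2)) (use that LX in blast)+
  show "bounded (U i)" for i by (rule K(3))
 qed (fact I Lne Lg c(1) et(1) `0 < s` sum K(1,2))+
 with K(4) show False by simp
qed

section \<open>Covering theorems, porosity and density\<close>

text \<open>Covering theorems deliver families indexed by discs or sets; bounding their finite
  partial sums spares an enumeration at each use.\<close>

lemma haus_pre_countable_index_le: fixes U :: "'i => 'a::metric_space set"
 assumes "countable I" "A <= (UN i:I. U i)" "!!i. i : I ==> U i <= X" "!!i. i : I ==> bounded (U i)"
  "!!i. i : I ==> diameter (U i) <= d" "0 <= d"
  and fin: "!!F. finite F ==> F <= I ==> (SUM i:F. haus_term s (U i)) <= b" shows "haus_pre X s d A <= b" proof -
 let ?N = "to_nat_on I ` I"
 define V where "V n = (if n : ?N then U (from_nat_into I n) else {})" for n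
 have inv: "from_nat_into I (to_nat_on I i) = i" if "i : I" for i using assms(1) that by simp
 have "haus_pre X s d A <= (\<Sum>n. haus_term s (V n))" proof (rule haus_pre_leI)
  show "A <= (UN n. V n)" proof
   fix x assume "x : A"
   then obtain i where i: "i : I" "x : U i" using assms(2) by blast
   hence "x : V (to_nat_on I i)" by (simp add: V_def inv)
   thus "x : (UN n. V n)" by (rule UN_I[OF UNIV_I])
  qed
  show "V n <= X" "bounded (V n)" "diameter (V n) <= d" for n
   using assms(3-6) inv by (auto simp: V_def simp del: Union_iff dest!: assms(3)[THEN subsetD, rotated])
 qed
 also have "... <= b" proof (rule suminf_le_const)
  fix n
  let ?F = "{i : I. to_nat_on I i < n}"
  have finF: "finite ?F" by (rule finite_imageD[of "to_nat_on I"])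
     (use assms(1) in \<open>auto intro: finite_subset[of _ "{..<n}"] inj_on_subset[OF inj_on_to_nat_on]\<close>)
  have "(\<Sum>k<n. haus_term s (V k)) = (SUM k:to_nat_on I ` ?F. haus_term s (V k))"
   by (rule sum.mono_neutral_right) (auto simp: V_def)
  also have "... = (SUM i:?F. haus_term s (V (to_nat_on I i)))"
   using assms(1) by (subst sum.reindex) (auto intro: inj_on_subset[OF inj_on_to_nat_on])
  also have "... = (SUM i:?F. haus_term s (U i))" by (intro sum.cong) (auto simp: V_def inv)
  also have "... <= b" by (rule fin[OF finF]) auto
  finally show "(\<Sum>k<n. haus_term s (V k)) <= b" .
 qed auto
 finally show ?thesis .
qed

text \<open>The five-fold enlargements of a disjoint subfamily cover A and have diameters 10 * R i.
  If all finite sums of these were at most M, so would be the premeasure.\<close>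

lemma vitali_finite_subfamily: fixes a :: "'i => complex"
 assumes d: "0 < d" and M: "0 <= M" "ennreal M < haus_pre UNIV 1 d A" and cov: "A <= (UN i:I. cball (a i) (R i))"
  and R: "!!i. i : I ==> 0 < R i & 10 * R i <= d"
 obtains F where "finite F" "F <= I" "!!i j. i : F ==> j : F ==> i ~= j ==> cball (a i) (R i) Int cball (a j) (R j) = {}"
  "M < (SUM i:F. 10 * R i)" proof -
 have "0 < R i & R i <= d" if "i : I" for i using R[OF that] by simp
 then obtain G where G: "countable G" "G <= I" "pairwise (%i j. disjnt (cball (a i) (R i)) (cball (a j) (R j))) G"
  "A <= (UN i:G. cball (a i) (5 * R i))" by (rule Vitali_covering_lemma_cballs[OF cov])
 have RG: "0 < R i" "10 * R i <= d" if "i : G" for i using R G(2) that by blast+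
 have "EX F. finite F & F <= G & M < (SUM i:F. 10 * R i)" proof (rule ccontr)
  assume nx: "~ ?thesis"
  have "haus_pre UNIV 1 d A <= ennreal M" proof (rule haus_pre_countable_index_le[OF G(1,4)])
   fix F assume F: "finite F" "F <= G"
   have "(SUM i:F. haus_term 1 (cball (a i) (5 * R i))) = (SUM i:F. ennreal (10 * R i))" proof (rule sum.cong[OF refl])
    fix i assume "i : F"
    hence "0 < R i" using RG F(2) by blast
    thus "haus_term 1 (cball (a i) (5 * R i)) = ennreal (10 * R i)" by (simp add: haus_term_pos diameter_cball)
   qed
   also have "... = ennreal (SUM i:F. 10 * R i)" using RG F(2) by (intro sum_ennreal) (simp add: less_imp_le subset_iff)
   also have "... <= ennreal M" using nx F by (intro ennreal_leI) (meson not_less)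
   finally show "(SUM i:F. haus_term 1 (cball (a i) (5 * R i))) <= ennreal M" .
  next
   fix i assume "i : G"
   thus "diameter (cball (a i) (5 * R i)) <= d" using RG[of i] by (simp add: diameter_cball)
  qed (use d in auto)
  thus False using M(2) by simp
 qed
 then obtain F where F: "finite F" "F <= G" "M < (SUM i:F. 10 * R i)" by blast
 show thesis proof (rule that[OF F(1) _ _ F(3)])
  show "cball (a i) (R i) Int cball (a j) (R j) = {}" if "i : F" "j : F" "i ~= j" for i j
   using pairwiseD[OF G(3), of i j] that F(2) by (auto simp: disjnt_def)
 qed (use F(2) G(2) in blast)
qed

text \<open>If A were not null, Vitali at a small scale would give disjoint holes carrying together
  at least \<open>ka1\<close> of the length of E. The half-size discs in these holes form a compact
  set at positive distance from A, so the construction repeats at a smaller scale around A, away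
  from all earlier holes. After n rounds E has length at least n times ka1, against its
  finiteness.\<close>

lemma hm_porous_null: fixes A E :: "complex set" assumes E: "hm UNIV 1 E < top" and c: "c > 0" and K: "K >= 0"
  and por: "!!p rh. p : A ==> rh > 0 ==> EX p' r. 0 < r & r < rh & dist p p' <= K * r &
    A Int ball p' r = {} & ennreal (c * r) <= hm UNIV 1 (E Int cball p' (r/2))" shows "hm UNIV 1 A = 0"
proof (rule ccontr)
 let ?H = "hm (UNIV::complex set) 1"
 assume "?H A ~= 0"
 have "EX d0>0. haus_pre UNIV 1 d0 A > 0" proof (rule ccontr)
  assume "~ ?thesis"
  hence "?H A <= 0" by (intro hm_least) (metis not_less)
  with `?H A ~= 0` show False by simp
 qed
 then obtain d0 where d0: "d0 > 0" "haus_pre UNIV 1 d0 A > 0" by blast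
 obtain ka' where "0 < ka'" "ka' < haus_pre UNIV 1 d0 A" using dense[OF d0(2)] by blast
 then obtain ka where ka: "ka > 0" "ennreal ka < haus_pre UNIV 1 d0 A" by (cases ka') (auto simp: less_top)
 define K' where "K' = K + 1"
 have K': "K' >= 1" using K by (simp add: K'_def)
 define ka1 where "ka1 = c * ka / (10 * K')"
 have ka1: "ka1 > 0" using c ka K' by (simp add: ka1_def)
 have ind: "EX C t. compact C & t > 0 & (ALL a:A. ALL x:C. t <= dist a x) & ennreal (real n * ka1) <= ?H (E Int C)" for n
 proof (induction n)
  case 0
  thus ?case by (intro exI[of _ "{}"] exI[of _ 1]) auto
 next
  case (Suc n)
  then obtain C t where C: "compact C" "t > 0" "!!a x. a : A ==> x : C ==> t <= dist a x"
   "ennreal (real n * ka1) <= ?H (E Int C)" by blast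
  \<comment> \<open>The first entry makes the Vitali discs admissible at scale d0; the second keeps
    the new discs away from the compact set C collected so far.\<close>
  define rh where "rh = min (d0 / 10) (t / 2) / K'"
  have rh: "rh > 0" "K' * rh <= d0 / 10" "K' * rh <= t / 2" using d0 C(2) K' by (auto simp: rh_def)
  define Idx where "Idx = {(p,p',r). p : A & 0 < r & r < rh & dist p p' <= K * r &
    A Int ball p' r = {} & ennreal (c * r) <= ?H (E Int cball p' (r/2))}"
  let ?a = "%(p::complex,p'::complex,r::real). p" and ?r = "%(p::complex,p'::complex,r). K' * r"
  have cov: "A <= (UN i:Idx. cball (?a i) (?r i))" proof
   fix p assume "p : A"
   then obtain p' r where "(p,p',r) : Idx" using por[OF _ rh(1)] by (force simp: Idx_def)
   thus "p : (UN i:Idx. cball (?a i) (?r i))" using K' by (intro UN_I[of "(p,p',r)"]) (auto simp: Idx_def)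
  qed
  have Rb: "0 < ?r i & 10 * ?r i <= d0" if "i : Idx" for i proof -
   have "0 < ?r i" "?r i <= K' * rh" using that K' by (auto simp: Idx_def)
   thus ?thesis using rh(2) by linarith
  qed
  obtain F where F: "finite F" "F <= Idx" "!!i j. i : F ==> j : F ==> i ~= j ==> cball (?a i) (?r i) Int cball (?a j) (?r j) = {}"
   "ka < (SUM i:F. 10 * ?r i)"
   by (rule vitali_finite_subfamily[OF d0(1) less_imp_le[OF ka(1)] ka(2) cov Rb]) (assumption | rule that)+
  note FI = F(2)
  let ?b = "%(p::complex,p'::complex,r). cball p' (r/2)" and ?rr = "%(p::complex,p'::complex,r::real). r"
  have rpos: "?rr i > 0" if "i : F" for i using that FI by (auto simp: Idx_def)
  have sub: "?b i <= cball (?a i) (?r i)" if iF: "i : F" for i proof -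
   obtain p p' r where i: "i = (p,p',r)" by (cases i)
   have "dist p p' <= K * r" "0 < r" using iF FI i by (auto simp: Idx_def)
   moreover have "dist p x <= K' * r" if "dist p' x <= r/2" for x proof -
    have "dist p x <= dist p p' + dist p' x" by (rule dist_triangle)
    also have "... <= K' * r" using `dist p p' <= K * r` `0 < r` that by (simp add: K'_def algebra_simps)
    finally show ?thesis .
   qed
   ultimately show ?thesis by (auto simp: i)
  qed
  define C2 where "C2 = (UN i:F. ?b i)"
  have C2: "compact C2" unfolding C2_def using F(1) by (intro compact_UN) (auto split: prod.split)
  have near: "t/2 <= dist x y" if "x : C" "y : C2" for x y proof -
   obtain i where i: "i : F" "y : ?b i" using `y : C2` by (auto simp: C2_def)
   hence "dist (?a i) y <= ?r i" using sub[OF i(1)] by auto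
   moreover have "?r i <= t/2" proof -
    have "?r i <= K' * rh" using i FI K' by (auto simp: Idx_def)
    thus ?thesis using rh(3) by linarith
   qed
   moreover have "?a i : A" using i FI by (auto simp: Idx_def)
   hence "t <= dist (?a i) x" using C(3) that(1) by blast
   moreover have "dist (?a i) x <= dist (?a i) y + dist x y" by (metis dist_commute dist_triangle)
   ultimately show ?thesis by linarith
  qed
  have disjb: "?b i Int ?b j = {}" if ij: "i : F" "j : F" "i ~= j" for i j proof -
   show ?thesis using F(3)[OF ij] sub[OF ij(1)] sub[OF ij(2)] by blast
  qed
  have HC2: "ennreal ka1 <= ?H (E Int C2)" proof -
   have "(SUM i:F. 10 * ?r i) = 10 * K' * (SUM i:F. ?rr i)"
    unfolding sum_distrib_left by (intro sum.cong) (auto split: prod.split)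
   hence "ka < 10 * K' * (SUM i:F. ?rr i)" using F(4) by simp
   hence "ka1 <= c * (SUM i:F. ?rr i)" using c K' by (simp add: ka1_def field_simps)
   hence "ennreal ka1 <= (SUM i:F. ennreal (c * ?rr i))"
    using rpos c by (subst sum_ennreal) (auto simp: sum_distrib_left less_imp_le ennreal_leI)
   also have "... <= (SUM i:F. ?H (E Int ?b i))" by (rule sum_mono) (use FI in \<open>auto simp: Idx_def\<close>)
   also have "... <= ?H (E Int C2)" unfolding C2_def using F(1) disjb by (intro hm_disjoint_compact_sum) auto
   finally show ?thesis .
  qed
  have "EX t'>0. ALL a:A. ALL x:C2. t' <= dist a x" proof -
   define P where "P = insert 1 ((%i. ?rr i / 2) ` F)"
   have P: "finite P" using F by (simp add: P_def)
   have "Min P > 0" using P rpos by (subst Min_gr_iff) (auto simp: P_def)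
   moreover have "Min P <= dist a x" if a: "a : A" and "x : C2" for a x proof -
    obtain i where i: "i : F" "x : ?b i" using `x : C2` by (auto simp: C2_def)
    obtain p p' r where ii: "i = (p,p',r)" by (cases i)
    have "i : Idx" using i(1) FI by blast
    hence "A Int ball p' r = {}" by (simp add: Idx_def ii)
    hence "a ~: ball p' r" using a by blast
    hence "r <= dist p' a" by auto
    also have "... <= dist p' x + dist a x" by (metis dist_commute dist_triangle)
    finally have "r/2 <= dist a x" using i(2) by (simp add: ii)
    moreover have "Min P <= r/2" using i P by (intro Min_le) (auto simp: P_def ii image_iff intro!: bexI[of _ i])
    ultimately show ?thesis by linarith
   qed
   ultimately show ?thesis by blast
  qed
  then obtain t' where t': "t' > 0" "!!a x. a : A ==> x : C2 ==> t' <= dist a x" by blast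
  show ?case proof (intro exI[of _ "C Un C2"] exI[of _ "min t t'"] conjI)
   show "ALL a:A. ALL x:C Un C2. min t t' <= dist a x" using C(3) t'(2) by (auto intro: min.coboundedI1 min.coboundedI2)
   have "ennreal (real (Suc n) * ka1) = ennreal (real n * ka1) + ennreal ka1"
    using ka1 by (simp add: ennreal_plus[symmetric] algebra_simps del: ennreal_plus)
   also have "... <= ?H (E Int C) + ?H (E Int C2)" using C(4) HC2 by (rule add_mono)
   also have "... <= ?H (E Int C Un E Int C2)" using near C(2) by (intro hm_separated[of _ _ "t/2"]) auto
   also have "E Int C Un E Int C2 = E Int (C Un C2)" by blast
   finally show "ennreal (real (Suc n) * ka1) <= ?H (E Int (C Un C2))" .
  qed (use C C2 t' in auto)
 qed
 obtain h where h: "?H E = ennreal h" "h >= 0" using E by (cases "?H E") auto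
 obtain n :: nat where n: "h / ka1 < real n" using reals_Archimedean2 by blast
 obtain C where "ennreal (real n * ka1) <= ?H (E Int C)" using ind by blast
 also have "... <= ennreal h" unfolding h(1)[symmetric] by (rule hm_mono) auto
 finally have "real n * ka1 <= h" using h(2) ka1 by simp
 with n ka1 show False by (simp add: field_simps)
qed

text \<open>Vitali selection for arbitrary sets by Zorn's lemma. \<open>Good\<close> families are
  disjoint, and whatever meets them meets a member of at least half its diameter. If some set were
  disjoint from a maximal family, one could add a set exceeding half the supremum of the diameters
  of such sets.\<close>

lemma vitali_maximal_disjoint: fixes VV :: "'a::metric_space set set"
 assumes "!!V. V : VV ==> 0 < diameter V" "!!V. V : VV ==> diameter V <= (b::real)"
 obtains G where "G <= VV" "!!V W. V : G ==> W : G ==> V ~= W ==> V Int W = {}"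
  "!!V. V : VV ==> EX W:G. V Int W ~= {} & diameter V <= 2 * diameter W" proof -
 define Good where "Good = {G. G <= VV & (ALL V:G. ALL W:G. V ~= W --> V Int W = {}) &
  (ALL V:VV. (EX W:G. V Int W ~= {}) --> (EX W:G. V Int W ~= {} & diameter V <= 2 * diameter W))}"
 have "EX M:Good. ALL X:Good. M <= X --> X = M" proof (rule subset_Zorn')
  fix C assume C: "subset.chain Good C"
  hence CG: "C <= Good" by (simp add: subset_chain_def)
  have dj: "V Int W = {}" if VW: "V : \<Union>C" "W : \<Union>C" "V ~= W" for V W proof -
   obtain G1 G2 where g: "G1 : C" "G2 : C" "V : G1" "W : G2" using VW by blast
   hence "G1 <= G2 | G2 <= G1" using C by (auto simp: subset_chain_def)
   then obtain G where "G : C" "V : G" "W : G" using g by blast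
   thus ?thesis using CG `V ~= W` by (auto simp: Good_def)
  qed
  show "\<Union>C : Good" unfolding Good_def proof (intro CollectI conjI ballI impI)
   show "\<Union>C <= VV" using CG by (auto simp: Good_def)
   show "V Int W = {}" if "V : \<Union>C" "W : \<Union>C" "V ~= W" for V W by (rule dj[OF that])
   show "EX W:\<Union>C. V Int W ~= {} & diameter V <= 2 * diameter W"
    if "V : VV" and ex: "EX W:\<Union>C. V Int W ~= {}" for V proof -
    obtain G W where G: "G : C" "W : G" "V Int W ~= {}" using ex by blast
    hence "G : Good" using CG by blast
    hence imp: "ALL V:VV. (EX W:G. V Int W ~= {}) --> (EX W:G. V Int W ~= {} & diameter V <= 2 * diameter W)"
     by (simp add: Good_def)
    have "EX W:G. V Int W ~= {} & diameter V <= 2 * diameter W"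
     by (rule bspec[OF imp `V : VV`, THEN mp]) (intro bexI[of _ W] G)
    then obtain W' where "W' : G" "V Int W' ~= {}" "diameter V <= 2 * diameter W'" by blast
    thus ?thesis using G(1) by blast
   qed
  qed
 qed
 then obtain M where M: "M : Good" and max: "!!X. X : Good ==> M <= X ==> X = M" by blast
 have "EX W:M. V Int W ~= {}" if "V : VV" for V proof (rule ccontr)
  define R where "R = {V : VV. ALL W:M. V Int W = {}}"
  assume "~ ?thesis"
  hence "V : R" using that by (auto simp: R_def)
  define S where "S = Sup (diameter ` R)"
  have bdd: "bdd_above (diameter ` R)" by (rule bdd_aboveI[of _ b]) (use assms(2) in \<open>auto simp: R_def\<close>)
  have "diameter V <= S" unfolding S_def using `V : R` bdd by (intro cSup_upper) auto
  moreover have "0 < diameter V" using that assms by auto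
  ultimately have "S / 2 < S" by simp
  then obtain V0 where V0: "V0 : R" "S / 2 < diameter V0"
   using `V : R` bdd unfolding S_def by (subst (asm) less_cSup_iff) auto
  have V0ne: "V0 ~= {}" using assms(1) V0(1) by (fastforce simp: R_def)
  have "insert V0 M : Good" unfolding Good_def proof (intro CollectI conjI ballI impI)
   show "insert V0 M <= VV" using V0 M by (auto simp: R_def Good_def)
   show "V Int W = {}" if "V : insert V0 M" "W : insert V0 M" "V ~= W" for V W proof -
    have a: "V0 Int W = {}" if "W : M" for W using V0(1) that by (auto simp: R_def)
    have b: "V Int W = {}" if "V : M" "W : M" "V ~= W" for V W using M that unfolding Good_def by simp
    show ?thesis proof (cases "V = V0")
     case True
     thus ?thesis using that a[of W] by auto
    next
     case VF: False
     hence "V : M" using that by auto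
     thus ?thesis using that a[of V] b[of V W] by (cases "W = V0") auto
    qed
   qed
   show "EX W:insert V0 M. U Int W ~= {} & diameter U <= 2 * diameter W"
    if "U : VV" and ex: "EX W:insert V0 M. U Int W ~= {}" for U proof (cases "EX W:M. U Int W ~= {}")
    case True
    have "ALL V:VV. (EX W:M. V Int W ~= {}) --> (EX W:M. V Int W ~= {} & diameter V <= 2 * diameter W)"
     using M by (simp add: Good_def)
    from bspec[OF this `U : VV`, THEN mp, OF True] show ?thesis by blast
   next
    case False
    hence "U : R" "U Int V0 ~= {}" using that by (auto simp: R_def)
    moreover have "diameter U <= S" unfolding S_def using `U : R` bdd by (intro cSup_upper) auto
    ultimately show ?thesis using V0(2) by auto
   qed
  qed
  hence "V0 : M" using max[of "insert V0 M"] by auto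
  thus False using V0(1) V0ne by (auto simp: R_def)
 qed
 moreover have "ALL V:VV. (EX W:M. V Int W ~= {}) --> (EX W:M. V Int W ~= {} & diameter V <= 2 * diameter W)"
  "M <= VV" "!!V W. V : M ==> W : M ==> V ~= W ==> V Int W = {}" using M by (simp_all add: Good_def)
 ultimately show thesis by (intro that[of M]) auto
qed

text \<open>Disjoint sets that each carry te times their diameter of the length h of J have
  diameters with sum at most h / te. They cover A only after enlargement by K, but finitely many
  need no enlargement and the remaining ones have small total diameter. So h <= h / te, which forces
  h = 0.\<close>

lemma hausdorff_upper_density: fixes J A :: "'a::heine_borel set"
 assumes J: "hm UNIV 1 J < top" "hm UNIV 1 (J - A) = 0" and te: "1 < te" and Kc: "0 <= Kc"
  and dens: "!!p rh. p : A ==> 0 < rh ==> EX U. closed U & bounded U & 0 < diameter U & diameter U < rh &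
    (EX u:U. dist p u <= Kc * diameter U) & ennreal (te * diameter U) <= hm UNIV 1 (J Int U)" shows "hm UNIV 1 J = 0"
proof -
 let ?H = "hm (UNIV::'a set) 1"
 obtain h where h: "?H J = ennreal h" "h >= 0" using J(1) by (cases "?H J") auto
 \<comment> \<open>The distance from p to a point of W is at most diameter W + (Kc + 1) * diameter
   U, and diameter U <= 2 * diameter W.\<close>
 define K where "K = 2 * Kc + 3"
 have K: "K >= 3" using Kc by (simp add: K_def)
 have pre: "haus_pre UNIV 1 d A <= ennreal (h / te)" if d: "d > 0" for d proof -
  define rh where "rh = d / (2 * K)"
  have rh: "rh > 0" "2 * K * rh <= d" "rh <= d" using d K by (auto simp: rh_def field_simps)
  define VV where "VV = {U. closed U & bounded U & 0 < diameter U & diameter U < rh &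
    ennreal (te * diameter U) <= ?H (J Int U)}"
  obtain G where G: "G <= VV" "!!V W. V : G ==> W : G ==> V ~= W ==> V Int W = {}"
   "!!V. V : VV ==> EX W:G. V Int W ~= {} & diameter V <= 2 * diameter W"
   by (rule vitali_maximal_disjoint[of VV rh]) (auto simp: VV_def)
  have sumle: "(SUM V:F. diameter V) <= h / te" if "finite F" "F <= G" for F proof -
   have "ennreal (te * (SUM V:F. diameter V)) = (SUM V:F. ennreal (te * diameter V))"
    using that G(1) te by (subst sum_ennreal) (auto simp: sum_distrib_left VV_def subset_iff less_imp_le)
   also have "... <= (SUM V:F. ?H (J Int V))" by (rule sum_mono) (use that G(1) in \<open>auto simp: VV_def\<close>)
   also have "... <= ?H (J Int (UN V:F. V))"
    using that G by (intro hm_disjoint_compact_sum) (auto simp: VV_def subset_iff)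
   also have "... <= ?H J" by (rule hm_mono) auto
   finally have "te * (SUM V:F. diameter V) <= h" using h by (simp add: ennreal_le_iff)
   thus ?thesis using te by (simp add: field_simps)
  qed
  have summ: "diameter summable_on G" proof (rule nonneg_bounded_partial_sums_imp_summable_on[where C = "h / te"])
   show "eventually (%F. sum diameter F <= h / te) (finite_subsets_at_top G)"
    by (rule eventually_finite_subsets_at_top_weakI) (rule sumle)
   show "0 <= diameter V" if "V : G" for V using that G(1) by (auto simp: VV_def)
  qed
  have "countable {V : G. diameter V ~= 0}" by (rule summable_countable_real[OF summ])
  moreover have "{V : G. diameter V ~= 0} = G" using G(1) by (auto simp: VV_def)
  ultimately have cG: "countable G" by simp
  have bound: "haus_pre UNIV 1 d A <= ennreal (h / te) + ennreal e" if e: "e > 0" for e proof -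
   define S where "S = infsum diameter G"
   obtain F where F: "finite F" "F <= G" "S - e / (2 * K) < sum diameter F" proof -
    have "(diameter has_sum S) G" using summ by (simp add: S_def)
    hence "eventually (%F. dist (sum diameter F) S < e / (2 * K)) (finite_subsets_at_top G)"
     unfolding has_sum_def using e K by (intro tendstoD) auto
    then obtain F where "finite F" "F <= G" "dist (sum diameter F) S < e / (2*K)"
     unfolding eventually_finite_subsets_at_top by blast
    thus thesis by (intro that[of F]) (auto simp: dist_real_def)
   qed
   have tail: "(SUM V:E. diameter V) <= e / (2 * K)" if E: "finite E" "E <= G - F" for E proof -
    have "sum diameter E + sum diameter F = sum diameter (E Un F)"
     using E F by (intro sum.union_disjoint[symmetric]) auto
    also have "... <= S"
     unfolding S_def using summ E F G(1) by (intro finite_sum_le_infsum) (auto simp: VV_def less_imp_le)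
    finally show ?thesis using F(3) by simp
   qed
   define v where "v V = (SOME x. x : V)" for V :: "'a set"
   have v: "v V : V" if "V : G" for V proof -
    have "V ~= {}" using that G(1) by (auto simp: VV_def)
    thus ?thesis unfolding v_def by (simp add: some_in_eq)
   qed
   have cover: "A <= (\<Union>F) Un (UN V:G-F. cball (v V) (K * diameter V))" proof
    fix p assume p: "p : A"
    show "p : (\<Union>F) Un (UN V:G-F. cball (v V) (K * diameter V))" proof (cases "p : \<Union>F")
     case False
     have "closed (\<Union>F)" using F G(1) by (intro closed_Union) (auto simp: VV_def)
     then obtain ta where ta: "ta > 0" "ball p ta Int \<Union>F = {}"
      using False by (metis Compl_iff disjoint_eq_subset_Compl openE open_Compl)
     \<comment> \<open>A set U this small meets W within ta of p, hence outside the closed union of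
       F; so W belongs to the tail.\<close>
     define rh' where "rh' = min rh (ta / (Kc + 2))"
     have "rh' > 0" using ta rh Kc by (auto simp: rh'_def)
     then obtain U u where U: "closed U" "bounded U" "0 < diameter U" "diameter U < rh'" "u : U"
      "dist p u <= Kc * diameter U" "ennreal (te * diameter U) <= ?H (J Int U)" using dens[OF p] by blast
     have "U : VV" using U by (auto simp: VV_def rh'_def)
     then obtain W where W: "W : G" "U Int W ~= {}" "diameter U <= 2 * diameter W" using G(3) by blast
     then obtain w where w: "w : U" "w : W" by blast
     have "dist u w <= diameter U" using U w by (intro diameter_bounded_bound) auto
     hence pw: "dist p w <= (Kc + 1) * diameter U" using U(6) dist_triangle[of p w u] by (simp add: algebra_simps)
     also have "... < (Kc + 1) * (ta / (Kc + 2))" using U(4) Kc by (intro mult_strict_left_mono) (auto simp: rh'_def)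
     also have "... <= ta" using ta(1) Kc by (simp add: field_simps)
     finally have "w ~: \<Union>F" using ta(2) by auto
     hence "W : G - F" using W(1) w(2) by blast
     moreover have "dist (v W) p <= K * diameter W" proof -
      have "dist (v W) w <= diameter W" using v W w G(1) by (intro diameter_bounded_bound) (auto simp: VV_def)
      moreover have "(Kc + 1) * diameter U <= (Kc + 1) * (2 * diameter W)" using W(3) Kc by (intro mult_left_mono) auto
      ultimately show ?thesis using pw dist_triangle[of "v W" p w] by (simp add: K_def algebra_simps dist_commute)
     qed
     ultimately show ?thesis by auto
    qed auto
   qed
   have "haus_pre UNIV 1 d A <= haus_pre UNIV 1 d (\<Union>F) + haus_pre UNIV 1 d (UN V:G-F. cball (v V) (K * diameter V))"
    using haus_pre_mono[OF cover] haus_pre_Un[OF d] by (rule order_trans)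
   also have "... <= ennreal (h / te) + ennreal e" proof (rule add_mono)
    show "haus_pre UNIV 1 d (\<Union>F) <= ennreal (h / te)"
    proof (rule haus_pre_countable_index_le[where I = F and U = "%V. V"])
     show "(SUM V:E. haus_term 1 V) <= ennreal (h / te)" if E: "finite E" "E <= F" for E proof -
      have "(SUM V:E. haus_term 1 V) = (SUM V:E. ennreal (diameter V))"
       using E F G(1) by (intro sum.cong) (auto simp: haus_term_pos VV_def subset_iff abs_of_pos)
      also have "... = ennreal (SUM V:E. diameter V)"
       using E F G(1) by (intro sum_ennreal) (auto simp: VV_def subset_iff less_imp_le)
      also have "... <= ennreal (h / te)" using E F by (intro ennreal_leI sumle) auto
      finally show ?thesis .
     qed
    qed (use F G(1) d rh in \<open>auto simp: VV_def subset_iff intro: countable_finite order_trans less_imp_le\<close>)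
    show "haus_pre UNIV 1 d (UN V:G-F. cball (v V) (K * diameter V)) <= ennreal e"
    proof (rule haus_pre_countable_index_le[where I = "G - F" and U = "%V. cball (v V) (K * diameter V)"])
     have dm: "diameter (cball (v V) (K * diameter V)) <= 2 * K * diameter V" if "V : G" for V proof (rule diameter_leI)
      show "0 <= 2 * K * diameter V" using that K G(1) by (auto simp: VV_def)
      show "dist x y <= 2 * K * diameter V"
       if "x : cball (v V) (K * diameter V)" "y : cball (v V) (K * diameter V)" for x y
       using that dist_triangle[of x y "v V"] by (auto simp: dist_commute)
     qed
     show "diameter (cball (v V) (K * diameter V)) <= d" if "V : G - F" for V proof -
      have "2 * K * diameter V <= 2 * K * rh" using that G(1) K by (intro mult_left_mono) (auto simp: VV_def)
      thus ?thesis using dm[of V] that rh(2) by auto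
     qed
     show "(SUM V:E. haus_term 1 (cball (v V) (K * diameter V))) <= ennreal e" if E: "finite E" "E <= G - F" for E
     proof -
      have "(SUM V:E. haus_term 1 (cball (v V) (K * diameter V))) <= (SUM V:E. ennreal (2 * K * diameter V))"
      proof (rule sum_mono)
       fix V assume "V : E"
       thus "haus_term 1 (cball (v V) (K * diameter V)) <= ennreal (2 * K * diameter V)"
        using dm[of V] E by (auto simp: haus_term_pos diameter_ge_0 intro!: ennreal_leI)
      qed
      also have "... = ennreal (2 * K * (SUM V:E. diameter V))"
       using E F G(1) K by (subst sum_ennreal) (auto simp: sum_distrib_left VV_def subset_iff less_imp_le)
      also have "... <= ennreal e" using tail[OF E] K by (intro ennreal_leI) (simp add: field_simps)
      finally show ?thesis .
     qed
    qed (use cG d in auto)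
   qed
   finally show ?thesis .
  qed
  show ?thesis by (rule ennreal_le_epsilon) (rule bound)
 qed
 have "?H A <= ennreal (h / te)" by (rule hm_least[OF pre])
 moreover have "?H J <= ?H A + ?H (J - A)" by (rule order_trans[OF hm_mono hm_Un]) auto
 ultimately have "?H J <= ennreal (h / te)" using J(2) by (auto intro: order_trans)
 hence "h <= h / te" using h te by (simp add: ennreal_le_iff)
 hence "h * te <= h" using te by (simp add: field_simps)
 hence "h * (te - 1) <= 0" by (simp add: algebra_simps)
 hence "h <= 0" using te by (simp add: mult_le_0_iff)
 thus ?thesis using h by simp
qed

section \<open>Length of continua\<close>

text \<open>The distance from a is 1-Lipschitz and, by connectedness, takes every value of {0..r} on
  S.\<close>

lemma connected_hausdorff_ge_radius: fixes a :: "'a::metric_space"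
 assumes "connected S" "a : S" "z : S" "r <= dist a z" shows "ennreal r <= hm UNIV 1 (S Int cball a r)"
proof (rule hm_ge_interval[where g = "dist a"])
 show "dist (dist a x) (dist a y) <= dist x y" for x y
  using dist_triangle[of a x y] dist_triangle[of a y x] by (auto simp: dist_real_def dist_commute)
 show "{0..r} <= dist a ` (S Int cball a r)" proof
  fix t assume t: "t : {0..r}"
  have "connected (dist a ` S)" by (intro connected_continuous_image continuous_intros assms)
  moreover have "0 : dist a ` S" "dist a z : dist a ` S" using assms by force+
  ultimately have "t : dist a ` S" using t assms(4) by (auto dest!: connectedD_interval[of _ 0 "dist a z" t])
  thus "t : dist a ` (S Int cball a r)" using t by auto
 qed
qed

text \<open>A point c of S off the segment makes S too long: S runs from a towards c, from b towards
  c, and has a piece around c besides. Conversely a connected subset of the segment containing a and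
  b is all of it.\<close>

lemma continuum_length_eq_diameter_is_segment: fixes S :: "'a::euclidean_space set"
 assumes S: "connected S" "a : S" "b : S"
  and D: "!!x. x : S ==> dist a x <= dist a b" "!!x. x : S ==> dist b x <= dist a b"
  and H: "hm UNIV 1 S <= ennreal (dist a b)" shows "S = closed_segment a b" proof -
 let ?H = "hm (UNIV::'a set) 1"
 have sub: "S <= closed_segment a b" proof
  fix c assume c: "c : S"
  show "c : closed_segment a b" proof (rule ccontr)
   assume nc: "c ~: closed_segment a b"
   define d where "d = dist a b"
   have "d < dist a c + dist c b"
    using nc dist_triangle[of a b c] by (auto simp: between_mem_segment[symmetric] between d_def)
   \<comment> \<open>A quarter of the excess in the triangle inequality. The three radii rh1, rh2
     and 3/2 * ka add up to d + ka/2, more than the available length, and the three discs are still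
     at least ka/2 apart.\<close>
   define ka where "ka = (dist a c + dist c b - d) / 4"
   have ka: "ka > 0" using `d < dist a c + dist c b` by (simp add: ka_def)
   define rh1 where "rh1 = dist a c - 2 * ka"
   define rh2 where "rh2 = d - dist a c + ka"
   have sum: "rh1 + rh2 = d - ka" by (simp add: rh1_def rh2_def)
   have r2: "rh2 = dist c b - 3 * ka" by (simp add: rh2_def ka_def field_simps)
   have dac: "dist a c <= d" "dist c b <= d" using D[OF c] by (auto simp: d_def dist_commute[of c b])
   define ta where "ta = min (3/2 * ka) (dist a c)"
   have ca: "c ~= a" using nc by auto
   have ta: "ta > 0" using ka ca by (simp add: ta_def)
   have H1: "ennreal rh1 <= ?H (S Int cball a rh1)"
    by (rule connected_hausdorff_ge_radius[OF S(1,2) c]) (use ka in \<open>simp add: rh1_def\<close>)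
   have H2: "ennreal rh2 <= ?H (S Int cball b rh2)"
    by (rule connected_hausdorff_ge_radius[OF S(1,3) c]) (use ka r2 in \<open>simp add: dist_commute\<close>)
   have H3: "ennreal (3/2 * ka) <= ?H (S Int cball c (3/2 * ka))" proof (cases "3/2 * ka <= dist c a")
    case True
    thus ?thesis by (rule connected_hausdorff_ge_radius[OF S(1) c S(2)])
   next
    case False
    have "3/2 * ka <= dist c b" proof -
     have "4 * ka = dist a c + dist c b - d" by (simp add: ka_def)
     hence "4 * ka <= dist c b" using dac by linarith
     thus ?thesis using ka by linarith
    qed
    thus ?thesis by (rule connected_hausdorff_ge_radius[OF S(1) c S(3)])
   qed
   have s1: "ka/2 <= dist x y" if "x : S Int cball a rh1" "y : S Int cball b rh2" for x y proof -
    have "dist a x <= rh1" "dist b y <= rh2" using that by auto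
    moreover have "d <= dist a x + dist x y + dist b y"
     unfolding d_def by (metis dist_commute dist_triangle dist_triangle_le add_right_mono order_trans)
    ultimately show ?thesis using sum ka by linarith
   qed
   have s2: "ka/2 <= dist x y" if "x : (S Int cball a rh1) Un (S Int cball b rh2)" "y : S Int cball c (3/2*ka)" for x y
   proof -
    have y: "dist c y <= 3/2 * ka" using that by auto
    have tri: "dist a c <= dist a x + dist x y + dist c y" "dist c b <= dist b x + dist x y + dist c y"
     by (smt (verit) dist_commute dist_triangle)+
    have "dist a x <= rh1 | dist b x <= rh2" using that by auto
    thus ?thesis proof
     assume "dist a x <= rh1" thus ?thesis using tri(1) y unfolding rh1_def by linarith
    next
     assume "dist b x <= rh2" thus ?thesis using tri(2) y ka unfolding r2 by linarith
    qed
   qed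
   have "?H (S Int cball a rh1) + ?H (S Int cball b rh2) + ?H (S Int cball c (3/2*ka))
     <= ?H ((S Int cball a rh1) Un (S Int cball b rh2)) + ?H (S Int cball c (3/2*ka))"
    using s1 ka by (intro add_right_mono hm_separated[of _ _ "ka/2"]) auto
   also have "... <= ?H ((S Int cball a rh1) Un (S Int cball b rh2) Un (S Int cball c (3/2*ka)))"
    using s2 ka by (intro hm_separated[of _ _ "ka/2"]) auto
   also have "... <= ?H S" by (rule hm_mono) auto
   also have "... <= ennreal d" using H by (simp add: d_def)
   finally have fin: "?H (S Int cball a rh1) + ?H (S Int cball b rh2) + ?H (S Int cball c (3/2*ka)) <= ennreal d" .
   \<comment> \<open>A radius may be negative, and \<open>ennreal\<close> then truncates its lower
     bound to 0.\<close>
   have "d < max 0 rh1 + max 0 rh2 + 3/2*ka" using sum ka by (auto simp: max_def)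
   hence "ennreal d < ennreal (max 0 rh1 + max 0 rh2 + 3/2*ka)" using ka by (subst ennreal_less_iff) (auto simp: d_def)
   also have "... = ennreal (max 0 rh1) + ennreal (max 0 rh2) + ennreal (3/2*ka)"
    using ka by (subst ennreal_plus[symmetric] | simp)+
   also have "... <= ?H (S Int cball a rh1) + ?H (S Int cball b rh2) + ?H (S Int cball c (3/2*ka))"
    using H1 H2 H3 by (intro add_mono) (auto simp: max_def)
   finally show False using fin by simp
  qed
 qed
 show ?thesis proof
  show "closed_segment a b <= S" proof
   fix x assume x: "x : closed_segment a b"
   have "connected (dist a ` S)" by (intro connected_continuous_image continuous_intros S)
   moreover have "0 : dist a ` S" "dist a b : dist a ` S" using S by force+
   moreover have "dist a x <= dist a b" using x dist_in_closed_segment[OF x] by (simp add: dist_commute)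
   ultimately have "dist a x : dist a ` S" by (auto dest!: connectedD_interval[of _ 0 "dist a b" "dist a x"])
   then obtain y where y: "y : S" "dist a x = dist a y" by auto
   obtain u v where uv: "0 <= u" "0 <= v" "x = (1 - u) *\<^sub>R a + u *\<^sub>R b" "y = (1 - v) *\<^sub>R a + v *\<^sub>R b"
    using x y(1) sub by (auto simp: closed_segment_def subset_iff)
   have "dist a x = u * dist a b" "dist a y = v * dist a b" proof -
    have "a - x = u *\<^sub>R (a - b)" "a - y = v *\<^sub>R (a - b)" unfolding uv(3,4) by (simp_all add: algebra_simps)
    thus "dist a x = u * dist a b" "dist a y = v * dist a b" using uv(1,2) by (simp_all add: dist_norm)
   qed
   hence "u = v | a = b" using y(2) by auto
   hence "x = y" proof
    assume "u = v" thus ?thesis unfolding uv(3,4) by simp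
   next
    assume "a = b" thus ?thesis unfolding uv(3,4) by (simp flip: scaleR_add_left)
   qed
   thus "x : S" using y by simp
  qed
 qed (rule sub)
qed

section \<open>Univalent functions\<close>

lemma holomorphic_derivative_bound: assumes "f holomorphic_on ball y r" "0 < s" "s < r"
  and "!!z. z : cball y s ==> norm (f z) <= B" shows "norm (deriv f y) <= B / s" proof -
 have "norm ((deriv ^^ 1) f y) <= fact 1 * B / s ^ 1" by (rule Cauchy_inequality[of f y s B 1])
    (use assms in \<open>auto simp: dist_norm intro: holomorphic_on_subset hol_cont continuous_on_subset\<close>)
 thus ?thesis by simp
qed

text \<open>A square root of 1 - g/w, where w is a value omitted by g, omits 0 and -1, so that
 Schottky's theorem applies.\<close>

lemma univalent_growth_unit: obtains B where "B > 0" "!!g z. [|g holomorphic_on ball 0 1; inj_on g (ball 0 1); g 0 = 0;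
   deriv g 0 = 1; norm z <= 4/5|] ==> norm (g z) <= B" proof -
 \<comment> \<open>Schottky's bound for norm (f 0) <= 1 and norm z <= 8/9.\<close>
 define S where "S = exp(pi * exp(pi * (2 + 2 * 1 + 12 * (8/9) / (1 - 8/9))))"
 show thesis proof (rule that[of "2 * (1 + S ^ 2)"])
  show "2 * (1 + S ^ 2) > 0" by (simp add: add_pos_nonneg)
  fix g :: "complex => complex" and z :: complex
  assume g: "g holomorphic_on ball 0 1" "inj_on g (ball 0 1)" "g 0 = 0" "deriv g 0 = 1" and z: "norm z <= (4/5::real)"
  \<comment> \<open>Otherwise the inverse of g, composed with doubling, would map the unit disc into
    itself with derivative 2 at 0, against Schwarz's lemma.\<close>
  have "EX w0. w0 : ball 0 2 & w0 ~: g ` ball 0 1" proof (rule ccontr)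
   assume "~ ?thesis"
   hence sub: "ball 0 2 <= g ` ball 0 1" by blast
   obtain h where h: "h holomorphic_on g ` ball 0 1"
    "!!z. z : ball 0 1 ==> deriv g z * deriv h (g z) = 1" "!!z. z : ball 0 1 ==> h (g z) = z"
    using holomorphic_has_inverse[OF g(1) open_ball g(2)] by blast
   define H where "H = (%z. h (2 * z))"
   have holh: "h holomorphic_on ball 0 2" using holomorphic_on_subset[OF h(1) sub] .
   have "norm (deriv H 0) <= 1" proof (rule Schwarz_Lemma[of H 0])
    show "H holomorphic_on ball 0 1" unfolding H_def
     by (rule holomorphic_on_compose_gen[unfolded o_def, OF _ holh]) (auto intro!: holomorphic_intros simp: norm_mult)
    show "H 0 = 0" using h(3)[of 0] g(3) by (simp add: H_def)
    show "norm (H z) < 1" if "norm z < 1" for z proof -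
     have "2 * z : ball 0 2" using that by (simp add: norm_mult)
     then obtain x where "x : ball 0 1" "2 * z = g x" using sub by blast
     thus ?thesis using h(3)[of x] by (simp add: H_def)
    qed
   qed auto
   moreover have "deriv H 0 = 2" proof -
    have "deriv h 0 = 1" using h(2)[of 0] g(3,4) by simp
    moreover have "(h has_field_derivative deriv h 0) (at 0)" using holomorphic_derivI[OF holh open_ball, of 0] by simp
    ultimately have "(h has_field_derivative 1) (at (2 * 0))" by simp
    hence "(H has_field_derivative 1 * 2) (at 0)"
     unfolding H_def by (rule DERIV_chain2) (auto intro!: derivative_eq_intros)
    thus ?thesis by (auto dest: DERIV_imp_deriv)
   qed
   ultimately show False by simp
  qed
  then obtain w0 where "w0 : ball 0 2" "w0 ~: g ` ball 0 1" by blast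
  hence w0: "norm w0 < 2" "!!z. z : ball 0 1 ==> g z ~= w0" by auto
  have w0n: "w0 ~= 0" using w0(2)[of 0] g(3) by auto
  have "(%z. 1 - g z / w0) holomorphic_on ball 0 1" using w0n by (intro holomorphic_intros g(1))
  then obtain s0 where s0: "s0 holomorphic_on ball 0 1" "!!z. z : ball 0 1 ==> 1 - g z / w0 = s0 z ^ 2"
   using contractible_imp_holomorphic_sqrt[of "%z. 1 - g z / w0" "ball 0 1"] w0(2) w0n
   by (auto simp: convex_imp_contractible)
  have "s0 0 ^ 2 = 1" using s0(2)[of 0] g(3) by simp
  hence s00: "s0 0 = 1 | s0 0 = -1" by (simp add: power2_eq_1_iff)
  define s where "s z = s0 z / s0 0" for z
  have s: "s holomorphic_on ball 0 1" "!!z. z : ball 0 1 ==> 1 - g z / w0 = s z ^ 2" "s 0 = 1"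
   using s0 s00 unfolding s_def by (auto intro!: holomorphic_intros simp: power_divide)
  have om: "s z ~= 0" "s z ~= -1" if "z : ball 0 1" for z proof -
   show "s z ~= 0" using s(2)[OF that] w0(2)[OF that] w0n by auto
   show "s z ~= -1" proof
    assume "s z = -1"
    hence "g z = g 0" using s(2)[OF that] w0n g(3) by auto
    hence "z = 0" using g(2) that by (auto simp: inj_on_def)
    thus False using `s z = -1` s(3) by simp
   qed
  qed
  \<comment> \<open>The factor 9/10 gives holomorphy on the closed disc and turns the radius 4/5
    into 8/9; the sign turns the omitted values 0 and -1 into 0 and 1.\<close>
  define f where "f = (%z. - s (9/10 * z))"
  have in1: "9/10 * z : ball 0 1" if "z : cball 0 1" for z :: complex using that by (simp add: norm_mult)
  have "norm (f (10/9 * z)) <= S" unfolding S_def proof (rule Schottky[of f 1 "8/9" "10/9 * z"])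
   show "f holomorphic_on cball 0 1" unfolding f_def
    by (intro holomorphic_intros holomorphic_on_compose_gen[unfolded o_def, OF _ s(1)]) (use in1 in auto)
   show "~ (f z = 0 | f z = 1)" if "z : cball 0 1" for z
    using om[OF in1[OF that]] by (auto simp: f_def minus_equation_iff)
  qed (use z s(3) in \<open>auto simp: f_def norm_mult\<close>)
  hence sz: "norm (s z) <= S" by (simp add: f_def)
  have "g z = w0 * (1 - s z ^ 2)" using s(2)[of z] z w0n by (auto simp: field_simps)
  hence "norm (g z) = norm w0 * norm (1 - s z ^ 2)" by (simp add: norm_mult)
  also have "... <= 2 * (1 + S ^ 2)" proof (rule mult_mono)
   have "norm (1 - s z ^ 2) <= 1 + norm (s z) ^ 2" using norm_triangle_ineq4[of 1 "s z ^ 2"] by (simp add: norm_power)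
   also have "... <= 1 + S ^ 2" using sz by (intro add_left_mono power_mono) auto
   finally show "norm (1 - s z ^ 2) <= 1 + S ^ 2" .
  qed (use w0 in auto)
  finally show "norm (g z) <= 2 * (1 + S ^ 2)" .
 qed
qed

lemma univalent_growth: obtains B where "B > 0" "!!f x e z. [|f holomorphic_on ball x e; inj_on f (ball x e); 0 < e;
   dist x z <= 4/5 * e|] ==> norm (f z - f x) <= B * e * norm (deriv f x)" proof -
 obtain B where B: "B > 0" "!!g z. [|g holomorphic_on ball 0 1; inj_on g (ball 0 1); g 0 = 0;
   deriv g 0 = 1; norm z <= 4/5|] ==> norm (g z) <= B" using univalent_growth_unit by blast
 show thesis proof (rule that[OF B(1)])
  fix f x and z :: complex and e :: real
  assume f: "f holomorphic_on ball x e" "inj_on f (ball x e)" "0 < e" "dist x z <= 4/5 * e"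
  define D where "D = of_real e * deriv f x"
  have "deriv f x ~= 0" using holomorphic_injective_imp_regular[OF f(1) _ f(2)] f(3) by simp
  hence D: "D ~= 0" using f(3) by (simp add: D_def)
  define g where "g = (%w. (f (x + of_real e * w) - f x) / D)"
  have inb: "x + of_real e * w : ball x e" if "w : ball 0 1" for w using that f(3) by (simp add: dist_norm norm_mult)
  have "norm (g ((z - x) / of_real e)) <= B" proof (rule B(2)[of g "(z - x) / of_real e"])
   show "g holomorphic_on ball 0 1" unfolding g_def
    by (intro holomorphic_intros holomorphic_on_compose_gen[unfolded o_def, OF _ f(1)]) (use inb D in auto)
   show "inj_on g (ball 0 1)" proof (rule inj_onI)
    fix a b assume "a : ball 0 1" "b : ball 0 1" "g a = g b"
    hence "f (x + of_real e * a) = f (x + of_real e * b)" using D by (simp add: g_def)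
    hence "x + of_real e * a = x + of_real e * b" using f(2) inb `a : ball 0 1` `b : ball 0 1` by (auto dest!: inj_onD)
    thus "a = b" using f(3) by simp
   qed
   show "g 0 = 0" by (simp add: g_def)
   have "(f has_field_derivative deriv f x) (at (x + of_real e * 0))"
    using holomorphic_derivI[OF f(1) open_ball, of x] f(3) by simp
   hence "((%w. f (x + of_real e * w)) has_field_derivative deriv f x * of_real e) (at 0)"
    by (rule DERIV_chain2) (auto intro!: derivative_eq_intros)
   hence "(g has_field_derivative (deriv f x * of_real e - 0) / D) (at 0)"
    unfolding g_def by (intro DERIV_cdivide DERIV_diff) auto
   thus "deriv g 0 = 1" using D by (auto dest!: DERIV_imp_deriv simp: D_def mult.commute)
   show "norm ((z - x) / of_real e) <= 4/5"
    using f(3,4) by (simp add: norm_divide dist_norm norm_minus_commute field_simps)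
  qed
  moreover have "x + of_real e * ((z - x) / of_real e) = z" using f(3) by simp
  ultimately have "norm ((f z - f x) / D) <= B" by (simp add: g_def)
  thus "norm (f z - f x) <= B * e * norm (deriv f x)"
   using D f(3) by (simp add: norm_divide D_def norm_mult field_simps)
 qed
qed

text \<open>Koebe's distortion theorem with a single constant for three estimates, relative to the
  derivative at the centre: Lipschitz bounds from above and below on the quarter disc, and a disc
  inside the image. What matters is uniformity in f, x and e.\<close>

locale distortion = fixes C :: real assumes C: "C >= 1" and
  up: "[|f holomorphic_on ball x e; inj_on f (ball x e); 0 < e; y : cball x (e/4); z : cball x (e/4)|]
    ==> dist (f y :: complex) (f z) <= C * norm (deriv f x) * dist y z"
  and low: "[|f holomorphic_on ball x e; inj_on f (ball x e); 0 < e; y : cball x (e/4); z : cball x (e/4)|]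
    ==> norm (deriv f x) * dist y z <= C * dist (f y) (f z)"
  and im: "[|f holomorphic_on ball x e; inj_on f (ball x e); 0 < e|]
    ==> ball (f x) (norm (deriv f x) * e / C) <= f ` ball x (e/4)"

text \<open>Cauchy's estimate turns the growth bound into a comparison of derivatives, and
  recentring gives the reverse comparison. The lower estimates come from Bloch's lemma, which asks
  that the derivative at most double on the disc used.\<close>

lemma univalent_distortion: "EX C. distortion C" proof -
 obtain B0 where B0: "B0 > 0" "!!f x e z. [|f holomorphic_on ball x e; inj_on f (ball x e); 0 < e;
   dist x z <= 4/5 * e|] ==> norm (f z - f x) <= B0 * e * norm (deriv f x)" using univalent_growth by blast
 define B where "B = 4 * max 1 B0"
 have B1: "B >= 4" by (simp add: B_def)
 have B2: "B^2 >= 16" using power_mono[OF B1, of 2] by simp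
 define C where "C = 24 * B ^ 3"
 have B3: "B <= B ^ 3" "1 <= B ^ 3" "B^2 <= B^3" using B1 by (auto simp: self_le_power power_increasing)
 have db: "norm (deriv f y) <= B * norm (deriv f x)"
  if f: "f holomorphic_on ball x e" "inj_on f (ball x e)" "0 < e" and y: "dist x y <= e/2" for f x y and e :: real
 proof -
  have D: "deriv (%z. f z - f x) y = deriv f y" proof -
   have "(f has_field_derivative deriv f y) (at y)" using holomorphic_derivI[OF f(1) open_ball, of y] y f(3) by simp
   hence "((%z. f z - f x) has_field_derivative deriv f y - 0) (at y)" by (intro DERIV_diff) auto
   thus ?thesis by (auto dest: DERIV_imp_deriv)
  qed
  have "norm (deriv (%z. f z - f x) y) <= (B0 * e * norm (deriv f x)) / (3/10 * e)"
  proof (rule holomorphic_derivative_bound[where r = "e/2"])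
   have sub: "ball y (e/2) <= ball x e" using y by (simp add: ball_subset_ball_iff dist_commute)
   show "(%z. f z - f x) holomorphic_on ball y (e/2)" by (intro holomorphic_intros holomorphic_on_subset[OF f(1) sub])
   show "norm (f z - f x) <= B0 * e * norm (deriv f x)" if "z : cball y (3/10 * e)" for z
    by (rule B0(2)[OF f]) (use that y dist_triangle[of x z y] in auto)
  qed (use f in auto)
  also have "... = 10/3 * B0 * norm (deriv f x)" using f(3) by (simp add: field_simps)
  also have "... <= B * norm (deriv f x)" by (intro mult_right_mono) (auto simp: B_def)
  finally show ?thesis by (simp add: D)
 qed
 have db': "norm (deriv f x) <= B * norm (deriv f y)"
  if f: "f holomorphic_on ball x e" "inj_on f (ball x e)" "0 < e" and y: "dist x y <= e/4" for f x y and e :: real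
 proof (rule db[where e = "3/4 * e"])
  have sub: "ball y (3/4 * e) <= ball x e" using y by (simp add: ball_subset_ball_iff dist_commute)
  show "f holomorphic_on ball y (3/4 * e)" "inj_on f (ball y (3/4 * e))"
   using f(1,2) sub holomorphic_on_subset inj_on_subset by blast+
 qed (use f y in \<open>auto simp: dist_commute\<close>)
 \<comment> \<open>On a disc of radius e / (9 * B^2) the Cauchy bound for the second derivative lets
   the derivative change by at most norm (deriv f y).\<close>
 have deriv2: "norm (deriv f z) <= 2 * norm (deriv f y)"
  if f: "f holomorphic_on ball x e" "inj_on f (ball x e)" "0 < e" and y: "dist x y <= e/4"
   and z: "dist y z <= e / (9 * B^2)" for f x y z and e :: real proof -
  have small: "e / (9 * B^2) <= e / 8" using f(3) B1 B2 by (simp add: field_simps)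
  have sub: "ball x e <= ball x e" by simp
  have hd: "deriv f holomorphic_on ball x e" using f(1) by (simp add: holomorphic_deriv)
  have "norm (deriv f z - deriv f y) <= (B * norm (deriv f x) / (e/9)) * norm (z - y)"
  proof (rule field_differentiable_bound[of "cball y (e / (9 * B^2))" _ "deriv (deriv f)"])
   fix w assume w: "w : cball y (e / (9 * B^2))"
   hence xw: "dist x w <= 3/8 * e" using small y dist_triangle[of x w y] by auto
   hence "w : ball x e" using f(3) by auto
   thus "(deriv f has_field_derivative deriv (deriv f) w) (at w within cball y (e / (9 * B^2)))"
    using holomorphic_derivI[OF hd open_ball] has_field_derivative_at_within by blast
   show "norm (deriv (deriv f) w) <= B * norm (deriv f x) / (e/9)"
   proof (rule holomorphic_derivative_bound[where r = "e/2"])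
    show "deriv f holomorphic_on ball w (e/2)"
     by (rule holomorphic_on_subset[OF hd]) (use xw f(3) in \<open>simp add: ball_subset_ball_iff dist_commute\<close>)
    show "norm (deriv f v) <= B * norm (deriv f x)" if "v : cball w (e/9)" for v
     by (rule db[OF f]) (use that xw dist_triangle[of x v w] f(3) in auto)
   qed (use f in auto)
  qed (use z f(3) B1 in auto)
  also have "... <= (B * (B * norm (deriv f y)) / (e/9)) * (e / (9 * B^2))"
   using z f(3) B1 db'[OF f y] by (intro mult_mono divide_right_mono mult_left_mono) (auto simp: dist_norm norm_minus_commute)
  also have "... = 1 * norm (deriv f y)" using f(3) B1 by (simp add: field_simps power2_eq_square)
  finally have *: "norm (deriv f z - deriv f y) <= 1 * norm (deriv f y)" .
  show ?thesis using * norm_triangle_sub[of "deriv f z" "deriv f y"] by simp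
 qed
 have lower: "ball (f y) (r * norm (deriv f y) / 6) <= f ` ball y r"
  if f: "f holomorphic_on ball x e" "inj_on f (ball x e)" "0 < e" and y: "dist x y <= e/4"
   and r: "0 < r" "r <= e / (9 * B^2)" for f x y and e r :: real proof -
  have small: "e / (9 * B^2) <= e / 8" using f(3) B1 B2 by (simp add: field_simps)
  \<comment> \<open>This bounds the constant 3 - 2 * sqrt 2 of Bloch's lemma below by 1/6.\<close>
  have "sqrt 2 <= 17/12" by (rule real_le_lsqrt) (auto simp: power2_eq_square)
  hence "r * norm (deriv f y) / 6 <= (3 - 2 * sqrt 2) * r * norm (deriv f y)"
   using mult_right_mono[of "1/6" "3 - 2 * sqrt 2" "r * norm (deriv f y)"] r by (simp add: mult.assoc)
  hence "ball (f y) (r * norm (deriv f y) / 6) <= ball (f y) ((3 - 2 * sqrt 2) * r * norm (deriv f y))"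
   by (rule subset_ball)
  also have "... <= f ` ball y r" proof (rule Bloch_lemma)
   have "cball y r <= ball x e" proof
    fix z assume "z : cball y r"
    thus "z : ball x e" using small r y f(3) dist_triangle[of x z y] by simp
   qed
   thus "f holomorphic_on cball y r" using f(1) holomorphic_on_subset by blast
   show "norm (deriv f z) <= 2 * norm (deriv f y)" if "z : ball y r" for z using that r by (intro deriv2[OF f y]) auto
  qed (use r in auto)
  finally show ?thesis .
 qed
 show ?thesis proof (rule exI[of _ "54 * B^3"], unfold_locales)
  show "1 <= 54 * B^3" using B3 by simp
 next
  fix f x and y z :: complex and e :: real
  assume f: "f holomorphic_on ball x e" "inj_on f (ball x e)" "0 < e" and yz: "y : cball x (e/4)" "z : cball x (e/4)"
  have "norm (f y - f z) <= (B * norm (deriv f x)) * norm (y - z)"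
  proof (rule field_differentiable_bound[of "cball x (e/4)" _ "deriv f"])
   fix w assume w: "w : cball x (e/4)"
   hence "w : ball x e" using f(3) by auto
   thus "(f has_field_derivative deriv f w) (at w within cball x (e/4))"
    using holomorphic_derivI[OF f(1) open_ball] has_field_derivative_at_within by blast
   show "norm (deriv f w) <= B * norm (deriv f x)" by (rule db[OF f]) (use w f(3) in auto)
  qed (use yz in auto)
  also have "... <= (54 * B^3 * norm (deriv f x)) * norm (y - z)" using B3 B1 by (intro mult_right_mono) auto
  finally show "dist (f y) (f z) <= 54 * B^3 * norm (deriv f x) * dist y z" by (simp add: dist_norm)
  show "norm (deriv f x) * dist y z <= 54 * B^3 * dist (f y) (f z)" proof (cases "y = z")
   case False
   define r where "r = min (dist y z) (e / (9 * B^2))"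
   have r: "0 < r" "r <= e / (9 * B^2)" using False f(3) B1 by (auto simp: r_def)
   have rz: "2 / (9 * B^2) * dist y z <= r" proof -
    have "dist y z <= e / 2" using yz dist_triangle[of y z x] by (auto simp: dist_commute)
    hence "2 / (9 * B^2) * dist y z <= 2 / (9 * B^2) * (e/2)" using B1 by (intro mult_left_mono) auto
    moreover have "2 / (9 * B^2) * dist y z <= 1 * dist y z" proof (rule mult_right_mono)
     show "2 / (9 * B^2) <= 1" using B2 by (subst divide_le_eq_1_pos) auto
    qed auto
    ultimately show ?thesis by (simp add: r_def)
   qed
   have "z ~: ball y r" by (simp add: r_def)
   moreover have "ball y r <= ball x e" proof
    fix w assume "w : ball y r"
    moreover have "e / (9 * B^2) <= e / 8" using f(3) B1 B2 by (simp add: field_simps)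
    ultimately show "w : ball x e" using r yz(1) f(3) dist_triangle[of x w y] by simp
   qed
   moreover have "z : ball x e" using yz f(3) by auto
   \<comment> \<open>Injectivity turns the disc covered about f y into a lower bound for the
     distance of f z.\<close>
   ultimately have "f z ~: f ` ball y r" using f(2) unfolding inj_on_def by blast
   hence "f z ~: ball (f y) (r * norm (deriv f y) / 6)" using lower[OF f _ r, of y] yz(1) by auto
   hence "r * norm (deriv f y) / 6 <= dist (f y) (f z)" by simp
   moreover have "norm (deriv f x) * dist y z <= (B * norm (deriv f y)) * (9 * B^2 / 2 * r)" proof (rule mult_mono)
    show "norm (deriv f x) <= B * norm (deriv f y)" by (rule db'[OF f]) (use yz(1) in auto)
    have "0 < B^2" using B1 by simp
    thus "dist y z <= 9 * B^2 / 2 * r" using rz by (simp add: field_simps)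
   qed (use B1 in auto)
   moreover have "(B * norm (deriv f y)) * (9 * B^2 / 2 * r) = 27 * B^3 * (r * norm (deriv f y) / 6)"
    by (simp add: power2_eq_square power3_eq_cube)
   moreover have "27 * B^3 * (r * norm (deriv f y) / 6) <= 54 * B^3 * (r * norm (deriv f y) / 6)"
    using B3 B1 r(1) by (intro mult_right_mono) auto
   moreover have "54 * B^3 * (r * norm (deriv f y) / 6) <= 54 * B^3 * dist (f y) (f z)"
    using `r * norm (deriv f y) / 6 <= dist (f y) (f z)` B3 B1 by (intro mult_left_mono) auto
   ultimately show ?thesis by linarith
  qed simp
 next
  fix f x and e :: real
  assume f: "f holomorphic_on ball x e" "inj_on f (ball x e)" "0 < e"
  have "norm (deriv f x) * e / (54 * B^3) <= (e / (9 * B^2)) * norm (deriv f x) / 6"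
   using B3 B1 f(3) by (simp add: frac_le mult.commute divide_left_mono)
  hence "ball (f x) (norm (deriv f x) * e / (54 * B^3)) <= ball (f x) ((e / (9 * B^2)) * norm (deriv f x) / 6)"
   by (rule subset_ball)
  also have "... <= f ` ball x (e / (9 * B^2))" using f(3) B1 B2 by (intro lower[OF f]) auto
  also have "... <= f ` ball x (e/4)" using f(3) B1 B2 by (intro image_mono subset_ball) (simp add: field_simps)
  finally show "ball (f x) (norm (deriv f x) * e / (54 * B^3)) <= f ` ball x (e/4)" .
 qed
qed

section \<open>Normal families omitting two values\<close>

text \<open>After normalization the functions omit 0 and 1, and so do their reciprocals. Infinitely
  many functions, or infinitely many reciprocals, are at most 1 at w, and \<open>GPicard3\<close>
  bounds these on compact sets. The alternative keeps limits finite where the functions tend to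
  infinity.\<close>

lemma Montel_two_values: fixes F :: "nat => complex => complex"
 assumes S: "open S" "connected S" and hol: "!!n. F n holomorphic_on S"
  and ab: "a ~= b" "!!n z. z : S ==> F n z ~= a & F n z ~= b"
 obtains r g where "strict_mono (r::nat => nat)" "g holomorphic_on S" "(locunif S (%n. F (r n)) g) |
   (locunif S (%n z. 1 / (F (r n) z - a)) g)" proof (cases "S = {}")
 case True
 thus thesis by (intro that[of id "%_. 0"]) (auto simp: strict_mono_id)
next
 case False
 then obtain w where w: "w : S" by blast
 have main: "EX r g. strict_mono (r::nat => nat) & g holomorphic_on S & locunif S (%n. h (r n)) g"
  if hh: "!!n. h n holomorphic_on S" and h01: "!!n z. z : S ==> h n z ~= 0 & h n z ~= 1"
   and inf: "infinite {n. norm (h n w) <= 1}" for h :: "nat => complex => complex" proof -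
  obtain r1 :: "nat => nat" where r1: "strict_mono r1" "!!n. r1 n : {n. norm (h n w) <= 1}"
   using infinite_enumerate[OF inf] by blast
  have bd: "EX B. ALL f:range (%n. h (r1 n)). ALL z:K. norm (f z) <= B" if K: "compact K" "K <= S" for K proof -
   obtain B where "!!f z. [|f : range (%n. h (r1 n)); z : K|] ==> norm (f z) <= B"
    by (rule GPicard3[OF S w, of "range (%n. h (r1 n))" "range (%n. h (r1 n))" K]) (use hh h01 r1 K in auto)
   thus ?thesis by blast
  qed
  obtain g r2 where g: "g holomorphic_on S" "strict_mono (r2::nat => nat)"
   "!!K. [|compact K; K <= S|] ==> uniform_limit K ((%n. h (r1 n)) o r2) g sequentially"
   by (rule Montel[OF S(1), of "range (%n. h (r1 n))" "%n. h (r1 n)"]) (use hh bd in auto)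
  show ?thesis by (rule exI[of _ "r1 o r2"], rule exI[of _ g])
     (use g r1 in \<open>auto simp: o_def strict_mono_def\<close>)
 qed
 define h where "h n z = (F n z - a) / (b - a)" for n z
 have hh: "h n holomorphic_on S" for n unfolding h_def using ab by (intro holomorphic_intros hol) auto
 have h01: "h n z ~= 0 & h n z ~= 1" if "z : S" for n z using ab(1) ab(2)[OF that, of n] by (auto simp: h_def)
 show thesis proof (cases "infinite {n. norm (h n w) <= 1}")
  case True
  obtain r g where rg: "strict_mono (r::nat => nat)" "g holomorphic_on S"
   "!!K. compact K ==> K <= S ==> uniform_limit K (%n. h (r n)) g sequentially" using main[OF hh h01 True] by blast
  have "uniform_limit K (%n. F (r n)) (%z. a + (b - a) * g z) sequentially" if "compact K" "K <= S" for K proof -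
   have "uniform_limit K (%n z. a + (b - a) * h (r n) z) (%z. a + (b - a) * g z) sequentially"
    by (intro uniform_limit_intros rg(3) that)
   thus ?thesis using ab(1) by (simp add: h_def)
  qed
  moreover have "(%z. a + (b - a) * g z) holomorphic_on S" by (intro holomorphic_intros rg)
  ultimately show ?thesis using rg(1) that by blast
 next
  case False
  have "infinite {n. norm (1 / h n w) <= 1}" proof
   assume "finite {n. norm (1 / h n w) <= 1}"
   moreover have "UNIV = {n. norm (h n w) <= 1} Un {n. norm (1 / h n w) <= 1}"
    by (auto simp: norm_divide divide_le_eq_1)
   ultimately show False using False by (metis finite_Un infinite_UNIV_nat)
  qed
  moreover have "(%z. 1 / h n z) holomorphic_on S" for n by (intro holomorphic_intros hh) (use h01 in auto)
  moreover have "1 / h n z ~= 0 & 1 / h n z ~= 1" if "z : S" for n z using h01[OF that] by auto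
  ultimately have "EX r g. strict_mono (r::nat => nat) & g holomorphic_on S & locunif S (%n z. 1 / h (r n) z) g"
   by (intro main[of "%n z. 1 / h n z"])
  then obtain r g where rg: "strict_mono (r::nat => nat)" "g holomorphic_on S"
   "!!K. compact K ==> K <= S ==> uniform_limit K (%n z. 1 / h (r n) z) g sequentially" by blast
  have "uniform_limit K (%n z. 1 / (F (r n) z - a)) (%z. (1 / (b - a)) * g z) sequentially" if "compact K" "K <= S" for K
  proof -
   have "uniform_limit K (%n z. (1 / (b - a)) * (1 / h (r n) z)) (%z. (1 / (b - a)) * g z) sequentially"
    by (intro uniform_limit_intros rg(3) that)
   thus ?thesis using ab(1) by (simp add: h_def)
  qed
  moreover have "(%z. (1 / (b - a)) * g z) holomorphic_on S" by (intro holomorphic_intros rg)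
  ultimately show ?thesis using rg(1) that by blast
 qed
qed

section \<open>Coordinates on the sphere\<close>

definition RS :: "(complex*real) set" where "RS = riemann_sphere"
definition sg :: "complex => complex*real" where "sg z = stereo (Some z)"
abbreviation np :: "complex*real" where "np \<equiv> (0, 1)"
definition zt :: "complex*real => complex" where "zt y = fst y / of_real (1 - snd y)"
text \<open>The map z -> 1/z. On the sphere it is a half-turn, hence an isometry, and it provides
  the chart at \<open>np\<close>.\<close>

definition iv :: "complex*real => complex*real" where "iv y = (cnj (fst y), - snd y)"
text \<open>The point with homogeneous coordinates u : v, continuous also across v = 0.\<close>

definition hst :: "complex => complex => complex*real" where
 "hst u v = (2 * u * cnj v / of_real ((cmod u)^2 + (cmod v)^2), ((cmod u)^2 - (cmod v)^2) / ((cmod u)^2 + (cmod v)^2))"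

lemma stereo_None: "stereo None = np" by (simp add: stereo_def)

lemma sg_eq: "sg z = (2 * z / of_real (1 + (cmod z)^2), ((cmod z)^2 - 1) / ((cmod z)^2 + 1))"
 by (simp add: sg_def stereo_def)

lemma one_plus_norm_pos [simp]: "0 < 1 + (cmod z)^2" "1 + (cmod z)^2 ~= 0" "0 < (cmod z)^2 + 1" "(cmod z)^2 + 1 ~= 0"
 by (simp_all add: add_pos_nonneg add_nonneg_pos less_imp_neq[symmetric])

lemma of_real_one_plus_norm [simp]: "complex_of_real (1 + (cmod z)^2) ~= 0" "1 + (complex_of_real (cmod z))^2 ~= 0"
 by (metis of_real_eq_0_iff one_plus_norm_pos(2)) (metis of_real_1 of_real_add of_real_eq_0_iff of_real_power one_plus_norm_pos(2))

lemma norm_pair_sphere: "(x, t) : RS <-> (cmod x)^2 + t^2 = 1"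
proof -
 have "(x, t) : RS <-> sqrt ((cmod x)^2 + t^2) = 1" by (simp add: RS_def norm_Pair)
 thus ?thesis by simp
qed

lemma sg_in [simp]: "sg z : RS"
proof -
 let ?a = "(cmod z)^2"
 have "(cmod (2 * z / of_real (1 + ?a)))^2 = 4 * ?a / (1 + ?a)^2"
  by (simp add: norm_divide norm_mult power_divide power_mult_distrib norm_of_real del: of_real_add)
 moreover have "4 * ?a / (1 + ?a)^2 + ((?a - 1) / (?a + 1))^2 = (4 * ?a + (?a - 1)^2) / (1 + ?a)^2"
  by (simp add: power_divide add_divide_distrib add.commute)
 moreover have "4 * ?a + (?a - 1)^2 = (1 + ?a)^2" by (simp add: power2_eq_square algebra_simps)
 ultimately show ?thesis unfolding sg_eq norm_pair_sphere by simp
qed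

lemma np_in [simp]: "np : RS" by (simp add: norm_pair_sphere)

lemma one_minus_snd_sg: "1 - snd (sg z) = 2 / (1 + (cmod z)^2)" by (simp add: sg_eq field_simps)

lemma sg_neq_np [simp]: "sg z ~= np" "np ~= sg z"
proof -
 have "2 / (1 + (cmod z)^2) ~= 0" by simp
 hence "1 - snd (sg z) ~= 0" unfolding one_minus_snd_sg .
 thus "sg z ~= np" by auto
 thus "np ~= sg z" by (rule not_sym)
qed

lemma zt_sg [simp]: "zt (sg z) = z"
proof -
 have "zt (sg z) = (2 * z / of_real (1 + (cmod z)^2)) / of_real (2 / (1 + (cmod z)^2))"
  unfolding zt_def one_minus_snd_sg by (simp add: sg_eq)
 also have "... = z" by (simp del: of_real_add add: field_simps)
 finally show ?thesis .
qed

lemma inj_sg [simp]: "sg z = sg w <-> z = w" by (metis zt_sg)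

lemma sg_zt: assumes "y : RS" "y ~= np" shows "sg (zt y) = y"
proof -
 obtain x t where y: "y = (x, t)" by (cases y)
 have e: "(cmod x)^2 = 1 - t^2" using assms(1) y by (simp add: norm_pair_sphere)
 have t: "t ~= 1" proof
  assume "t = 1" hence "x = 0" using e by simp
  thus False using assms(2) y `t = 1` by simp
 qed
 have "t^2 <= 1" using e by (metis diff_ge_0_iff_ge zero_le_power2)
 hence "t < 1" using t by (simp add: abs_square_le_1)
 have n: "(cmod (zt y))^2 = (1 + t) / (1 - t)" proof -
  have "(cmod (zt y))^2 = (1 - t^2) / (1 - t)^2" proof -
   have "zt y = x / of_real (1 - t)" by (simp add: y zt_def)
   hence "cmod (zt y) = cmod x / \<bar>1 - t\<bar>" by (simp only: norm_divide norm_of_real)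
   thus ?thesis using e by (simp add: power_divide)
  qed
  also have "1 - t^2 = (1 + t) * (1 - t)" by (simp add: power2_eq_square algebra_simps)
  finally show ?thesis using t by (simp add: power2_eq_square)
 qed
 have a: "1 + (cmod (zt y))^2 = 2 / (1 - t)" using t unfolding n by (simp add: field_simps)
 have "((cmod (zt y))^2 - 1) / ((cmod (zt y))^2 + 1) = t" proof -
  have "(cmod (zt y))^2 - 1 = 2 * t / (1 - t)" using t unfolding n by (simp add: field_simps)
  moreover have "(cmod (zt y))^2 + 1 = 2 / (1 - t)" using a by simp
  ultimately show ?thesis using t by simp
 qed
 moreover have "2 * zt y / of_real (1 + (cmod (zt y))^2) = x" proof -
  have "complex_of_real (1 - t) ~= 0" using t by (metis of_real_eq_0_iff right_minus_eq)
  thus ?thesis unfolding a by (simp add: y zt_def del: of_real_diff)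
 qed
 ultimately show ?thesis by (simp add: sg_eq y)
qed

lemma sphere_cases: assumes "y : RS" obtains "y = np" | z where "y = sg z" using sg_zt[OF assms] by metis

lemma iv_in [simp]: "iv y : RS <-> y : RS" by (cases y) (simp add: iv_def norm_pair_sphere)

lemma iv_iv [simp]: "iv (iv y) = y" by (simp add: iv_def)

lemma iv_isometry: "dist (iv x) (iv y) = dist x y"
proof -
 have "dist (cnj a) (cnj b) = dist a b" for a b by (metis complex_cnj_diff complex_mod_cnj dist_norm)
 thus ?thesis by (simp add: iv_def dist_prod_def dist_minus)
qed

lemma iv_sg: "z ~= 0 ==> iv (sg z) = sg (1 / z)"
proof -
 assume z: "z ~= 0"
 let ?a = "(cmod z)^2"
 have a: "?a ~= 0" using z by simp
 have az: "complex_of_real ?a = z * cnj z" by (rule complex_norm_square)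
 have "2 * (1 / z) / of_real (1 + (cmod (1/z))^2) = cnj (2 * z / of_real (1 + ?a))" proof -
  have "1 + (cmod (1/z))^2 = (1 + ?a) / ?a" using a by (simp add: norm_divide power_divide field_simps)
  hence "2 * (1 / z) / of_real (1 + (cmod (1/z))^2) = 2 * (1 / z) * of_real ?a / of_real (1 + ?a)"
   using a by (simp del: of_real_add of_real_power)
  also have "... = 2 * cnj z / of_real (1 + ?a)" using z unfolding az by simp
  finally show ?thesis by simp
 qed
 moreover have "((cmod (1/z))^2 - 1) / ((cmod (1/z))^2 + 1) = - ((?a - 1) / (?a + 1))"
  using a by (simp add: norm_divide power_divide divide_simps) (simp add: algebra_simps)?
 ultimately show ?thesis by (simp add: iv_def sg_eq)
qed

lemma iv_sg0 [simp]: "iv (sg 0) = np" "iv np = sg 0" by (simp_all add: iv_def sg_eq)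

lemma hst_eq: "u ~= 0 | v ~= 0 ==> hst u v = (if v = 0 then np else sg (u / v))"
proof -
 assume uv: "u ~= 0 | v ~= 0"
 show ?thesis proof (cases "v = 0")
  case True thus ?thesis using uv by (simp add: hst_def)
 next
  case False
  let ?a = "(cmod u)^2" and ?b = "(cmod v)^2"
  have b: "?b ~= 0" using False by simp
  have bz: "complex_of_real ?b = v * cnj v" by (rule complex_norm_square)
  have n: "(cmod (u/v))^2 = ?a / ?b" by (simp add: norm_divide power_divide)
  have "2 * (u/v) / of_real (1 + ?a / ?b) = 2 * u * cnj v / of_real (?a + ?b)" proof -
   have "1 + ?a / ?b = (?a + ?b) / ?b" using b by (simp add: field_simps)
   hence "2 * (u/v) / of_real (1 + ?a / ?b) = 2 * (u/v) * of_real ?b / of_real (?a + ?b)"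
    using b by (simp del: of_real_add of_real_power)
   thus ?thesis using False unfolding bz by simp
  qed
  moreover have "(?a / ?b - 1) / (?a / ?b + 1) = (?a - ?b) / (?a + ?b)" proof -
   have "?a + ?b ~= 0" using False by (simp add: add_nonneg_eq_0_iff)
   thus ?thesis using b by (simp add: divide_simps) (simp add: algebra_simps)?
  qed
  ultimately show ?thesis using False by (simp add: hst_def sg_eq n)
 qed
qed

lemma continuous_on_hst: assumes "continuous_on S f" "continuous_on S g" "!!z. z : S ==> f z ~= 0 | g z ~= 0"
 shows "continuous_on S (%z. hst (f z) (g z))"
proof -
 have "(cmod (f z))^2 + (cmod (g z))^2 ~= 0" if "z : S" for z using assms(3)[OF that] by (simp add: add_nonneg_eq_0_iff)
 moreover hence "complex_of_real ((cmod (f z))^2 + (cmod (g z))^2) ~= 0" if "z : S" for z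
  using that by (metis of_real_eq_0_iff)
 ultimately show ?thesis unfolding hst_def by (intro continuous_intros assms) auto
qed

lemma continuous_on_sg [continuous_intros]: "continuous_on S f ==> continuous_on S (%x. sg (f x))"
 unfolding sg_eq by (intro continuous_intros) (auto simp del: of_real_add)

lemma continuous_on_iv [continuous_intros]: "continuous_on S f ==> continuous_on S (%x. iv (f x))"
 unfolding iv_def by (intro continuous_intros)

lemma continuous_on_zt: "continuous_on (RS - {np}) zt"
proof -
 have "1 - snd y ~= 0" if "y : RS - {np}" for y using one_minus_snd_sg[of "zt y"] sg_zt[of y] that by auto
 moreover hence "complex_of_real (1 - snd y) ~= 0" if "y : RS - {np}" for y using that by (metis of_real_eq_0_iff)
 ultimately show ?thesis unfolding zt_def by (intro continuous_intros) auto
qed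

lemma iv_eq_np: "y : RS ==> iv y = np <-> y = sg 0" by (metis iv_iv iv_sg0(2))

lemma zt_iv: "y : RS ==> y ~= np ==> y ~= sg 0 ==> zt (iv y) = 1 / zt y" by (metis iv_sg sg_zt zt_sg)

lemma openin_sg_image: "open V ==> openin (top_of_set RS) (sg ` V)"
proof -
 assume V: "open V"
 have "openin (top_of_set (RS - {np})) ((RS - {np}) Int zt -` V)"
  by (rule continuous_openin_preimage_gen[OF continuous_on_zt V])
 moreover have "(RS - {np}) Int zt -` V = sg ` V" proof (intro equalityI subsetI)
  fix y assume "y : (RS - {np}) Int zt -` V"
  thus "y : sg ` V" using sg_zt[of y] by (intro image_eqI[of _ _ "zt y"]) auto
 qed auto
 moreover have "openin (top_of_set RS) (RS - {np})" by (simp add: openin_delete)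
 ultimately show ?thesis using openin_trans by metis
qed

definition tr :: "complex => complex*real => complex*real" where "tr k y = (if y = np then np else sg (zt y + k))"

lemma tr_np [simp]: "tr k np = np" and tr_sg [simp]: "tr k (sg z) = sg (z + k)" by (simp_all add: tr_def)

lemma tr_in [simp]: "y : RS ==> tr k y : RS" by (simp add: tr_def)

lemma tr_tr: "y : RS ==> tr k (tr l y) = tr (k + l) y" by (erule sphere_cases) (auto simp: add_ac)

lemma tr_0: "y : RS ==> tr 0 y = y" by (erule sphere_cases) auto

lemma dist_sg: "(dist (sg z) (sg w))^2 = 4 * (cmod (z - w))^2 / ((1 + (cmod z)^2) * (1 + (cmod w)^2))"
proof -
 let ?a = "1 + (cmod z)^2" and ?b = "1 + (cmod w)^2"
 have pos: "?a > 0" "?b > 0" by simp_all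
 have 1: "(2 * z / of_real ?a - 2 * w / of_real ?b) = of_real (2 / (?a * ?b)) * (of_real ?b * z - of_real ?a * w)"
  using of_real_one_plus_norm(1)[of z] of_real_one_plus_norm(1)[of w] by (simp add: divide_simps del: of_real_add)
 have 2: "(?a - 2) / ?a - (?b - 2) / ?b = (2 / (?a * ?b)) * (?a - ?b)" using pos by (simp add: field_simps)
 have "(dist (sg z) (sg w))^2 = (cmod (2 * z / of_real ?a - 2 * w / of_real ?b))^2 + ((?a - 2) / ?a - (?b - 2) / ?b)^2"
  by (simp add: sg_eq dist_prod_def dist_real_def dist_norm add.commute del: of_real_add)
 also have "... = (2 / (?a * ?b))^2 * ((cmod (of_real ?b * z - of_real ?a * w))^2 + (?a - ?b)^2)"
  unfolding 1 2 norm_mult norm_of_real power_mult_distrib by (simp add: distrib_left)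
 also have "(cmod (of_real ?b * z - of_real ?a * w))^2 + (?a - ?b)^2 = ?a * ?b * (cmod (z - w))^2" proof -
  have e1: "(cmod (of_real b * z - of_real a * w))^2 = b^2 * (cmod z)^2 + a^2 * (cmod w)^2 - 2 * a * b * Re (z * cnj w)" for a b :: real
   by (simp add: cmod_power2) (simp add: power2_eq_square algebra_simps)
  have e2: "(cmod (z - w))^2 = (cmod z)^2 + (cmod w)^2 - 2 * Re (z * cnj w)" using e1[of 1 1] by simp
  have e3: "b^2 * z' + a^2 * w' - 2 * a * b * R + (a - b)^2 = a * b * (z' + w' - 2 * R)"
   if "a = 1 + z'" "b = 1 + w'" for a b z' w' R :: real unfolding that by (simp add: power2_eq_square algebra_simps)
  show ?thesis unfolding e1 e2 by (rule e3) simp_all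
 qed
 also have "(2 / (?a * ?b))^2 * (?a * ?b * (cmod (z - w))^2) = 4 * (cmod (z - w))^2 / (?a * ?b)" proof -
  have "(2 / (a * b))^2 * (a * b * N) = 4 * N / (a * b)" if "a ~= 0" "b ~= 0" for a b N :: real
   using that by (simp add: power2_eq_square field_simps)
  thus ?thesis using pos by (metis less_irrefl)
 qed
 finally show ?thesis .
qed

lemma dist_sg_np: "(dist (sg z) np)^2 = 4 / (1 + (cmod z)^2)"
proof -
 let ?a = "1 + (cmod z)^2"
 have "(dist (sg z) np)^2 = (cmod (2 * z / of_real ?a))^2 + (1 - (?a - 2) / ?a)^2"
  by (simp add: sg_eq dist_prod_def dist_real_def dist_norm add.commute del: of_real_add)
 also have "... = 4 * (cmod z)^2 / ?a\<^sup>2 + 4 / ?a\<^sup>2" proof -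
  have "1 - (?a - 2) / ?a = 2 / ?a" by (simp add: field_simps)
  moreover have "cmod (2 * z / of_real ?a) = 2 * cmod z / ?a"
   by (simp add: norm_divide norm_mult norm_of_real del: of_real_add)
  ultimately show ?thesis by (simp only: power_divide power_mult_distrib) simp
 qed
 also have "... = 4 * ?a / ?a\<^sup>2" by (simp add: add_divide_distrib[symmetric] algebra_simps)
 also have "... = 4 / ?a" proof -
  have "4 * a / a^2 = 4 / a" if "a ~= 0" for a :: real using that by (simp add: power2_eq_square)
  thus ?thesis using one_plus_norm_pos(2) .
 qed
 finally show ?thesis .
qed

lemma dist_sg_le: "dist (sg z) (sg w) <= 2 * dist z w"
proof (rule power2_le_imp_le)
 have "1 <= (1 + (cmod z)^2) * (1 + (cmod w)^2)" by (simp add: algebra_simps)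
 hence "4 * (cmod (z - w))^2 / ((1 + (cmod z)^2) * (1 + (cmod w)^2)) <= 4 * (cmod (z - w))^2 / 1"
  by (intro divide_left_mono) auto
 thus "(dist (sg z) (sg w))^2 <= (2 * dist z w)^2" unfolding power_mult_distrib dist_sg by (simp add: dist_norm)
qed simp

lemma dist_sg_ge: assumes "cmod z <= R" "cmod w <= R" shows "2 * dist z w <= (1 + R^2) * dist (sg z) (sg w)"
proof (rule power2_le_imp_le)
 have R: "(cmod z)^2 <= R^2" "(cmod w)^2 <= R^2" using assms by (auto intro: power_mono)
 have "(1 + (cmod z)^2) * (1 + (cmod w)^2) <= (1 + R^2)^2"
  unfolding power2_eq_square[of "1 + R^2"] using R by (intro mult_mono) auto
 hence "4 * (cmod (z - w))^2 * ((1 + (cmod z)^2) * (1 + (cmod w)^2)) <= 4 * (cmod (z - w))^2 * (1 + R^2)^2"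
  by (intro mult_left_mono) auto
 thus "(2 * dist z w)^2 <= ((1 + R^2) * dist (sg z) (sg w))^2" unfolding power_mult_distrib dist_sg
  by (subst times_divide_eq_right, subst pos_le_divide_eq) (simp_all add: dist_norm mult_ac)
qed (simp add: add_nonneg_nonneg)

lemma div_le_helper: fixes N P Q c :: real assumes "0 < P" "0 < Q" "0 <= N" "Q <= c * P" shows "N / P <= c * (N / Q)"
proof -
 have "N * Q <= N * (c * P)" using assms by (intro mult_left_mono)
 thus ?thesis using assms by (simp add: field_simps)
qed

text \<open>By the chordal distance formula it suffices to compare 1 + |z|^2 with 1 + |z + k|^2,
  which is \<open>est\<close>.\<close>

lemma tr_lipschitz: assumes "x : RS" "y : RS" shows "dist (tr k x) (tr k y) <= (2 + 2 * (cmod k)^2) * dist x y"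
proof -
 define C where "C = 2 + 2 * (cmod k)^2"
 have C: "C >= 2" by (simp add: C_def)
 have est: "1 + (cmod z)^2 <= C * (1 + (cmod (z + k))^2)" for z proof -
  have "cmod z <= cmod (z + k) + cmod k" using norm_triangle_ineq4[of "z + k" k] by simp
  hence "(cmod z)^2 <= (cmod (z + k) + cmod k)^2" by (rule power_mono) simp
  also have "... <= 2 * (cmod (z + k))^2 + 2 * (cmod k)^2"
   using sum_squares_bound[of "cmod (z + k)" "cmod k"] by (simp add: power2_sum)
  finally have "1 + (cmod z)^2 <= 1 + 2 * (cmod (z + k))^2 + 2 * (cmod k)^2" by simp
  also have "... <= C * (1 + (cmod (z + k))^2)" by (simp add: C_def algebra_simps)
  finally show ?thesis .
 qed
 have *: "dist (tr k (sg z)) np <= C * dist (sg z) np" for z proof (rule power2_le_imp_le)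
  have "1 + (cmod z)^2 <= C^2 * (1 + (cmod (z + k))^2)" proof (rule order_trans[OF est mult_right_mono])
   show "C <= C^2" using C by (simp add: power2_eq_square)
  qed simp
  thus "(dist (tr k (sg z)) np)^2 <= (C * dist (sg z) np)^2" by (simp add: dist_sg_np power_mult_distrib field_simps)
 qed (use C in simp)
 have **: "dist (tr k (sg z)) (tr k (sg w)) <= C * dist (sg z) (sg w)" for z w proof (rule power2_le_imp_le)
  have "(1 + (cmod z)^2) * (1 + (cmod w)^2) <= (C * (1 + (cmod (z + k))^2)) * (C * (1 + (cmod (w + k))^2))"
   using C by (intro mult_mono est) auto
  hence "(1 + (cmod z)^2) * (1 + (cmod w)^2) <= C^2 * ((1 + (cmod (z + k))^2) * (1 + (cmod (w + k))^2))"
   by (simp add: power2_eq_square[of C] mult_ac)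
  hence "4 * (cmod (z + k - (w + k)))^2 / ((1 + (cmod (z + k))^2) * (1 + (cmod (w + k))^2))
    <= C^2 * (4 * (cmod (z - w))^2 / ((1 + (cmod z)^2) * (1 + (cmod w)^2)))"
   by (simp only: add_diff_cancel_right) (intro div_le_helper, auto intro!: mult_pos_pos)
  thus "(dist (tr k (sg z)) (tr k (sg w)))^2 <= (C * dist (sg z) (sg w))^2" unfolding tr_sg power_mult_distrib dist_sg .
 qed (use C in simp)
 show ?thesis unfolding C_def[symmetric] by (rule sphere_cases[OF assms(1)]; rule sphere_cases[OF assms(2)])
    (use * ** in \<open>auto simp: dist_commute simp del: tr_sg\<close>)
qed

lemma continuous_on_lipschitz_real: fixes f :: "'a::metric_space => 'b::metric_space"
 assumes "!!x y. x : S ==> y : S ==> dist (f x) (f y) <= C * dist x y" "0 <= C" shows "continuous_on S f"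
 by (rule lipschitz_on_continuous_on[of C]) (use assms in \<open>auto intro!: lipschitz_onI\<close>)

lemma continuous_on_tr: "continuous_on RS (tr k)" by (rule continuous_on_lipschitz_real[OF tr_lipschitz]) auto

text \<open>Coordinate sending the point k to infinity and infinity to 0.\<close>
definition th :: "complex => complex*real => complex" where "th k y = zt (iv (tr (- k) y))"

lemma th_np [simp]: "th k np = 0" by (simp add: th_def)

lemma th_sg: "z ~= k ==> th k (sg z) = 1 / (z - k)" by (simp add: th_def iv_sg)

definition ith :: "complex => complex => complex*real" where "ith k v = tr k (iv (sg v))"

lemma ith_in [simp]: "ith k v : RS" by (simp add: ith_def)

lemma ith_th: "y : RS ==> y ~= sg k ==> ith k (th k y) = y" by (erule sphere_cases) (auto simp: ith_def th_sg iv_sg)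

lemma ith_lipschitz: "dist (ith k v) (ith k w) <= (4 + 4 * (cmod k)^2) * dist v w"
proof -
 have "dist (ith k v) (ith k w) <= (2 + 2 * (cmod k)^2) * dist (sg v) (sg w)"
  using tr_lipschitz[of "iv (sg v)" "iv (sg w)" k] by (simp add: ith_def iv_isometry)
 also have "... <= (2 + 2 * (cmod k)^2) * (2 * dist v w)" by (intro mult_left_mono dist_sg_le) auto
 finally show ?thesis by (simp add: algebra_simps)
qed

lemma th_inj: "x : RS ==> y : RS ==> x ~= sg k ==> y ~= sg k ==> th k x = th k y ==> x = y" by (metis ith_th)

lemma compact_RS: "compact RS" and closed_RS: "closed RS" and connected_RS: "connected RS"
proof -
 show "compact RS" by (simp add: RS_def)
 thus "closed RS" by (rule compact_imp_closed)
 show "connected RS" unfolding RS_def by (rule connected_sphere) simp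
qed

lemma openin_iv_image: "openin (top_of_set RS) W ==> openin (top_of_set RS) (iv ` W)"
proof -
 assume W: "openin (top_of_set RS) W"
 hence "W <= RS" by (rule openin_imp_subset)
 hence "iv ` W = RS Int iv -` W" by (auto intro!: image_eqI[of _ iv "iv _"])
 moreover have "openin (top_of_set RS) (RS Int iv -` W)"
  by (rule continuous_openin_preimage[OF continuous_on_iv[OF continuous_on_id] _ W]) auto
 ultimately show ?thesis by simp
qed

text \<open>Continuity makes holomorphy away from a finite set sufficient everywhere.\<close>
definition fmero :: "complex set => (complex => complex*real) => bool" where
 "fmero D h <-> open D & continuous_on D h & h ` D <= RS & (ALL y:RS. finite {z:D. h z = y}) &
   (%z. zt (h z)) holomorphic_on {z:D. h z ~= np}"

lemma fmeroD: assumes "fmero D h"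
 shows "open D" "continuous_on D h" "!!z. z : D ==> h z : RS" "!!y. y : RS ==> finite {z:D. h z = y}"
  "(%z. zt (h z)) holomorphic_on {z:D. h z ~= np}" using assms by (auto simp: fmero_def)

lemma open_neq: "open D ==> continuous_on D h ==> open {z:D. h z ~= (y::'a::t1_space)}"
proof -
 assume *: "open D" "continuous_on D h"
 have "open (D Int h -` (- {y}))" by (rule continuous_open_preimage[OF *(2,1)]) auto
 moreover have "D Int h -` (- {y}) = {z:D. h z ~= y}" by auto
 ultimately show ?thesis by simp
qed

lemma fmeroI: assumes "open D" "continuous_on D h" "!!z. z : D ==> h z : RS" "!!y. y : RS ==> finite {z:D. h z = y}"
  "finite F" "(%z. zt (h z)) holomorphic_on ({z:D. h z ~= np} - F)" shows "fmero D h" proof -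
 have "(%z. zt (h z)) holomorphic_on {z:D. h z ~= np}" proof (rule no_isolated_singularity)
  show "continuous_on {z:D. h z ~= np} (%z. zt (h z))"
   by (rule continuous_on_compose2[OF continuous_on_zt continuous_on_subset[OF assms(2)]]) (use assms(3) in auto)
 qed (use assms open_neq in auto)
 thus ?thesis using assms by (auto simp: fmero_def)
qed

lemma fmero_iv: "fmero D h ==> fmero D (%z. iv (h z))"
proof -
 assume h: "fmero D h"
 note h = fmeroD[OF h]
 show ?thesis proof (rule fmeroI[where F = "{z:D. h z = np}"])
  show "continuous_on D (%z. iv (h z))" by (intro continuous_intros h)
  show "finite {z:D. iv (h z) = y}" if "y : RS" for y
   by (rule finite_subset[OF _ h(4)[of "iv y"]]) (use that iv_iv in auto)
  have "(%z. 1 / zt (h z)) holomorphic_on ({z:D. iv (h z) ~= np} - {z:D. h z = np})"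
  proof (intro holomorphic_intros holomorphic_on_subset[OF h(5)])
   fix z assume "z : {z:D. iv (h z) ~= np} - {z:D. h z = np}"
   thus "zt (h z) ~= 0" using sg_zt[of "h z"] h(3)[of z] by (auto simp: iv_eq_np)
  qed auto
  thus "(%z. zt (iv (h z))) holomorphic_on ({z:D. iv (h z) ~= np} - {z:D. h z = np})"
   by (rule holomorphic_transform) (use h(3) in \<open>auto simp: zt_iv iv_eq_np\<close>)
 qed (use h in auto)
qed

lemma fmero_tr: "fmero D h ==> fmero D (%z. tr k (h z))"
proof -
 assume h: "fmero D h"
 note h = fmeroD[OF h]
 show ?thesis proof (rule fmeroI[where F = "{}"])
  show "continuous_on D (%z. tr k (h z))" by (rule continuous_on_compose2[OF continuous_on_tr h(2)]) (use h in auto)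
  show "finite {z:D. tr k (h z) = y}" if "y : RS" for y proof (rule finite_subset[OF _ h(4)[of "tr (- k) y"]])
   show "{z : D. tr k (h z) = y} <= {z : D. h z = tr (- k) y}" using h(3) by (auto simp: tr_tr tr_0)
  qed (use that in auto)
  have "(%z. zt (h z) + k) holomorphic_on ({z:D. h z ~= np})" by (intro holomorphic_intros h)
  hence "(%z. zt (h z) + k) holomorphic_on ({z:D. tr k (h z) ~= np} - {})" by (rule holomorphic_on_subset) auto
  thus "(%z. zt (tr k (h z))) holomorphic_on ({z:D. tr k (h z) ~= np} - {})"
   by (rule holomorphic_transform) (auto simp: tr_def)
 qed (use h in auto)
qed

lemma fmero_sg: "fmero UNIV sg"
proof (rule fmeroI[where F = "{}"])
 show "finite {z : UNIV. sg z = y}" for y by (rule finite_subset[of _ "{zt y}"]) (use zt_sg in force)+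
qed (auto intro!: continuous_intros)

text \<open>Points over \<open>np\<close> are treated after an inversion. Finite fibres exclude that
  the map is constant on a disc.\<close>

lemma fmero_open_image: assumes h: "fmero D h" and V: "open V" "V <= D" shows "openin (top_of_set RS) (h ` V)"
proof -
 have main: "EX W. openin (top_of_set RS) W & h z0 : W & W <= h ` V"
  if h: "fmero D h" and z0: "z0 : V" "h z0 ~= np" for h z0 proof -
  note h = fmeroD[OF h]
  let ?V = "{z:V. h z ~= np}"
  have "open ?V" using V h(2) by (intro open_neq continuous_on_subset[OF h(2)]) auto
  then obtain r where r: "r > 0" "ball z0 r <= ?V" using z0 by (metis (mono_tags, lifting) mem_Collect_eq open_contains_ball)
  let ?f = "%z. zt (h z)"
  have hol: "?f holomorphic_on ball z0 r" by (rule holomorphic_on_subset[OF h(5)]) (use r V in auto)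
  have eq: "sg (?f z) = h z" if "z : ball z0 r" for z proof -
   have "z : D" "h z ~= np" using that r V by blast+
   thus ?thesis using h(3) by (intro sg_zt)
  qed
  have "open (?f ` ball z0 r)" proof (rule open_mapping_thm[OF hol])
   show "~ ?f constant_on ball z0 r" proof
    assume "?f constant_on ball z0 r"
    hence "h z = h z0" if "z : ball z0 r" for z
     using eq[OF that] eq[of z0] r(1) that unfolding constant_on_def by (metis centre_in_ball)
    hence "ball z0 r <= {z:D. h z = h z0}" using r V by blast
    moreover have "finite {z:D. h z = h z0}" by (rule h(4), rule h(3)) (use z0 V in blast)
    ultimately have "finite (ball z0 r)" by (rule finite_subset)
    thus False using uncountable_ball[OF r(1), of z0] countable_finite by blast
   qed
  qed auto
  hence "openin (top_of_set RS) (sg ` ?f ` ball z0 r)" by (rule openin_sg_image)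
  moreover have "sg ` ?f ` ball z0 r = h ` ball z0 r" unfolding image_image using eq by (rule image_cong[OF refl])
  ultimately show ?thesis using r by (intro exI[of _ "h ` ball z0 r"]) auto
 qed
 have "EX W. openin (top_of_set RS) W & y : W & W <= h ` V" if y: "y : h ` V" for y proof -
  obtain z0 where z0: "z0 : V" "y = h z0" using y by blast
  show ?thesis proof (cases "h z0 = np")
   case False thus ?thesis using main[OF h z0(1)] z0 by auto
  next
   case True
   hence "iv (h z0) ~= np" by simp
   then obtain W where W: "openin (top_of_set RS) W" "iv (h z0) : W" "W <= (%z. iv (h z)) ` V"
    using main[OF fmero_iv[OF h] z0(1)] by auto
   have "iv ` W <= h ` V" using W(3) by (auto dest!: subsetD)
   moreover have "y : iv ` W" using W(2) z0 by (metis image_eqI iv_iv)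
   ultimately show ?thesis using openin_iv_image[OF W(1)] by blast
  qed
 qed
 thus ?thesis by (subst openin_subopen) blast
qed

section \<open>Abstract rational maps of the sphere\<close>

text \<open>The properties of rational maps on which the dynamics rests. They pass directly to
  compositions, iterates and conjugates, with no need for representations by coprime
  polynomials.\<close>

locale rat_sphere = fixes T :: "complex*real => complex*real"
 assumes T_cont: "continuous_on RS T" and T_fm: "fmero UNIV (%z. T (sg z))" and T_np: "T np : RS"
begin

lemma T_in: "y : RS ==> T y : RS" using fmeroD(3)[OF T_fm] T_np by (auto elim: sphere_cases)

lemma T_fibre: "y : RS ==> finite {x:RS. T x = y}"
proof -
 assume y: "y : RS"
 have "{x:RS. T x = y} <= insert np (sg ` {z. T (sg z) = y})" by (auto elim!: sphere_cases)
 moreover have "finite {z. T (sg z) = y}" using fmeroD(4)[OF T_fm y] by simp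
 ultimately show ?thesis by (meson finite_imageI finite_insert finite_subset)
qed

lemma T_comp_fm: assumes "fmero D h" shows "fmero D (%z. T (h z))"
proof -
 note h = fmeroD[OF assms]
 show ?thesis proof (rule fmeroI[where F = "{z:D. h z = np}"])
  show "continuous_on D (%z. T (h z))" by (rule continuous_on_compose2[OF T_cont h(2)]) (use h in auto)
  show "finite {z:D. T (h z) = y}" if "y : RS" for y proof (rule finite_subset)
   show "{z:D. T (h z) = y} <= (UN x:{x:RS. T x = y}. {z:D. h z = x})" using h(3) by auto
   show "finite (UN x:{x:RS. T x = y}. {z:D. h z = x})" using T_fibre[OF that] h(4) by auto
  qed
  let ?S = "{z:D. T (h z) ~= np} - {z:D. h z = np}"
  have eq: "sg (zt (h z)) = h z" if "z : ?S" for z using that h(3) by (intro sg_zt) auto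
  have "((%u. zt (T (sg u))) o (%z. zt (h z))) holomorphic_on ?S" proof (rule holomorphic_on_compose_gen)
   show "(%z. zt (h z)) holomorphic_on ?S" by (rule holomorphic_on_subset[OF h(5)]) auto
   show "(%u. zt (T (sg u))) holomorphic_on {u. T (sg u) ~= np}" using fmeroD(5)[OF T_fm] by simp
   show "(%z. zt (h z)) ` ?S <= {u. T (sg u) ~= np}" proof (intro image_subsetI)
    fix z assume "z : ?S"
    thus "zt (h z) : {u. T (sg u) ~= np}" using eq[of z] by simp
   qed
  qed
  thus "(%z. zt (T (h z))) holomorphic_on ?S" by (rule holomorphic_transform) (use eq in auto)
 qed (use h T_in in auto)
qed

lemma T_open: assumes U: "openin (top_of_set RS) U" shows "openin (top_of_set RS) (T ` U)"
proof -
 obtain O' where O: "open O'" "U = RS Int O'" using U by (auto simp: openin_open)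
 have opv: "open (h -` O')" if "continuous_on UNIV h" for h :: "complex => complex*real"
  using that O(1) by (simp add: continuous_on_open_vimage)
 have 1: "openin (top_of_set RS) ((%z. T (sg z)) ` (sg -` O'))"
  by (rule fmero_open_image[OF T_fm opv]) (auto intro!: continuous_intros)
 have 2: "openin (top_of_set RS) ((%z. T (iv (sg z))) ` ((%z. iv (sg z)) -` O'))"
  by (rule fmero_open_image[OF T_comp_fm[OF fmero_iv[OF fmero_sg]] opv]) (auto intro!: continuous_intros)
 have "T ` U = (%z. T (sg z)) ` (sg -` O') Un (%z. T (iv (sg z))) ` ((%z. iv (sg z)) -` O')"
 proof (intro equalityI subsetI)
  fix y assume "y : T ` U"
  then obtain x where x: "x : RS" "x : O'" "y = T x" using O by auto
  from x(1) show "y : (%z. T (sg z)) ` (sg -` O') Un (%z. T (iv (sg z))) ` ((%z. iv (sg z)) -` O')"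
  proof (cases rule: sphere_cases)
   case 1
   thus ?thesis using x by (intro UnI2 image_eqI[of _ _ 0]) auto
  next
   case (2 z)
   thus ?thesis using x by auto
  qed
 next
  fix y assume "y : (%z. T (sg z)) ` (sg -` O') Un (%z. T (iv (sg z))) ` ((%z. iv (sg z)) -` O')"
  then obtain x where "y = T x" "x : RS" "x : O'" proof (elim UnE imageE)
   fix z assume "y = T (sg z)" "z : sg -` O'"
   thus thesis by (intro that[of "sg z"]) auto
  next
   fix z assume "y = T (iv (sg z))" "z : (%z. iv (sg z)) -` O'"
   thus thesis by (intro that[of "iv (sg z)"]) auto
  qed
  thus "y : T ` U" using O(2) by (intro image_eqI[of _ _ x]) auto
 qed
 thus ?thesis using openin_Un[OF 1 2] by simp
qed

lemma T_surj: "T ` RS = RS"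
proof -
 have "openin (top_of_set RS) (T ` RS)" by (rule T_open) auto
 moreover have "closedin (top_of_set RS) (T ` RS)" using compact_image[OF T_cont compact_RS] T_in
  by (intro closed_subset) (auto intro: compact_imp_closed)
 ultimately have "T ` RS = {} | T ` RS = RS" using connected_clopen[THEN iffD1, OF connected_RS] by blast
 thus ?thesis using np_in by blast
qed

end

lemma rat_sphere_comp: assumes "rat_sphere T" "rat_sphere S" shows "rat_sphere (%x. T (S x))"
proof -
 interpret T: rat_sphere T by fact
 interpret S: rat_sphere S by fact
 show ?thesis proof
  show "continuous_on RS (%x. T (S x))" by (rule continuous_on_compose2[OF T.T_cont S.T_cont]) (use S.T_in in auto)
 qed (use T.T_comp_fm[OF S.T_fm] T.T_in S.T_np in auto)
qed

lemma rat_sphere_id: "rat_sphere (%x. x)" by unfold_locales (auto intro!: fmero_sg continuous_intros)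

lemma rat_sphere_funpow: "rat_sphere T ==> rat_sphere (T ^^ n)"
 by (induction n) (auto simp: id_def o_def intro: rat_sphere_id rat_sphere_comp)

lemma rat_sphere_tr: "rat_sphere (tr k)"
proof
 show "fmero UNIV (%z. tr k (sg z))" by (rule fmero_tr[OF fmero_sg])
qed (auto intro: continuous_on_tr)

lemma rat_sphere_iv: "rat_sphere iv" by unfold_locales (auto intro!: continuous_intros fmero_iv fmero_sg)

text \<open>In the plane z -> 1 / (z - c), which takes \<open>sg c\<close> to \<open>np\<close>;
  \<open>mobi c\<close> is the inverse.\<close>

definition mob :: "complex => complex*real => complex*real" where "mob c y = iv (tr (- c) y)"
definition mobi :: "complex => complex*real => complex*real" where "mobi c y = tr c (iv y)"

lemma rat_sphere_mob: "rat_sphere (mob c)" "rat_sphere (mobi c)" unfolding mob_def[abs_def] mobi_def[abs_def]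
 by (rule rat_sphere_comp[OF rat_sphere_iv rat_sphere_tr] rat_sphere_comp[OF rat_sphere_tr rat_sphere_iv])+

lemma mobi_mob: assumes "y : RS" shows "mobi c (mob c y) = y" "mob c (mobi c y) = y"
proof -
 show "mobi c (mob c y) = y" using tr_tr[OF assms, of c "- c"] tr_0[OF assms] by (simp add: mob_def mobi_def)
 have i: "iv y : RS" using assms by simp
 show "mob c (mobi c y) = y" using tr_tr[OF i, of "- c" c] tr_0[OF i] by (simp add: mob_def mobi_def)
qed

lemma mob_in [simp]: "y : RS ==> mob c y : RS" "y : RS ==> mobi c y : RS" by (simp_all add: mob_def mobi_def)

lemma mob_lipschitz: assumes "x : RS" "y : RS" shows "dist (mob c x) (mob c y) <= (2 + 2 * (cmod c)^2) * dist x y"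
  "dist (mobi c x) (mobi c y) <= (2 + 2 * (cmod c)^2) * dist x y"
 using tr_lipschitz[of x y "- c"] tr_lipschitz[of "iv x" "iv y" c] assms by (simp_all add: mob_def mobi_def iv_isometry)

section \<open>Fatou and Julia sets\<close>

lemma openin_fatou_set: "openin (top_of_set X) (fatou_set T X)"
proof (subst openin_subopen, intro ballI)
 fix x assume "x : fatou_set T X"
 then obtain U where U: "openin (top_of_set X) U" "x : U" "normal_iterates_on T U" by (auto simp: fatou_set_def)
 hence "U <= fatou_set T X" using openin_imp_subset[OF U(1)] by (auto simp: fatou_set_def)
 thus "EX U. openin (top_of_set X) U & x : U & U <= fatou_set T X" using U by blast
qed

lemma closedin_julia_set: "closedin (top_of_set X) (julia_set T X)"
 unfolding julia_set_def by (intro closedin_diff openin_fatou_set) auto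

context rat_sphere
begin

abbreviation "Fat \<equiv> fatou_set T RS"
abbreviation "Jul \<equiv> julia_set T RS"

lemma compact_Jul: "compact Jul" using closedin_julia_set[of RS T] compact_RS closedin_compact by blast

text \<open>T is open, so it maps a neighbourhood of x to one of T x. There the iterates of order m
  are those of order m + 1 read at a chosen preimage, and normality comes from the shifted
  sequence.\<close>

lemma fatou_forward: assumes "x : Fat" shows "T x : Fat"
proof -
 obtain U where U: "openin (top_of_set RS) U" "x : U" "normal_iterates_on T U" and x: "x : RS"
  using assms by (auto simp: fatou_set_def)
 obtain O' where O: "open O'" "U = RS Int O'" using U(1) by (auto simp: openin_open)
 then obtain r where r: "r > 0" "cball x r <= O'" using U(2) by (metis IntD2 open_contains_cball)
 let ?W = "RS Int ball x r" and ?C = "RS Int cball x r"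
 have C: "compact ?C" "?C <= U" using compact_RS r O by (auto intro: compact_Int_closed)
 have W: "openin (top_of_set RS) (T ` ?W)" by (rule T_open) (auto simp: openin_open)
 have "normal_iterates_on T (T ` ?W)" unfolding normal_iterates_on_def proof
  fix m :: "nat => nat"
  obtain s g where s: "strict_mono s" and
   lim: "!!K. compact K ==> K <= U ==> uniform_limit K (%j. T ^^ Suc (m (s j))) g sequentially"
   using U(3) unfolding normal_iterates_on_def by (elim allE[of _ "%j. Suc (m j)"]) auto
  have limC: "uniform_limit ?C (%j. T ^^ Suc (m (s j))) g sequentially" by (rule lim[OF C])
  define g' where "g' y = g (SOME x'. x' : ?W & T x' = y)" for y
  have "uniform_limit K (%j. T ^^ m (s j)) g' sequentially" if K: "compact K" "K <= T ` ?W" for K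
  proof (rule uniform_limitI)
   fix e :: real assume "e > 0"
   show "eventually (%j. ALL y:K. dist ((T ^^ m (s j)) y) (g' y) < e) sequentially"
    using uniform_limitD[OF limC `e > 0`] proof eventually_elim
    case (elim j)
    show ?case proof
     fix y assume "y : K"
     hence "y : T ` ?W" using K by blast
     hence "EX x'. x' : ?W & T x' = y" by blast
     hence *: "(SOME x'. x' : ?W & T x' = y) : ?W & T (SOME x'. x' : ?W & T x' = y) = y" by (rule someI_ex)
     define x' where "x' = (SOME x'. x' : ?W & T x' = y)"
     have x': "x' : ?C" "T x' = y" using * unfolding x'_def by auto
     have "(T ^^ m (s j)) y = (T ^^ Suc (m (s j))) x'" by (simp add: funpow_swap1 x'(2)[symmetric])
     moreover have "g' y = g x'" by (simp add: g'_def x'_def)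
     ultimately show "dist ((T ^^ m (s j)) y) (g' y) < e" using elim x'(1) by simp
    qed
   qed
  qed
  thus "EX r g. strict_mono r & locunif (T ` ?W) (%j. T ^^ m (r j)) g" using s by blast
 qed
 moreover have "T x : T ` ?W" using x r(1) by auto
 ultimately show ?thesis using W T_in[OF x] by (auto simp: fatou_set_def)
qed

lemma fatou_backward: assumes x: "x : RS" "T x : Fat" shows "x : Fat"
proof -
 obtain U where U: "openin (top_of_set RS) U" "T x : U" "normal_iterates_on T U"
  using assms by (auto simp: fatou_set_def)
 let ?V = "RS Int T -` U"
 have V: "openin (top_of_set RS) ?V" by (rule continuous_openin_preimage[OF T_cont _ U(1)]) (use T_in in auto)
 have "normal_iterates_on T ?V" unfolding normal_iterates_on_def proof
  fix m :: "nat => nat"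
  \<comment> \<open>Only iterates of positive order factor through T; if the order 0 occurs
    infinitely often, the identity is a limit.\<close>
  show "EX r g. strict_mono r & locunif ?V (%j. T ^^ m (r j)) g" proof (cases "infinite {j. m j = 0}")
   case True
   then obtain r :: "nat => nat" where r: "strict_mono r" "!!j. r j : {j. m j = 0}" using infinite_enumerate by blast
   hence "(%j. T ^^ m (r j)) = (%j. id)" by auto
   thus ?thesis using r(1) by (intro exI[of _ r] exI[of _ id]) (auto intro!: uniform_limitI)
  next
   case False
   then obtain j0 where j0: "!!j. j0 <= j ==> m j ~= 0"
    by (metis (mono_tags, lifting) finite_nat_set_iff_bounded mem_Collect_eq not_less)
   obtain s g where s: "strict_mono s" and
    lim: "!!K. compact K ==> K <= U ==> uniform_limit K (%j. T ^^ (m (s j + j0) - 1)) g sequentially"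
    using U(3) unfolding normal_iterates_on_def by (elim allE[of _ "%j. m (j + j0) - 1"]) auto
   have "uniform_limit K (%j. T ^^ m (s j + j0)) (%y. g (T y)) sequentially" if K: "compact K" "K <= ?V" for K
   proof (rule uniform_limitI)
    have TK: "compact (T ` K)" "T ` K <= U" using K by (auto intro!: compact_image continuous_on_subset[OF T_cont])
    fix e :: real assume "e > 0"
    show "eventually (%j. ALL y:K. dist ((T ^^ m (s j + j0)) y) (g (T y)) < e) sequentially"
     using uniform_limitD[OF lim[OF TK] `e > 0`] proof eventually_elim
     case (elim j)
     have "T ^^ m (s j + j0) = T ^^ (m (s j + j0) - 1) o T"
      using j0[of "s j + j0"] funpow_Suc_right[of "m (s j + j0) - 1" T] by simp
     thus ?case using elim by simp
    qed
   qed
   moreover have "strict_mono (%j. s j + j0)" using s by (auto simp: strict_mono_def)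
   ultimately show ?thesis by (intro exI[of _ "%j. s j + j0"] exI[of _ "%y. g (T y)"]) auto
  qed
 qed
 thus ?thesis using V x U(2) by (auto simp: fatou_set_def)
qed

lemma fatou_iff: "x : RS ==> T x : Fat <-> x : Fat" using fatou_forward fatou_backward by blast

lemma funpow_in: "x : RS ==> (T ^^ n) x : RS" by (induction n) (auto intro: T_in)

lemma fatou_funpow_iff: "x : RS ==> (T ^^ n) x : Fat <-> x : Fat" by (induction n) (auto simp: fatou_iff funpow_in)

lemma julia_funpow_iff: "x : RS ==> (T ^^ n) x : Jul <-> x : Jul"
 using fatou_funpow_iff[of x n] funpow_in[of x n] by (auto simp: julia_set_def)

end

subsection \<open>Change of coordinate\<close>

definition conj_by :: "complex => (complex*real => complex*real) => complex*real => complex*real" where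
 "conj_by c T y = mob c (T (mobi c y))"

lemma rat_sphere_conj: "rat_sphere T ==> rat_sphere (conj_by c T)" unfolding conj_by_def[abs_def]
 by (rule rat_sphere_comp[OF rat_sphere_mob(1) rat_sphere_comp[OF _ rat_sphere_mob(2)]])

text \<open>S agrees with the conjugate of T on the sphere only. The two Lipschitz bounds are there
  because radial points are defined by metric balls and diameters.\<close>

locale conj_sphere = T: rat_sphere T + h: rat_sphere h + h': rat_sphere h' for T h h' :: "complex*real => complex*real" +
 fixes C :: real and S :: "complex*real => complex*real"
 assumes S: "!!y. y : RS ==> S y = h (T (h' y))" and inv: "!!x. x : RS ==> h' (h x) = x" "!!x. x : RS ==> h (h' x) = x"
  and lip: "!!x y. x : RS ==> y : RS ==> dist (h x) (h y) <= C * dist x y"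
   "!!x y. x : RS ==> y : RS ==> dist (h' x) (h' y) <= C * dist x y" and C1: "1 <= C"
begin

lemma S_funpow: "y : RS ==> (S ^^ n) y = h ((T ^^ n) (h' y))"
proof (induction n)
 case (Suc n)
 have "(T ^^ n) (h' y) : RS" using Suc.prems h'.T_in T.funpow_in by blast
 thus ?case using Suc by (simp add: inv S h.T_in)
qed (simp add: inv)

lemma S_funpow_h: "x : RS ==> (S ^^ n) (h x) = h ((T ^^ n) x)" using S_funpow[of "h x" n] h.T_in inv by simp

lemma fatou_image: assumes "x : fatou_set T RS" shows "h x : fatou_set S RS"
proof -
 obtain U where U: "openin (top_of_set RS) U" "x : U" "normal_iterates_on T U" and x: "x : RS"
  using assms by (auto simp: fatou_set_def)
 have URS: "U <= RS" using U(1) by (rule openin_imp_subset)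
 have "normal_iterates_on S (h ` U)" unfolding normal_iterates_on_def proof
  fix m :: "nat => nat"
  obtain s g where s: "strict_mono s" and
   lim: "!!K. compact K ==> K <= U ==> uniform_limit K (%j. T ^^ m (s j)) g sequentially"
   using U(3) unfolding normal_iterates_on_def by metis
  have "uniform_limit K (%j. S ^^ m (s j)) (%y. h (g (h' y))) sequentially" if K: "compact K" "K <= h ` U" for K
  proof (rule uniform_limitI)
   have KRS: "K <= RS" using K URS h.T_in by blast
   have hK: "compact (h' ` K)" by (rule compact_image[OF continuous_on_subset[OF h'.T_cont KRS] K(1)])
   have hKU: "h' ` K <= U" using K(2) URS inv by force
   note limK = lim[OF hK hKU]
   have gRS: "g y : RS" if "y : h' ` K" for y proof (rule Lim_in_closed_set[OF closed_RS])
    show "((%j. (T ^^ m (s j)) y) \<longlongrightarrow> g y) sequentially" by (rule tendsto_uniform_limitI[OF limK that])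
    show "\<forall>\<^sub>F j in sequentially. (T ^^ m (s j)) y : RS"
     by (intro always_eventually allI T.funpow_in) (use that hKU URS in blast)
   qed simp
   fix e :: real assume e: "e > 0"
   hence "e / C > 0" using C1 by simp
   from uniform_limitD[OF limK this]
   show "eventually (%j. ALL y:K. dist ((S ^^ m (s j)) y) (h (g (h' y))) < e) sequentially" proof eventually_elim
    case (elim j)
    show ?case proof
     fix y assume y: "y : K"
     hence "y : RS" using KRS by blast
     hence "(S ^^ m (s j)) y = h ((T ^^ m (s j)) (h' y))" by (rule S_funpow)
     moreover have "h' y : RS" using `y : RS` by (rule h'.T_in)
     moreover have "g (h' y) : RS" using y by (intro gRS) (rule imageI)
     ultimately have "dist ((S ^^ m (s j)) y) (h (g (h' y))) <= C * dist ((T ^^ m (s j)) (h' y)) (g (h' y))"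
      using lip(1)[OF T.funpow_in] by simp
     also have "... < C * (e / C)" using elim y C1 by (intro mult_strict_left_mono) auto
     finally show "dist ((S ^^ m (s j)) y) (h (g (h' y))) < e" using C1 by simp
    qed
   qed
  qed
  thus "EX r g. strict_mono r & locunif (h ` U) (%j. S ^^ m (r j)) g" using s by blast
 qed
 thus ?thesis using h.T_open[OF U(1)] U(2) h.T_in[OF x] by (auto simp: fatou_set_def)
qed

lemma radial_image: assumes "p : radial_julia_set T RS" shows "h p : radial_julia_set S RS"
proof -
 obtain ep n ph where p: "p : RS" and e: "ep > 0" and n: "strict_mono (n :: nat => nat)" and
  ph: "!!j. continuous_on (RS Int ball ((T ^^ n j) p) ep) (ph j)" "!!j. ph j ` (RS Int ball ((T ^^ n j) p) ep) <= RS"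
   "!!j y. y : RS Int ball ((T ^^ n j) p) ep ==> (T ^^ n j) (ph j y) = y" "!!j. ph j ((T ^^ n j) p) = p"
  and lim: "(%j. diameter (ph j ` (RS Int ball ((T ^^ n j) p) ep))) \<longlonglongrightarrow> 0"
  using assms unfolding radial_julia_set_def by blast
 define B where "B j = RS Int ball ((T ^^ n j) p) ep" for j
 define B' where "B' j = RS Int ball ((S ^^ n j) (h p)) (ep / C)" for j
 have Sp: "(S ^^ n j) (h p) = h ((T ^^ n j) p)" for j by (rule S_funpow_h[OF p])
 have hB: "h' y : B j" if "y : B' j" for y j proof -
  have y: "y : RS" "dist (h ((T ^^ n j) p)) y < ep / C" using that by (auto simp: B'_def Sp)
  have "dist (h' (h ((T ^^ n j) p))) (h' y) <= C * dist (h ((T ^^ n j) p)) y" by (intro lip h.T_in T.funpow_in p y)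
  also have "... < C * (ep / C)" using y C1 by (intro mult_strict_left_mono) auto
  finally show ?thesis using y C1 p by (simp add: B_def inv T.funpow_in h'.T_in)
 qed
 define ps where "ps j y = h (ph j (h' y))" for j y
 have c: "continuous_on (B' j) (ps j)" for j unfolding ps_def proof (rule continuous_on_compose2[OF h.T_cont])
  show "continuous_on (B' j) (%y. ph j (h' y))"
   by (rule continuous_on_compose2[OF ph(1) continuous_on_subset[OF h'.T_cont]])
     (use hB in \<open>auto simp: B'_def B_def\<close>)
  show "(%y. ph j (h' y)) ` B' j <= RS" using ph(2) hB by (fastforce simp: B_def)
 qed
 have sub: "ps j ` B' j <= h ` ph j ` B j" for j using hB by (auto simp: ps_def)
 have phiRS: "ph j ` B j <= RS" for j using ph(2) by (simp add: B_def)
 have bd: "bounded (ph j ` B j)" for j using phiRS compact_RS by (meson bounded_subset compact_imp_bounded)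
 have dm: "diameter (ps j ` B' j) <= C * diameter (ph j ` B j)" for j proof (rule diameter_leI)
  show "0 <= C * diameter (ph j ` B j)" using C1 bd by (simp add: diameter_ge_0)
  fix x y assume xy: "x : ps j ` B' j" "y : ps j ` B' j"
  obtain a where a: "a : ph j ` B j" "x = h a" using subsetD[OF sub xy(1)] by (rule imageE)
  obtain b where b: "b : ph j ` B j" "y = h b" using subsetD[OF sub xy(2)] by (rule imageE)
  note ab = a(1) b(1) a(2) b(2)
  have "dist x y <= C * dist a b" unfolding ab(3,4) by (rule lip) (use phiRS ab in blast)+
  also have "... <= C * diameter (ph j ` B j)"
   using C1 by (intro mult_left_mono[OF diameter_bounded_bound[OF bd ab(1,2)]]) simp
  finally show "dist x y <= C * diameter (ph j ` B j)" .
 qed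
 have psiRS: "ps j ` B' j <= RS" for j proof (rule image_subsetI)
  fix y assume "y : B' j"
  hence "ph j (h' y) : RS" using hB phiRS by blast
  thus "ps j y : RS" unfolding ps_def by (rule h.T_in)
 qed
 have lim': "(%j. diameter (ps j ` B' j)) \<longlonglongrightarrow> 0"
 proof (rule tendsto_sandwich[of "%_. 0" _ _ "%j. C * diameter (ph j ` B j)"])
  show "\<forall>\<^sub>F j in sequentially. 0 <= diameter (ps j ` B' j)"
   by (intro always_eventually allI diameter_ge_0 bounded_subset[OF compact_imp_bounded[OF compact_RS] psiRS])
  show "(%j. C * diameter (ph j ` B j)) \<longlonglongrightarrow> 0"
   using tendsto_mult_left[OF lim, of C] by (simp add: B_def)
 qed (use dm in auto)
 have sect: "(S ^^ n j) (ps j y) = y" if "y : B' j" for j y proof -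
  have "ph j (h' y) : RS" "h' y : B j" using hB[OF that] phiRS by blast+
  hence "(S ^^ n j) (ps j y) = h (h' y)" using ph(3)[of "h' y" j] by (simp add: ps_def S_funpow_h B_def)
  thus ?thesis using that by (simp add: inv B'_def)
 qed
 have fixp: "ps j ((S ^^ n j) (h p)) = h p" for j using ph(4) p by (simp add: ps_def Sp inv T.funpow_in)
 have "ep / C > 0" using e C1 by simp
 thus ?thesis unfolding radial_julia_set_def
 proof (intro CollectI conjI exI[of _ "ep / C"] exI[of _ n] exI[of _ ps] allI)
  fix j
  show "continuous_on (RS Int ball ((S ^^ n j) (h p)) (ep / C)) (ps j)" using c by (simp only: B'_def)
  show "ps j ` (RS Int ball ((S ^^ n j) (h p)) (ep / C)) <= RS" using psiRS by (simp only: B'_def)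
  show "ALL y:RS Int ball ((S ^^ n j) (h p)) (ep / C). (S ^^ n j) (ps j y) = y"
   by (intro ballI sect) (simp only: B'_def)
  show "ps j ((S ^^ n j) (h p)) = h p" by (rule fixp)
 next
  show "(%j. diameter (ps j ` (RS Int ball ((S ^^ n j) (h p)) (ep / C)))) \<longlonglongrightarrow> 0"
   using lim' by (simp only: B'_def)
 qed (use n h.T_in[OF p] in auto)
qed

end

lemma fmero_th: assumes "fmero D h" shows "(%z. th k (h z)) holomorphic_on {z:D. h z ~= sg k}"
proof -
 note h = fmeroD[OF assms]
 have "(%z. zt (iv (tr (- k) (h z)))) holomorphic_on {z:D. iv (tr (- k) (h z)) ~= np}"
  by (rule fmeroD(5)[OF fmero_iv[OF fmero_tr[OF assms]]])
 moreover have "{z:D. h z ~= sg k} <= {z:D. iv (tr (- k) (h z)) ~= np}" proof safe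
  fix z assume z: "z : D" "h z ~= sg k" "iv (tr (- k) (h z)) = np"
  have "h z : RS" using h(3) z(1) .
  thus False using z(2,3) by (cases rule: sphere_cases) (auto simp: iv_eq_np)
 qed
 ultimately show ?thesis unfolding th_def by (rule holomorphic_on_subset)
qed

text \<open>Lipschitz parametrizations of the sphere by the two types of coordinates in which the
 limits of a family omitting two values are finite.\<close>
lemma th_coordinate_alternative: fixes a k :: complex
 obtains C where "0 <= C" "!!v w. dist (tr k (iv (tr a (iv (sg v))))) (tr k (iv (tr a (iv (sg w))))) <= C * dist v w"
  "!!y. y : RS ==> y ~= sg k ==> th k y ~= a ==> tr k (iv (tr a (iv (sg (1 / (th k y - a)))))) = y"
proof (rule that[of "(2 + 2 * (cmod k)^2) * ((2 + 2 * (cmod a)^2) * 2)"])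
 fix v w
 have "dist (tr k (iv (tr a (iv (sg v))))) (tr k (iv (tr a (iv (sg w))))) <=
   (2 + 2 * (cmod k)^2) * dist (iv (tr a (iv (sg v)))) (iv (tr a (iv (sg w))))" by (rule tr_lipschitz) auto
 also have "... <= (2 + 2 * (cmod k)^2) * ((2 + 2 * (cmod a)^2) * dist (iv (sg v)) (iv (sg w)))"
  unfolding iv_isometry[of "tr a _"] by (intro mult_left_mono tr_lipschitz) auto
 also have "... <= (2 + 2 * (cmod k)^2) * ((2 + 2 * (cmod a)^2) * (2 * dist v w))"
  unfolding iv_isometry by (intro mult_left_mono dist_sg_le) auto
 finally show "dist (tr k (iv (tr a (iv (sg v))))) (tr k (iv (tr a (iv (sg w))))) <=
   (2 + 2 * (cmod k)^2) * ((2 + 2 * (cmod a)^2) * 2) * dist v w" by (simp only: mult.assoc)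
next
 fix y assume y: "y : RS" "y ~= sg k" "th k y ~= a"
 hence "iv (sg (1 / (th k y - a))) = sg (th k y - a)" by (subst iv_sg) auto
 thus "tr k (iv (tr a (iv (sg (1 / (th k y - a)))))) = y" using ith_th[OF y(1,2)] by (simp add: ith_def)
qed auto

context rat_sphere
begin

lemma it_rat: "rat_sphere (T ^^ n)" by (rule rat_sphere_funpow) unfold_locales

lemma it_fm: "fmero UNIV (%z. (T ^^ n) (sg z))" using rat_sphere.T_fm[OF it_rat] .

lemma it_cont: "continuous_on RS (T ^^ n)" using rat_sphere.T_cont[OF it_rat] .

text \<open>Montel: iterates along an arithmetic progression omitting three values form a normal
 family, hence so do all iterates.\<close>
lemma omit_three_imp_fatou: assumes l: "1 <= l" and r: "0 < r" and e: "e1 ~= e2" "e1 ~= e3" "e2 ~= e3"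
  and om: "!!j z. z : ball x r ==> (T ^^ (l * j)) (sg z) ~: {sg e1, sg e2, sg e3}" shows "sg x : Fat" proof -
 define D where "D = ball x r"
 have "normal_iterates_on T (sg ` D)" unfolding normal_iterates_on_def proof
  fix m :: "nat => nat"
  have "finite (range (%j. m j mod l))" by (rule finite_subset[of _ "{..<l}"]) (use l in auto)
  then obtain j0 where inf: "infinite {j. m j mod l = m j0 mod l}"
   using pigeonhole_infinite[of "UNIV::nat set" "%j. m j mod l"] by auto
  define i where "i = m j0 mod l"
  obtain s :: "nat => nat" where s: "strict_mono s" "!!j. s j : {j. m j mod l = i}"
   using infinite_enumerate[OF inf] unfolding i_def by blast
  define q where "q j = m (s j) div l" for j
  \<comment> \<open>All selected orders leave the same remainder i modulo l, so one fixed iterate is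
    applied to members of the progression.\<close>
  have ms: "T ^^ m (s j) = (T ^^ i) o (T ^^ (l * q j))" for j proof -
   have "m (s j) = i + l * q j" using s(2)[of j] mod_mult_div_eq[of "m (s j)" l] by (simp add: q_def)
   thus ?thesis by (simp add: funpow_add)
  qed
  define F where "F j z = th e1 ((T ^^ (l * q j)) (sg z))" for j z
  have FRS: "(T ^^ (l * q j)) (sg z) : RS" for j z by (intro funpow_in) auto
  have hol: "F j holomorphic_on D" for j
   unfolding F_def[abs_def] by (rule holomorphic_on_subset[OF fmero_th[OF it_fm]]) (use om in \<open>auto simp: D_def\<close>)
  have F2: "F j z ~= th e1 (sg e2)" and F3: "F j z ~= th e1 (sg e3)" if "z : D" for j z proof -
   have o: "(T ^^ (l * q j)) (sg z) ~= sg e1" "(T ^^ (l * q j)) (sg z) ~= sg e2" "(T ^^ (l * q j)) (sg z) ~= sg e3"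
    using om[of z "q j"] that by (simp_all add: D_def)
   have "th e1 ((T ^^ (l * q j)) (sg z)) ~= th e1 (sg w)" if "w ~= e1" "(T ^^ (l * q j)) (sg z) ~= sg w" for w
    using th_inj[where k = e1 and y = "sg w", OF FRS _ o(1)] that by auto
   thus "F j z ~= th e1 (sg e2)" "F j z ~= th e1 (sg e3)" using o e by (simp_all add: F_def)
  qed
  have ne: "th e1 (sg e2) ~= th e1 (sg e3)" using e th_inj[of "sg e2" "sg e3" e1] by auto
  obtain rh g where rh: "strict_mono (rh::nat => nat)" and lim: "(locunif D (%n. F (rh n)) g) |
    (locunif D (%n z. 1 / (F (rh n) z - th e1 (sg e2))) g)"
   using Montel_two_values[of D F "th e1 (sg e2)" "th e1 (sg e3)"] hol ne F2 F3 r unfolding D_def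
   by (metis open_ball connected_ball)
  \<comment> \<open>Both alternatives of \<open>Montel_two_values\<close> take one form: u converges
    in the plane, and a Lipschitz map Em carries it to the iterates on the sphere.\<close>
  have "EX Em C u. 0 <= (C::real) & (ALL v w. dist (Em v) (Em w) <= C * dist v w) & (ALL v. Em v : RS) &
   (ALL n. ALL z:D. Em (u n z) = (T ^^ (l * q (rh n))) (sg z)) & locunif D u g" using lim proof
   assume lim1: "locunif D (%n. F (rh n)) g"
   have "ith e1 (F (rh n) z) = (T ^^ (l * q (rh n))) (sg z)" if "z : D" for n z
    unfolding F_def by (rule ith_th[OF FRS]) (use om that in \<open>auto simp: D_def\<close>)
   thus ?thesis by (intro exI[of _ "ith e1"] exI[of _ "4 + 4 * (cmod e1)^2"] exI[of _ "%n. F (rh n)"])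
      (use lim1 in \<open>simp add: ith_lipschitz\<close>)
  next
   assume lim2: "locunif D (%n z. 1 / (F (rh n) z - th e1 (sg e2))) g"
   obtain C where C: "0 <= C"
    "!!v w. dist (tr e1 (iv (tr (th e1 (sg e2)) (iv (sg v))))) (tr e1 (iv (tr (th e1 (sg e2)) (iv (sg w))))) <= C * dist v w"
    "!!y. y : RS ==> y ~= sg e1 ==> th e1 y ~= th e1 (sg e2) ==>
      tr e1 (iv (tr (th e1 (sg e2)) (iv (sg (1 / (th e1 y - th e1 (sg e2))))))) = y"
    using th_coordinate_alternative[where k = e1 and a = "th e1 (sg e2)"] by metis
   have "tr e1 (iv (tr (th e1 (sg e2)) (iv (sg (1 / (F (rh n) z - th e1 (sg e2))))))) = (T ^^ (l * q (rh n))) (sg z)"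
    if "z : D" for n z
    unfolding F_def by (rule C(3)[OF FRS]) (use om that F2[OF that, of "rh n"] in \<open>auto simp: D_def F_def\<close>)
   thus ?thesis by (intro exI[of _ "%v. tr e1 (iv (tr (th e1 (sg e2)) (iv (sg v))))"] exI[of _ C]
       exI[of _ "%n z. 1 / (F (rh n) z - th e1 (sg e2))"]) (use lim2 C in simp)
  qed
  then obtain Em C u where Em0: "0 <= (C::real) & (ALL v w. dist (Em v) (Em w) <= C * dist v w) & (ALL v. Em v : RS) &
   (ALL n. ALL z:D. Em (u n z) = (T ^^ (l * q (rh n))) (sg z)) & locunif D u g" by (elim exE)
  hence Em: "0 <= (C::real)" "!!v w. dist (Em v) (Em w) <= C * dist v w" "!!v. Em v : RS"
   "!!n z. z : D ==> Em (u n z) = (T ^^ (l * q (rh n))) (sg z)"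
   "!!K. compact K ==> K <= D ==> uniform_limit K u g sequentially" by simp_all
  have "uniform_limit K (%j. T ^^ m (s (rh j))) (%y. (T ^^ i) (Em (g (zt y)))) sequentially"
   if K: "compact K" "K <= sg ` D" for K proof (rule uniform_limitI)
   fix ep :: real assume "ep > 0"
   have "uniformly_continuous_on RS (T ^^ i)" by (rule compact_uniformly_continuous[OF it_cont compact_RS])
   then obtain de where de: "de > 0" "!!x y. x : RS ==> y : RS ==> dist y x < de ==> dist ((T ^^ i) y) ((T ^^ i) x) < ep"
    using `ep > 0` unfolding uniformly_continuous_on_def by meson
   have zK: "compact (zt ` K)" proof (rule compact_image[OF continuous_on_subset[OF continuous_on_zt] K(1)])
    show "K <= RS - {np}" using K(2) by auto
   qed
   have zKD: "zt ` K <= D" using K(2) by auto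
   have "de / (C + 1) > 0" using de Em(1) by simp
   from uniform_limitD[OF Em(5)[OF zK zKD] this]
   show "eventually (%j. ALL y:K. dist ((T ^^ m (s (rh j))) y) ((T ^^ i) (Em (g (zt y)))) < ep) sequentially"
   proof eventually_elim
    case (elim j)
    show ?case proof
     fix y assume y: "y : K"
     then obtain z where z: "z : D" "y = sg z" using K(2) by blast
     hence zz: "zt y = z" by simp
     have "dist (u j z) (g z) < de / (C + 1)" using elim y zz by force
     hence "(C + 1) * dist (u j z) (g z) < de" using Em(1) by (simp add: field_simps)
     moreover have "dist (Em (u j z)) (Em (g z)) <= (C + 1) * dist (u j z) (g z)"
      using Em(2)[of "u j z" "g z"] by (simp add: distrib_right add_increasing2)
     ultimately have "dist (Em (u j z)) (Em (g z)) < de" by linarith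
     hence "dist ((T ^^ i) (Em (u j z))) ((T ^^ i) (Em (g z))) < ep" by (intro de(2) Em(3))
     thus "dist ((T ^^ m (s (rh j))) y) ((T ^^ i) (Em (g (zt y)))) < ep"
      using Em(4)[OF z(1), of j] zz z(2) by (simp add: ms)
    qed
   qed
  qed
  moreover have "strict_mono (%j. s (rh j))" using s(1) rh by (simp add: strict_mono_def)
  ultimately show "EX r g. strict_mono r & locunif (sg ` D) (%j. T ^^ m (r j)) g"
   by (intro exI[of _ "%j. s (rh j)"] exI[of _ "%y. (T ^^ i) (Em (g (zt y)))"]) simp
 qed
 moreover have "openin (top_of_set RS) (sg ` D)" by (rule openin_sg_image) (simp add: D_def)
 moreover have "sg x : sg ` D" using r by (simp add: D_def)
 ultimately show ?thesis by (auto simp: fatou_set_def)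
qed

end

section \<open>The Julia set in a planar coordinate\<close>

text \<open>With \<open>np\<close> in the Fatou set the Julia set is a compact subset of the plane.
  \<open>generic\<close> expresses degree at least two through distinct preimages, the form in which
  exceptional points are excluded.\<close>

locale julia_plane = rat_sphere + assumes np_fat: "np : fatou_set T RS"
  and np_nonper: "!!n. 1 <= n ==> (T ^^ n) np ~= np"
  and generic: "finite {y:RS. ~ (EX x1:RS. EX x2:RS. x1 ~= x2 & T x1 = y & T x2 = y)}"
  and inf_Jul: "infinite (julia_set T RS)"
begin

definition J :: "complex set" where "J = {z. sg z : Jul}"
text \<open>At a pole the value is \<open>zt np\<close> = 0, so statements about \<open>f n\<close>
  are confined to \<open>dm n\<close>.\<close>

definition f :: "nat => complex => complex" where "f n z = zt ((T ^^ n) (sg z))"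
definition dm :: "nat => complex set" where "dm n = {z. (T ^^ n) (sg z) ~= np}"

lemma Jul_eq: "Jul = sg ` J"
proof (intro equalityI subsetI)
 fix y assume y: "y : Jul"
 hence "y : RS" "y ~= np" using np_fat by (auto simp: julia_set_def)
 hence "sg (zt y) = y" by (rule sg_zt)
 thus "y : sg ` J" using y by (intro image_eqI[of _ _ "zt y"]) (simp_all add: J_def)
qed (auto simp: J_def)

lemma compact_J: "compact J"
proof -
 have "J = zt ` Jul" by (simp add: Jul_eq image_image)
 moreover have "compact (zt ` Jul)" by (rule compact_image[OF continuous_on_subset[OF continuous_on_zt] compact_Jul])
    (use Jul_eq in auto)
 ultimately show ?thesis by simp
qed

lemma closed_J: "closed J" using compact_J by (rule compact_imp_closed)

lemma sg_f: "z : dm n ==> sg (f n z) = (T ^^ n) (sg z)" unfolding f_def dm_def by (intro sg_zt funpow_in) auto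

lemma dm_iff: "(T ^^ n) (sg z) = sg w <-> z : dm n & f n z = w" using sg_f[of z n] by (auto simp: f_def dm_def)

lemma J_inv: "z : dm n ==> f n z : J <-> z : J" using julia_funpow_iff[of "sg z" n] by (simp add: J_def sg_f)

lemma J_dm: "z : J ==> z : dm n"
proof -
 assume "z : J"
 hence "(T ^^ n) (sg z) : Jul" using julia_funpow_iff[of "sg z" n] by (simp add: J_def)
 thus ?thesis using Jul_eq by (auto simp: dm_def)
qed

lemma f_in_J: "z : J ==> f n z : J" using J_inv J_dm by blast

lemma open_dm: "open (dm n)"
proof -
 have "open {z:UNIV. (T ^^ n) (sg z) ~= np}" by (rule open_neq) (use fmeroD(2)[OF it_fm] in auto)
 thus ?thesis by (simp add: dm_def)
qed

lemma hol_f: "f n holomorphic_on dm n" using fmeroD(5)[OF it_fm[of n]] unfolding f_def[abs_def] dm_def by simp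

lemma finite_fibre: "finite {z. (T ^^ n) (sg z) = y}"
proof (cases "y : RS")
 case True thus ?thesis using fmeroD(4)[OF it_fm] by simp
next
 case False
 hence "{z. (T ^^ n) (sg z) = y} = {}" using funpow_in[OF sg_in, of n] by auto
 thus ?thesis by simp
qed

lemma finite_compl_dm: "finite (- dm n)"
proof -
 have "- dm n = {z. (T ^^ n) (sg z) = np}" by (auto simp: dm_def)
 thus ?thesis using finite_fibre by simp
qed

lemma connected_dm: "connected (dm n)"
proof -
 have "connected (UNIV - (- dm n))" by (rule connected_open_delete_finite) (auto intro: finite_compl_dm)
 thus ?thesis by (simp add: Diff_eq)
qed

lemma f_0 [simp]: "f 0 z = z" by (simp add: f_def)
lemma dm_0 [simp]: "dm 0 = UNIV" by (auto simp: dm_def)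

lemma f_add: "z : dm k ==> f (n + k) z = f n (f k z)"
 using sg_f[of z k] by (simp add: f_def[of "n + k"] f_def[of n] funpow_add)

lemma dm_add: "z : dm k ==> z : dm (n + k) <-> f k z : dm n" by (simp add: dm_def funpow_add sg_f[unfolded dm_def])

lemma f_nonconst: assumes "open V" "V <= dm n" "V ~= {}" shows "~ f n constant_on V"
proof
 assume "f n constant_on V"
 then obtain c where c: "!!z. z : V ==> f n z = c" by (auto simp: constant_on_def)
 have "V <= {z. (T ^^ n) (sg z) = sg c}" using c assms(2) by (auto simp: dm_iff)
 hence "finite V" using finite_fibre finite_subset by blast
 moreover obtain x r where "ball x r <= V" "r > 0" using assms by (meson open_contains_ball ex_in_conv)
 ultimately show False using uncountable_ball[of r x] countable_finite finite_subset by metis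
qed

lemma open_map_f: "open V ==> V <= dm n ==> open (f n ` V)"
proof -
 assume V: "open V" "V <= dm n"
 show ?thesis proof (rule open_mapping_thm2[OF holomorphic_on_subset[OF hol_f V(2)] V(1) V(1) order_refl])
  show "!!X. open X ==> X <= V ==> X ~= {} ==> ~ f n constant_on X" using f_nonconst V by blast
 qed
qed

lemma J_surj: "w : J ==> EX z:J. f n z = w"
proof -
 assume w: "w : J"
 have "sg w : (T ^^ n) ` RS" using rat_sphere.T_surj[OF it_rat, of n] by simp
 then obtain x where x: "x : RS" "(T ^^ n) x = sg w" by auto
 hence "x : Jul" using w julia_funpow_iff[OF x(1), of n] by (simp add: J_def)
 then obtain z where "z : J" "x = sg z" using Jul_eq by auto
 hence "z : J" "f n z = w" using x(2) by (simp_all add: f_def)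
 thus ?thesis by blast
qed

lemma two_preimages:
 assumes "1 <= n" shows "finite {y:RS. ~ (EX x1:RS. EX x2:RS. x1 ~= x2 & (T ^^ n) x1 = y & (T ^^ n) x2 = y)}"
proof (rule finite_subset[OF _ generic])
 obtain k where k: "n = Suc k" using assms by (cases n) auto
 show "{y:RS. ~ (EX x1:RS. EX x2:RS. x1 ~= x2 & (T ^^ n) x1 = y & (T ^^ n) x2 = y)}
   <= {y:RS. ~ (EX x1:RS. EX x2:RS. x1 ~= x2 & T x1 = y & T x2 = y)}" proof (intro Collect_mono impI conjI notI)
  fix y assume y: "y : RS & ~ (EX x1:RS. EX x2:RS. x1 ~= x2 & (T ^^ n) x1 = y & (T ^^ n) x2 = y)"
   and "EX x1:RS. EX x2:RS. x1 ~= x2 & T x1 = y & T x2 = y"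
  then obtain x1 x2 where x: "x1 : RS" "x2 : RS" "x1 ~= x2" "T x1 = y" "T x2 = y" by blast
  have s: "(T ^^ k) ` RS = RS" by (rule rat_sphere.T_surj[OF it_rat])
  obtain x1' where x1': "x1' : RS" "(T ^^ k) x1' = x1" using s x(1) by (metis imageE)
  obtain x2' where x2': "x2' : RS" "(T ^^ k) x2' = x2" using s x(2) by (metis imageE)
  have "x1' ~= x2'" "(T ^^ n) x1' = y" "(T ^^ n) x2' = y" using x x1' x2' k by auto
  thus False using y x1'(1) x2'(1) by blast
 qed auto
qed

text \<open>Exceptional points are not in the Julia set. If \<open>f n\<close> were regular at e,
  nearby values would have a single preimage, against \<open>two_preimages\<close>. So e is a
  critical fixed point, a disc about it is mapped into itself by the iterates of \<open>f n\<close>,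
  and Montel puts e in the Fatou set.\<close>

lemma no_backward_invariant_point:
 assumes n: "1 <= n" and e: "e : J" "!!x. x : RS ==> (T ^^ n) x = sg e ==> x = sg e" shows False
proof -
 have fe: "f n e = e" proof -
  have "sg e : (T ^^ n) ` RS" using rat_sphere.T_surj[OF it_rat, of n] by simp
  then obtain x where "x : RS" "(T ^^ n) x = sg e" by auto
  thus ?thesis using e(2)[of x] by (simp add: f_def)
 qed
 have edm: "e : dm n" by (rule J_dm[OF e(1)])
 have d0: "deriv (f n) e = 0" proof (rule ccontr)
  assume "deriv (f n) e ~= 0"
  then obtain rh where rh: "rh > 0" "ball e rh <= dm n" "inj_on (f n) (ball e rh)"
   using has_complex_derivative_locally_injective[OF hol_f edm open_dm] by metis
  \<comment> \<open>The complement of the disc has a compact image that misses e. Hence all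
    preimages of nearby values lie in the disc, where \<open>f n\<close> is injective.\<close>
  let ?R = "RS - sg ` ball e rh"
  have "closedin (top_of_set RS) ?R" by (intro closedin_diff openin_sg_image) auto
  hence "compact ?R" using compact_RS closedin_compact by blast
  hence "compact ((T ^^ n) ` ?R)" by (intro compact_image continuous_on_subset[OF it_cont]) auto
  hence cl: "closed ((T ^^ n) ` ?R)" by (rule compact_imp_closed)
  have "sg e ~: (T ^^ n) ` ?R" proof
   assume "sg e : (T ^^ n) ` ?R"
   then obtain x where "x : ?R" "(T ^^ n) x = sg e" by auto
   thus False using e(2)[of x] rh(1) by auto
  qed
  hence "open (- (T ^^ n) ` ?R)" "sg e : - (T ^^ n) ` ?R" using cl by auto
  moreover have "continuous_on UNIV sg" by (intro continuous_intros)
  ultimately have "open (sg -` (- (T ^^ n) ` ?R))" "e : sg -` (- (T ^^ n) ` ?R)"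
   by (auto simp: continuous_on_open_vimage)
  then obtain ta where ta: "ta > 0" "ball e ta <= sg -` (- (T ^^ n) ` ?R)" by (meson open_contains_ball)
  have "sg ` ball e ta <= {y:RS. ~ (EX x1:RS. EX x2:RS. x1 ~= x2 & (T ^^ n) x1 = y & (T ^^ n) x2 = y)}"
  proof (intro image_subsetI CollectI conjI notI)
   fix w assume w: "w : ball e ta"
   assume "EX x1:RS. EX x2:RS. x1 ~= x2 & (T ^^ n) x1 = sg w & (T ^^ n) x2 = sg w"
   then obtain x1 x2 where x: "x1 : RS" "x2 : RS" "x1 ~= x2" "(T ^^ n) x1 = sg w" "(T ^^ n) x2 = sg w" by blast
   have nin: "sg w ~: (T ^^ n) ` ?R" using ta(2) w by blast
   have "x1 : sg ` ball e rh" "x2 : sg ` ball e rh" using nin x by (metis DiffI image_eqI)+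
   then obtain z1 z2 where z: "z1 : ball e rh" "z2 : ball e rh" "x1 = sg z1" "x2 = sg z2" by blast
   hence "f n z1 = f n z2" using x by (simp add: f_def)
   hence "z1 = z2" using rh(3) z by (auto dest: inj_onD)
   thus False using x z by simp
  qed auto
  hence "finite (sg ` ball e ta)" using two_preimages[OF n] finite_subset by blast
  hence "finite (ball e ta)" by (rule finite_imageD) (auto simp: inj_on_def)
  thus False using uncountable_ball[OF ta(1), of e] countable_finite by blast
 qed
 have "(f n has_field_derivative 0) (at e)" using holomorphic_derivI[OF hol_f open_dm edm] d0 by simp
 hence "((%z. (f n z - f n e) / (z - e)) \<longlongrightarrow> 0) (at e)" by (simp add: has_field_derivative_iff)
 hence "eventually (%z. norm ((f n z - e) / (z - e)) < 1/2) (at e)"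
  unfolding fe using order_tendstoD(2)[OF tendsto_norm, of _ 0 "at e" "1/2"] by force
 then obtain d where d: "d > 0" "!!z. z ~= e ==> dist z e < d ==> norm ((f n z - e) / (z - e)) < 1/2"
  by (auto simp: eventually_at)
 obtain rh0 where rh0: "rh0 > 0" "ball e rh0 <= dm n" using open_dm edm by (meson open_contains_ball)
 define rh where "rh = min d rh0"
 have rh: "rh > 0" using d rh0 by (simp add: rh_def)
 have step: "f n z : ball e rh" if z: "z : ball e rh" for z proof (cases "z = e")
  case True thus ?thesis using fe rh by simp
 next
  case False
  have "dist z e < d" using z by (simp add: rh_def dist_commute)
  hence "norm ((f n z - e) / (z - e)) < 1/2" by (rule d(2)[OF False])
  hence "norm (f n z - e) < norm (z - e)"
   using False norm_ge_zero[of "f n z - e"] by (simp add: norm_divide field_simps del: norm_ge_zero)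
  thus ?thesis using z by (simp add: dist_norm norm_minus_commute)
 qed
 have iter: "(T ^^ (n * j)) (sg z) : sg ` ball e rh" if "z : ball e rh" for j z proof (induction j)
  case (Suc j)
  then obtain w where w: "w : ball e rh" "(T ^^ (n * j)) (sg z) = sg w" by blast
  hence "(T ^^ (n * Suc j)) (sg z) = (T ^^ n) (sg w)" by (simp add: funpow_add)
  also have "... = sg (f n w)" by (rule sg_f[symmetric]) (use w rh0 in \<open>auto simp: rh_def\<close>)
  finally show ?case using step[OF w(1)] by blast
 qed (use that in auto)
 have out: "e + of_real (rh * t) ~: ball e rh" if "t >= 1" for t :: real proof -
  have "rh <= rh * t" using rh that by simp
  moreover have "norm (of_real (rh * t) :: complex) = rh * t" using rh that by (simp only: norm_of_real) simp
  ultimately show ?thesis by (simp add: dist_norm del: of_real_mult)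
 qed
 have "sg e : Fat" proof (rule omit_three_imp_fatou[OF n rh])
  show "e + of_real (rh * 1) ~= e + of_real (rh * 2)" "e + of_real (rh * 1) ~= e + of_real (rh * 3)"
   "e + of_real (rh * 2) ~= e + of_real (rh * 3)" using rh by (simp_all flip: of_real_mult)
  show "(T ^^ (n * j)) (sg z) ~: {sg (e + of_real (rh * 1)), sg (e + of_real (rh * 2)), sg (e + of_real (rh * 3))}"
   if "z : ball e rh" for j z using iter[OF that, of j] out[of 1] out[of 2] out[of 3] by auto
 qed
 thus False using e(1) by (simp add: J_def julia_set_def)
qed

end

abbreviation "HM1 \<equiv> hm (UNIV :: complex set) 1"

lemma finite_injection_power_id: assumes "finite E" "inj_on g E" "g ` E <= E"
 obtains t :: nat where "1 <= t" "!!e. e : E ==> (g ^^ t) e = e" proof -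
 have maps: "(g ^^ t) e : E" if "e : E" for t e by (induction t) (use that assms in auto)
 have inj: "inj_on (g ^^ t) E" for t proof (induction t)
  case (Suc t)
  have "inj_on g ((g ^^ t) ` E)" by (rule inj_on_subset[OF assms(2)]) (use maps in auto)
  thus ?case using comp_inj_on[OF Suc] by (simp add: o_def)
 qed simp
 have "finite (E \<rightarrow>\<^sub>E E)" using assms by (intro finite_PiE)
 hence "finite (range (%t. restrict (g ^^ t) E))" by (rule finite_subset[rotated]) (use maps in auto)
 hence "~ inj (%t. restrict (g ^^ t) E)" using finite_imageD infinite_UNIV_nat by blast
 then obtain i j where ij: "i < j" "restrict (g ^^ i) E = restrict (g ^^ j) E"
  unfolding inj_def by (metis linorder_neqE_nat)
 show thesis proof (rule that[of "j - i"])
  show "1 <= j - i" using ij by simp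
  fix e assume e: "e : E"
  have "j = i + (j - i)" using ij(1) by simp
  hence "(g ^^ i) ((g ^^ (j - i)) e) = (g ^^ j) e" by (metis comp_apply funpow_add)
  also have "... = (g ^^ i) e" using ij(2) e by (metis restrict_apply')
  finally show "(g ^^ (j - i)) e = e" using inj[of i] maps[OF e] e by (auto dest: inj_onD)
 qed
qed

text \<open>K need not be convex. Points at distance at most d lie in a disc inside D, where the
  derivative is bounded; for other pairs the diameter of the image is compared with d.\<close>

lemma holomorphic_lipschitz_on_compact: assumes "g holomorphic_on D" "open D" "compact K" "K <= D"
 obtains C where "0 < C" "!!x y. x : K ==> y : K ==> dist (g x) (g y) <= C * dist x y" proof (cases "K = {}")
 case True thus thesis by (intro that[of 1]) auto
next
 case False
 obtain d where d: "d > 0" "(UN x:K. cball x d) <= D"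
  using compact_subset_open_imp_cball_epsilon_subset[OF assms(3,2,4)] by blast
 let ?K = "{x + y | x y. x : K & y : cball 0 d}"
 have cK: "compact ?K" using assms(3) by (intro compact_sums) auto
 have sub: "cball x d <= ?K" if "x : K" for x proof
  fix y assume "y : cball x d"
  thus "y : ?K" using that by (intro CollectI exI[of _ x] exI[of _ "y - x"]) (auto simp: dist_norm norm_minus_commute)
 qed
 have KD: "?K <= D" proof
  fix w assume "w : ?K"
  then obtain x y where "w = x + y" "x : K" "norm y <= d" by auto
  hence "w : cball x d" by (simp add: dist_norm)
  thus "w : D" using d(2) `x : K` by blast
 qed
 have "continuous_on ?K (deriv g)" by (rule continuous_on_subset[OF hol_cont[OF holomorphic_deriv[OF assms(1,2)]] KD])
 hence "bounded (deriv g ` ?K)" using cK by (intro compact_imp_bounded compact_image)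
 then obtain B where B: "B > 0" "!!x. x : ?K ==> norm (deriv g x) <= B" unfolding bounded_pos by blast
 have "bounded (g ` K)"
  by (intro compact_imp_bounded compact_image continuous_on_subset[OF hol_cont[OF assms(1)] assms(4)] assms(3))
 note bd = this
 define M where "M = diameter (g ` K)"
 have M: "M >= 0" using bd by (simp add: M_def diameter_ge_0)
 show thesis proof (rule that[of "B + M / d"])
  show "0 < B + M / d" using B M d by (simp add: add_pos_nonneg)
  fix x y assume xy: "x : K" "y : K"
  show "dist (g x) (g y) <= (B + M / d) * dist x y" proof (cases "dist x y <= d")
   case True
   have "norm (g x - g y) <= B * norm (x - y)" proof (rule field_differentiable_bound[of "cball x d" _ "deriv g"])
    fix z assume z: "z : cball x d"
    hence "z : D" using sub[OF xy(1)] KD by blast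
    thus "(g has_field_derivative deriv g z) (at z within cball x d)"
     using holomorphic_derivI[OF assms(1,2)] has_field_derivative_at_within by blast
    show "norm (deriv g z) <= B" using z sub[OF xy(1)] by (intro B(2)) blast
   qed (use True d in auto)
   moreover have "0 <= M / d * dist x y" using M d by simp
   ultimately show ?thesis by (simp add: dist_norm distrib_right)
  next
   case False
   have "dist (g x) (g y) <= M" unfolding M_def using xy bd by (intro diameter_bounded_bound) auto
   also have "... = M / d * d" using d by simp
   also have "... <= M / d * dist x y" using False M d by (intro mult_left_mono) auto
   also have "... <= (B + M / d) * dist x y" using B by (intro mult_right_mono) auto
   finally show ?thesis .
  qed
 qed
qed

lemma holomorphic_inverse_ex: assumes "g holomorphic_on S" "open S" "inj_on g S"
 shows "EX h. h holomorphic_on g ` S & (ALL z:S. h (g z) = z)" using holomorphic_has_inverse[OF assms] by metis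

text \<open>The branches in the definition of the radial set are only continuous. Invariance of
  domain makes the image open, so the section inverts an injective holomorphic map.\<close>

lemma continuous_section_holomorphic: fixes ph :: "complex => complex"
 assumes g: "g holomorphic_on D" "open D" and ph: "continuous_on V ph" "open V" "ph ` V <= D"
  and sec: "!!y. y : V ==> g (ph y) = y" shows "ph holomorphic_on V" proof -
 have inj: "inj_on ph V" using sec by (metis inj_onI)
 have op: "open (ph ` V)" by (rule invariance_of_domain[OF ph(1,2) inj])
 have "inj_on g (ph ` V)" using sec by (auto simp: inj_on_def)
 then obtain h where h: "h holomorphic_on g ` ph ` V" "!!z. z : ph ` V ==> h (g z) = z"
  using holomorphic_inverse_ex[OF holomorphic_on_subset[OF g(1) ph(3)] op] by blast
 have "g ` ph ` V = V" using sec by force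
 hence "h holomorphic_on V" using h(1) by simp
 thus ?thesis by (rule holomorphic_transform) (use h(2) sec in force)
qed

context julia_plane
begin

text \<open>By Montel the iterates of order l * j of the disc miss at most two points of J. The
  missed points E are closed under preimages in J, so under some iterate each is its own only
  preimage, which \<open>no_backward_invariant_point\<close> excludes. Compactness of J then bounds
  j.\<close>

lemma expand: assumes l: "1 <= l" and x: "x : J" and r: "0 < r"
 obtains m where "J <= (UN j<=m. f (l * j) ` (J Int ball x r))" proof -
 define E where "E = {e:J. ALL j. ALL y:ball x r. (T ^^ (l * j)) (sg y) ~= sg e}"
 have bwd: "y : E" if "y : J" "f l y : E" for y proof -
  have "False" if z: "z : ball x r" "(T ^^ (l * j)) (sg z) = sg y" for z j proof -
   have "(T ^^ (l * Suc j)) (sg z) = (T ^^ l) (sg y)" using z(2) by (simp add: funpow_add)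
   also have "... = sg (f l y)" using J_dm[OF `y : J`] by (simp add: sg_f)
   finally show False using `f l y : E` z(1) unfolding E_def by blast
  qed
  thus ?thesis using `y : J` unfolding E_def by blast
 qed
 have finE: "finite E" proof (rule ccontr)
  assume "infinite E"
  then obtain B where B: "finite B" "card B = 3" "B <= E" using infinite_arbitrarily_large by metis
  then obtain e1 e2 e3 where e: "B = {e1, e2, e3}" "e1 ~= e2" "e1 ~= e3" "e2 ~= e3" by (metis card_3_iff)
  have "sg x : Fat" proof (rule omit_three_imp_fatou[OF l r e(2-4)])
   show "(T ^^ (l * j)) (sg z) ~: {sg e1, sg e2, sg e3}" if "z : ball x r" for j z
    using B(3) that unfolding e(1) E_def by blast
  qed
  thus False using x by (simp add: J_def julia_set_def)
 qed
 have "E = {}" proof (rule ccontr)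
  assume "E ~= {}"
  then obtain e0 where e0: "e0 : E" by blast
  \<comment> \<open>A choice g of preimages maps the finite set E injectively into itself, hence
    onto, so g e is the only preimage of e in J.\<close>
  have "ALL e:E. EX z. z : J & f l z = e" using J_surj unfolding E_def by blast
  then obtain g where g: "!!e. e : E ==> g e : J" "!!e. e : E ==> f l (g e) = e" by metis
  have gE: "g ` E <= E" using bwd g by auto
  have ginj: "inj_on g E" by (rule inj_onI) (metis g(2))
  hence gsurj: "g ` E = E" using gE finE by (simp add: endo_inj_surj)
  have uniq: "z = g e" if "z : J" "f l z = e" "e : E" for z e proof -
   have "z : E" using bwd that by simp
   then obtain e' where "e' : E" "z = g e'" using gsurj by blast
   thus ?thesis using g(2) that(2) by metis
  qed
  obtain t :: nat where t: "1 <= t" "!!e. e : E ==> (g ^^ t) e = e"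
   using finite_injection_power_id[OF finE ginj gE] by blast
  have it: "y = (g ^^ i) e" if "y : J" "(T ^^ (l * i)) (sg y) = sg e" "e : E" for y e i using that
  proof (induction i arbitrary: e)
   case (Suc i)
   have "(T ^^ (l * Suc i)) (sg y) = (T ^^ l) ((T ^^ (l * i)) (sg y))" by (simp add: funpow_add)
   also have "(T ^^ (l * i)) (sg y) = sg (f (l * i) y)" using J_dm[OF Suc.prems(1)] by (simp add: sg_f)
   finally have "f l (f (l * i) y) = e" using Suc.prems(2) by (simp add: f_def)
   hence fi: "f (l * i) y = g e" using Suc.prems f_in_J by (intro uniq) auto
   have "(T ^^ (l * i)) (sg y) = sg (g e)" using fi J_dm[OF Suc.prems(1)] by (simp add: sg_f[symmetric])
   hence "y = (g ^^ i) (g e)" using Suc gE by (intro Suc.IH) auto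
   thus ?case by (simp add: funpow_swap1)
  qed simp
  show False proof (rule no_backward_invariant_point[of "l * t" e0])
   show "1 <= l * t" using l t(1) by simp
   show "e0 : J" using e0 by (simp add: E_def)
   fix y assume y: "y : RS" "(T ^^ (l * t)) y = sg e0"
   hence "y : Jul" using `e0 : J` julia_funpow_iff[OF y(1), of "l * t"] by (simp add: J_def)
   then obtain z where z: "z : J" "y = sg z" using Jul_eq by auto
   hence "z = e0" using it[of z t e0] y(2) e0 t(2) by simp
   thus "y = sg e0" using z by simp
  qed
 qed
 hence cov: "EX j. EX y:ball x r. (T ^^ (l * j)) (sg y) = sg e" if "e : J" for e using that unfolding E_def by blast
 let ?O = "%j. f (l * j) ` (ball x r Int dm (l * j))"
 have "J <= (UN j:UNIV. ?O j)" proof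
  fix e assume "e : J"
  then obtain j y where "y : ball x r" "(T ^^ (l * j)) (sg y) = sg e" using cov by blast
  hence "e : ?O j" by (auto simp: dm_iff)
  thus "e : (UN j:UNIV. ?O j)" by blast
 qed
 note covO = this
 have opO: "open (?O j)" for j by (intro open_map_f open_Int open_dm) auto
 obtain I where I: "I <= UNIV" "finite I" "J <= (UN j:I. ?O j)" by (rule compactE_image[OF compact_J opO covO])
 define m where "m = Max (insert 0 I)"
 have m: "j <= m" if "j : I" for j using I(2) that by (simp add: m_def)
 show thesis proof (rule that[of m], rule subsetI)
  fix e assume e: "e : J"
  then obtain j y where j: "j : I" "y : ball x r" "y : dm (l * j)" "e = f (l * j) y" using I(3) by blast
  hence "y : J" using J_inv e by blast
  thus "e : (UN j<=m. f (l * j) ` (J Int ball x r))" using j m by blast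
 qed
qed

lemma expand1: assumes "x : J" "0 < r" obtains m where "J <= (UN j<=m. f j ` (J Int ball x r))"
 using expand[of 1 x r] assms by auto

text \<open>On a disc inside J all iterates stay in the bounded set J, so they miss three points far
  out.\<close>

lemma interior_J_empty: "interior J = {}"
proof (rule ccontr)
 assume "interior J ~= {}"
 then obtain x where "x : interior J" by blast
 then obtain r where r: "r > 0" "ball x r <= J" by (meson mem_interior)
 hence x: "x : J" by auto
 obtain R where R: "R > 0" "!!z. z : J ==> norm z <= R" using compact_imp_bounded[OF compact_J] bounded_pos by metis
 have "sg x : Fat" proof (rule omit_three_imp_fatou[of 1, OF _ r(1)])
  show "of_real (R+1) ~= (of_real (R+2) :: complex)" "of_real (R+1) ~= (of_real (R+3) :: complex)"
   "of_real (R+2) ~= (of_real (R+3) :: complex)" by (simp_all del: of_real_add)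
  fix j z assume "z : ball x r"
  hence z: "z : J" using r by blast
  have "(T ^^ (1 * j)) (sg z) = sg (f j z)" using J_dm[OF z] by (simp add: sg_f)
  moreover have "norm (f j z) <= R" using f_in_J[OF z] R(2) by blast
  moreover have "norm (of_real (R + t) :: complex) = R + t" if "t >= 1" for t
   unfolding norm_of_real using R(1) that by simp
  hence "w ~= of_real (R + t)" if "norm w <= R" "t >= 1" for w :: complex and t
   using that by (metis add_le_same_cancel1 not_one_le_zero order_trans)
  ultimately show "(T ^^ (1 * j)) (sg z) ~: {sg (of_real (R+1)), sg (of_real (R+2)), sg (of_real (R+3))}"
   by (simp del: of_real_add)
 qed simp
 thus False using x by (simp add: J_def julia_set_def)
qed

lemma finite_crit: "finite {z:J. deriv (f n) z = 0}"
proof (rule ccontr)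
 assume inf: "infinite {z:J. deriv (f n) z = 0}"
 then obtain w where w: "w : J" "w islimpt {z:J. deriv (f n) z = 0}"
  using compact_J unfolding compact_eq_Bolzano_Weierstrass by (metis (no_types, lifting) mem_Collect_eq subsetI)
 have z0: "deriv (f n) z = 0" if "z : dm n" for z
  by (rule analytic_continuation[OF holomorphic_deriv[OF hol_f open_dm] open_dm connected_dm _ _ w(2) _ that])
    (use J_dm w in auto)
 obtain r where r: "r > 0" "ball w r <= dm n" using open_dm J_dm[OF w(1)] by (meson open_contains_ball)
 have "EX c. ALL z:ball w r. f n z = c" proof (rule has_field_derivative_zero_constant)
  fix z assume "z : ball w r"
  thus "(f n has_field_derivative 0) (at z within ball w r)"
   using holomorphic_derivI[OF hol_f open_dm, of z n] z0[of z] r has_field_derivative_at_within by (metis subsetD)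
 qed auto
 hence "f n constant_on ball w r" unfolding constant_on_def by blast
 thus False using f_nonconst[OF _ r(2)] r(1) by auto
qed

lemma f_lipschitz: obtains C where "0 < C" "!!x y. x : J ==> y : J ==> dist (f n x) (f n y) <= C * dist x y"
 using holomorphic_lipschitz_on_compact[OF hol_f open_dm compact_J, of n] J_dm by blast

text \<open>By \<open>expand1\<close>, A consists of finitely many images of its part in the disc,
  apart from finitely many critical values. The iterates are Lipschitz on J, so local information on
  length becomes global.\<close>

lemma backward_closed_measure_transport:
 assumes A: "A <= J" "!!n q. q : J ==> deriv (f n) q ~= 0 ==> f n q : A ==> q : A" and x: "x : J" "0 < r"
 shows "HM1 (A Int ball x r) = 0 ==> HM1 A = 0" "HM1 (A Int ball x r) < top ==> HM1 A < top"
proof -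
 obtain m where m: "J <= (UN j<=m. f j ` (J Int ball x r))" using expand1[OF x] by blast
 let ?cr = "%j. {z:J. deriv (f j) z = 0}"
 have sub: "A <= (UN j<=m. f j ` (A Int ball x r)) Un (UN j<=m. f j ` ?cr j)" proof
  fix a assume a: "a : A"
  then obtain j q where q: "j <= m" "q : J" "q : ball x r" "a = f j q" using A(1) m by blast
  show "a : (UN j<=m. f j ` (A Int ball x r)) Un (UN j<=m. f j ` ?cr j)" proof (cases "deriv (f j) q = 0")
   case False
   hence "q : A" using A(2)[of q j] q a by simp
   thus ?thesis using q by blast
  qed (use q in blast)
 qed
 have z: "HM1 (UN j<=m. f j ` ?cr j) = 0" proof (rule hm_countable_null)
  have "countable (f j ` ?cr j)" for j by (intro countable_finite finite_imageI finite_crit)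
  thus "countable (UN j<=m. f j ` ?cr j)" by (intro countable_UN) auto
 qed auto
 have le: "HM1 A <= HM1 (UN j<=m. f j ` (A Int ball x r))"
  using order_trans[OF hm_mono[OF sub, of UNIV 1] hm_Un] unfolding z by simp
 have lip: "EX C>0. HM1 (f j ` (A Int ball x r)) <= ennreal C * HM1 (A Int ball x r)" for j proof -
  obtain C where C: "0 < C" "!!x y. x : J ==> y : J ==> dist (f j x) (f j y) <= C * dist x y" using f_lipschitz[of j] by metis
  have "HM1 (f j ` (A Int ball x r)) <= ennreal (C powr 1) * HM1 (A Int ball x r)"
   by (rule hm_lipschitz[OF C(1)]) (use C(2) A(1) in auto)
  thus ?thesis using C(1) by auto
 qed
 show "HM1 A = 0" if "HM1 (A Int ball x r) = 0" proof -
  have "HM1 (f j ` (A Int ball x r)) = 0" for j using lip[of j] that by auto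
  hence "HM1 (UN j<=m. f j ` (A Int ball x r)) = 0" by (intro hm_null_UN_finite) auto
  thus ?thesis using le by simp
 qed
 show "HM1 A < top" if "HM1 (A Int ball x r) < top" proof -
  have "HM1 (f j ` (A Int ball x r)) < top" for j
   using lip[of j] that by (metis ennreal_less_top ennreal_mult_less_top order_le_less_trans)
  hence "HM1 (UN j<=m. f j ` (A Int ball x r)) < top" by (intro hm_finite_UN_finite) auto
  thus ?thesis using le by (rule order_le_less_trans[rotated])
 qed
qed

subsection \<open>Inverse branches\<close>

definition br :: "nat => complex => real => (complex => complex) => bool" where
 "br n x rh ph <-> ph holomorphic_on ball x rh & (ALL y:ball x rh. ph y : dm n & f n (ph y) = y)"

lemma brD: assumes "br n x rh ph"
 shows "ph holomorphic_on ball x rh" "!!y. y : ball x rh ==> ph y : dm n" "!!y. y : ball x rh ==> f n (ph y) = y"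
  "inj_on ph (ball x rh)" "!!y. y : ball x rh ==> ph y : J <-> y : J"
  "!!y. y : ball x rh ==> deriv (f n) (ph y) ~= 0" proof -
 show h: "ph holomorphic_on ball x rh" and d: "!!y. y : ball x rh ==> ph y : dm n"
  and s: "!!y. y : ball x rh ==> f n (ph y) = y" using assms by (auto simp: br_def)
 show "inj_on ph (ball x rh)" by (rule inj_onI) (metis s)
 show "ph y : J <-> y : J" if "y : ball x rh" for y using J_inv[OF d[OF that]] s[OF that] by simp
 show "deriv (f n) (ph y) ~= 0" if y: "y : ball x rh" for y proof
  assume 0: "deriv (f n) (ph y) = 0"
  have "(ph has_field_derivative deriv ph y) (at y)" by (rule holomorphic_derivI[OF h open_ball y])
  moreover have "(f n has_field_derivative deriv (f n) (ph y)) (at (ph y))"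
   by (rule holomorphic_derivI[OF hol_f open_dm d[OF y]])
  ultimately have "((%z. f n (ph z)) has_field_derivative deriv (f n) (ph y) * deriv ph y) (at y)"
   by (intro DERIV_chain2)
  hence "((%z. f n (ph z)) has_field_derivative 0) (at y)" unfolding 0 by simp
  hence "((%z. z) has_field_derivative 0) (at y)"
   by (rule has_field_derivative_transform_within_open[of _ _ _ "ball x rh"]) (use y s in auto)
  hence "(0::complex) = 1" using DERIV_ident DERIV_unique by blast
  thus False by simp
 qed
qed

lemma br_regular: "br n x rh ph ==> y : ball x rh ==> deriv ph y ~= 0"
 by (rule holomorphic_injective_imp_regular[OF brD(1) open_ball brD(4)])

lemma br_comp: assumes "br n x rh ph" "br k x' rh' s" "s ` ball x' rh' <= ball x rh" shows "br (k + n) x' rh' (ph o s)"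
proof -
 note b1 = brD[OF assms(1)] and b2 = brD[OF assms(2)]
 have "(ph o s) holomorphic_on ball x' rh'" by (rule holomorphic_on_compose_gen[OF b2(1) b1(1) assms(3)])
 moreover have "(ph o s) y : dm (k + n) & f (k + n) ((ph o s) y) = y" if y: "y : ball x' rh'" for y proof -
  have sy: "s y : ball x rh" using assms(3) y by blast
  show ?thesis using b1(2,3)[OF sy] b2(2,3)[OF y] by (simp add: f_add dm_add)
 qed
 ultimately show ?thesis by (simp add: br_def)
qed

lemma br_subset: "br n x rh ph ==> ball x' rh' <= ball x rh ==> br n x' rh' ph"
 unfolding br_def by (blast intro: holomorphic_on_subset)

lemma local_branch: assumes q: "q : dm n" "deriv (f n) q ~= 0" and et: "et > 0"
 obtains rh s where "rh > 0" "br n (f n q) rh s" "s (f n q) = q" "s ` ball (f n q) rh <= ball q et" proof -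
 obtain r where r: "r > 0" "ball q r <= dm n" "inj_on (f n) (ball q r)"
  using has_complex_derivative_locally_injective[OF hol_f q(1) open_dm q(2)] by metis
 define V where "V = ball q (min r et)"
 have V: "open V" "q : V" "V <= dm n" "inj_on (f n) V" "V <= ball q et"
  using r et unfolding V_def by (auto intro: inj_on_subset)
 obtain s where s: "s holomorphic_on f n ` V" "!!z. z : V ==> s (f n z) = z"
  using holomorphic_inverse_ex[OF holomorphic_on_subset[OF hol_f V(3)] V(1) V(4)] by blast
 have "open (f n ` V)" by (rule open_map_f[OF V(1,3)])
 then obtain rh where rh: "rh > 0" "ball (f n q) rh <= f n ` V" using V(2) by (meson imageI open_contains_ball)
 have sV: "s y : V & f n (s y) = y" if y: "y : ball (f n q) rh" for y proof -
  obtain z where "z : V" "y = f n z" using rh(2) y by blast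
  thus ?thesis using s(2) by simp
 qed
 show thesis proof (rule that[OF rh(1)])
  show "br n (f n q) rh s" unfolding br_def using holomorphic_on_subset[OF s(1) rh(2)] sV V(3) by blast
 qed (use s(2) V sV in auto)
qed

text \<open>The points radial at a fixed scale e. Shrinking is expressed by images in arbitrarily
  small discs; that orders tend to infinity follows in \<open>Lset_late_branch\<close>.\<close>

definition Lset :: "real => complex set" where
 "Lset e = {p:J. ALL et>0. EX n ph. br n (f n p) e ph & ph (f n p) = p & ph ` ball (f n p) e <= ball p et}"

lemma Lset_J: "Lset e <= J" by (auto simp: Lset_def)

lemma LsetD: assumes "p : Lset e" "0 < et"
 obtains n ph where "br n (f n p) e ph" "ph (f n p) = p" "ph ` ball (f n p) e <= ball p et"
 using assms by (auto simp: Lset_def)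

lemma Lset_mono: "e' <= e ==> Lset e <= Lset e'"
proof
 fix p assume e: "e' <= e" and p: "p : Lset e"
 have "EX n ph. br n (f n p) e' ph & ph (f n p) = p & ph ` ball (f n p) e' <= ball p et" if et: "et > 0" for et proof -
  obtain n ph where *: "br n (f n p) e ph" "ph (f n p) = p" "ph ` ball (f n p) e <= ball p et"
   using p et by (rule LsetD)
  have "ball (f n p) e' <= ball (f n p) e" using e by auto
  thus ?thesis using * br_subset by blast
 qed
 thus "p : Lset e'" using p by (auto simp: Lset_def)
qed

text \<open>Composition with a local branch at q turns branches landing near f n q into branches
  landing near q, on the same discs of radius e.\<close>

lemma Lset_backward: assumes q: "q : J" "deriv (f n) q ~= 0" "f n q : Lset e" shows "q : Lset e"
proof -
 have "EX m ph. br m (f m q) e ph & ph (f m q) = q & ph ` ball (f m q) e <= ball q et" if et: "et > 0" for et proof -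
  obtain rh s where s: "rh > 0" "br n (f n q) rh s" "s (f n q) = q" "s ` ball (f n q) rh <= ball q et"
   using local_branch[OF J_dm[OF q(1)] q(2) et] by metis
  obtain m ph where ph: "br m (f m (f n q)) e ph" "ph (f m (f n q)) = f n q"
   "ph ` ball (f m (f n q)) e <= ball (f n q) rh" using LsetD[OF q(3) s(1)] by blast
  have eq: "f (m + n) q = f m (f n q)" using J_dm[OF q(1)] by (simp add: f_add)
  have "br (m + n) (f (m + n) q) e (s o ph)" unfolding eq by (rule br_comp[OF s(2) ph(1,3)])
  moreover have "(s o ph) (f (m + n) q) = q" unfolding eq using ph(2) s(3) by simp
  moreover have "(s o ph) ` ball (f (m + n) q) e <= ball q et"
   unfolding eq image_comp[symmetric] using ph(3) s(4) by blast
  ultimately show ?thesis by blast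
 qed
 thus ?thesis using q(1) by (auto simp: Lset_def)
qed

lemma Lset_br: assumes "br n x rh ph" "y : ball x rh" "y : Lset e" shows "ph y : Lset e"
proof (rule Lset_backward[where n = n])
 show "ph y : J" using brD(5)[OF assms(1,2)] assms(3) Lset_J by blast
qed (use brD[OF assms(1)] assms in auto)

end

section \<open>Finite length of the Julia set\<close>

text \<open>A finite sum is continuous in the exponent, so the strict inequality at 1 persists
  slightly beyond.\<close>

lemma sum_powr_gt_1: fixes c :: "'i => real" assumes "finite F" "!!i. i : F ==> 0 < c i" "1 < (SUM i:F. c i)"
 obtains s where "1 < s" "1 <= (SUM i:F. c i powr s)" proof -
 have "((%s. SUM i:F. c i powr s) \<longlongrightarrow> (SUM i:F. c i powr 1)) (at_right 1)"
  using assms(2) by (intro tendsto_intros) (auto simp: less_imp_neq[symmetric])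
 moreover have "1 < (SUM i:F. c i powr 1)" using assms by (simp add: less_imp_le)
 ultimately have "eventually (%s. 1 < (SUM i:F. c i powr s)) (at_right 1)" by (rule order_tendstoD)
 hence "eventually (%s. 1 < s & 1 < (SUM i:F. c i powr s)) (at_right (1::real))"
  by (intro eventually_conj eventually_at_right_less)
 then obtain s where "1 < s" "1 < (SUM i:F. c i powr s)" using eventually_happens trivial_limit_at_right_real by blast
 thus thesis using that by force
qed

lemma finite_net: fixes J :: "complex set" assumes "compact J" "0 < e"
 obtains X where "finite X" "X <= J" "J <= (UN x:X. ball x e)" proof -
 have op: "open (ball x e)" for x :: complex by simp
 have cov: "J <= (UN x:J. ball x e)" using assms(2) by auto
 obtain X where "X <= J" "finite X" "J <= (UN x:X. ball x e)" by (rule compactE_image[OF assms(1) op cov])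
 thus thesis using that by blast
qed

lemma finite_pos_lower_bound: assumes "finite X" "!!x. x : X ==> 0 < (g x :: real)"
 obtains si where "0 < si" "!!x. x : X ==> si <= g x" proof (rule that[of "Min (insert 1 (g ` X))"])
 show "0 < Min (insert 1 (g ` X))" using assms by (subst Min_gr_iff) auto
 show "Min (insert 1 (g ` X)) <= g x" if "x : X" for x using that assms by (intro Min_le) auto
qed

context julia_plane
begin

lemma uncountable_J: assumes pos: "0 < HM1 J" shows "uncountable J"
proof
 assume "countable J"
 hence z: "HM1 J = 0" by (rule hm_countable_null) auto
 show False using pos unfolding z by simp
qed

text \<open>Only critical points on J enter, so the set is countable and avoiding it costs no
  length.\<close>

definition postcrit :: "complex set" where "postcrit = (UN n. f n ` {z:J. deriv (f n) z = 0})"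

lemma countable_postcrit: "countable postcrit"
 unfolding postcrit_def by (rule countable_UN) (auto intro: countable_finite finite_crit)

lemma postcritD: "x ~: postcrit ==> q : J ==> f n q = x ==> deriv (f n) q ~= 0" by (auto simp: postcrit_def)

text \<open>Branches from one disc about x0 into all discs of a finite net. They close the loop: a
  radial branch starts from a disc of the net and can be composed to start at x0.\<close>

lemma branch_net: assumes x0: "x0 : J" "x0 ~: postcrit" and X: "finite X" "X <= J" and r: "0 < r"
 obtains rh k s where "0 < rh" "!!x. x : X ==> br (k x) x0 rh (s x)" "!!x. x : X ==> s x ` ball x0 rh <= ball x r"
proof -
 have "EX k rh s. rh > 0 & br k x0 rh s & s ` ball x0 rh <= ball x r" if x: "x : X" for x proof -
  have "x : J" using x X(2) by blast
  then obtain m where m: "J <= (UN j<=m. f j ` (J Int ball x r))" using expand1 r by metis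
  then obtain j q where q: "q : J" "q : ball x r" "f j q = x0" using x0(1) by blast
  obtain et where et: "et > 0" "ball q et <= ball x r" using q(2) by (metis open_ball open_contains_ball)
  obtain rh s where "rh > 0" "br j (f j q) rh s" "s ` ball (f j q) rh <= ball q et"
   using local_branch[OF J_dm[OF q(1)] postcritD[OF x0(2) q(1,3)] et(1)] by metis
  thus ?thesis using et(2) q(3) by blast
 qed
 then obtain k rhX s where sX: "!!x. x : X ==> rhX x > 0" "!!x. x : X ==> br (k x) x0 (rhX x) (s x)"
  "!!x. x : X ==> s x ` ball x0 (rhX x) <= ball x r" by metis
 obtain rh where rh: "rh > 0" "!!x. x : X ==> rh <= rhX x" using finite_pos_lower_bound[OF X(1), of rhX] sX(1) by metis
 have b: "ball x0 rh <= ball x0 (rhX x)" if "x : X" for x using rh(2)[OF that] by auto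
 show thesis proof (rule that[OF rh(1)])
  show "br (k x) x0 rh (s x)" if "x : X" for x by (rule br_subset[OF sX(2)[OF that] b[OF that]])
  show "s x ` ball x0 rh <= ball x r" if "x : X" for x using sX(3)[OF that] b[OF that] by blast
 qed
qed

text \<open>For p radial at scale e near x0, the branch landing at p is composed with a branch from
  x0 into its domain. This gives contractions of one disc X0 into itself. If the length were
  infinite, Vitali would select finitely many with disjoint images and ratios c of sum above 1.
  Their limit set would have nonzero measure in some dimension t > 1 and consist of points radial at
  scale rh0/8.\<close>

lemma Lset_finite_measure: assumes e: "0 < e" and null: "!!s e'. 1 < s ==> 0 < e' ==> hm UNIV s (Lset e') = 0"
 shows "HM1 (Lset e) < top"
proof (rule ccontr)
 assume "~ HM1 (Lset e) < top"
 hence Ltop: "HM1 (Lset e) = top" by (simp add: top.not_eq_extremum[symmetric])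
 have "HM1 (Lset e) <= HM1 J" by (intro hm_mono Lset_J)
 hence "0 < HM1 J" using Ltop by (simp add: top_unique)
 hence "uncountable J" by (rule uncountable_J)
 hence "J - postcrit ~= {}" using countable_postcrit countable_subset by (metis Diff_eq_empty_iff)
 then obtain x0 where x0: "x0 : J" "x0 ~: postcrit" by blast
 obtain C where "distortion C" using univalent_distortion by blast
 then interpret distortion C .
 obtain X where X: "finite X" "X <= J" "J <= (UN x:X. ball x (e/16))"
  using finite_net[OF compact_J, of "e/16"] e by auto
 obtain rh0 kk s where rh0: "0 < rh0" and s1: "!!x. x : X ==> br (kk x) x0 rh0 (s x)"
  and s2: "!!x. x : X ==> s x ` ball x0 rh0 <= ball x (e/16)" using branch_net[OF x0 X(1,2), of "e/16"] e by auto
 have "norm (deriv (s x) x0) > 0" if "x : X" for x using br_regular[OF s1[OF that]] rh0 by simp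
 then obtain si where si: "si > 0" "!!x. x : X ==> si <= norm (deriv (s x) x0)"
  using finite_pos_lower_bound[OF X(1), of "%x. norm (deriv (s x) x0)"] by metis
 define X0 where "X0 = cball x0 (rh0/4)"
 have X0b: "X0 <= ball x0 rh0" using rh0 by (auto simp: X0_def)
 define A where "A = Lset e Int ball x0 (rh0/16)"
 have Atop: "HM1 A = top" proof (rule ccontr)
  assume "HM1 A ~= top"
  hence "HM1 (Lset e) < top"
   using backward_closed_measure_transport(2)[OF Lset_J[of e] _ x0(1), where r = "rh0/16"] rh0 Lset_backward
   by (simp add: A_def top.not_eq_extremum)
  thus False using Ltop by simp
 qed
 \<comment> \<open>Chosen so that 10 * R p = M * c p: Vitali diameters of sum above M mean
   contraction ratios of sum above 1.\<close>
 define M where "M = 10 * C^3 * e / (4 * si)"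
 have M: "M > 0" using C e si by (simp add: M_def)
 have "EX d>0. ennreal M < haus_pre UNIV 1 d A" proof (rule ccontr)
  assume "~ ?thesis"
  hence "HM1 A <= ennreal M" by (intro hm_least) (metis not_less)
  thus False using Atop by (simp add: top_unique)
 qed
 then obtain d where d: "d > 0" "ennreal M < haus_pre UNIV 1 d A" by blast
 \<comment> \<open>The first entry makes every g p contract by 1/2 and land in the disc of radius
   rh0/8 about x0; the second makes 10 * R p at most d.\<close>
 define et where "et = min (rh0 / (16 * C^2)) (d * si * rh0 / (20 * C^3 * e))"
 have et: "et > 0" using rh0 C d si e by (simp add: et_def)
 have et1: "et <= rh0/16" proof -
  have "1 <= C^2" using C by simp
  hence "rh0 / (16 * C^2) <= rh0 / 16" using rh0 by (intro divide_left_mono) auto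
  thus ?thesis by (simp add: et_def)
 qed
 have "EX n ph x. br n (f n p) e ph & ph (f n p) = p & ph ` ball (f n p) e <= ball p et & x : X & f n p : ball x (e/16)"
  if p: "p : A" for p proof -
  have pL: "p : Lset e" using p by (simp add: A_def)
  obtain n ph where *: "br n (f n p) e ph" "ph (f n p) = p" "ph ` ball (f n p) e <= ball p et" by (rule LsetD[OF pL et])
  moreover have "f n p : J" using pL Lset_J by (intro f_in_J) blast
  then obtain x where "x : X" "f n p : ball x (e/16)" using X(3) by blast
  ultimately show ?thesis by blast
 qed
 then obtain n ph xx where br1: "!!p. p : A ==> br (n p) (f (n p) p) e (ph p)"
  and br2: "!!p. p : A ==> ph p (f (n p) p) = p" and br3: "!!p. p : A ==> ph p ` ball (f (n p) p) e <= ball p et"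
  and br4: "!!p. p : A ==> xx p : X" "!!p. p : A ==> f (n p) p : ball (xx p) (e/16)" by metis
 define r where "r p = norm (deriv (ph p) (f (n p) p))" for p
 define g where "g p = ph p o s (xx p)" for p
 have incl: "ball (xx p) (e/16) <= cball (f (n p) p) (e/4)" if p: "p : A" for p proof
  fix w assume "w : ball (xx p) (e/16)"
  thus "w : cball (f (n p) p) (e/4)"
   using br4(2)[OF p] dist_triangle[of "f (n p) p" w "xx p"] e by (simp add: dist_commute)
 qed
 have cbb: "cball (f (n p) p) (e/4) <= ball (f (n p) p) e" for p using e by auto
 have sin: "s (xx p) ` ball x0 rh0 <= cball (f (n p) p) (e/4)" if p: "p : A" for p
  using s2[OF br4(1)[OF p]] incl[OF p] by blast
 have gbr: "br (kk (xx p) + n p) x0 rh0 (g p)" if p: "p : A" for p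
  unfolding g_def by (rule br_comp[OF br1[OF p] s1[OF br4(1)[OF p]]]) (use sin[OF p] cbb in blast)
 have gball: "g p ` ball x0 rh0 <= ball p et" if p: "p : A" for p
  unfolding g_def image_comp[symmetric] using sin[OF p] cbb br3[OF p] by blast
 have rpos: "r p > 0" if p: "p : A" for p using br_regular[OF br1[OF p]] e by (simp add: r_def)
 define R where "R p = C * r p * (e/4)" for p
 have gcball: "g p ` ball x0 rh0 <= cball p (R p)" if p: "p : A" for p proof
  fix w assume "w : g p ` ball x0 rh0"
  then obtain u where u: "u : cball (f (n p) p) (e/4)" "w = ph p u" using sin[OF p] by (auto simp: g_def)
  have "dist (ph p (f (n p) p)) (ph p u) <= C * norm (deriv (ph p) (f (n p) p)) * dist (f (n p) p) u"
   using u e by (intro up[OF brD(1)[OF br1[OF p]] brD(4)[OF br1[OF p]]]) auto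
  also have "... <= C * r p * (e/4)" unfolding r_def using u C by (intro mult_left_mono) auto
  finally show "w : cball p (R p)" using u br2[OF p] by (simp add: R_def)
 qed
 define c where "c p = r p * si / C^2" for p
 have cpos: "c p > 0" if "p : A" for p using rpos[OF that] si C by (simp add: c_def)
 have glow: "c p * dist y z <= dist (g p y) (g p z)" if p: "p : A" and yz: "y : X0" "z : X0" for p y z proof -
  note x = br4(1)[OF p]
  have "norm (deriv (s (xx p)) x0) * dist y z <= C * dist (s (xx p) y) (s (xx p) z)"
   using yz rh0 by (intro low[OF brD(1)[OF s1[OF x]] brD(4)[OF s1[OF x]]]) (auto simp: X0_def)
  moreover have "si * dist y z <= norm (deriv (s (xx p)) x0) * dist y z" using si(2)[OF x] by (intro mult_right_mono) auto
  ultimately have a: "si * dist y z <= C * dist (s (xx p) y) (s (xx p) z)" by linarith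
  have b: "r p * dist (s (xx p) y) (s (xx p) z) <= C * dist (g p y) (g p z)" unfolding r_def g_def o_def
   by (rule low[OF brD(1)[OF br1[OF p]] brD(4)[OF br1[OF p]] e]) (use sin[OF p] yz X0b in blast)+
  have "r p * (si * dist y z) <= r p * (C * dist (s (xx p) y) (s (xx p) z))"
   using a rpos[OF p] by (intro mult_left_mono) auto
  also have "... = C * (r p * dist (s (xx p) y) (s (xx p) z))" by simp
  also have "... <= C * (C * dist (g p y) (g p z))" using b C by (intro mult_left_mono) auto
  finally show ?thesis using C by (simp add: c_def field_simps power2_eq_square)
 qed
 define q where "q = x0 + of_real (rh0/4)"
 have q: "q : X0" "dist x0 q = rh0/4" using rh0 by (simp_all add: q_def X0_def dist_norm)
 have x0X: "x0 : X0" using rh0 by (simp add: X0_def)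
 have gsmall: "dist (g p y) (g p z) < 2 * et" if "p : A" "y : ball x0 rh0" "z : ball x0 rh0" for p y z proof -
  have "g p y : ball p et" "g p z : ball p et" using gball that by blast+
  thus ?thesis using dist_triangle[of "g p y" "g p z" p] by (simp add: dist_commute)
 qed
 have csmall: "c p <= 8 * et / rh0" if p: "p : A" for p proof -
  have "c p * (rh0/4) <= dist (g p x0) (g p q)" using glow[OF p x0X q(1)] q(2) by simp
  also have "... <= 2 * et" using gsmall[OF p, of x0 q] X0b x0X q(1) rh0 by (simp add: less_imp_le subset_iff)
  finally show ?thesis using rh0 by (simp add: field_simps)
 qed
 have glip: "dist (g p y) (g p z) <= 1/2 * dist y z" if p: "p : A" and yz: "y : X0" "z : X0" for p y z proof -
  let ?D = "norm (deriv (g p) x0)"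
  note hg = brD(1)[OF gbr[OF p]] brD(4)[OF gbr[OF p]]
  have "?D * dist x0 q <= C * dist (g p x0) (g p q)" using x0X q by (intro low[OF hg rh0]) (auto simp: X0_def)
  also have "... <= C * (2 * et)"
   using gsmall[OF p, of x0 q] X0b x0X q(1) C by (intro mult_left_mono) (auto simp: less_imp_le subset_iff)
  finally have "?D * rh0 <= 8 * C * et" using q(2) by simp
  hence "C * ?D * rh0 <= 8 * C^2 * et"
   using mult_left_mono[of "?D * rh0" "8 * C * et" C] C by (simp add: power2_eq_square mult_ac)
  also have "... <= 8 * C^2 * (rh0 / (16 * C^2))" using C by (intro mult_left_mono) (auto simp: et_def)
  also have "... = rh0 / 2" using C by simp
  finally have "C * ?D <= 1/2" using rh0 by (simp add: field_simps)
  moreover have "dist (g p y) (g p z) <= C * ?D * dist y z" using yz by (intro up[OF hg rh0]) (auto simp: X0_def)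
  ultimately show ?thesis using mult_right_mono[of "C * ?D" "1/2" "dist y z"] by simp
 qed
 have gin8: "g p ` ball x0 rh0 <= ball x0 (rh0/8)" if p: "p : A" for p proof -
  have "ball p et <= ball x0 (rh0/8)" using p et1 by (simp add: A_def ball_subset_ball_iff dist_commute)
  thus ?thesis using gball[OF p] by blast
 qed
 have gX0: "g p ` X0 <= X0" if p: "p : A" for p proof -
  have "ball x0 (rh0/8) <= X0" using rh0 by (auto simp: X0_def)
  thus ?thesis using gin8[OF p] X0b by blast
 qed
 have Rpos: "0 < R p" if "p : A" for p using C rpos[OF that] e by (simp add: R_def)
 have Rle: "10 * R p <= d" if p: "p : A" for p proof -
  have "r p = c p * C^2 / si" using si C by (simp add: c_def)
  also have "... <= (8 * et / rh0) * C^2 / si" using csmall[OF p] si C by (intro divide_right_mono mult_right_mono) auto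
  finally have "r p <= (8 * et / rh0) * C^2 / si" .
  hence "10 * R p <= 10 * (C * ((8 * et / rh0) * C^2 / si) * (e/4))"
   unfolding R_def using C e by (intro mult_left_mono mult_right_mono) auto
  also have "... = 20 * C^3 * e / (rh0 * si) * et" by (simp add: power2_eq_square power3_eq_cube)
  also have "... <= 20 * C^3 * e / (rh0 * si) * (d * si * rh0 / (20 * C^3 * e))"
   using C e rh0 si by (intro mult_left_mono) (auto simp: et_def)
  also have "... = d" using C e rh0 si by (simp add: field_simps)
  finally show ?thesis .
 qed
 have cov: "A <= (UN p:A. cball p (R p))" using Rpos by force
 have Rb: "0 < R p & 10 * R p <= d" if "p : A" for p using Rpos[OF that] Rle[OF that] by simp
 obtain F where F: "finite F" "F <= A" "!!i j. i : F ==> j : F ==> i ~= j ==> cball i (R i) Int cball j (R j) = {}"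
  "M < (SUM i:F. 10 * R i)" by (rule vitali_finite_subfamily[OF d(1) less_imp_le[OF M] d(2) cov Rb]) (assumption | rule that)+
 note FA = F(2)
 have "M < (SUM i:F. 10 * R i)" by (rule F(4))
 also have "(SUM i:F. 10 * R i) = M * (SUM i:F. c i)" proof -
  have "10 * R i = M * c i" for i using C e si by (simp add: R_def M_def c_def field_simps power2_eq_square power3_eq_cube)
  thus ?thesis by (simp add: sum_distrib_left)
 qed
 finally have sum1: "1 < (SUM i:F. c i)" using M by simp
 have c14: "c p <= 1/2" if "p : A" for p proof -
  have "8 * et / rh0 <= 1/2" using et1 rh0(1) by (simp add: field_simps)
  thus ?thesis using csmall[OF that] by linarith
 qed
 have card2: "2 <= card F" proof (rule ccontr)
  assume "~ 2 <= card F"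
  hence "(SUM i:F. c i) <= real (card F) * (1/2)" "real (card F) <= 1"
   using sum_bounded_above[of F c "1/2"] c14 FA by (auto simp: subset_iff)
  thus False using sum1 by linarith
 qed
 obtain t where t: "1 < t" "1 <= (SUM i:F. c i powr t)" using sum_powr_gt_1[OF F(1) _ sum1] cpos FA by blast
 define La where "La = (INT n. ifs_level g F X0 n)"
 have pos: "hm UNIV t La ~= 0" unfolding La_def proof (rule ifs_attractor_positive_measure[where c = c])
  show "continuous_on X0 (g i)" if "i : F" for i
   using brD(1)[OF gbr[of i]] FA that X0b by (meson continuous_on_subset hol_cont subsetD)
  show "g i ` X0 Int g j ` X0 = {}" if ij: "i : F" "j : F" "i ~= j" for i j proof -
   note F(3)[OF ij]
   moreover have "g i ` X0 <= cball i (R i)" "g j ` X0 <= cball j (R j)"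
    using gcball[of i] gcball[of j] X0b FA ij(1,2) by blast+
   ultimately show ?thesis by blast
  qed
  show "compact X0" "X0 ~= {}" using x0X by (auto simp: X0_def)
  show "g i ` X0 <= X0" if "i : F" for i using gX0 FA that by blast
  show "0 < c i" if "i : F" for i using cpos FA that by blast
  show "c i * dist x y <= dist (g i x) (g i y)" if "i : F" "x : X0" "y : X0" for i x y
   using glow[OF _ that(2,3)] FA that(1) by blast
 qed (use F card2 t in auto)
 \<comment> \<open>A point of level k + 1 is ps y, with ps composed of k contractions and y in a
   first-level piece. As y is within rh0/8 of x0, the disc of radius rh0/8 about y lies in X0, and
   ps is a branch on it.\<close>
 have lev: "EX N ps y. y : (UN i:F. g i ` X0) & br N x0 rh0 ps & ps y = z & ps ` X0 <= X0 & ps ` ball x0 rh0 <= ball x0 rh0 &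
   (ALL u:X0. ALL v:X0. dist (ps u) (ps v) <= (1/2)^k * dist u v)" if z: "z : ifs_level g F X0 (Suc k)" for k z
  using z proof (induction k arbitrary: z)
  case 0
  thus ?case by (intro exI[of _ 0] exI[of _ "%x. x"] exI[of _ z]) (auto simp: br_def)
 next
  case (Suc k)
  then obtain i z' where i: "i : F" "z' : ifs_level g F X0 (Suc k)" "z = g i z'" by (auto simp del: ifs_level.simps(2) simp: ifs_level.simps(2)[of g F X0 "Suc k"])
  have iA: "i : A" using i FA by blast
  obtain N ps y where N: "y : (UN i:F. g i ` X0)" "br N x0 rh0 ps" "ps y = z'" "ps ` X0 <= X0" "ps ` ball x0 rh0 <= ball x0 rh0"
   "ALL u:X0. ALL v:X0. dist (ps u) (ps v) <= (1/2)^k * dist u v" using Suc.IH[OF i(2)] by (elim exE conjE)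
  have b: "br (N + (kk (xx i) + n i)) x0 rh0 (g i o ps)" by (rule br_comp[OF gbr[OF iA] N(2,5)])
  have gib: "g i ` ball x0 rh0 <= ball x0 rh0" using gin8[OF iA] rh0(1) by fastforce
  have "(g i o ps) y = z" using N(3) i(3) by simp
  moreover have "(g i o ps) ` X0 <= X0" unfolding image_comp[symmetric] using N(4) gX0[OF iA] by blast
  moreover have "(g i o ps) ` ball x0 rh0 <= ball x0 rh0" unfolding image_comp[symmetric] using N(5) gib by blast
  moreover have "dist ((g i o ps) u) ((g i o ps) v) <= (1/2)^Suc k * dist u v" if uv: "u : X0" "v : X0" for u v proof -
   have "ps u : X0" "ps v : X0" using N(4) uv by blast+
   hence "dist (g i (ps u)) (g i (ps v)) <= 1/2 * dist (ps u) (ps v)" by (rule glip[OF iA])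
   also have "... <= 1/2 * ((1/2)^k * dist u v)" using N(6) uv by (intro mult_left_mono) auto
   finally show ?thesis by simp
  qed
  ultimately show ?case using N(1) b by blast
 qed
 have "La <= Lset (rh0/8)" proof
  fix z assume z: "z : La"
  have ex: "(EX N ph. br N (f N z) (rh0/8) ph & ph (f N z) = z & ph ` ball (f N z) (rh0/8) <= ball z ep) &
    (EX w:J. dist w z < ep)" if ep: "ep > 0" for ep proof -
   obtain k where "(1/2::real)^k < ep / (rh0/2)" using real_arch_pow_inv[of "ep / (rh0/2)" "1/2"] ep rh0 by auto
   hence k: "(1/2)^k * (rh0/2) < ep" using rh0 by (simp add: field_simps)
   have "z : ifs_level g F X0 (Suc k)" using z unfolding La_def by blast
   then obtain N ps y where N: "y : (UN i:F. g i ` X0)" "br N x0 rh0 ps" "ps y = z"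
    "!!u v. u : X0 ==> v : X0 ==> dist (ps u) (ps v) <= (1/2)^k * dist u v" using lev by metis
   obtain i where i: "i : F" "y : g i ` X0" using N(1) by blast
   have iA: "i : A" using FA i(1) by blast
   have y: "y : ball x0 (rh0/8)" using i(2) gin8[OF iA] X0b by blast
   have sub: "ball y (rh0/8) <= X0" proof
    fix w assume "w : ball y (rh0/8)"
    thus "w : X0" using y dist_triangle[of x0 w y] by (simp add: X0_def)
   qed
   have yX: "y : X0" using y rh0 by (simp add: X0_def)
   have near: "dist z (ps w) < ep" if w: "w : X0" for w proof -
    have "dist (ps y) (ps w) <= (1/2)^k * dist y w" by (rule N(4)[OF yX w])
    also have "... <= (1/2)^k * (rh0/2)"
     using yX w dist_triangle[of y w x0] by (intro mult_left_mono) (auto simp: X0_def dist_commute)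
    finally show ?thesis using k N(3) by simp
   qed
   have "f N z = y" using brD(3)[OF N(2), of y] N(3) yX X0b by auto
   moreover have "br N y (rh0/8) ps" by (rule br_subset[OF N(2)]) (use sub X0b in blast)
   moreover have "ps ` ball y (rh0/8) <= ball z ep" using near sub by auto
   moreover have "ps x0 : J" using brD(5)[OF N(2), of x0] x0(1) rh0 by simp
   moreover have "dist (ps x0) z < ep" using near[OF x0X] by (simp add: dist_commute)
   ultimately show ?thesis using N(3) by blast
  qed
  hence "z : closure J" by (simp add: closure_approachable)
  hence "z : J" using closed_J by simp
  thus "z : Lset (rh0/8)" using ex unfolding Lset_def by blast
 qed
 hence "hm UNIV t La <= hm UNIV t (Lset (rh0/8))" by (rule hm_mono)
 thus False using null[of t "rh0/8"] t(1) rh0(1) pos by simp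
qed

text \<open>Zero-one law: points radial only at a smaller scale form a porous set relative to the set
 of points radial at scale e0.\<close>

lemma Lset_scale_independent: assumes e0: "0 < e0" "0 < HM1 (Lset e0)" "HM1 (Lset e0) < top" and e': "0 < e'"
 shows "HM1 (Lset e' - Lset (e0/2)) = 0"
proof -
 define E where "E = Lset e0"
 obtain C where "distortion C" using univalent_distortion by blast
 then interpret distortion C .
 have dens: "0 < HM1 (E Int ball x r)" if "x : J" "0 < r" for x r
  using backward_closed_measure_transport(1)[OF Lset_J[of e0] _ that] Lset_backward e0(2) by (metis E_def not_gr_zero)
 obtain X where X: "finite X" "X <= J" "J <= (UN x:X. ball x (e'/16))"
  using finite_net[OF compact_J, of "e'/16"] e' by auto
 have "EX a m s. a : E & br m (f m a) e0 s & s (f m a) = a & s ` ball (f m a) e0 <= ball x (e'/16)" if x: "x : X" for x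
 proof -
  have "0 < HM1 (E Int ball x (e'/32))" using dens x X(2) e' by auto
  hence "E Int ball x (e'/32) ~= {}" by auto
  then obtain a where a: "a : E" "a : ball x (e'/32)" by blast
  have "0 < e'/32" using e' by simp
  then obtain m s where s: "br m (f m a) e0 s" "s (f m a) = a" "s ` ball (f m a) e0 <= ball a (e'/32)"
   using LsetD[of a e0 "e'/32"] a(1) unfolding E_def by metis
  have "ball a (e'/32) <= ball x (e'/16)" using a(2) by (simp add: ball_subset_ball_iff dist_commute)
  thus ?thesis using s a(1) by blast
 qed
 then obtain a m s where sX: "!!x. x : X ==> a x : E" "!!x. x : X ==> br (m x) (f (m x) (a x)) e0 (s x)"
  "!!x. x : X ==> s x (f (m x) (a x)) = a x" "!!x. x : X ==> s x ` ball (f (m x) (a x)) e0 <= ball x (e'/16)" by metis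
 define u where "u x = f (m x) (a x)" for x
 have EJ: "E <= J" unfolding E_def by (rule Lset_J)
 have uJ: "u x : J" if "x : X" for x using sX(1)[OF that] EJ unfolding u_def by (intro f_in_J) blast
 have sbr: "br (m x) (u x) e0 (s x)" if "x : X" for x using sX(2)[OF that] by (simp add: u_def)
 have sin: "s x ` ball (u x) e0 <= ball x (e'/16)" if "x : X" for x using sX(4)[OF that] by (simp add: u_def)
 have "norm (deriv (s x) (u x)) > 0" if "x : X" for x using br_regular[OF sbr[OF that]] e0(1) by simp
 then obtain si where si: "si > 0" "!!x. x : X ==> si <= norm (deriv (s x) (u x))"
  using finite_pos_lower_bound[OF X(1), of "%x. norm (deriv (s x) (u x))"] by metis
 \<comment> \<open>With this choice the branch ps below sends the disc of radius ta * e0 about u x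
   into the half-size hole: C * D * ta * e0 <= r/2.\<close>
 define ta where "ta = 1 / (4 * C^2)"
 have C2: "1 <= C^2" using C by simp
 have ta: "0 < ta" "ta <= 1/4" using C2 C unfolding ta_def by (auto simp: field_simps)
 have "EX b>0. ennreal b <= HM1 (E Int cball (u x) (ta * e0))" if x: "x : X" for x proof -
  have "0 < HM1 (E Int ball (u x) (ta * e0))" using dens[OF uJ[OF x]] ta(1) e0(1) by simp
  also have "... <= HM1 (E Int cball (u x) (ta * e0))" by (rule hm_mono) auto
  finally obtain b where "0 < b" "b < HM1 (E Int cball (u x) (ta * e0))" using dense by blast
  thus ?thesis by (cases b) (auto intro!: exI[of _ "enn2real b"] simp: less_top)
 qed
 then obtain b where b: "!!x. x : X ==> b x > 0" "!!x. x : X ==> ennreal (b x) <= HM1 (E Int cball (u x) (ta * e0))"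
  by metis
 obtain be where be: "be > 0" "!!x. x : X ==> be <= b x" using finite_pos_lower_bound[OF X(1), of b] b(1) by metis
 \<comment> \<open>The points at which branches on discs of radius e0/2 fail to land within et; for
   some et every point of the difference is of this kind.\<close>
 define A where "A et = {p:Lset e'. ALL n ph. br n (f n p) (e0/2) ph --> ph (f n p) = p --> ~ ph ` ball (f n p) (e0/2) <= ball p et}" for et
 have Anull: "HM1 (A et) = 0" if et: "0 < et" for et
 proof (rule hm_porous_null[where E = E and c = "be / e0" and K = "C^5 * e' / (8 * e0 * si)"])
  show "HM1 E < top" using e0 by (simp add: E_def)
  show "0 < be / e0" using be e0 by simp
  show "0 <= C^5 * e' / (8 * e0 * si)" using C e' e0 si by simp
  fix p and rh :: real assume p: "p : A et" and rh: "0 < rh"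
  define et' where "et' = min (et/2) (rh/2)"
  have et': "0 < et'" "2 * et' <= et" "et' < rh" using et rh by (auto simp: et'_def)
  have pL: "p : Lset e'" using p by (simp add: A_def)
  obtain n ph where ph: "br n (f n p) e' ph" "ph (f n p) = p" "ph ` ball (f n p) e' <= ball p et'"
   by (rule LsetD[OF pL et'(1)])
  define y where "y = f n p"
  have "y : J" using pL Lset_J unfolding y_def by (intro f_in_J) blast
  then obtain x where x: "x : X" "y : ball x (e'/16)" using X(3) by blast
  have incl: "ball x (e'/16) <= cball y (e'/8)" proof
   fix w assume "w : ball x (e'/16)"
   thus "w : cball y (e'/8)" using x(2) dist_triangle[of y w x] by (simp add: dist_commute)
  qed
  have cb: "cball y (e'/8) <= cball y (e'/4)" "cball y (e'/4) <= ball y e'" using e' by auto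
  define ps where "ps = ph o s x"
  note phy = ph(1)[folded y_def]
  have ps: "br (m x + n) (u x) e0 ps"
   unfolding ps_def by (rule br_comp[OF phy sbr[OF x(1)]]) (use sin[OF x(1)] incl cb in blast)
  have psim: "ps ` ball (u x) e0 <= ball p et'"
   unfolding ps_def image_comp[symmetric] using sin[OF x(1)] incl cb ph(3)[folded y_def] by blast
  define D where "D = norm (deriv ps (u x))"
  have D: "D > 0" using br_regular[OF ps] e0(1) by (simp add: D_def)
  define p' where "p' = ps (u x)"
  \<comment> \<open>The radius of a disc that the image of ps is known to contain, by
    \<open>im\<close>; this disc is the hole.\<close>
  define r where "r = D * e0 / C"
  have r: "0 < r" using D e0 C by (simp add: r_def)
  have rim: "ball p' r <= ps ` ball (u x) (e0/4)" unfolding p'_def r_def D_def by (rule im[OF brD(1,4)[OF ps] e0(1)])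
  have bb: "ball (u x) (e0/4) <= ball (u x) e0" using e0 by auto
  have "ball p' r <= ball p et'" using rim bb psim by blast
  hence "r < rh" using r et'(3) by (simp add: ball_subset_ball_iff) (smt (verit) zero_le_dist)
  \<comment> \<open>The derivative of ph at y bounds the distance from p to p' and is itself bounded
    by D, hence by r, up to constants that do not depend on p.\<close>
  moreover have "dist p p' <= C^5 * e' / (8 * e0 * si) * r" proof -
   define v where "v = u x + of_real (e0/4)"
   have v: "v : cball (u x) (e0/4)" "dist (u x) v = e0/4" using e0(1) by (simp_all add: v_def dist_norm)
   have uv: "u x : ball (u x) e0" "v : ball (u x) e0" "u x : cball (u x) (e0/4)" using v e0(1) by auto
   have "norm (deriv (s x) (u x)) * dist (u x) v <= C * dist (s x (u x)) (s x v)"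
    by (rule low[OF brD(1)[OF sbr[OF x(1)]] brD(4)[OF sbr[OF x(1)]] e0(1) uv(3) v(1)])
   moreover have "si * (e0/4) <= norm (deriv (s x) (u x)) * dist (u x) v"
    unfolding v(2) using si(2)[OF x(1)] e0(1) by (intro mult_right_mono) auto
   ultimately have s1: "si * (e0/4) <= C * dist (s x (u x)) (s x v)" by linarith
   have sxin: "s x (u x) : cball y (e'/4)" "s x v : cball y (e'/4)" "s x (u x) : cball y (e'/8)"
    using sin[OF x(1)] incl cb uv by blast+
   have s2: "norm (deriv ph y) * dist (s x (u x)) (s x v) <= C * dist (ps (u x)) (ps v)"
    unfolding ps_def o_def by (rule low[OF brD(1)[OF phy] brD(4)[OF phy] e' sxin(1,2)])
   have s3: "dist (ps (u x)) (ps v) <= C * D * (e0/4)"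
    using up[OF brD(1)[OF ps] brD(4)[OF ps] e0(1) uv(3) v(1)] v(2) by (simp add: D_def)
   have "norm (deriv ph y) * (si * (e0/4)) <= norm (deriv ph y) * (C * dist (s x (u x)) (s x v))"
    using s1 by (intro mult_left_mono) auto
   also have "... = C * (norm (deriv ph y) * dist (s x (u x)) (s x v))" by simp
   also have "... <= C * (C * dist (ps (u x)) (ps v))" using s2 C by (intro mult_left_mono) auto
   also have "... <= C * (C * (C * D * (e0/4)))" using s3 C by (intro mult_left_mono) auto
   finally have dphi: "norm (deriv ph y) * si <= C^3 * D" using e0(1) by (simp add: power3_eq_cube field_simps)
   have "dist (ph y) (ph (s x (u x))) <= C * norm (deriv ph y) * dist y (s x (u x))"
    using sxin e' by (intro up[OF brD(1)[OF phy] brD(4)[OF phy] e']) auto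
   also have "... <= C * norm (deriv ph y) * (e'/8)" using sxin C by (intro mult_left_mono) auto
   also have "... <= C * (C^3 * D / si) * (e'/8)"
    using dphi si(1) C e' by (intro mult_right_mono mult_left_mono) (auto simp: field_simps)
   also have "... = C^5 * e' / (8 * e0 * si) * r"
    using C e0 si by (simp add: r_def field_simps power_numeral_reduce power_Suc)
   finally show ?thesis using ph(2) by (simp add: y_def p'_def ps_def)
  qed
  \<comment> \<open>A point q of the hole is ps w, and ps on the disc of radius e0/2 about w is a
    branch at q whose image is within et of q.\<close>
  moreover have "A et Int ball p' r = {}" proof (rule ccontr)
   assume "A et Int ball p' r ~= {}"
   then obtain q where q: "q : A et" "q : ball p' r" by blast
   obtain w where w: "w : ball (u x) (e0/4)" "q = ps w" using q(2) rim by blast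
   have wb: "w : ball (u x) e0" using w(1) bb by blast
   have fq: "f (m x + n) q = w" using brD(3)[OF ps wb] w(2) by simp
   have sub: "ball w (e0/2) <= ball (u x) e0" using w(1) e0(1) by (simp add: ball_subset_ball_iff dist_commute)
   have "br (m x + n) (f (m x + n) q) (e0/2) ps" unfolding fq by (rule br_subset[OF ps sub])
   moreover have "ps (f (m x + n) q) = q" using fq w(2) by simp
   moreover have "ps ` ball (f (m x + n) q) (e0/2) <= ball q et" proof (rule image_subsetI)
    fix t assume "t : ball (f (m x + n) q) (e0/2)"
    hence "ps t : ball p et'" using sub psim unfolding fq by blast
    moreover have "q : ball p et'" using wb w(2) psim by blast
    ultimately show "ps t : ball q et" using et'(2) dist_triangle[of q "ps t" p] by (simp add: dist_commute)
   qed
   ultimately show False using q(1) unfolding A_def by blast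
  qed
  moreover have "ennreal (be / e0 * r) <= HM1 (E Int cball p' (r/2))" proof -
   let ?S = "E Int cball (u x) (ta * e0)"
   have te: "ta * e0 <= e0/4" using ta(2) e0(1) by simp
   have S4: "?S <= cball (u x) (e0/4)" "?S <= ball (u x) e0"
    by (intro subsetI; use te e0(1) in \<open>simp only: Int_iff mem_cball mem_ball, linarith\<close>)+
   have "HM1 ?S <= ennreal ((C / D) powr 1) * HM1 (ps ` ?S)" proof -
    define inv where "inv = the_inv_into (ball (u x) e0) ps"
    have inv: "inv (ps w) = w" if "w : ?S" for w
     unfolding inv_def using brD(4)[OF ps] S4 that by (intro the_inv_into_f_f) auto
    have "HM1 (inv ` (ps ` ?S)) <= ennreal ((C / D) powr 1) * HM1 (ps ` ?S)" proof (rule hm_lipschitz)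
     fix a b assume "a : ps ` ?S" "b : ps ` ?S"
     then obtain a' b' where ab: "a' : ?S" "b' : ?S" "a = ps a'" "b = ps b'" by blast
     have "D * dist a' b' <= C * dist (ps a') (ps b')"
      unfolding D_def by (rule low[OF brD(1,4)[OF ps] e0(1)]) (use ab S4 in blast)+
     thus "dist (inv a) (inv b) <= C / D * dist a b" using D inv[OF ab(1)] inv[OF ab(2)] ab by (simp add: field_simps)
    qed (use C D in auto)
    moreover have "inv ` (ps ` ?S) = ?S" using inv by (force simp: image_image)
    ultimately show ?thesis by simp
   qed
   hence "ennreal (D / C) * HM1 ?S <= ennreal (D / C) * (ennreal (C / D) * HM1 (ps ` ?S))"
    using C D by (intro mult_left_mono) auto
   also have "... = HM1 (ps ` ?S)" using C D by (simp add: mult.assoc[symmetric] ennreal_mult[symmetric])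
   also have "... <= HM1 (E Int cball p' (r/2))" proof (rule hm_mono, rule image_subsetI)
    fix w assume w: "w : ?S"
    have "dist (ps (u x)) (ps w) <= C * D * dist (u x) w"
     unfolding D_def by (rule up[OF brD(1,4)[OF ps] e0(1)]) (use w S4 e0(1) in auto)
    also have "... <= C * D * (ta * e0)" using w C D by (intro mult_left_mono) auto
    also have "... <= r/2" using C D e0(1) by (simp add: ta_def r_def field_simps power2_eq_square)
    finally have "ps w : cball p' (r/2)" by (simp add: p'_def)
    moreover have "ps w : E" using Lset_br[OF ps] w S4 unfolding E_def by blast
    ultimately show "ps w : E Int cball p' (r/2)" by blast
   qed
   finally have "ennreal (D / C) * HM1 ?S <= HM1 (E Int cball p' (r/2))" .
   moreover have "ennreal (be / e0 * r) <= ennreal (D / C) * HM1 ?S" proof -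
    have "be / e0 * r = D / C * be" using C e0 by (simp add: r_def)
    hence "ennreal (be / e0 * r) = ennreal (D / C) * ennreal be" using C D be(1) by (simp add: ennreal_mult[symmetric])
    also have "... <= ennreal (D / C) * HM1 ?S"
     by (rule mult_left_mono[OF order_trans[OF ennreal_leI[OF be(2)[OF x(1)]] b(2)[OF x(1)]]]) simp
    finally show ?thesis .
   qed
   ultimately show ?thesis by (rule order_trans[rotated])
  qed
  ultimately show "EX p' r. 0 < r & r < rh & dist p p' <= C^5 * e' / (8 * e0 * si) * r &
    A et Int ball p' r = {} & ennreal (be / e0 * r) <= HM1 (E Int cball p' (r/2))" using r by blast
 qed
 have "Lset e' - Lset (e0/2) <= (UN k::nat. A (1 / real (Suc k)))" proof
  fix p assume p: "p : Lset e' - Lset (e0/2)"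
  hence "p : J" using Lset_J by blast
  then obtain et where et: "et > 0" "!!n ph. br n (f n p) (e0/2) ph ==> ph (f n p) = p ==> ~ ph ` ball (f n p) (e0/2) <= ball p et"
   using p unfolding Lset_def by blast
  obtain k where k: "1 / real (Suc k) < et" using et(1) nat_approx_posE by metis
  hence "ball p (1 / real (Suc k)) <= ball p et" by auto
  hence "p : A (1 / real (Suc k))" using p et(2) unfolding A_def by blast
  thus "p : (UN k::nat. A (1 / real (Suc k)))" by blast
 qed
 hence "HM1 (Lset e' - Lset (e0/2)) <= HM1 (UN k::nat. A (1 / real (Suc k)))" by (rule hm_mono)
 also have "... = 0" by (intro hm_null_UN Anull) simp
 finally show ?thesis by simp
qed

text \<open>Some scale carries positive length, since J is the union of all scales up to a null set.
  Every other scale adds only a null set, so half that scale, of finite length, already exhausts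
  almost all of J.\<close>

lemma J_finite_length: assumes null: "!!s e'. 1 < s ==> 0 < e' ==> hm UNIV s (Lset e') = 0"
  and full: "HM1 (J - (UN k. Lset (1 / real (Suc k)))) = 0" and pos: "0 < HM1 J"
 obtains e where "0 < e" "HM1 (J - Lset e) = 0" "HM1 J < top" proof -
 have "EX k. HM1 (Lset (1 / real (Suc k))) ~= 0" proof (rule ccontr)
  assume "~ ?thesis"
  hence "HM1 (UN k. Lset (1 / real (Suc k))) = 0" by (intro hm_null_UN) auto
  moreover have "HM1 J <= HM1 ((UN k. Lset (1 / real (Suc k))) Un (J - (UN k. Lset (1 / real (Suc k)))))"
   by (rule hm_mono) auto
  hence "HM1 J <= HM1 (UN k. Lset (1 / real (Suc k))) + HM1 (J - (UN k. Lset (1 / real (Suc k))))"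
   using hm_Un by (rule order_trans)
  ultimately show False using full pos by simp
 qed
 then obtain k where k: "HM1 (Lset (1 / real (Suc k))) ~= 0" by blast
 define e0 where "e0 = 1 / real (Suc k)"
 have e0: "0 < e0" "0 < HM1 (Lset e0)" using k by (auto simp: e0_def zero_less_iff_neq_zero)
 have fin: "HM1 (Lset e) < top" if "0 < e" for e by (rule Lset_finite_measure[OF that null])
 have sub: "J - Lset (e0/2) <= (J - (UN k. Lset (1 / real (Suc k)))) Un (UN k. Lset (1 / real (Suc k)) - Lset (e0/2))"
  by blast
 have "HM1 (UN k. Lset (1 / real (Suc k)) - Lset (e0/2)) = 0" by (intro hm_null_UN Lset_scale_independent e0 fin) auto
 hence z: "HM1 (J - Lset (e0/2)) = 0" using order_trans[OF hm_mono[OF sub, of UNIV 1] hm_Un] full by simp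
 have "HM1 J <= HM1 (Lset (e0/2) Un (J - Lset (e0/2)))" by (rule hm_mono) auto
 also have "... <= HM1 (Lset (e0/2)) + HM1 (J - Lset (e0/2))" by (rule hm_Un)
 also have "... < top" using z fin[of "e0/2"] e0 by simp
 finally show thesis using that[of "e0/2"] z e0 by simp
qed

end

section \<open>Small pieces spread over the whole Julia set\<close>

lemma finite_separation: fixes S :: "'a::metric_space set" assumes "finite S"
 obtains d where "0 < d" "!!x y. x : S ==> y : S ==> x ~= y ==> d <= dist x y" proof -
 have "finite {p : S \<times> S. fst p ~= snd p}" using assms by auto
 then obtain d where "0 < d" "!!p. p : {p : S \<times> S. fst p ~= snd p} ==> d <= dist (fst p) (snd p)"
  by (rule finite_pos_lower_bound[where g = "%p. dist (fst p) (snd p)"]) auto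
 thus thesis using that[of d] by force
qed

context julia_plane
begin

text \<open>A radial point off the postcritical set has an inverse branch mapping a disc around it well
 inside itself; hence the images of the Julia set in that disc increase to everything.\<close>

lemma radial_leo: assumes x0: "x0 : Lset e" "x0 ~: postcrit" and e: "0 < e" and rh0: "0 < rh0"
 obtains n0 where "!!n. n0 <= n ==> J <= f n ` (J Int ball x0 rh0)" proof -
 have x0J: "x0 : J" using x0(1) Lset_J by blast
 have e2: "0 < e/2" using e by simp
 obtain X where X: "finite X" "X <= J" "J <= (UN x:X. ball x (e/2))" by (rule finite_net[OF compact_J e2])
 obtain rh1 k s where s: "0 < rh1" "!!x. x : X ==> br (k x) x0 rh1 (s x)" "!!x. x : X ==> s x ` ball x0 rh1 <= ball x (e/2)"
  by (rule branch_net[OF x0J x0(2) X(1,2) e2]) blast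
 define rh where "rh = min rh0 rh1"
 have rh: "0 < rh" "ball x0 rh <= ball x0 rh0" "ball x0 rh <= ball x0 rh1" using rh0 s(1) by (auto simp: rh_def)
 have rh2: "0 < rh/2" using rh(1) by simp
 obtain n ph where ph: "br n (f n x0) e ph" "ph (f n x0) = x0" "ph ` ball (f n x0) e <= ball x0 (rh/2)"
  by (rule LsetD[OF x0(1) rh2])
 obtain x where x: "x : X" "f n x0 : ball x (e/2)" using X(3) f_in_J[OF x0J] by blast
 have "ball x (e/2) <= ball (f n x0) e" using x(2) by (simp add: ball_subset_ball_iff dist_commute)
 hence sb: "s x ` ball x0 rh <= ball (f n x0) e" using s(3)[OF x(1)] rh(3) by blast
 define N g where "N = k x + n" and "g = ph o s x"
 have g: "br N x0 rh g" unfolding N_def g_def by (rule br_comp[OF ph(1) br_subset[OF s(2)[OF x(1)] rh(3)] sb])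
 have gb: "g ` ball x0 rh <= ball x0 (rh/2)" unfolding g_def image_comp[symmetric] using sb ph(3) by blast
 \<comment> \<open>A branch of order 0 is the identity, which does not map the disc into the disc of
   half the radius.\<close>
 have N: "1 <= N" proof (rule ccontr)
  assume "~ 1 <= N"
  hence "g y = y" if "y : ball x0 rh" for y using brD(3)[OF g that] by (simp add: not_le)
  hence "ball x0 rh <= ball x0 (rh/2)" using gb by force
  thus False using rh(1) by (simp add: ball_subset_ball_iff)
 qed
 let ?B = "J Int ball x0 rh"
 \<comment> \<open>g maps ?B into itself and f N undoes g, so the images of ?B under f (N * i)
   increase with i.\<close>
 have step: "?B <= f N ` ?B" proof
  fix y assume y: "y : ?B"
  have "ball x0 (rh/2) <= ball x0 rh" using rh(1) by auto
  hence "g y : ?B" using y brD(5)[OF g, of y] gb by blast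
  moreover have "y = f N (g y)" using y brD(3)[OF g, of y] by simp
  ultimately show "y : f N ` ?B" by blast
 qed
 have fa: "f (i + j) ` ?B = f i ` f j ` ?B" for i j unfolding image_image by (intro image_cong refl f_add J_dm) simp
 have inc: "?B <= f (N * i) ` ?B" for i proof (induction i)
  case (Suc i)
  have "?B <= f (N * i) ` f N ` ?B" using Suc step by blast
  thus ?case using fa[of "N * i" N] by (simp add: add.commute)
 qed (auto simp: image_iff)
 have mono: "f (N * j) ` ?B <= f (N * m) ` ?B" if "j <= m" for j m proof -
  have "f (N * j) ` ?B <= f (N * j) ` f (N * (m - j)) ` ?B" using inc by (rule image_mono)
  also have "... = f (N * m) ` ?B" using that unfolding fa[symmetric] by (simp add: add_mult_distrib2[symmetric])
  finally show ?thesis .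
 qed
 obtain m where m: "J <= (UN j<=m. f (N * j) ` ?B)" by (rule expand[OF N x0J rh(1)])
 hence Jm: "J <= f (N * m) ` ?B" using mono by (meson UN_least atMost_iff order_trans)
 show thesis proof (rule that[of "N * m"])
  fix n assume n: "N * m <= n"
  show "J <= f n ` (J Int ball x0 rh0)" proof
   fix a assume "a : J"
   then obtain z where z: "z : J" "f (n - N * m) z = a" using J_surj by metis
   then obtain q where q: "q : ?B" "z = f (N * m) q" using Jm by blast
   have "f (n - N * m + N * m) q = a" using q z by (subst f_add) (auto simp: J_dm)
   hence "f n q = a" using n by simp
   thus "a : f n ` (J Int ball x0 rh0)" using q rh(2) by blast
  qed
 qed
qed

end

locale rigid_plane = julia_plane + fixes e0 :: real
 assumes e0: "0 < e0" and rad_full: "HM1 (J - Lset e0) = 0" and J_pos: "0 < HM1 J" and J_fin: "HM1 J < top"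
begin

lemma Lset_pos: "0 < HM1 (Lset e0)"
proof -
 have "HM1 J <= HM1 (Lset e0 Un (J - Lset e0))" by (rule hm_mono) auto
 also have "... <= HM1 (Lset e0) + HM1 (J - Lset e0)" by (rule hm_Un)
 finally show ?thesis using rad_full J_pos by simp
qed

lemma radial_uncountable: assumes "x : J" "0 < r" shows "uncountable ((Lset e0 - postcrit) Int ball x r)"
proof
 assume c: "countable ((Lset e0 - postcrit) Int ball x r)"
 have "0 < HM1 (Lset e0 Int ball x r)"
  using backward_closed_measure_transport(1)[OF Lset_J[of e0] _ assms] Lset_backward Lset_pos by (metis not_gr_zero)
 moreover have "Lset e0 Int ball x r <= (Lset e0 - postcrit) Int ball x r Un postcrit" by blast
 hence "countable (Lset e0 Int ball x r)" using c countable_postcrit by (meson countable_Un countable_subset)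
 hence "HM1 (Lset e0 Int ball x r) = 0" by (rule hm_countable_null) auto
 ultimately show False by simp
qed

lemma leo: assumes "x : J" "0 < r" obtains n0 where "!!n. n0 <= n ==> J <= f n ` (J Int ball x r)"
proof -
 have "(Lset e0 - postcrit) Int ball x r ~= {}" using radial_uncountable[OF assms] by (metis countable_empty)
 then obtain y where y: "y : Lset e0" "y ~: postcrit" "y : ball x r" by blast
 obtain d where d: "d > 0" "ball y d <= ball x r" using y(3) by (metis open_ball open_contains_ball)
 obtain n0 where "!!n. n0 <= n ==> J <= f n ` (J Int ball y d)" using radial_leo[OF y(1,2) e0 d(1)] by blast
 thus thesis using d(2) that[of n0] by blast
qed

text \<open>Disjoint small discs are placed about L points of J. For large n each part of J in such
  a disc is mapped onto J by f n, so each contains a preimage of a.\<close>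

lemma many_preimages: assumes "x : J" "0 < r"
 obtains n0 where "!!n a. n0 <= n ==> a : J ==> EX X. finite X & card X = L & X <= {q:J Int ball x r. f n q = a}"
proof -
 have "infinite ((Lset e0 - postcrit) Int ball x r)" using radial_uncountable[OF assms] countable_finite by blast
 then obtain S where S: "S <= (Lset e0 - postcrit) Int ball x r" "finite S" "card S = L"
  using infinite_arbitrarily_large by metis
 obtain d where d: "0 < d" "!!x y. x : S ==> y : S ==> x ~= y ==> d <= dist x y" by (rule finite_separation[OF S(2)]) blast
 obtain d' where d': "0 < d'" "!!y. y : S ==> d' <= r - dist x y"
  using finite_pos_lower_bound[OF S(2), of "%y. r - dist x y"] S(1) by (metis IntD2 diff_gt_0_iff_gt mem_ball subsetD)
 define t where "t = min (d/2) d'"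
 have t: "0 < t" using d d' by (simp add: t_def)
 have tb: "ball y t <= ball x r" if "y : S" for y
  using d'(2)[OF that] by (auto simp: ball_subset_ball_iff t_def dist_commute min_def)
 have tt: "ball y t Int ball y' t = {}" if "y : S" "y' : S" "y ~= y'" for y y'
  by (rule disjoint_ballI) (use d(2)[OF that] in \<open>simp add: t_def\<close>)
 have "EX n0. ALL n>=n0. J <= f n ` (J Int ball y t)" if "y : S" for y
  using leo[of y t] t S(1) that Lset_J[of e0] by (metis DiffD1 IntD1 subsetD)
 then obtain n0 where n0: "!!y n. y : S ==> n0 y <= n ==> J <= f n ` (J Int ball y t)" by metis
 show thesis proof (rule that[of "Max (insert 0 (n0 ` S))"])
  fix n a assume n: "Max (insert 0 (n0 ` S)) <= n" and a: "a : J"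
  have "EX q. q : J Int ball y t & f n q = a" if y: "y : S" for y proof -
   have "n0 y <= Max (insert 0 (n0 ` S))" using S(2) y by (intro Max_ge) auto
   hence "a : f n ` (J Int ball y t)" using n0[OF y, of n] n a by force
   thus ?thesis by blast
  qed
  then obtain q where q: "!!y. y : S ==> q y : J Int ball y t" "!!y. y : S ==> f n (q y) = a" by metis
  have "inj_on q S" by (rule inj_onI) (use q(1) tt in \<open>metis IntD2 IntI empty_iff\<close>)
  hence "card (q ` S) = L" using S(3) by (simp add: card_image)
  moreover have "q ` S <= {q:J Int ball x r. f n q = a}" using q tb by blast
  ultimately show "EX X. finite X & card X = L & X <= {q:J Int ball x r. f n q = a}" using S(2) by blast
 qed
qed

end

section \<open>Blowing up at points of small density\<close>

text \<open>Uniform closeness would not control length, so ps is compared with Fi through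
  increments, up to a scale c and relative errors t. Length and diameter scale alike, c cancels, and
  t tends to 0.\<close>

lemma hm_le_diameter_limit: fixes Fi :: "complex => complex"
 assumes A: "A <= V" and b: "bounded (Fi ` V)" and ap: "!!t. 0 < t ==> t < 1 ==> EX ps c. 0 < c &
    (ALL z:V. ALL w:V. c * (1 - t) * dist (Fi z) (Fi w) <= dist (ps z) (ps w) &
     dist (ps z) (ps w) <= c * (1 + t) * dist (Fi z) (Fi w)) &
    inj_on ps V & HM1 (ps ` A) <= ennreal ((1 + t) * diameter (ps ` V))"
 shows "HM1 (Fi ` A) <= ennreal (diameter (Fi ` V))"
proof -
 define d where "d = diameter (Fi ` V)"
 have d: "0 <= d" using b by (simp add: d_def diameter_ge_0)
 have main: "HM1 (Fi ` A) <= ennreal ((1 + t)^2 / (1 - t) * d)" if t: "0 < t" "t < 1" for t proof -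
  obtain ps c where c: "0 < c" and l: "ALL z:V. ALL w:V. c * (1 - t) * dist (Fi z) (Fi w) <= dist (ps z) (ps w) &
     dist (ps z) (ps w) <= c * (1 + t) * dist (Fi z) (Fi w)"
   and inj: "inj_on ps V" and H: "HM1 (ps ` A) <= ennreal ((1 + t) * diameter (ps ` V))"
   using ap[OF t] by (elim exE conjE)
  have dV: "diameter (ps ` V) <= c * (1 + t) * d" proof (rule diameter_leI)
   show "0 <= c * (1 + t) * d" using c t d by simp
   fix x y assume "x : ps ` V" "y : ps ` V"
   then obtain z w where zw: "z : V" "w : V" "x = ps z" "y = ps w" by (elim imageE)
   have "dist x y <= c * (1 + t) * dist (Fi z) (Fi w)" using l zw by simp
   also have "... <= c * (1 + t) * d" unfolding d_def
    using zw c t by (intro mult_left_mono diameter_bounded_bound[OF b]) auto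
   finally show "dist x y <= c * (1 + t) * d" .
  qed
  define g where "g = Fi o the_inv_into V ps"
  have g: "g (ps z) = Fi z" if "z : V" for z using the_inv_into_f_f[OF inj that] by (simp add: g_def)
  have "HM1 (g ` ps ` A) <= ennreal ((1 / (c * (1 - t))) powr 1) * HM1 (ps ` A)" proof (rule hm_lipschitz)
   fix x y assume "x : ps ` A" "y : ps ` A"
   then obtain z w where zw: "z : A" "w : A" "x = ps z" "y = ps w" by (elim imageE)
   have "c * (1 - t) * dist (Fi z) (Fi w) <= dist x y" using l zw A by blast
   thus "dist (g x) (g y) <= 1 / (c * (1 - t)) * dist x y"
    using g[of z] g[of w] zw A c t by (simp add: field_simps subset_iff)
  qed (use c t in auto)
  moreover have "g ` ps ` A = Fi ` A" unfolding image_image using g A by (intro image_cong) auto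
  ultimately have "HM1 (Fi ` A) <= ennreal (1 / (c * (1 - t))) * HM1 (ps ` A)" using c t by simp
  also have "... <= ennreal (1 / (c * (1 - t))) * ennreal ((1 + t) * (c * (1 + t) * d))"
   using dV t by (intro mult_left_mono order_trans[OF H] ennreal_leI) auto
  also have "... = ennreal ((1 + t)^2 / (1 - t) * d)"
   using c t d by (simp add: ennreal_mult[symmetric] power2_eq_square)
  finally show ?thesis .
 qed
 have "HM1 (Fi ` A) < top" using main[of "1/2"] by (simp add: order_le_less_trans)
 then obtain m where m: "0 <= m" "HM1 (Fi ` A) = ennreal m" by (cases "HM1 (Fi ` A)") auto
 have "((%t. (1 + t)\<^sup>2 / (1 - t) * d) \<longlongrightarrow> (1 + 0)^2 / (1 - 0) * d) (at_right (0::real))"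
  by (intro tendsto_intros) auto
 moreover have "eventually (%t. m <= (1 + t)^2 / (1 - t) * d) (at_right (0::real))"
  using eventually_at_right_real[of 0 1] proof (rule eventually_mono)
  show "m <= (1 + t)^2 / (1 - t) * d" if "t : {0<..<1}" for t using main[of t] that d m by (simp add: ennreal_le_iff)
 qed simp
 ultimately have "m <= d" using tendsto_lowerbound trivial_limit_at_right_real by fastforce
 thus ?thesis unfolding d_def[symmetric] using m by (simp add: ennreal_leI)
qed

context rigid_plane
begin

text \<open>For each k some radial p has no set of density 1 + 1 / (k + 1) or more among the small
  sets close to it relative to their diameter. A branch from a disc of radius e0 into a small
  neighbourhood of p transports this to sets of definite size in that disc. A limit of the centres
  serves for all K at once.\<close>

lemma blowup_branches: obtains y where "y : J" "!!K. 0 < K ==> EX n ph. br n y (e0/2) ph &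
   (ALL V. compact V & V <= cball y (e0/8) & 1 / K <= diameter V -->
    HM1 (ph ` (J Int V)) <= ennreal ((1 + 1 / K) * diameter (ph ` V)))" proof -
 obtain C where "distortion C" using univalent_distortion by blast
 then interpret distortion C .
 have ex: "EX y n ph. y : J & br n y e0 ph & (ALL V. compact V & V <= cball y (e0/4) & C^2 * e0 <= real k * diameter V & 0 < diameter V -->
    HM1 (ph ` (J Int V)) <= ennreal ((1 + 1 / real (Suc k)) * diameter (ph ` V)))" for k proof -
  have "EX p:Lset e0. EX rh>0. ALL U. closed U --> bounded U --> 0 < diameter U --> diameter U < rh -->
    (EX u:U. dist p u <= real k * diameter U) --> ~ ennreal ((1 + 1 / real (Suc k)) * diameter U) <= HM1 (J Int U)"
  proof (rule ccontr)
   assume n: "~ ?thesis"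
   have "HM1 J = 0" by (rule hausdorff_upper_density[OF J_fin rad_full, of "1 + 1 / real (Suc k)" "real k"])
      (use n in simp, simp, meson n)
   thus False using J_pos by simp
  qed
  then obtain p rh where p: "p : Lset e0" "0 < rh"
   and U: "!!U. [|closed U; bounded U; 0 < diameter U; diameter U < rh; EX u:U. dist p u <= real k * diameter U|]
     ==> ~ ennreal ((1 + 1 / real (Suc k)) * diameter U) <= HM1 (J Int U)" by blast
  have rh3: "0 < rh/3" using p(2) by simp
  obtain n ph where ph: "br n (f n p) e0 ph" "ph (f n p) = p" "ph ` ball (f n p) e0 <= ball p (rh/3)"
   by (rule LsetD[OF p(1) rh3])
  let ?y = "f n p"
  have yJ: "?y : J" using p(1) Lset_J f_in_J by blast
  have "HM1 (ph ` (J Int V)) <= ennreal ((1 + 1 / real (Suc k)) * diameter (ph ` V))"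
   if V: "compact V" "V <= cball ?y (e0/4)" "C^2 * e0 <= real k * diameter V" "0 < diameter V" for V proof -
   have V4: "V <= ball ?y e0" using V(2) e0 by auto
   have cont: "continuous_on V ph" by (rule continuous_on_subset[OF hol_cont[OF brD(1)[OF ph(1)]] V4])
   have cV: "compact (ph ` V)" by (rule compact_image[OF cont V(1)])
   have bV: "bounded (ph ` V)" using cV by (rule compact_imp_bounded)
   have Vne: "V ~= {}" using V(4) by auto
   obtain v w where vw: "v : V" "w : V" "dist v w = diameter V" using diameter_compact_attained[OF V(1) Vne] by blast
   define D where "D = norm (deriv ph ?y)"
   have "D ~= 0" unfolding D_def using br_regular[OF ph(1)] e0 by simp
   hence D: "0 < D" by (simp add: D_def)
   have vwc: "v : cball ?y (e0/4)" "w : cball ?y (e0/4)" "?y : cball ?y (e0/4)" using vw V(2) e0 by auto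
   have 1: "D * diameter V <= C * diameter (ph ` V)" proof -
    have "D * diameter V <= C * dist (ph v) (ph w)"
     unfolding D_def vw(3)[symmetric] by (rule low[OF brD(1,4)[OF ph(1)] e0 vwc(1,2)])
    also have "... <= C * diameter (ph ` V)" using C vw by (intro mult_left_mono diameter_bounded_bound bV) auto
    finally show ?thesis .
   qed
   \<comment> \<open>By distortion the image of V is within k times its diameter of p unless V is
     too small; hence the condition C^2 * e0 <= real k * diameter V.\<close>
   have 2: "dist p (ph v) <= real k * diameter (ph ` V)" proof -
    have "dist (ph ?y) (ph v) <= C * D * dist ?y v" unfolding D_def by (rule up[OF brD(1,4)[OF ph(1)] e0 vwc(3,1)])
    also have "... <= C * D * e0" using vwc(1) C D e0 by (intro mult_left_mono) auto
    finally have "C * dist p (ph v) <= C * (C * D * e0)" using C ph(2) by simp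
    also have "... = D * (C^2 * e0)" by (simp add: power2_eq_square)
    also have "... <= D * (real k * diameter V)" using V(3) D by (intro mult_left_mono) auto
    also have "... = real k * (D * diameter V)" by simp
    also have "... <= real k * (C * diameter (ph ` V))" using 1 by (intro mult_left_mono) auto
    finally have "C * dist p (ph v) <= C * (real k * diameter (ph ` V))" by (simp add: mult_ac)
    thus ?thesis using C by simp
   qed
   have 3: "0 < diameter (ph ` V)" using 1 D V(4) C by (smt (verit) mult_pos_pos mult_nonneg_nonpos)
   have 4: "diameter (ph ` V) < rh" proof -
    have "diameter (ph ` V) <= diameter (ball p (rh/3))" using V4 ph(3) by (intro diameter_subset) auto
    also have "... < rh" using p(2) by simp
    finally show ?thesis .
   qed
   have "~ ennreal ((1 + 1 / real (Suc k)) * diameter (ph ` V)) <= HM1 (J Int ph ` V)"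
    by (rule U[OF compact_imp_closed[OF cV] bV 3 4]) (use 2 vw in blast)
   moreover have "J Int ph ` V = ph ` (J Int V)" using brD(5)[OF ph(1)] V4 by blast
   ultimately show ?thesis by simp
  qed
  thus ?thesis using yJ ph(1) by blast
 qed
 obtain y n ph where y: "!!k. y k : J" and ph: "!!k. br (n k) (y k) e0 (ph k)"
  and H: "!!k V. [|compact V; V <= cball (y k) (e0/4); C^2 * e0 <= real k * diameter V; 0 < diameter V|] ==>
    HM1 (ph k ` (J Int V)) <= ennreal ((1 + 1 / real (Suc k)) * diameter (ph k ` V))" using ex by metis
 obtain l r where l: "l : J" "strict_mono (r :: nat => nat)" "(y o r) \<longlonglongrightarrow> l"
  using compact_J y unfolding compact_def by metis
 show thesis proof (rule that[OF l(1)])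
  fix K :: real assume K: "0 < K"
  have e8: "0 < e0/8" using e0 by simp
  have "eventually (%j. dist ((y o r) j) l < e0/8) sequentially" by (rule tendstoD[OF l(3) e8])
  moreover have "eventually (%j. K * (C^2 * e0) + K <= real j) sequentially"
   using filterlim_real_sequentially by (simp add: filterlim_at_top)
  ultimately have "eventually (%j. dist ((y o r) j) l < e0/8 & K * (C^2 * e0) + K <= real j) sequentially"
   by (rule eventually_conj)
  then obtain j where j: "dist (y (r j)) l < e0/8" "K * (C^2 * e0) + K <= real j"
   by (auto simp: eventually_sequentially)
  define k where "k = r j"
  have "j <= r j" using l(2) by (rule seq_suble)
  hence jk: "real j <= real k" by (simp add: k_def)
  have Ce: "0 < C^2 * e0" using C e0 by simp
  have k: "K * (C^2 * e0) <= real k" "K <= real (Suc k)" using j(2) jk K Ce by (smt (verit) mult_pos_pos of_nat_Suc)+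
  show "EX n ph. br n l (e0/2) ph & (ALL V. compact V & V <= cball l (e0/8) & 1 / K <= diameter V -->
    HM1 (ph ` (J Int V)) <= ennreal ((1 + 1 / K) * diameter (ph ` V)))" proof (intro exI conjI allI impI; (elim conjE)?)
   have "ball l (e0/2) <= ball (y k) e0" using j(1) e0 by (simp add: k_def ball_subset_ball_iff dist_commute)
   thus "br (n k) l (e0/2) (ph k)" by (rule br_subset[OF ph])
   fix V assume V: "compact V" "V <= cball l (e0/8)" "1 / K <= diameter V"
   have "cball l (e0/8) <= cball (y k) (e0/4)" using j(1) e0 by (simp add: k_def cball_subset_cball_iff dist_commute)
   hence V2: "V <= cball (y k) (e0/4)" using V(2) by blast
   have pos: "0 < diameter V" using V(3) K by (smt (verit) divide_pos_pos)
   have "C^2 * e0 = K * (C^2 * e0) * (1 / K)" using K by simp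
   also have "... <= real k * diameter V" using k(1) V(3) K by (intro mult_mono) auto
   finally have "HM1 (ph k ` (J Int V)) <= ennreal ((1 + 1 / real (Suc k)) * diameter (ph k ` V))"
    by (intro H V(1) V2 pos)
   also have "... <= ennreal ((1 + 1 / K) * diameter (ph k ` V))"
   proof (intro ennreal_leI mult_right_mono add_left_mono divide_left_mono)
    have "V <= ball (y k) e0" using V2 e0 by auto
    hence "compact (ph k ` V)" using brD(1)[OF ph[of k]] V(1) by (meson compact_image continuous_on_subset hol_cont)
    thus "0 <= diameter (ph k ` V)" by (simp add: compact_imp_bounded diameter_ge_0)
   qed (use k K in auto)
   finally show "HM1 (ph k ` (J Int V)) <= ennreal ((1 + 1 / K) * diameter (ph k ` V))" .
  qed
 qed
qed

text \<open>Normalized by value and derivative at y, the branches are bi-Lipschitz with uniform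
  constants on a smaller disc. So a limit exists, the lower bound makes it injective, and the
  density bounds become exactly 1.\<close>

lemma blowup_limit: obtains y r Fi where "y : J" "0 < r" "Fi holomorphic_on ball y r" "inj_on Fi (ball y r)"
  "!!V. compact V ==> V <= ball y r ==> HM1 (Fi ` (J Int V)) <= ennreal (diameter (Fi ` V))" proof -
 obtain y where y: "y : J" and ex: "!!K. 0 < K ==> EX n ph. br n y (e0/2) ph &
   (ALL V. compact V & V <= cball y (e0/8) & 1 / K <= diameter V -->
    HM1 (ph ` (J Int V)) <= ennreal ((1 + 1 / K) * diameter (ph ` V)))"
  by (rule blowup_branches) (assumption | rule that)+
 obtain C where "distortion C" using univalent_distortion by blast
 then interpret distortion C .
 define rh where "rh = e0/2"
 have rh: "0 < rh" using e0 by (simp add: rh_def)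
 have "EX n ph. br n y rh ph & (ALL V. compact V & V <= cball y (rh/4) & 1 / real (Suc k) <= diameter V -->
    HM1 (ph ` (J Int V)) <= ennreal ((1 + 1 / real (Suc k)) * diameter (ph ` V)))" for k
  using ex[of "real (Suc k)"] by (simp add: rh_def)
 then obtain n ph where ph: "!!k. br (n k) y rh (ph k)"
  and H: "!!k V. compact V ==> V <= cball y (rh/4) ==> 1 / real (Suc k) <= diameter V ==>
    HM1 (ph k ` (J Int V)) <= ennreal ((1 + 1 / real (Suc k)) * diameter (ph k ` V))" by metis
 define D where "D k = deriv (ph k) y" for k
 have D: "D k ~= 0" for k unfolding D_def using br_regular[OF ph] rh by simp
 define F where "F k x = (ph k x - ph k y) / D k" for k x
 have dF: "norm (F k z - F k w) = dist (ph k z) (ph k w) / norm (D k)" for k z w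
  unfolding F_def diff_divide_distrib[symmetric] by (simp add: norm_divide dist_norm)
 have Fup: "norm (F k z - F k w) <= C * dist z w" if "z : cball y (rh/4)" "w : cball y (rh/4)" for k z w
  using up[OF brD(1,4)[OF ph] rh that, of k] D[of k] unfolding dF by (simp add: D_def field_simps)
 have Flow: "dist z w <= C * norm (F k z - F k w)" if "z : cball y (rh/4)" "w : cball y (rh/4)" for k z w
  using low[OF brD(1,4)[OF ph] rh that, of k] D[of k] unfolding dF by (simp add: D_def field_simps)
 let ?S = "ball y (rh/4)"
 have Sb: "?S <= ball y rh" "?S <= cball y (rh/4)" using rh by auto
 have Fh: "F k holomorphic_on ?S" for k
  unfolding F_def using D by (intro holomorphic_intros holomorphic_on_subset[OF brD(1)[OF ph] Sb(1)]) auto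
 have yS: "y : ?S" "y : cball y (rh/4)" using rh by auto
 obtain Fi r where Fi: "Fi holomorphic_on ?S" and r: "strict_mono (r :: nat => nat)"
  and lim: "!!x. x : ?S ==> (%j. F (r j) x) \<longlonglongrightarrow> Fi x"
  and unif: "!!K. compact K ==> K <= ?S ==> uniform_limit K (F o r) Fi sequentially"
 proof (rule Montel[of ?S "range F" F])
  show "h holomorphic_on ?S" if "h : range F" for h using that Fh by auto
  fix K assume K: "compact K" "K <= ?S"
  have "norm (F k z) <= C * (rh/4)" if "z : K" for k z proof -
   have z: "z : cball y (rh/4)" using that K(2) Sb(2) by blast
   have "norm (F k z - F k y) <= C * dist z y" by (rule Fup[OF z yS(2)])
   also have "... <= C * (rh/4)" using z C by (intro mult_left_mono) (auto simp: dist_commute)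
   finally show ?thesis by (simp add: F_def)
  qed
  thus "EX B. ALL h:range F. ALL z:K. norm (h z) <= B" by blast
 qed (auto intro: that)
 have Filow: "dist z w <= C * norm (Fi z - Fi w)" if "z : ?S" "w : ?S" for z w
 proof (rule tendsto_le[OF sequentially_bot])
  show "(%j. C * norm (F (r j) z - F (r j) w)) \<longlonglongrightarrow> C * norm (Fi z - Fi w)"
   by (intro tendsto_intros lim that)
  show "(%j. dist z w) \<longlonglongrightarrow> dist z w" by simp
  show "\<forall>\<^sub>F j in sequentially. dist z w <= C * norm (F (r j) z - F (r j) w)"
   using Flow that Sb(2) by (intro always_eventually allI) blast
 qed
 have Fiinj: "inj_on Fi ?S" by (rule inj_onI) (use Filow in force)
 let ?R = "ball y (rh/16)"
 have RS': "?R <= ?S" "cball y (rh/8) <= ?S" using rh by auto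
 \<comment> \<open>Cauchy's estimate makes the derivative of F (r j) - Fi small on a smaller disc,
   and \<open>Filow\<close> turns this into an error relative to the increment of Fi.\<close>
 have close: "eventually (%j. ALL z:?R. ALL w:?R. norm ((F (r j) z - Fi z) - (F (r j) w - Fi w)) <= t * norm (Fi z - Fi w)) sequentially"
  if t: "0 < t" for t proof -
  define de where "de = t / C * (rh/32)"
  have de: "0 < de" using t C rh by (simp add: de_def)
  have "uniform_limit (cball y (rh/8)) (F o r) Fi sequentially" by (rule unif[OF compact_cball RS'(2)])
  hence "eventually (%j. ALL x:cball y (rh/8). dist ((F o r) j x) (Fi x) < de) sequentially"
   using de by (rule uniform_limitD)
  thus ?thesis proof (rule eventually_mono)
   fix j assume j: "ALL x:cball y (rh/8). dist ((F o r) j x) (Fi x) < de"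
   let ?G = "%x. F (r j) x - Fi x"
   have Gh: "?G holomorphic_on ?S" by (intro holomorphic_intros Fh Fi)
   have dG: "norm (deriv ?G x) <= t / C" if x: "x : ?R" for x proof -
    have b: "ball x (rh/16) <= cball y (rh/8)" using x by (auto simp: ball_subset_cball_iff dist_commute)
    have "norm (deriv ?G x) <= de / (rh/32)" proof (rule holomorphic_derivative_bound)
     show "?G holomorphic_on ball x (rh/16)" using b RS'(2) by (intro holomorphic_on_subset[OF Gh]) blast
     show "norm (?G z) <= de" if "z : cball x (rh/32)" for z proof -
      have "z : ball x (rh/16)" using that rh by auto
      thus ?thesis using b j by (force simp: dist_norm)
     qed
    qed (use rh in auto)
    thus ?thesis using rh by (simp add: de_def)
   qed
   show "ALL z:?R. ALL w:?R. norm (?G z - ?G w) <= t * norm (Fi z - Fi w)" proof (intro ballI)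
    fix z w assume zw: "z : ?R" "w : ?R"
    have "norm (?G z - ?G w) <= t / C * norm (z - w)" proof (rule field_differentiable_bound[OF convex_ball _ dG zw])
     show "(?G has_field_derivative deriv ?G x) (at x within ?R)" if "x : ?R" for x
      by (rule has_field_derivative_at_within[OF holomorphic_derivI[OF Gh open_ball subsetD[OF RS'(1) that]]])
    qed
    also have "... <= t / C * (C * norm (Fi z - Fi w))"
     using t C Filow[OF subsetD[OF RS'(1) zw(1)] subsetD[OF RS'(1) zw(2)]]
     by (intro mult_left_mono) (auto simp: dist_norm)
    also have "... = t * norm (Fi z - Fi w)" using C by simp
    finally show "norm (?G z - ?G w) <= t * norm (Fi z - Fi w)" .
   qed
  qed
 qed
 \<comment> \<open>\<open>H\<close> reaches only sets with 1 / (k + 1) <= diameter V, so sets of at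
   most one point are treated apart.\<close>
 have final: "HM1 (Fi ` (J Int V)) <= ennreal (diameter (Fi ` V))" if V: "compact V" "V <= ?R" for V
 proof (cases "diameter V = 0")
  case True
  have "x = x'" if "x : V" "x' : V" for x x'
   using diameter_bounded_bound[OF compact_imp_bounded[OF V(1)] that] True by simp
  hence "EX x. V <= {x}" by blast
  hence "countable (Fi ` (J Int V))" by (meson countable_finite countable_image finite.emptyI finite_insert finite_subset inf_le2)
  hence z: "HM1 (Fi ` (J Int V)) = 0" by (rule hm_countable_null) auto
  show ?thesis unfolding z by simp
 next
  case False
  hence dV: "0 < diameter V" using diameter_ge_0[OF compact_imp_bounded[OF V(1)]] by simp
  have VS: "V <= ?S" using V(2) RS'(1) by blast
  have Vb: "V <= cball y (rh/4)" using VS Sb(2) by blast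
  show ?thesis proof (rule hm_le_diameter_limit)
   show "J Int V <= V" by blast
   have "continuous_on V Fi" by (rule continuous_on_subset[OF hol_cont[OF Fi] VS])
   thus "bounded (Fi ` V)" using V(1) by (intro compact_imp_bounded compact_image)
   fix t :: real assume t: "0 < t" "t < 1"
   have "eventually (%j. 1 / t + 1 / diameter V <= real j) sequentially"
    using filterlim_real_sequentially by (simp add: filterlim_at_top)
   hence "eventually (%j. 1 / t + 1 / diameter V <= real j &
    (ALL z:?R. ALL w:?R. norm ((F (r j) z - Fi z) - (F (r j) w - Fi w)) <= t * norm (Fi z - Fi w))) sequentially"
    using close[OF t(1)] by (rule eventually_conj)
   then obtain j where j: "1 / t + 1 / diameter V <= real j"
    "!!z w. z : ?R ==> w : ?R ==> norm ((F (r j) z - Fi z) - (F (r j) w - Fi w)) <= t * norm (Fi z - Fi w)"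
    by (auto simp: eventually_sequentially)
   define k where "k = r j"
   have "j <= r j" using r by (rule seq_suble)
   hence "real j <= real (Suc k)" by (simp add: k_def)
   hence sum: "1 / t + 1 / diameter V <= real (Suc k)" using j(1) by linarith
   have "0 < 1 / t" "0 < 1 / diameter V" using t dV by auto
   hence "1 / t <= real (Suc k)" "1 / diameter V <= real (Suc k)" using sum by linarith+
   hence k: "1 / real (Suc k) <= t" "1 / real (Suc k) <= diameter V" using t dV by (simp_all add: field_simps)
   show "EX ps c. 0 < c & (ALL z:V. ALL w:V. c * (1 - t) * dist (Fi z) (Fi w) <= dist (ps z) (ps w) &
     dist (ps z) (ps w) <= c * (1 + t) * dist (Fi z) (Fi w)) &
     inj_on ps V & HM1 (ps ` (J Int V)) <= ennreal ((1 + t) * diameter (ps ` V))"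
   proof (intro exI[of _ "ph k"] exI[of _ "norm (D k)"] conjI ballI)
    show "0 < norm (D k)" using D by simp
    fix z w assume "z : V" "w : V"
    hence zw: "z : ?R" "w : ?R" using V(2) by blast+
    let ?P = "norm (Fi z - Fi w)" and ?Q = "norm (F k z - F k w)"
    have eq0: "(F k z - F k w) - (Fi z - Fi w) = (F k z - Fi z) - (F k w - Fi w)" by simp
    have n: "norm ((F k z - F k w) - (Fi z - Fi w)) <= t * ?P" unfolding eq0 unfolding k_def by (rule j(2)[OF zw])
    hence "?Q <= ?P + t * ?P" "?P <= ?Q + t * ?P"
     using norm_triangle_sub[of "F k z - F k w" "Fi z - Fi w"] norm_triangle_sub[of "Fi z - Fi w" "F k z - F k w"]
     by (simp_all add: norm_minus_commute)
    hence q: "(1 - t) * ?P <= ?Q" "?Q <= (1 + t) * ?P" by (simp_all add: algebra_simps)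
    have eq: "dist (ph k z) (ph k w) = norm (D k) * ?Q" unfolding dF using D by simp
    show "norm (D k) * (1 - t) * dist (Fi z) (Fi w) <= dist (ph k z) (ph k w)"
     using mult_left_mono[OF q(1), of "norm (D k)"] eq by (simp add: dist_norm mult.assoc)
    show "dist (ph k z) (ph k w) <= norm (D k) * (1 + t) * dist (Fi z) (Fi w)"
     using mult_left_mono[OF q(2), of "norm (D k)"] eq by (simp add: dist_norm mult.assoc)
   next
    show "inj_on (ph k) V" using VS Sb(1) by (intro inj_on_subset[OF brD(4)[OF ph]]) blast
    have "continuous_on V (ph k)" using VS Sb(1) by (intro continuous_on_subset[OF hol_cont[OF brD(1)[OF ph]]]) blast
    hence d0: "0 <= diameter (ph k ` V)" using V(1) by (intro diameter_ge_0 compact_imp_bounded compact_image)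
    have "HM1 (ph k ` (J Int V)) <= ennreal ((1 + 1 / real (Suc k)) * diameter (ph k ` V))" by (rule H[OF V(1) Vb k(2)])
    also have "... <= ennreal ((1 + t) * diameter (ph k ` V))" using k(1) d0 by (intro ennreal_leI mult_right_mono) auto
    finally show "HM1 (ph k ` (J Int V)) <= ennreal ((1 + t) * diameter (ph k ` V))" .
   qed
  qed
 qed
 show thesis
  by (rule that[OF y _ holomorphic_on_subset[OF Fi RS'(1)] inj_on_subset[OF Fiinj RS'(1)] final]) (use rh in auto)
qed

end

section \<open>A straight piece of the Julia set\<close>

text \<open>If the component of c were {c}, the Sura-Bura theorem would give a relatively clopen
  neighbourhood of it inside the open ball. This would be clopen in the connected set C, although d
  lies outside the ball.\<close>

lemma boundary_bumping: fixes C :: "'a::euclidean_space set"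
 assumes C: "compact C" "connected C" "c : C" "d : C" and r: "0 < r" "r <= dist c d"
 obtains K where "compact K" "connected K" "c : K" "K <= C Int cball c r" "EX z:K. z ~= c" proof -
 let ?S = "C Int cball c r"
 define K where "K = connected_component_set ?S c"
 have S: "compact ?S" using C by (intro compact_Int_closed) auto
 have cS: "c : ?S" using C r by auto
 have Kc: "K : components ?S" using cS by (auto simp: K_def components_def)
 have cK: "compact K" by (rule compact_components[OF S Kc])
 have "c : K" using cS by (simp add: K_def)
 moreover have "EX z:K. z ~= c" proof (rule ccontr)
  assume "~ ?thesis"
  hence "K <= ball c r" using r by auto
  then obtain K' where K': "openin (top_of_set ?S) K'" "compact K'" "K <= K'" "K' <= ball c r"
   using Sura_Bura_clopen_subset[OF closed_imp_locally_compact[OF compact_imp_closed[OF S]] Kc cK open_ball] by metis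
  obtain U where U: "open U" "K' = ?S Int U" using K'(1) by (auto simp: openin_open)
  have "K' = C Int (U Int ball c r)" using U(2) K'(4) by auto
  hence "openin (top_of_set C) K'" using U(1) by (metis open_Int open_ball openin_open)
  moreover have "closedin (top_of_set C) K'"
   using K'(2) U(2) by (metis closed_subset compact_imp_closed inf_le1 le_infE)
  moreover have "c : K'" using `c : K` K'(3) by blast
  ultimately have "K' = C" using C(2) by (auto simp: connected_clopen)
  thus False using C(4) K'(4) r(2) by auto
 qed
 moreover have "K <= ?S" "connected K" using Kc in_components_subset in_components_connected by blast+
 ultimately show thesis using cK that by blast
qed

context rigid_plane
begin

text \<open>The given continuum may be far from y. A small subcontinuum at a point c off
  \<open>postcrit\<close> is pulled back by a branch that sends c to a preimage near y.\<close>

lemma continuum_near: assumes C: "compact C" "connected C" "C <= J" "a : C" "b : C" "a ~= b" and y: "y : J" "0 < r"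
 obtains K p q where "compact K" "connected K" "K <= J Int ball y r" "p : K" "q : K" "p ~= q" proof -
 have "uncountable C" by (rule connected_uncountable[OF C(2,4,5,6)])
 hence "C - postcrit ~= {}" using countable_postcrit countable_subset by (metis Diff_eq_empty_iff)
 then obtain c where c: "c : C" "c ~: postcrit" by blast
 obtain m where "J <= (UN j<=m. f j ` (J Int ball y r))" by (rule expand1[OF y])
 then obtain j q where q: "q : J" "q : ball y r" "f j q = c" using c(1) C(3) by blast
 obtain et where et: "et > 0" "ball q et <= ball y r" using q(2) by (metis open_ball open_contains_ball)
 obtain rh s where s: "rh > 0" "br j (f j q) rh s" "s ` ball (f j q) rh <= ball q et"
  using local_branch[OF J_dm[OF q(1)] postcritD[OF c(2) q(1,3)] et(1)] by metis
 note s = s[unfolded q(3)]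
 obtain d where d: "d : C" "d ~= c" using C(4-6) by metis
 have "0 < min (rh/2) (dist c d)" "min (rh/2) (dist c d) <= dist c d" using s(1) d by auto
 then obtain K where K: "compact K" "connected K" "c : K" "K <= C Int cball c (min (rh/2) (dist c d))" "EX z:K. z ~= c"
  by (rule boundary_bumping[OF C(1,2) c(1) d(1)])
 have Kb: "K <= ball c rh" using K(4) s(1) by auto
 have cont: "continuous_on K s" by (rule continuous_on_subset[OF hol_cont[OF brD(1)[OF s(2)]] Kb])
 obtain z where z: "z : K" "z ~= c" using K(5) by blast
 show thesis proof (rule that)
  show "compact (s ` K)" "connected (s ` K)" using K(1,2) cont by (auto intro: compact_image connected_continuous_image)
  show "s c : s ` K" "s z : s ` K" using K(3) z by auto
  show "s c ~= s z" using inj_onD[OF brD(4)[OF s(2)], of c z] z K(3) Kb by blast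
  show "s ` K <= J Int ball y r" proof (rule image_subsetI)
   fix x assume x: "x : K"
   hence "x : J" "x : ball c rh" using K(4) C(3) Kb by blast+
   thus "s x : J Int ball y r" using brD(5)[OF s(2)] s(3) et(2) by blast
  qed
 qed
qed

text \<open>In the chart Fi a continuum of J is a segment. A disc of radius t about its midpoint
  contains a chord of length 2 * t, which is all the length of J that the disc admits. A further
  point of J inside would add length, since J has positive length near each of its points.\<close>

lemma straight_arc: assumes C: "compact C" "connected C" "C <= J" "a0 : C" "b0 : C" "a0 ~= b0"
 obtains h where "h holomorphic_on ball 0 1" "inj_on h (ball 0 1)" "!!z. z : ball 0 1 ==> h z : J <-> Im z = 0" proof -
 obtain y r Fi where y: "y : J" "0 < r" and Fi: "Fi holomorphic_on ball y r" "inj_on Fi (ball y r)"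
  and H: "!!V. compact V ==> V <= ball y r ==> HM1 (Fi ` (J Int V)) <= ennreal (diameter (Fi ` V))"
  by (rule blowup_limit) (assumption | rule that)+
 obtain K p q where K: "compact K" "connected K" "K <= J Int ball y r" "p : K" "q : K" "p ~= q"
  by (rule continuum_near[OF C y])
 have Fic: "continuous_on (ball y r) Fi" by (rule hol_cont[OF Fi(1)])
 define S where "S = Fi ` K"
 have KB: "K <= ball y r" using K(3) by blast
 have S: "compact S" "connected S" unfolding S_def using K(1,2) continuous_on_subset[OF Fic KB]
  by (auto intro: compact_image connected_continuous_image)
 have pq: "Fi p : S" "Fi q : S" "Fi p ~= Fi q" using K(4-6) inj_onD[OF Fi(2) _ subsetD[OF KB K(4)] subsetD[OF KB K(5)]] by (auto simp: S_def)
 hence "S ~= {}" by blast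
 then obtain a b where ab: "a : S" "b : S" "dist a b = diameter S" using diameter_compact_attained[OF S(1)] by blast
 have ds: "dist x x' <= dist a b" if "x : S" "x' : S" for x x'
  unfolding ab(3) by (rule diameter_bounded_bound[OF compact_imp_bounded[OF S(1)] that])
 have dab: "0 < dist a b" using ds[OF pq(1,2)] pq(3) by (smt (verit) zero_less_dist_iff)
 have JK: "J Int K = K" using K(3) by blast
 have "HM1 S <= ennreal (dist a b)" using H[OF K(1) KB] unfolding JK ab(3) S_def .
 hence seg: "S = closed_segment a b" by (intro continuum_length_eq_diameter_is_segment S(2) ab(1,2) ds)
 define m where "m = (a + b) / 2"
 define W where "W = Fi ` ball y r"
 have oW: "open W" unfolding W_def by (rule open_mapping_thm3[OF Fi(1) open_ball Fi(2)])
 have SW: "S <= W" using KB by (auto simp: S_def W_def)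
 have "m : S" using midpoint_in_closed_segment[of a b]
  by (simp add: seg m_def midpoint_def scaleR_conv_of_real field_simps)
 then obtain t0 where t0: "0 < t0" "cball m t0 <= W" using SW oW open_contains_cball by blast
 define t where "t = min t0 (dist a b / 2)"
 have t: "0 < t" "cball m t <= W" "t <= dist a b / 2" using t0 dab by (auto simp: t_def)
 define ka where "ka = t / dist a b"
 have ka: "0 < ka" "ka <= 1/2" "ka * dist a b = t" using t dab by (auto simp: ka_def field_simps)
 obtain Ps where Ps: "Ps holomorphic_on W" "!!z. z : ball y r ==> Ps (Fi z) = z"
  using holomorphic_inverse_ex[OF Fi(1) open_ball Fi(2)] unfolding W_def by metis
 have PsW: "Ps w : ball y r" "Fi (Ps w) = w" if "w : W" for w using that Ps(2) by (auto simp: W_def)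
 \<comment> \<open>Sends the unit disc onto the disc of radius t about m and its real diameter into
   the segment.\<close>
 define L where "L z = m + of_real ka * (b - a) * z" for z
 have Ld: "dist (L z) (L w) = t * norm (z - w)" for z w proof -
  have "L z - L w = of_real ka * (b - a) * (z - w)" by (simp add: L_def algebra_simps)
  thus ?thesis using ka by (simp add: dist_norm norm_mult norm_minus_commute)
 qed
 have L0: "L 0 = m" by (simp add: L_def)
 have Lc: "L z : cball m t <-> norm z <= 1" "L z : ball m t <-> norm z < 1" for z
  using Ld[of 0 z] t(1) by (simp_all add: L0)
 have LW: "L z : W" if "norm z <= 1" for z using t(2) that Lc(1) by blast
 have real: "L (of_real x) : S" if x: "\<bar>x\<bar> <= 1" for x proof -
  have "\<bar>ka * x\<bar> <= 1/2 * 1" unfolding abs_mult using ka x by (intro mult_mono) auto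
  moreover have "L (of_real x) = (1 - (1/2 + ka * x)) *\<^sub>R a + (1/2 + ka * x) *\<^sub>R b"
   by (simp add: L_def m_def scaleR_conv_of_real algebra_simps add_divide_distrib)
  ultimately show ?thesis unfolding seg closed_segment_def by (intro CollectI exI[of _ "1/2 + ka * x"]) auto
 qed
 have SJ: "Ps w : J" if w: "w : S" for w proof -
  obtain v where "v : K" "w = Fi v" using w by (auto simp: S_def)
  thus ?thesis using Ps(2)[OF subsetD[OF KB]] K(3) by auto
 qed
 have LJ: "Ps (L z) : J <-> Im z = 0" if z: "norm z < 1" for z proof
  assume "Im z = 0"
  hence "z = of_real (Re z)" "\<bar>Re z\<bar> <= 1" using z abs_Re_le_cmod[of z] by (auto simp: complex_eq_iff)
  thus "Ps (L z) : J" using SJ[OF real] by metis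
 next
  assume zJ: "Ps (L z) : J"
  show "Im z = 0" proof (rule ccontr)
   assume im: "Im z ~= 0"
   define V where "V = Ps ` cball m t"
   have V: "compact V" "V <= ball y r" unfolding V_def
    using t(2) PsW(1) continuous_on_subset[OF hol_cont[OF Ps(1)] t(2)] by (auto intro!: compact_image)
   have FiV: "Fi ` V = cball m t" unfolding V_def image_image using t(2) PsW(2) by force
   define E where "E = Fi ` (J Int V)"
   have E: "w : E <-> w : cball m t & Ps w : J" for w proof
    assume "w : E"
    then obtain v where v: "v : J" "v : V" "w = Fi v" by (auto simp: E_def)
    hence "Ps w = v" using Ps(2) V(2) by blast
    thus "w : cball m t & Ps w : J" using v FiV by blast
   next
    assume w: "w : cball m t & Ps w : J"
    hence "w = Fi (Ps w)" using PsW(2) t(2) by force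
    thus "w : E" using w by (auto simp: E_def V_def)
   qed
   have HE: "HM1 E <= ennreal (2 * t)" using H[OF V] t(1) unfolding FiV E_def by (simp add: diameter_cball)
   define G where "G = (%x. L (of_real x)) ` {-1..1}"
   have Lcont: "continuous_on A (%x. L (of_real x))" for A unfolding L_def by (intro continuous_intros)
   have G: "connected G" "compact G" unfolding G_def
    using Lcont by (auto intro: connected_continuous_image compact_image)
   have GE: "G <= E" proof
    fix w assume "w : G"
    then obtain x where x: "\<bar>x\<bar> <= 1" "w = L (of_real x)" unfolding G_def by (auto simp: abs_le_iff)
    thus "w : E" using SJ[OF real[OF x(1)]] Lc(1)[of "of_real x"] unfolding E by simp
   qed
   have HG: "ennreal (2 * t) <= HM1 G" proof -
    have ends: "L (-1) : G" "L 1 : G" using imageI[of "-1" "{-1..1::real}" "%x. L (of_real x)"] imageI[of 1 "{-1..1::real}" "%x. L (of_real x)"]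
     by (simp_all add: G_def)
    have "2 * t <= dist (L (-1)) (L 1)" by (simp add: Ld)
    hence "ennreal (2 * t) <= HM1 (G Int cball (L (-1)) (2 * t))" by (rule connected_hausdorff_ge_radius[OF G(1) ends])
    also have "... <= HM1 G" by (rule hm_mono) blast
    finally show ?thesis .
   qed
   have "L z ~: G" proof
    assume "L z : G"
    then obtain x where "L z = L (of_real x)" by (auto simp: G_def)
    hence "t * norm (z - of_real x) = 0" unfolding Ld[symmetric] by simp
    hence "z = of_real x" using t(1) by simp
    thus False using im by simp
   qed
   moreover have "L z : ball m t" using Lc(2) z by blast
   ultimately have "L z : ball m t - G" by blast
   moreover have "open (ball m t - G)" using G(2) compact_imp_closed by blast
   ultimately obtain et where et: "0 < et" "cball (L z) et <= ball m t - G" by (metis open_contains_cball)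
   have cW: "cball (L z) et <= W" using et(2) t(2) ball_subset_cball by blast
   have "0 < HM1 (E Int cball (L z) et)" proof (rule ccontr)
    assume "~ ?thesis"
    hence n0: "HM1 (E Int cball (L z) et) = 0" by simp
    obtain c where c: "0 < c" "!!x y. x : cball (L z) et ==> y : cball (L z) et ==> dist (Ps x) (Ps y) <= c * dist x y"
     by (rule holomorphic_lipschitz_on_compact[OF Ps(1) oW compact_cball cW]) blast
    have "HM1 (Ps ` (E Int cball (L z) et)) <= ennreal (c powr 1) * HM1 (E Int cball (L z) et)"
     using c by (intro hm_lipschitz) auto
    hence n1: "HM1 (Ps ` (E Int cball (L z) et)) = 0" using n0 by simp
    define Q where "Q = Ps ` ball (L z) et"
    have bW: "ball (L z) et <= W" using cW by auto
    have "inj_on Ps W" by (rule inj_on_inverseI[where g = Fi]) (rule PsW(2))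
    hence "open Q" unfolding Q_def
     using open_mapping_thm3[OF holomorphic_on_subset[OF Ps(1) bW] open_ball] inj_on_subset bW by blast
    moreover have "Ps (L z) : Q" using et(1) by (simp add: Q_def)
    ultimately obtain d where d: "0 < d" "ball (Ps (L z)) d <= Q" by (metis open_contains_ball)
    have "J Int ball (Ps (L z)) d <= Ps ` (E Int cball (L z) et)" proof
     fix v assume v: "v : J Int ball (Ps (L z)) d"
     then obtain w where w: "w : ball (L z) et" "v = Ps w" using d(2) unfolding Q_def by blast
     have wc: "w : cball (L z) et" using w(1) by auto
     have "w : E" unfolding E using v w(2) wc et(2) by auto
     thus "v : Ps ` (E Int cball (L z) et)" using w(2) wc by blast
    qed
    hence "HM1 (J Int ball (Ps (L z)) d) <= HM1 (Ps ` (E Int cball (L z) et))" by (rule hm_mono)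
    hence "HM1 (J Int ball (Ps (L z)) d) = 0" using n1 by simp
    hence "HM1 (Lset e0 Int ball (Ps (L z)) d) = 0"
     using hm_mono[of "Lset e0 Int ball (Ps (L z)) d" "J Int ball (Ps (L z)) d" UNIV 1] Lset_J[of e0] by auto
    moreover have "HM1 (Lset e0 Int ball (Ps (L z)) d) ~= 0"
     using backward_closed_measure_transport(1)[OF Lset_J[of e0] _ zJ d(1)] Lset_backward Lset_pos by force
    ultimately show False by simp
   qed
   moreover have "(SUM i:UNIV. HM1 (E Int (if i then G else cball (L z) et))) <= HM1 (E Int (UN i:UNIV. if i then G else cball (L z) et))"
    by (rule hm_disjoint_compact_sum)
      (use G(2) et(2) in \<open>auto simp: compact_imp_closed compact_imp_bounded split: if_splits\<close>)
   hence "HM1 (E Int G) + HM1 (E Int cball (L z) et) <= HM1 (E Int (UN i:UNIV. if i then G else cball (L z) et))"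
    by (simp add: UNIV_bool add.commute)
   hence "HM1 (E Int G) + HM1 (E Int cball (L z) et) <= ennreal (2 * t)"
    using hm_mono[of "E Int (UN i:UNIV. if i then G else cball (L z) et)" E UNIV 1] HE by (meson inf_le1 order_trans)
   moreover have EG: "E Int G = G" using GE by blast
   ultimately have p: "0 < HM1 (E Int cball (L z) et)" "HM1 G + HM1 (E Int cball (L z) et) <= ennreal (2 * t)"
    unfolding EG by blast+
   have "ennreal (2 * t) + HM1 (E Int cball (L z) et) <= ennreal (2 * t) + 0"
    using order_trans[OF add_right_mono[OF HG] p(2)] by simp
   thus False using p(1) by (simp only: ennreal_add_left_cancel_le) simp
  qed
 qed
 show thesis proof (rule that[of "%z. Ps (L z)"])
  show "(%z. Ps (L z)) holomorphic_on ball 0 1" proof (rule holomorphic_on_compose_gen[OF _ Ps(1), unfolded o_def])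
   show "L holomorphic_on ball 0 1" unfolding L_def by (intro holomorphic_intros)
   show "L ` ball 0 1 <= W" by (rule image_subsetI) (rule LW, simp)
  qed
  show "inj_on (%z. Ps (L z)) (ball 0 1)" proof (rule inj_onI)
   fix z w :: complex assume *: "z : ball 0 1" "w : ball 0 1" "Ps (L z) = Ps (L w)"
   have "norm z <= 1" "norm w <= 1" using *(1,2) by auto
   hence "L z = L w" using PsW(2)[OF LW] *(3) by metis
   hence "dist (L z) (L w) = 0" by simp
   hence "t * norm (z - w) = 0" unfolding Ld .
   thus "z = w" using t(1) by simp
  qed
 qed (use LJ in simp)
qed

text \<open>Near h 0 the set J is part of the image of the diameter, and by \<open>leo\<close> an
  iterate spreads this part over J.\<close>

lemma J_connected:
 assumes h: "h holomorphic_on ball 0 1" "inj_on h (ball 0 1)" "!!z. z : ball 0 1 ==> h z : J <-> Im z = 0"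
 shows "connected J"
proof -
 define I where "I = {z : ball (0::complex) 1. Im z = 0}"
 have eq: "I = ball 0 1 Int {z. inner \<i> z = 0}" by (auto simp: I_def inner_complex_def)
 have "convex I" unfolding eq by (intro convex_Int convex_ball convex_hyperplane)
 hence cI: "connected I" by (rule convex_connected)
 have IJ: "h ` I <= J" using h(3) by (auto simp: I_def)
 have "connected (h ` I)"
  by (rule connected_continuous_image[OF continuous_on_subset[OF hol_cont[OF h(1)]] cI]) (auto simp: I_def)
 have "open (h ` ball 0 1)" by (rule open_mapping_thm3[OF h(1) open_ball h(2)])
 moreover have "h 0 : h ` ball 0 1" by simp
 ultimately obtain d where d: "0 < d" "ball (h 0) d <= h ` ball 0 1" by (metis open_contains_ball)
 have "h 0 : J" using h(3)[of 0] by simp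
 then obtain n where n: "J <= f n ` (J Int ball (h 0) d)" using leo[OF _ d(1)] by (metis order_refl)
 have "J Int ball (h 0) d <= h ` I" using d(2) h(3) by (auto simp: I_def)
 hence "J <= f n ` h ` I" using n by blast
 moreover have "f n ` h ` I <= J" using IJ f_in_J by blast
 moreover have "connected (f n ` h ` I)"
  using IJ J_dm by (intro connected_continuous_image[OF continuous_on_subset[OF hol_cont[OF hol_f]] \<open>connected (h ` I)\<close>]) blast
 ultimately show ?thesis by (metis subset_antisym)
qed

end

section \<open>Bounds for holomorphic functions on the unit disc\<close>

text \<open>The radius 1/2 keeps the circle and its reflection inside the domain of h.\<close>

definition circ :: "real => complex" where "circ t = exp (2 * of_real pi * \<i> * of_real t) / 2"

lemma norm_circ [simp]: "norm (circ t) = 1/2" by (simp add: circ_def norm_divide)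

lemma circ_mult_cnj: "circ t * cnj (circ t) = 1/4" by (simp add: complex_norm_square[symmetric] power2_eq_square)

lemma continuous_on_circ: "continuous_on S circ" unfolding circ_def by (intro continuous_intros) auto

lemma circle_Cauchy: assumes "g holomorphic_on ball 0 1" "norm w < 1/2"
 shows "((%t. g (circ t) * circ t / (circ t - w)) has_integral g w) {0..1}"
proof -
 have "cball 0 (1/2) <= ball (0::complex) 1" by auto
 hence "g holomorphic_on cball 0 (1/2)" by (rule holomorphic_on_subset[OF assms(1)])
 hence "((%u. g u / (u - w)) has_contour_integral (2 * of_real pi * \<i> * g w)) (circlepath 0 (1/2))"
  by (rule Cauchy_integral_circlepath_simple) (use assms(2) in simp)
 hence "((%t. g (circ t) / (circ t - w) * (2 * of_real pi * \<i> * circ t)) has_integral 2 * of_real pi * \<i> * g w) {0..1}"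
  unfolding has_contour_integral_def proof (rule has_integral_eq[rotated])
  fix t :: real assume "t : {0..1}"
  hence "vector_derivative (circlepath 0 (1/2)) (at t within {0..1}) = 2 * of_real pi * \<i> * circ t"
   by (simp add: vector_derivative_circlepath01 circ_def)
  thus "g (circlepath 0 (1/2) t) / (circlepath 0 (1/2) t - w) * vector_derivative (circlepath 0 (1/2)) (at t within {0..1}) =
   g (circ t) / (circ t - w) * (2 * of_real pi * \<i> * circ t)" by (simp add: circlepath circ_def)
 qed
 hence "((%t. 1 / (2 * of_real pi * \<i>) * (g (circ t) / (circ t - w) * (2 * of_real pi * \<i> * circ t))) has_integral
   1 / (2 * of_real pi * \<i>) * (2 * of_real pi * \<i> * g w)) {0..1}" by (rule has_integral_mult_right)
 moreover have c: "1 / k * (a / b * (k * c)) = a * c / b" "1 / k * (k * c) = c" if "k ~= 0" for k a b c :: complex using that by simp_all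
 moreover have k: "2 * of_real pi * \<i> ~= (0::complex)" by simp
 ultimately show ?thesis by (simp only: c[OF k])
qed

text \<open>Adding the conjugate integral, which vanishes, to Cauchy's formula leaves only the real part of g.\<close>

lemma holomorphic_bound_by_mean_Re: assumes g: "g holomorphic_on ball 0 1" "g 0 = 0" and w: "norm w <= 1/4"
  and I: "integral {0..1} (%t. \<bar>Re (g (circ t))\<bar>) <= I" shows "norm (g w) <= 4 * I" proof -
 have A: "((%t. g (circ t) * circ t / (circ t - w)) has_integral g w) {0..1}" by (rule circle_Cauchy[OF g(1)]) (use w in auto)
 have nz: "1 - 4 * cnj w * z ~= 0" if "norm z < 1" for z proof
  assume "1 - 4 * cnj w * z = 0"
  hence "norm (4 * cnj w * z) = 1" by (metis eq_iff_diff_eq_0 norm_one)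
  moreover have "norm (4 * cnj w * z) <= 1 * norm z" unfolding norm_mult using w by (intro mult_right_mono) auto
  ultimately show False using that by simp
 qed
 \<comment> \<open>On the circle z * cnj z = 1/4, so the conjugate of 1 / (1 - 4 * cnj w * z) is z /
   (z - w). The mean of the new function is its value at 0, which is g 0 = 0.\<close>
 have "(%z. g z / (1 - 4 * cnj w * z)) holomorphic_on ball 0 1" using nz by (intro holomorphic_intros g(1)) auto
 from circle_Cauchy[OF this, of 0]
 have "((%t. g (circ t) / (1 - 4 * cnj w * circ t) * circ t / (circ t - 0)) has_integral 0) {0..1}" using g(2) by simp
 hence "((%t. g (circ t) / (1 - 4 * cnj w * circ t)) has_integral 0) {0..1}" proof (rule has_integral_eq[rotated])
  fix t
  have "circ t ~= 0" by (simp add: circ_def)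
  thus "g (circ t) / (1 - 4 * cnj w * circ t) * circ t / (circ t - 0) = g (circ t) / (1 - 4 * cnj w * circ t)" by simp
 qed
 hence "((%t. cnj (g (circ t) / (1 - 4 * cnj w * circ t))) has_integral cnj 0) {0..1}" by (rule has_integral_cnj[THEN iffD2, unfolded o_def])
 moreover have "cnj (g (circ t) / (1 - 4 * cnj w * circ t)) = cnj (g (circ t)) * circ t / (circ t - w)" for t proof -
  have "circ t * (1 - 4 * w * cnj (circ t)) = circ t - w * (4 * (circ t * cnj (circ t)))" by (simp add: algebra_simps)
  hence e: "circ t * (1 - 4 * w * cnj (circ t)) = circ t - w" unfolding circ_mult_cnj by simp
  have "circ t ~= 0" by (simp add: circ_def)
  thus ?thesis unfolding e[symmetric] by simp
 qed
 ultimately have "((%t. cnj (g (circ t)) * circ t / (circ t - w)) has_integral 0) {0..1}" by simp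
 from has_integral_add[OF A this]
 have B: "((%t. of_real (2 * Re (g (circ t))) * circ t / (circ t - w)) has_integral g w) {0..1}"
  by (simp add: add_divide_distrib[symmetric] distrib_right[symmetric] complex_add_cnj)
 have "norm (g w) = norm (integral {0..1} (%t. of_real (2 * Re (g (circ t))) * circ t / (circ t - w)))"
  using integral_unique[OF B] by simp
 also have "... <= integral {0..1} (%t. 4 * \<bar>Re (g (circ t))\<bar>)" proof (rule integral_norm_bound_integral)
  show "(%t. of_real (2 * Re (g (circ t))) * circ t / (circ t - w)) integrable_on {0..1}" using B by blast
  have "continuous_on {0..1} (%t. g (circ t))"
   by (rule continuous_on_compose2[OF hol_cont[OF g(1)] continuous_on_circ]) auto
  thus "(%t. 4 * \<bar>Re (g (circ t))\<bar>) integrable_on {0..1}"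
   by (intro integrable_continuous_interval continuous_intros)
  fix t :: real
  have "1/4 <= norm (circ t - w)" using norm_triangle_ineq2[of "circ t" w] w by simp
  hence "1/2 / norm (circ t - w) <= (1/2) / (1/4)" by (intro divide_left_mono) auto
  hence "1/2 / norm (circ t - w) <= 2" by simp
  hence "2 * \<bar>Re (g (circ t))\<bar> * (1/2 / norm (circ t - w)) <= 2 * \<bar>Re (g (circ t))\<bar> * 2"
   by (intro mult_left_mono) auto
  thus "norm (of_real (2 * Re (g (circ t))) * circ t / (circ t - w)) <= 4 * \<bar>Re (g (circ t))\<bar>"
   by (simp add: norm_mult norm_divide)
 qed
 also have "... = 4 * integral {0..1} (%t. \<bar>Re (g (circ t))\<bar>)" by simp
 finally show ?thesis using I by linarith
qed

text \<open>Zeros are divided out one at a time. A zero in the disc of radius 1/16 is at least 3/16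
  away from the circle of radius 1/4, so the bound grows by 16/3, while at 0 the factor removed is
  at most 1/16. The net gain is 3 per zero.\<close>

lemma many_zeros_small:
 assumes "finite X" "X <= ball 0 (1/16)" "g holomorphic_on ball 0 1" "!!z. norm z <= 1/4 ==> norm (g z) <= M"
  "!!x. x : X ==> g x = (0::complex)" shows "norm (g 0) <= M / 3 ^ card X" using assms
proof (induction X arbitrary: g M rule: finite_induct)
 case empty
 thus ?case by simp
next
 case (insert a X)
 define G where "G z = (if z = a then deriv g a else (g z - g a) / (z - a))" for z
 have a: "norm a < 1/16" "g a = 0" using insert.prems by auto
 have Gh: "G holomorphic_on ball 0 1" unfolding G_def by (rule pole_lemma_open[OF insert.prems(2)]) simp
 have bd: "norm (G z) <= M * (16/3)" if z: "norm z <= 1/4" for z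
 proof (rule maximum_modulus_frontier[of G "cball 0 (1/4)"])
  have s: "cball 0 (1/4) <= ball (0::complex) 1" by auto
  show "G holomorphic_on interior (cball 0 (1/4))" using s by (intro holomorphic_on_subset[OF Gh]) auto
  show "continuous_on (closure (cball 0 (1/4))) G" using continuous_on_subset[OF hol_cont[OF Gh] s] by simp
  fix z assume "z : frontier (cball (0::complex) (1/4))"
  hence z: "norm z = 1/4" by simp
  have d: "3/16 <= norm (z - a)" using norm_triangle_ineq2[of z a] a(1) z by linarith
  hence "norm (G z) = norm (g z) / norm (z - a)" using a(2) by (auto simp: G_def norm_divide)
  also have "... <= M / (3/16)" using insert.prems(3)[of z] z d by (intro frac_le) (auto intro: order_trans[OF norm_ge_zero])
  finally show "norm (G z) <= M * (16/3)" by simp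
 qed (use z in auto)
 have "norm (G 0) <= M * (16/3) / 3 ^ card X" proof (rule insert.IH[OF _ Gh bd])
  show "G x = 0" if "x : X" for x using insert.hyps(2) insert.prems(4) that a(2) by (auto simp: G_def)
 qed (use insert.prems in auto)
 moreover have "norm (g 0) = norm a * norm (G 0)" using a(2) by (cases "a = 0") (auto simp: G_def norm_divide)
 moreover have "norm a * norm (G 0) <= 1/16 * norm (G 0)" using a(1) by (intro mult_right_mono) auto
 ultimately show ?case using insert.hyps by simp
qed

lemma holomorphic_on_removable: assumes D: "open D" and g: "g holomorphic_on D - S" and S: "finite S"
  and lim: "!!a. a : S ==> a : D ==> EX l. l ~= 0 & (g \<longlongrightarrow> l) (at a)" and nz: "!!z. z : D - S ==> g z ~= (0::complex)"
 obtains G where "G holomorphic_on D" "!!z. z : D ==> G z ~= 0" "!!z. z : D - S ==> G z = g z" proof -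
 have "EX l. a : S --> a : D --> l ~= 0 & (g \<longlongrightarrow> l) (at a)" for a using lim by blast
 then obtain l where l: "!!a. a : S ==> a : D ==> l a ~= 0 & (g \<longlongrightarrow> l a) (at a)" by metis
 define G where "G z = (if z : S then l z else g z)" for z
 have eq: "G z = g z" if "z : D - S" for z using that by (simp add: G_def)
 have o: "open (D - S)" using D S by (simp add: open_Diff finite_imp_closed)
 show thesis proof (rule that)
  show "G holomorphic_on D" proof (rule no_isolated_singularity'[OF _ _ D])
   show "finite (S Int D)" using S by simp
   show "G holomorphic_on D - S Int D" using g by (rule holomorphic_transform[THEN holomorphic_on_subset]) (auto simp: G_def)
   fix a assume a: "a : S Int D"
   have "(g \<longlongrightarrow> G a) (at a)" using l a by (simp add: G_def)
   moreover have "eventually (%z. z ~: S) (at a)"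
    using S islimpt_finite[OF S, of a] by (simp add: islimpt_iff_eventually)
   hence "eventually (%z. g z = G z) (at a)" by (rule eventually_mono) (simp add: G_def)
   ultimately have "(G \<longlongrightarrow> G a) (at a)" by (rule Lim_transform_eventually)
   thus "(G \<longlongrightarrow> G a) (at a within D)" by (rule tendsto_within_subset) simp
  qed
  show "G z ~= 0" if "z : D" for z using l nz that by (auto simp: G_def)
 qed (rule eq)
qed

text \<open>The zeros and poles are simple and fixed by conjugation, so numerator and denominator
  share them. At each the quotient tends to cnj l / l, which is not 0.\<close>

lemma reflected_quotient:
 assumes D: "open D" "!!z. z : D ==> cnj z : D" and A: "finite A" "A <= D" "finite B" "B <= D" "!!a. a : A Un B ==> cnj a = a"
  and w: "w holomorphic_on D - B" "!!z. z : D - B ==> w z = 0 ==> z : A"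
  and zero: "!!a. a : A ==> EX l. l ~= 0 & ((%z. w z / (z - a)) \<longlongrightarrow> l) (at a)"
  and pole: "!!a. a : B ==> EX l. l ~= 0 & ((%z. w z * (z - a)) \<longlongrightarrow> l) (at a)"
 obtains E where "E holomorphic_on D" "!!z. z : D ==> E z ~= 0" "!!z. z : D - (A Un B) ==> E z = cnj (w (cnj z)) / w z"
proof -
 have c: "filterlim cnj (at (cnj a)) (at a)" for a :: complex
  unfolding filterlim_at by (auto intro: tendsto_eq_intros simp: eventually_at_filter)
 show thesis proof (rule holomorphic_on_removable[OF D(1), of "%z. cnj (w (cnj z)) / w z" "A Un B"])
  have o: "open (D - (A Un B))" using D(1) A by (simp add: open_Diff finite_imp_closed)
  have "cnj ` (D - (A Un B)) <= D - B" proof (rule image_subsetI)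
   fix z assume z: "z : D - (A Un B)"
   thus "cnj z : D - B" using D(2) A(5) by (metis Diff_iff UnI2 complex_cnj_cnj)
  qed
  hence "(cnj o w o cnj) holomorphic_on D - (A Un B)"
   by (intro holomorphic_on_compose_cnj_cnj holomorphic_on_subset[OF w(1)] o)
  thus "(%z. cnj (w (cnj z)) / w z) holomorphic_on D - (A Un B)" unfolding o_def proof (rule holomorphic_on_divide)
   show "w holomorphic_on D - (A Un B)" by (rule holomorphic_on_subset[OF w(1)]) blast
   show "w z ~= 0" if "z : D - (A Un B)" for z using w(2)[of z] that by blast
  qed
  show "finite (A Un B)" using A by simp
  show "cnj (w (cnj z)) / w z ~= 0" if z: "z : D - (A Un B)" for z proof -
   have "cnj z : D - B" "cnj z ~: A" using D(2) A(5) z by (metis Diff_iff UnI1 UnI2 complex_cnj_cnj)+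
   thus ?thesis using w(2)[of z] w(2)[of "cnj z"] z by auto
  qed
  show "EX l. l ~= 0 & ((%z. cnj (w (cnj z)) / w z) \<longlongrightarrow> l) (at a)" if a: "a : A Un B" "a : D" for a
  proof (cases "a : A")
   case True
   obtain l where l: "l ~= 0" "((%z. w z / (z - a)) \<longlongrightarrow> l) (at a)" using zero[OF True] by blast
   have "((%z. w (cnj z) / (cnj z - a)) \<longlongrightarrow> l) (at a)"
    using filterlim_compose[OF l(2)] c[of a] A(5)[OF a(1)] by simp
   hence "((%z. cnj (w (cnj z) / (cnj z - a)) / (w z / (z - a))) \<longlongrightarrow> cnj l / l) (at a)"
    using l by (intro tendsto_intros) auto
   hence "((%z. cnj (w (cnj z)) / w z) \<longlongrightarrow> cnj l / l) (at a)"
    by (rule Lim_transform_eventually) (use A(5)[OF a(1)] in \<open>auto simp: eventually_at_filter\<close>)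
   thus ?thesis using l(1) by (intro exI[of _ "cnj l / l"]) simp
  next
   case False
   hence aB: "a : B" using a by blast
   obtain l where l: "l ~= 0" "((%z. w z * (z - a)) \<longlongrightarrow> l) (at a)" using pole[OF aB] by blast
   have "((%z. w (cnj z) * (cnj z - a)) \<longlongrightarrow> l) (at a)"
    using filterlim_compose[OF l(2)] c[of a] A(5)[OF a(1)] by simp
   hence "((%z. cnj (w (cnj z) * (cnj z - a)) / (w z * (z - a))) \<longlongrightarrow> cnj l / l) (at a)"
    using l by (intro tendsto_intros) auto
   hence "((%z. cnj (w (cnj z)) / w z) \<longlongrightarrow> cnj l / l) (at a)"
    by (rule Lim_transform_eventually) (use A(5)[OF a(1)] in \<open>auto simp: eventually_at_filter\<close>)
   thus ?thesis using l(1) by (intro exI[of _ "cnj l / l"]) simp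
  qed
 qed (use that in blast)
qed

section \<open>Potentials of arcs and chordal distances\<close>

text \<open>Each side of t0 has length at most 1 and contributes at most 2, the integral of x powr
  (-1/2) from 0 to 1.\<close>

lemma nn_integral_inverse_sqrt: fixes t0 :: real assumes "al <= t0" "t0 <= be" "be <= al + 1"
 shows "(\<integral>\<^sup>+t. ennreal (\<bar>t - t0\<bar> powr (-1/2)) * indicator {al..be} t \<partial>lborel) <= 4"
proof -
 define F where "F x = (if x : {0..1} then x powr (-1/2) else 0)" for x :: real
 have [measurable]: "F : borel_measurable borel" unfolding F_def by measurable
 have "((%x::real. x powr (-1/2)) has_integral (1 powr (-1/2 + 1) / (-1/2 + 1))) {0..1}"
  by (rule has_integral_powr_from_0) auto
 hence "(F has_integral 2) UNIV" unfolding F_def by (subst has_integral_restrict_UNIV) simp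
 hence F2: "(\<integral>\<^sup>+x. ennreal (F x) \<partial>lborel) = 2"
  using nn_integral_has_integral_lborel[of F 2] by (simp add: F_def)
 have A: "(\<integral>\<^sup>+x. ennreal (F (- t0 + 1 * x)) \<partial>lborel) = 2" "(\<integral>\<^sup>+x. ennreal (F (t0 + (-1) * x)) \<partial>lborel) = 2"
  using nn_integral_real_affine[of "%x. ennreal (F x)" 1 "- t0"] nn_integral_real_affine[of "%x. ennreal (F x)" "-1" t0] F2
  by simp_all
 have "(\<integral>\<^sup>+t. ennreal (\<bar>t - t0\<bar> powr (-1/2)) * indicator {al..be} t \<partial>lborel)
   <= (\<integral>\<^sup>+t. ennreal (F (- t0 + 1 * t)) + ennreal (F (t0 + (-1) * t)) \<partial>lborel)"
  by (intro nn_integral_mono) (use assms in \<open>auto simp: F_def indicator_def\<close>)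
 also have "... = 2 + 2" using A by (subst nn_integral_add) simp_all
 finally show ?thesis by simp
qed

text \<open>The potential of an arc is bounded, so most points of the arc are not approached closely in
 the mean by a given closed curve.\<close>

lemma good_parameter: fixes P1 P2 ga :: "real => 'a::{second_countable_topology, metric_space}"
 assumes cont [measurable]: "P1 : borel_measurable borel" "P2 : borel_measurable borel" "ga : borel_measurable borel"
  and g: "continuous_on {al..be} ga" and c: "0 < c" and ab: "al < be" "be <= al + 1"
  and low: "!!s t. s : {al..be} ==> t : {al..be} ==> c * \<bar>s - t\<bar> <= dist (ga s) (ga t)" and Z: "countable Z"
 obtains t where "t : {al..be} - Z"
  "(\<integral>\<^sup>+x. ennreal (dist (P1 x) (ga t) powr (-1/2) + dist (P2 x) (ga t) powr (-1/2)) * indicator {0..1} x \<partial>lborel)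
    <= ennreal (16 * (c/2) powr (-1/2) / (be - al))" proof -
 define b where "b = (c/2) powr (-1/2)"
 have b: "0 < b" using c by (simp add: b_def)
 \<comment> \<open>If ga t0 is nearest to q, then dist q (ga t) is at least c / 2 times the distance
   of t from t0, wherever q lies.\<close>
 have inner: "(\<integral>\<^sup>+t. ennreal (dist q (ga t) powr (-1/2)) * indicator {al..be} t \<partial>lborel) <= ennreal (4 * b)" for q
 proof -
  have "continuous_on {al..be} (%t. dist q (ga t))" by (intro continuous_intros g)
  moreover have "{al..be} ~= {}" using ab by simp
  ultimately obtain t0 where t0: "t0 : {al..be}" "!!t. t : {al..be} ==> dist q (ga t0) <= dist q (ga t)"
   using continuous_attains_inf[of "{al..be}" "%t. dist q (ga t)"] compact_Icc by blast
  have pt: "dist q (ga t) powr (-1/2) <= b * \<bar>t - t0\<bar> powr (-1/2)" if t: "t : {al..be}" "t ~= t0" for t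
  proof -
   have "c * \<bar>t - t0\<bar> <= dist (ga t) (ga t0)" by (rule low[OF t(1) t0(1)])
   also have "... <= dist q (ga t) + dist q (ga t0)" by (metis dist_commute dist_triangle)
   finally have "c / 2 * \<bar>t - t0\<bar> <= dist q (ga t)" using t0(2)[OF t(1)] by simp
   hence "dist q (ga t) powr (-1/2) <= (c / 2 * \<bar>t - t0\<bar>) powr (-1/2)"
    using c t(2) by (intro powr_mono2') auto
   also have "... = b * \<bar>t - t0\<bar> powr (-1/2)" unfolding b_def using c by (subst powr_mult) auto
   finally show ?thesis .
  qed
  have "AE t in lborel. t ~= t0" by (rule AE_lborel_singleton)
  hence "(\<integral>\<^sup>+t. ennreal (dist q (ga t) powr (-1/2)) * indicator {al..be} t \<partial>lborel)
    <= (\<integral>\<^sup>+t. ennreal b * (ennreal (\<bar>t - t0\<bar> powr (-1/2)) * indicator {al..be} t) \<partial>lborel)"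
   by (intro nn_integral_mono_AE) (elim eventually_mono, use pt b in \<open>auto simp: indicator_def ennreal_mult[symmetric] intro!: ennreal_leI\<close>)
  also have "... = ennreal b * (\<integral>\<^sup>+t. ennreal (\<bar>t - t0\<bar> powr (-1/2)) * indicator {al..be} t \<partial>lborel)"
   by (rule nn_integral_cmult) measurable
  also have "... <= ennreal b * 4" using t0(1) ab by (intro mult_left_mono nn_integral_inverse_sqrt) auto
  also have "... = ennreal (4 * b)" using b by (simp add: ennreal_mult mult.commute)
  finally show ?thesis .
 qed
 define G where "G x t = ennreal (dist (P1 x) (ga t) powr (-1/2) + dist (P2 x) (ga t) powr (-1/2))" for x t
 have [measurable]: "case_prod G : borel_measurable (borel \<Otimes>\<^sub>M borel)" unfolding G_def by measurable
 \<comment> \<open>Twice the mean: by Fubini the double integral is at most 8 * b, so some parameter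
   off Z has an integral of at most K.\<close>
 define K where "K = 16 * b / (be - al)"
 have K: "0 < K" "K * (be - al) = 16 * b" using b ab by (auto simp: K_def)
 have "EX t:{al..be} - Z. (\<integral>\<^sup>+x. G x t * indicator {0..1} x \<partial>lborel) <= ennreal K"
 proof (rule ccontr)
  assume "~ ?thesis"
  hence big: "ennreal K <= (\<integral>\<^sup>+x. G x t * indicator {0..1} x \<partial>lborel)" if "t : {al..be} - Z" for t
   using that by (meson linear)
  have "AE t in lborel. t ~: Z" by (rule AE_not_in[OF countable_imp_null_set_lborel[OF Z]])
  hence "(\<integral>\<^sup>+t. ennreal K * indicator {al..be} t \<partial>lborel)
    <= (\<integral>\<^sup>+t. (\<integral>\<^sup>+x. G x t * indicator {0..1} x * indicator {al..be} t \<partial>lborel) \<partial>lborel)"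
   by (intro nn_integral_mono_AE) (elim eventually_mono, use big in \<open>auto simp: indicator_def\<close>)
  also have "... = (\<integral>\<^sup>+x. (\<integral>\<^sup>+t. G x t * indicator {0..1} x * indicator {al..be} t \<partial>lborel) \<partial>lborel)"
   by (rule lborel_pair.Fubini') measurable
  also have "... <= (\<integral>\<^sup>+x. ennreal (8 * b) * indicator {0..1} x \<partial>(lborel::real measure))"
  proof (rule nn_integral_mono)
   fix x :: real
   have "(\<integral>\<^sup>+t. G x t * indicator {0..1} x * indicator {al..be} t \<partial>lborel) =
    (\<integral>\<^sup>+t. indicator {0..1} x * (ennreal (dist (P1 x) (ga t) powr (-1/2)) * indicator {al..be} t
     + ennreal (dist (P2 x) (ga t) powr (-1/2)) * indicator {al..be} t) \<partial>lborel)"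
    unfolding G_def by (intro nn_integral_cong) (auto simp: indicator_def)
   also have "... = indicator {0..1} x * ((\<integral>\<^sup>+t. ennreal (dist (P1 x) (ga t) powr (-1/2)) * indicator {al..be} t \<partial>lborel)
     + (\<integral>\<^sup>+t. ennreal (dist (P2 x) (ga t) powr (-1/2)) * indicator {al..be} t \<partial>lborel))"
    by (subst nn_integral_cmult, measurable, subst nn_integral_add, measurable)
   also have "... <= indicator {0..1} x * (ennreal (4 * b) + ennreal (4 * b))" by (intro mult_left_mono add_mono inner) auto
   also have "... = ennreal (8 * b) * indicator {0..1} x" using b by (simp add: ennreal_plus[symmetric] mult.commute del: ennreal_plus)
   finally show "(\<integral>\<^sup>+t. G x t * indicator {0..1} x * indicator {al..be} t \<partial>lborel) <= ennreal (8 * b) * indicator {0..1} x" .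
  qed
  also have "... = ennreal (8 * b)" by (subst nn_integral_cmult_indicator) auto
  finally have "ennreal K * ennreal (be - al) <= ennreal (8 * b)" using ab by (simp add: nn_integral_cmult_indicator)
  hence "K * (be - al) <= 8 * b" using K(1) ab b by (simp add: ennreal_mult[symmetric] ennreal_le_iff)
  thus False using K(2) b by simp
 qed
 thus thesis using that unfolding G_def K_def b_def by blast
qed

text \<open>The modulus of a coordinate with zero at a1 and pole at a3 is a ratio of chordal
  distances up to a constant, so potentials control its logarithm.\<close>

lemma th_difference_chordal: assumes a: "a1 ~= a3" obtains ka where "0 < ka" "!!y. y : RS ==> y ~= sg a3 ==>
  norm (th a3 y - 1 / (a1 - a3)) * dist y (sg a3) = ka * dist y (sg a1)" proof -
 define A where "A k = 1 + (cmod k)^2" for k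
 have A: "A k > 0" for k by (simp add: A_def)
 define ka where "ka = sqrt (A a1 / A a3) / norm (a1 - a3)"
 have ka: "0 < ka" using A a by (simp add: ka_def)
 have ka2: "ka^2 = A a1 / A a3 / (norm (a1 - a3))^2"
  using A[of a1] A[of a3] by (simp add: ka_def power_divide real_sqrt_pow2)
 show thesis proof (rule that[OF ka])
  fix y assume y: "y : RS" "y ~= sg a3"
  have "(norm (th a3 y - 1 / (a1 - a3)) * dist y (sg a3))^2 = (ka * dist y (sg a1))^2"
   using y(1) proof (cases rule: sphere_cases)
   case 1
   have eq: "norm (th a3 y - 1 / (a1 - a3)) = 1 / norm (a1 - a3)" using 1 by (simp add: norm_divide)
   show ?thesis unfolding power_mult_distrib ka2 eq using 1 dist_sg_np[of a1] dist_sg_np[of a3] A[of a1] A[of a3] a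
    by (simp add: dist_commute power_divide A_def[symmetric] field_simps)
  next
   case (2 z)
   hence z: "z ~= a3" using y(2) by auto
   have "th a3 y - 1 / (a1 - a3) = (a1 - z) / ((z - a3) * (a1 - a3))" using 2 z a by (simp add: th_sg field_simps)
   hence eq: "norm (th a3 y - 1 / (a1 - a3)) = norm (z - a1) / (norm (z - a3) * norm (a1 - a3))"
    by (simp add: norm_divide norm_mult norm_minus_commute)
   show ?thesis unfolding power_mult_distrib ka2 eq using 2(1) A[of a1] A[of a3] A[of z] a z
    by (simp add: dist_sg power_divide power_mult_distrib A_def[symmetric] field_simps)
  qed
  thus "norm (th a3 y - 1 / (a1 - a3)) * dist y (sg a3) = ka * dist y (sg a1)"
   using ka by (simp add: power2_eq_iff_nonneg)
 qed
qed

text \<open>The bound 2 is the diameter of the sphere. For s = d powr (-1/2), both signs follow from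
  ln s <= s - 1 and s >= 1/2.\<close>

lemma abs_ln_le_inverse_sqrt: assumes "0 < d" "d <= (2::real)" shows "\<bar>ln d\<bar> <= 2 * d powr (-1/2)"
proof -
 define s where "s = d powr (-1/2)"
 have s: "0 < s" "ln s = - ln d / 2" using assms by (auto simp: s_def ln_powr)
 have "ln s <= s - 1" by (rule ln_le_minus_one[OF s(1)])
 moreover have "ln d <= 2 * s" proof -
  have "2 powr (-1/2) <= s" unfolding s_def using assms by (intro powr_mono2') auto
  moreover have "1 / 2 <= (2::real) powr (-1/2)"
   using powr_mono[of "-1" "-1/2" "2::real"] by (simp add: powr_minus_divide)
  moreover have "ln d <= ln 2" "ln (2::real) <= 2 - 1" using assms ln_le_minus_one[of 2] by auto
  ultimately show ?thesis by linarith
 qed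
 ultimately show ?thesis using s unfolding s_def[symmetric] by linarith
qed

lemma circ_real_countable: "countable {t. cnj (circ t) = circ t}"
proof -
 have "{t. cnj (circ t) = circ t} <= range (%i::int. of_int i / 2)" proof
  fix t assume "t : {t. cnj (circ t) = circ t}"
  hence "Im (circ t) = 0" by (simp add: complex_eq_iff)
  moreover have "Im (circ t) = sin (2 * pi * t) / 2" by (simp add: circ_def Im_exp)
  ultimately obtain i :: int where "2 * pi * t = of_int i * pi" by (auto simp: sin_zero_iff_int2)
  hence "pi * (2 * t) = pi * of_int i" by (simp add: mult_ac)
  hence "t = of_int i / 2" by simp
  thus "t : range (%i::int. of_int i / 2)" by blast
 qed
 thus ?thesis by (rule countable_subset) simp
qed

section \<open>Reflected cross-ratios along the straight piece\<close>

locale straight_plane = rigid_plane + fixes h :: "complex => complex"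
 assumes h_hol: "h holomorphic_on ball 0 1" and h_inj: "inj_on h (ball 0 1)"
  and h_real: "!!z. z : ball 0 1 ==> h z : J <-> Im z = 0"
begin

definition Ph :: "nat => complex => complex*real" where "Ph n x = (T ^^ n) (sg (h x))"

lemma Ph_fm: "fmero (ball 0 1) (Ph n)"
proof -
 note fm = fmeroD[OF it_fm[of n]]
 have hc: "continuous_on (ball 0 1) h" by (rule hol_cont[OF h_hol])
 have "(f n o h) holomorphic_on {x : ball 0 1. Ph n x ~= np}"
  by (rule holomorphic_on_compose_gen[OF holomorphic_on_subset[OF h_hol] hol_f]) (auto simp: Ph_def dm_def)
 moreover have "finite {x : ball 0 1. Ph n x = y}" for y proof -
  have "finite (h -` {z. (T ^^ n) (sg z) = y} Int ball 0 1)" by (rule finite_vimage_IntI[OF finite_fibre h_inj])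
  thus ?thesis by (rule rev_finite_subset) (auto simp: Ph_def)
 qed
 moreover have "continuous_on (ball 0 1) (Ph n)" unfolding Ph_def by (rule continuous_on_compose2[OF fm(2) hc]) auto
 ultimately show ?thesis unfolding fmero_def by (auto simp: Ph_def funpow_in f_def o_def)
qed

lemma Ph_eq_sg: assumes "x : ball 0 1" "a : J" "Ph n x = sg a" shows "h x : J" "f n (h x) = a" "h x : dm n" "cnj x = x"
proof -
 show *: "h x : dm n" "f n (h x) = a" using assms(3) dm_iff[of n "h x" a] by (auto simp: Ph_def)
 show "h x : J" using J_inv[OF *(1)] * assms(2) by simp
 thus "cnj x = x" using h_real[OF assms(1)] by (simp add: complex_eq_iff)
qed

lemma Ph_sg: "h x : dm n ==> Ph n x = sg (f n (h x))" by (simp add: Ph_def sg_f)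

lemma Ph_derivative: assumes x: "x : ball 0 1" and a: "a : J" "a ~: postcrit" "Ph n x = sg a"
 obtains c where "c ~= 0" "((%z. f n (h z)) has_field_derivative c) (at x)" "eventually (%z. Ph n z = sg (f n (h z))) (at x)"
proof -
 note hx = Ph_eq_sg[OF x a(1,3)]
 have d1: "(h has_field_derivative deriv h x) (at x)" by (rule holomorphic_derivI[OF h_hol open_ball x])
 have d2: "(f n has_field_derivative deriv (f n) (h x)) (at (h x))" by (rule holomorphic_derivI[OF hol_f open_dm hx(3)])
 have "deriv (f n) (h x) ~= 0" by (rule postcritD[OF a(2) hx(1,2)])
 moreover have "deriv h x ~= 0" by (rule holomorphic_injective_imp_regular[OF h_hol open_ball h_inj x])
 moreover have "((%z. f n (h z)) has_field_derivative deriv (f n) (h x) * deriv h x) (at x)" by (rule DERIV_chain2[OF d2 d1])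
 moreover have "eventually (%z. h z : dm n) (at x)"
  using DERIV_isCont[OF d1] topological_tendstoD[OF _ open_dm hx(3)] by (simp add: isCont_def)
 hence "eventually (%z. Ph n z = sg (f n (h z))) (at x)" by (rule eventually_mono) (rule Ph_sg)
 ultimately show thesis using that by (metis mult_eq_0_iff)
qed

text \<open>The potential at a of the n-th image of the circle, together with that of the reflected
  parametrization, since the quotient involves both.\<close>

abbreviation "pot n a \<equiv> (\<integral>\<^sup>+t. ennreal (dist (Ph n (circ t)) (sg a) powr (-1/2)
  + dist (Ph n (cnj (circ t))) (sg a) powr (-1/2)) * indicator {0..1} t \<partial>lborel)"

text \<open>Take the reflected quotient E of a coordinate w with zeros over a1 and poles over a3;
  these are simple because a1 and a3 avoid \<open>postcrit\<close>. The potentials bound the mean of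
  the modulus of ln (norm (E x)) on the circle by 4 * K, so a logarithm of E, normalized at 0, is at
  most 16 * K on the disc of radius 1/4. At real points E depends only on f n (h x), so E takes one
  value on X, which \<open>many_zeros_small\<close> compares with E 0.\<close>

lemma reflected_cross_ratio_bound: assumes a: "a1 : J - postcrit" "a3 : J - postcrit" "a1 ~= a3"
  and K: "!!a. a : {a1, a3} ==> pot n a <= ennreal K" "0 <= K"
  and a2: "a2 : J" "a2 ~= a1" "a2 ~= a3" and b: "f n (h 0) ~= a1" "f n (h 0) ~= a3"
  and X: "finite X" "X <= {x : ball 0 (1/16). h x : J & f n (h x) = a2}"
  and c: "!!s. c s = 1 / (s - a3) - 1 / (a1 - a3)"
 shows "norm (cnj (c (f n (h 0))) / c (f n (h 0)) - cnj (c a2) / c a2) <= (exp (16 * K) + 1) / 3 ^ card X"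
proof -
 let ?D = "ball (0::complex) 1"
 define w where "w x = th a3 (Ph n x) - 1 / (a1 - a3)" for x
 define A B where "A = {x:?D. Ph n x = sg a1}" and "B = {x:?D. Ph n x = sg a3}"
 note Pf = fmeroD[OF Ph_fm[of n]]
 have PRS: "Ph n x : RS" if "x : ?D" for x by (rule Pf(3)[OF that])
 have fin: "finite A" "finite B" unfolding A_def B_def by (rule Pf(4)[OF sg_in])+
 have sub: "A <= ?D" "B <= ?D" by (auto simp: A_def B_def)
 have rl: "cnj x = x" if "x : A Un B" for x using that a Ph_eq_sg(4)[of x] by (auto simp: A_def B_def)
 have cD: "cnj z : ?D" if "z : ?D" for z using that by simp
 have wh: "w holomorphic_on ?D - B"
  unfolding w_def by (intro holomorphic_intros holomorphic_on_subset[OF fmero_th[OF Ph_fm]]) (auto simp: B_def)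
 have th1: "th a3 (sg a1) = 1 / (a1 - a3)" using a(3) by (simp add: th_sg)
 have w0: "z : A" if z: "z : ?D - B" "w z = 0" for z proof -
  have "th a3 (Ph n z) = th a3 (sg a1)" using z(2) th1 by (simp add: w_def)
  hence "Ph n z = sg a1" using z(1) a(3) PRS by (intro th_inj[of _ _ a3]) (auto simp: B_def)
  thus ?thesis using z(1) by (simp add: A_def)
 qed
 have wsg: "w x = c (f n (h x))" if "Ph n x = sg (f n (h x))" "f n (h x) ~= a3" for x
  using that by (simp add: w_def c th_sg)
 have zero: "EX l. l ~= 0 & ((%z. w z / (z - x)) \<longlongrightarrow> l) (at x)" if x: "x : A" for x proof -
  have x': "x : ?D" "Ph n x = sg a1" using x by (auto simp: A_def)
  obtain d where d: "d ~= 0" "((%z. f n (h z)) has_field_derivative d) (at x)" "eventually (%z. Ph n z = sg (f n (h z))) (at x)"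
   by (rule Ph_derivative[OF x'(1) _ _ x'(2)]) (use a in auto)
  have fx: "f n (h x) = a1" using Ph_eq_sg(2)[OF x'(1) _ x'(2)] a by blast
  have "((%z. c (f n (h z))) has_field_derivative - d / (a1 - a3)^2) (at x)"
   unfolding c by (rule derivative_eq_intros d(2) refl | use fx a(3) in \<open>simp add: power2_eq_square field_simps\<close>)+
  hence "((%z. (c (f n (h z)) - c (f n (h x))) / (z - x)) \<longlongrightarrow> - d / (a1 - a3)^2) (at x)"
   by (simp add: has_field_derivative_iff)
  moreover have "((%z. f n (h z)) \<longlongrightarrow> a1) (at x)" using DERIV_isCont[OF d(2)] fx by (simp add: isCont_def)
  hence "eventually (%z. f n (h z) ~= a3) (at x)" by (rule tendsto_imp_eventually_ne) (use a(3) in simp)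
  with d(3) have "eventually (%z. (c (f n (h z)) - c (f n (h x))) / (z - x) = w z / (z - x)) (at x)"
   by eventually_elim (simp add: wsg fx c)
  ultimately have "((%z. w z / (z - x)) \<longlongrightarrow> - d / (a1 - a3)^2) (at x)" by (rule Lim_transform_eventually)
  thus ?thesis using d(1) a(3) by (intro exI[of _ "- d / (a1 - a3)^2"]) simp
 qed
 have pole: "EX l. l ~= 0 & ((%z. w z * (z - x)) \<longlongrightarrow> l) (at x)" if x: "x : B" for x proof -
  have x': "x : ?D" "Ph n x = sg a3" using x by (auto simp: B_def)
  obtain d where d: "d ~= 0" "((%z. f n (h z)) has_field_derivative d) (at x)" "eventually (%z. Ph n z = sg (f n (h z))) (at x)"
   by (rule Ph_derivative[OF x'(1) _ _ x'(2)]) (use a in auto)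
  have fx: "f n (h x) = a3" using Ph_eq_sg(2)[OF x'(1) _ x'(2)] a by blast
  have l: "((%z. (f n (h z) - a3) / (z - x)) \<longlongrightarrow> d) (at x)" using d(2) fx by (simp add: has_field_derivative_iff)
  hence "((%z. inverse ((f n (h z) - a3) / (z - x)) - 1 / (a1 - a3) * (z - x)) \<longlongrightarrow> inverse d - 1 / (a1 - a3) * (x - x)) (at x)"
   using d(1) by (intro tendsto_intros)
  moreover have "eventually (%z. (f n (h z) - a3) / (z - x) ~= 0) (at x)" by (rule tendsto_imp_eventually_ne[OF l d(1)])
  with d(3) have "eventually (%z. inverse ((f n (h z) - a3) / (z - x)) - 1 / (a1 - a3) * (z - x) = w z * (z - x)) (at x)"
   by eventually_elim (auto simp: wsg c left_diff_distrib)
  ultimately have "((%z. w z * (z - x)) \<longlongrightarrow> inverse d - 1 / (a1 - a3) * (x - x)) (at x)" by (rule Lim_transform_eventually)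
  thus ?thesis using d(1) by (intro exI[of _ "inverse d"]) simp
 qed
 obtain E where E: "E holomorphic_on ?D" "!!z. z : ?D ==> E z ~= 0" "!!z. z : ?D - (A Un B) ==> E z = cnj (w (cnj z)) / w z"
  by (rule reflected_quotient[OF open_ball cD fin(1) sub(1) fin(2) sub(2) rl wh w0 zero pole]) (assumption | rule that)+
 have Ereal: "E x = cnj (c (f n (h x))) / c (f n (h x))" if x: "x : ?D" "h x : J" "f n (h x) ~= a1" "f n (h x) ~= a3" for x
 proof -
  have P: "Ph n x = sg (f n (h x))" by (rule Ph_sg[OF J_dm[OF x(2)]])
  hence "x : ?D - (A Un B)" using x by (auto simp: A_def B_def)
  moreover have "cnj x = x" using h_real[OF x(1)] x(2) by (simp add: complex_eq_iff)
  ultimately show ?thesis using E(3) wsg[OF P x(4)] by simp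
 qed
 have h0: "h 0 : J" using h_real[of 0] by simp
 have E0: "E 0 = cnj (c (f n (h 0))) / c (f n (h 0))" by (rule Ereal) (use h0 b in auto)
 have nE0: "norm (E 0) = 1" using E0 E(2)[of 0] by (auto simp: norm_divide)
 obtain g where g: "g holomorphic_on ?D" "!!x. x : ?D ==> exp (g x) = E x"
  by (rule holomorphic_logarithm_exists[OF convex_ball open_ball E(1,2), of 0]) auto
 \<comment> \<open>0 is a real point, so E has modulus 1 there; subtracting g 0 leaves real parts
   unchanged and gives the value 0 needed for the mean bound.\<close>
 have Re0: "Re (g 0) = 0" using g(2)[of 0] nE0 by (metis centre_in_ball exp_eq_one_iff norm_exp_eq_Re zero_less_one)
 define G where "G = (%x. g x - g 0)"
 have G: "G holomorphic_on ?D" "G 0 = 0" "!!x. Re (G x) = Re (g x)"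
  using Re0 by (auto simp: G_def intro!: holomorphic_intros g(1))
 have nE: "norm (E x) = exp (Re (G x))" if "x : ?D" for x using g(2)[OF that] by (simp add: G(3) norm_exp_eq_Re[symmetric])
 let ?d = "%a x. dist (Ph n x) (sg a) powr (-1/2)"
 let ?p = "%a t. ?d a (circ t) + ?d a (cnj (circ t))"
 obtain ka where ka: "0 < ka" "!!y. y : RS ==> y ~= sg a3 ==>
  norm (th a3 y - 1 / (a1 - a3)) * dist y (sg a3) = ka * dist y (sg a1)" by (rule th_difference_chordal[OF a(3)]) blast
 have lw: "\<bar>ln (norm (w x)) - ln ka\<bar> <= 2 * (?d a1 x + ?d a3 x)" if x: "x : ?D" "x ~: A" "x ~: B" for x
 proof -
  have d: "0 < dist (Ph n x) (sg a1)" "0 < dist (Ph n x) (sg a3)" using x by (auto simp: A_def B_def)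
  have "dist (Ph n x) (sg t) <= 2" for t
   using norm_triangle_ineq4[of "Ph n x" "sg t"] PRS[OF x(1)] sg_in[of t] by (simp add: dist_norm RS_def)
  hence l: "\<bar>ln (dist (Ph n x) (sg a1))\<bar> <= 2 * ?d a1 x" "\<bar>ln (dist (Ph n x) (sg a3))\<bar> <= 2 * ?d a3 x"
   using abs_ln_le_inverse_sqrt[OF d(1)] abs_ln_le_inverse_sqrt[OF d(2)] by blast+
  have "norm (w x) * dist (Ph n x) (sg a3) = ka * dist (Ph n x) (sg a1)"
   unfolding w_def by (rule ka(2)[OF PRS[OF x(1)]]) (use x in \<open>auto simp: B_def\<close>)
  hence "norm (w x) = ka * dist (Ph n x) (sg a1) / dist (Ph n x) (sg a3)" using d(2) by (simp add: field_simps)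
  hence eq: "ln (norm (w x)) = ln ka + ln (dist (Ph n x) (sg a1)) - ln (dist (Ph n x) (sg a3))"
   using d ka(1) by (simp add: ln_div ln_mult_pos)
  have "\<bar>u - k\<bar> <= 2 * (s1 + s3)" if "u = k + l1 - l3" "\<bar>l1\<bar> <= 2 * s1" "\<bar>l3\<bar> <= 2 * s3" for u k l1 l3 s1 s3 :: real
   using that abs_triangle_ineq4[of l1 l3] by simp
  from this[OF eq l] show ?thesis .
 qed
 define ph where "ph t = (if t : {0..1} then \<bar>Re (G (circ t))\<bar> else 0)" for t
 have "continuous_on {0..1} (%t. G (circ t))"
  by (rule continuous_on_compose2[OF hol_cont[OF G(1)] continuous_on_circ]) auto
 hence co: "continuous_on {0..1} (%t. \<bar>Re (G (circ t))\<bar>)" by (intro continuous_intros)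
 define I where "I = integral {0..1} (%t. \<bar>Re (G (circ t))\<bar>)"
 have "((%t. \<bar>Re (G (circ t))\<bar>) has_integral I) {0..1}"
  unfolding I_def by (rule integrable_integral[OF integrable_continuous_interval[OF co]])
 hence hI: "(ph has_integral I) UNIV" unfolding ph_def by (subst has_integral_restrict_UNIV)
 have "ph = (%t. indicator {0..1} t *\<^sub>R \<bar>Re (G (circ t))\<bar>)" by (auto simp: ph_def indicator_def fun_eq_iff)
 hence "ph : borel_measurable borel" using borel_measurable_continuous_on_indicator[OF _ co] by simp
 hence nI: "(\<integral>\<^sup>+t. ennreal (ph t) \<partial>lborel) = ennreal I"
  by (rule nn_integral_has_integral_lborel[OF _ _ hI]) (simp add: ph_def)
 have Pm: "(%t. Ph n (circ t)) : borel_measurable borel" "(%t. Ph n (cnj (circ t))) : borel_measurable borel"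
  by (intro borel_measurable_continuous_onI continuous_on_compose2[OF Pf(2)] continuous_intros continuous_on_circ; auto)+
 note [measurable] = Pm
 have "AE t in lborel. t ~: {t. cnj (circ t) = circ t}" by (rule AE_not_in[OF countable_imp_null_set_lborel[OF circ_real_countable]])
 hence "(\<integral>\<^sup>+t. ennreal (ph t) \<partial>lborel) <= (\<integral>\<^sup>+t. 2 * (ennreal (?p a1 t) * indicator {0..1} t) +
   2 * (ennreal (?p a3 t) * indicator {0..1} t) \<partial>lborel)"
 proof (intro nn_integral_mono_AE, elim eventually_mono)
  fix t assume t: "t ~: {t. cnj (circ t) = circ t}"
  hence cA: "circ t ~: A Un B" "cnj (circ t) ~: A Un B" using rl by (metis (mono_tags) complex_cnj_cnj mem_Collect_eq)+
  have D: "circ t : ?D" "cnj (circ t) : ?D" by simp_all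
  have wn: "w (circ t) ~= 0" "w (cnj (circ t)) ~= 0" using w0[of "circ t"] w0[of "cnj (circ t)"] cA D by auto
  have ex: "exp (Re (G (circ t))) = norm (w (cnj (circ t))) / norm (w (circ t))"
   using nE[OF D(1)] E(3)[of "circ t"] cA D by (simp add: norm_divide)
  have eq: "Re (G (circ t)) = ln (norm (w (cnj (circ t)))) - ln (norm (w (circ t)))"
   using arg_cong[OF ex, of ln] wn by (simp add: ln_div)
  have "\<bar>Re (G (circ t))\<bar> <= 2 * (?d a1 (circ t) + ?d a3 (circ t)) + 2 * (?d a1 (cnj (circ t)) + ?d a3 (cnj (circ t)))"
  proof -
   have l: "\<bar>ln (norm (w (circ t))) - ln ka\<bar> <= 2 * (?d a1 (circ t) + ?d a3 (circ t))"
    "\<bar>ln (norm (w (cnj (circ t)))) - ln ka\<bar> <= 2 * (?d a1 (cnj (circ t)) + ?d a3 (cnj (circ t)))"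
    by (rule lw[OF D(1)] lw[OF D(2)]; use cA in blast)+
   have "\<bar>r\<bar> <= s + s'" if "r = v - u" "\<bar>u - k\<bar> <= s" "\<bar>v - k\<bar> <= s'" for r u v k s s' :: real
    using that abs_triangle_ineq4[of "v - k" "u - k"] by simp
   from this[OF eq l] show ?thesis .
  qed
  hence "ennreal \<bar>Re (G (circ t))\<bar> <= ennreal (2 * (?p a1 t) + 2 * (?p a3 t))" by (intro ennreal_leI) simp
  also have "... = 2 * ennreal (?p a1 t) + 2 * ennreal (?p a3 t)" proof -
   have "ennreal (2 * r + 2 * s) = 2 * ennreal r + 2 * ennreal s" if "0 <= r" "0 <= s" for r s
    using that by (simp add: ennreal_mult)
   thus ?thesis by simp
  qed
  finally show "ennreal (ph t) <= 2 * (ennreal (?p a1 t) * indicator {0..1} t) +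
   2 * (ennreal (?p a3 t) * indicator {0..1} t)" by (auto simp: ph_def)
 qed
 also have "... = 2 * (\<integral>\<^sup>+t. ennreal (?p a1 t) * indicator {0..1} t \<partial>lborel) +
   2 * (\<integral>\<^sup>+t. ennreal (?p a3 t) * indicator {0..1} t \<partial>lborel)"
  by (subst nn_integral_add, measurable, subst (1 2) nn_integral_cmult, measurable)
 also have "... <= 2 * ennreal K + 2 * ennreal K" by (intro add_mono mult_left_mono K(1)) auto
 also have "... = ennreal (4 * K)" using K(2) by (simp add: ennreal_mult' distrib_right[symmetric])
 finally have "I <= 4 * K" unfolding nI using K(2) by (simp add: ennreal_le_iff)
 hence Gb: "norm (G z) <= 4 * (4 * K)" if "norm z <= 1/4" for z
  using that unfolding I_def by (intro holomorphic_bound_by_mean_Re[OF G(1,2)])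
 define ep where "ep = cnj (c a2) / c a2"
 have nep: "norm ep <= 1" by (cases "c a2 = 0") (auto simp: ep_def norm_divide)
 have "norm (E 0 - ep) <= (exp (16 * K) + 1) / 3 ^ card X" proof (rule many_zeros_small[OF X(1)])
  show "X <= ball 0 (1/16)" using X(2) by blast
  show "(%x. E x - ep) holomorphic_on ?D" by (intro holomorphic_intros E(1))
  show "E x - ep = 0" if "x : X" for x proof -
   have "x : ball 0 (1/16)" "h x : J" "f n (h x) = a2" using X(2) that by blast+
   thus ?thesis using Ereal[of x] a2 by (simp add: ep_def)
  qed
  fix z :: complex assume z: "norm z <= 1/4"
  have "Re (G z) <= 16 * K" using Gb[OF z] complex_Re_le_cmod[of "G z"] by linarith
  hence "norm (E z) <= exp (16 * K)" using nE[of z] z by simp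
  thus "norm (E z - ep) <= exp (16 * K) + 1" using norm_triangle_ineq4[of "E z" ep] nep by linarith
 qed
 thus ?thesis unfolding E0 ep_def .
qed

end

lemma dist_Pair_le: "dist (a, b) (c, d) <= dist a c + dist b d"
 unfolding dist_Pair_Pair by (rule sqrt_sum_squares_le_sum) auto

lemma unimodular_quotient_eq_imp_real: assumes "cnj u / u = cnj v / v" "u ~= 0" "v ~= (0::complex)"
 obtains t where "v = of_real t * u" proof -
 have "cnj (v / u) = v / u" using assms by (simp add: field_simps)
 hence "v / u : \<real>" by (simp add: Reals_cnj_iff)
 thus thesis using that assms(2) by (auto elim!: Reals_cases simp: field_simps)
qed

context straight_plane
begin

text \<open>The inverse of h is Lipschitz on a compact set; this supplies the hypothesis
  \<open>low\<close> of \<open>good_parameter\<close> for the arc.\<close>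

lemma h_chordal_lower: obtains c where "0 < c" "!!s t. s : {-1/2..1/2} ==> t : {-1/2..1/2} ==>
  c * \<bar>s - t\<bar> <= dist (sg (h (of_real s))) (sg (h (of_real t)))" proof -
 have sub: "cball 0 (1/2) <= ball (0::complex) 1" by auto
 let ?K = "h ` cball 0 (1/2)"
 have cK: "compact ?K" using continuous_on_subset[OF hol_cont[OF h_hol] sub] by (intro compact_image) auto
 obtain g where g: "g holomorphic_on h ` ball 0 1" "!!z. z : ball 0 1 ==> g (h z) = z"
  using holomorphic_inverse_ex[OF h_hol open_ball h_inj] by metis
 obtain C where C: "0 < C" "!!x y. x : ?K ==> y : ?K ==> dist (g x) (g y) <= C * dist x y"
  by (rule holomorphic_lipschitz_on_compact[OF g(1) open_mapping_thm3[OF h_hol open_ball h_inj] cK]) (use sub in auto)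
 obtain R where R: "!!x. x : ?K ==> norm x <= R" using compact_imp_bounded[OF cK] unfolding bounded_iff by blast
 define Q where "Q = 1 + R^2"
 have p: "0 < Q" by (simp add: Q_def add_pos_nonneg)
 show thesis proof (rule that[of "2 / (C * Q)"])
  show "0 < 2 / (C * Q)" using C p by simp
  fix s t :: real assume "s : {-1/2..1/2}" "t : {-1/2..1/2}"
  hence st: "of_real s : cball (0::complex) (1/2)" "of_real t : cball (0::complex) (1/2)" by (auto simp: abs_le_iff)
  hence K: "h (of_real s) : ?K" "h (of_real t) : ?K" by blast+
  have "\<bar>s - t\<bar> = dist (g (h (of_real s))) (g (h (of_real t)))"
   using g(2) st sub by (simp add: subset_iff dist_norm of_real_diff[symmetric] del: of_real_diff)
  also have "... <= C * dist (h (of_real s)) (h (of_real t))" by (rule C(2)[OF K])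
  finally have "2 * \<bar>s - t\<bar> <= C * (2 * dist (h (of_real s)) (h (of_real t)))" by simp
  also have "... <= C * (Q * dist (sg (h (of_real s))) (sg (h (of_real t))))"
   using C(1) by (intro mult_left_mono dist_sg_ge[of _ R, folded Q_def] R K) auto
  finally show "2 / (C * Q) * \<bar>s - t\<bar> <= dist (sg (h (of_real s))) (sg (h (of_real t)))"
   using C(1) p by (simp add: field_simps)
 qed
qed

lemma good_arc_point: assumes cc: "0 < cc" "!!s t. s : {-1/2..1/2} ==> t : {-1/2..1/2} ==>
   cc * \<bar>s - t\<bar> <= dist (sg (h (of_real s))) (sg (h (of_real t)))"
  and t: "0 <= t" "0 < et" "t + et <= 1/2" obtains s where "s : {t..t+et}" "h (of_real s) : J - postcrit"
  "pot n (h (of_real s)) <= ennreal (16 * (cc/2) powr (-1/2) / et)" proof -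
 \<comment> \<open>Clamping the parameter makes the curve continuous on the whole line, as needed
   for measurability.\<close>
 define ga where "ga s = sg (h (of_real (max 0 (min s (1/2)))))" for s :: real
 have ga: "ga s = sg (h (of_real s))" if "s : {t..t+et}" for s using that t by (simp add: ga_def max_def min_def)
 have hc: "continuous_on (ball 0 1) h" by (rule hol_cont[OF h_hol])
 have g: "continuous_on UNIV ga" unfolding ga_def
  by (intro continuous_on_sg continuous_on_compose2[OF hc] continuous_intros) auto
 define Z where "Z = {s : {0..1/2}. h (of_real s) : postcrit}"
 have "inj_on (%s. h (of_real s)) Z" by (rule inj_onI) (auto simp: Z_def dest!: inj_onD[OF h_inj])
 moreover have "countable ((%s. h (of_real s)) ` Z)" by (rule countable_subset[OF _ countable_postcrit]) (auto simp: Z_def)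
 ultimately have Z: "countable Z" by (rule countable_image_inj_on[rotated])
 note Pc = fmeroD(2)[OF Ph_fm[of n]]
 have Pm: "(%t. Ph n (circ t)) : borel_measurable borel" "(%t. Ph n (cnj (circ t))) : borel_measurable borel"
  by (intro borel_measurable_continuous_onI continuous_on_compose2[OF Pc] continuous_intros continuous_on_circ; auto)+
 obtain s where s: "s : {t..t+et} - Z"
  "(\<integral>\<^sup>+x. ennreal (dist (Ph n (circ x)) (ga s) powr (-1/2) + dist (Ph n (cnj (circ x))) (ga s) powr (-1/2)) * indicator {0..1} x \<partial>lborel)
    <= ennreal (16 * (cc/2) powr (-1/2) / (t + et - t))"
 proof (rule good_parameter[OF Pm borel_measurable_continuous_onI[OF g] continuous_on_subset[OF g] cc(1) _ _ _ Z])
  show "cc * \<bar>s - s'\<bar> <= dist (ga s) (ga s')" if "s : {t..t+et}" "s' : {t..t+et}" for s s'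
   unfolding ga[OF that(1)] ga[OF that(2)] using that t by (intro cc(2)) auto
 qed (use t in auto)
 have "s : {0..1/2}" using s(1) t by auto
 hence "h (of_real s) : J" "h (of_real s) ~: postcrit" using h_real[of "of_real s"] s(1) by (auto simp: Z_def)
 thus thesis using that[of s] s ga[of s] by simp
qed

text \<open>The claim says that 1 / (z - b3) lies on a fixed line for z in J. If it failed at z,
  continuity would keep the difference of reflected cross-ratios above ka for all points near b1, b3
  and l, whereas \<open>reflected_cross_ratio_bound\<close> makes it smaller for suitable a1, a3 and
  f n (h 0). These depend on n, hence the detour over neighbourhoods.\<close>

lemma J_in_circle:
 obtains k p c where "c ~= 0" "k : J" "!!z. z : J ==> z ~= k ==> EX t. 1 / (z - k) = p + of_real t * c" proof -
 obtain cc where cc: "0 < cc" "!!s t. s : {-1/2..1/2} ==> t : {-1/2..1/2} ==>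
   cc * \<bar>s - t\<bar> <= dist (sg (h (of_real s))) (sg (h (of_real t)))" by (rule h_chordal_lower) blast
 have hJ: "h (of_real t) : J" if "\<bar>t\<bar> < 1" for t using h_real[of "of_real t"] that by simp
 have h0: "h 0 : J" using hJ[of 0] by simp
 have "ALL n. f n (h 0) : J" using f_in_J[OF h0] by blast
 then obtain l r where l: "l : J" "strict_mono (r :: nat => nat)" "((%n. f n (h 0)) o r) \<longlonglongrightarrow> l"
  using compact_J unfolding compact_def by (metis (mono_tags))
 have dist3: "h (of_real s) ~= h (of_real t)" if "\<bar>s\<bar> < 1" "\<bar>t\<bar> < 1" "s ~= t" for s t
  using inj_onD[OF h_inj, of "of_real s" "of_real t"] that by auto
 \<comment> \<open>h is injective, so at most one of the parameters 0, 1/8 and 1/4 is mapped to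
   l.\<close>
 have "EX t1 t3. t1 : {0..1/4} & t3 : {0..1/4} & h (of_real t1) ~= l & h (of_real t3) ~= l & t1 ~= t3"
 proof (cases "h (of_real 0) = l")
  case True
  thus ?thesis using dist3[of 0 "1/8"] dist3[of 0 "1/4"] by (intro exI[of _ "1/8"] exI[of _ "1/4"]) auto
 next
  case False
  show ?thesis proof (cases "h (of_real (1/4)) = l")
   case True
   thus ?thesis using False dist3[of "1/4" "1/8"] by (intro exI[of _ "1/8"] exI[of _ 0]) auto
  next
   case F: False
   thus ?thesis using False by (intro exI[of _ "1/4"] exI[of _ 0]) auto
  qed
 qed
 then obtain t1 t3 where t: "t1 : {0..1/4}" "t3 : {0..1/4}" "h (of_real t1) ~= l" "h (of_real t3) ~= l" "t1 ~= t3" by blast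
 define b1 b3 where "b1 = h (of_real t1)" and "b3 = h (of_real t3)"
 have b13: "b1 ~= b3" "b1 ~= l" "b3 ~= l" using t dist3[of t1 t3] by (auto simp: b1_def b3_def)
 have b3J: "b3 : J" unfolding b3_def using t(2) by (intro hJ) auto
 define c where "c = 1 / (l - b3) - 1 / (b1 - b3)"
 have c0: "c ~= 0" using b13 by (simp add: c_def)
 have claim: "cnj c / c = cnj (1 / (z - b3) - 1 / (b1 - b3)) / (1 / (z - b3) - 1 / (b1 - b3))"
  if z: "z : J" "z ~= b1" "z ~= b3" for z proof (rule ccontr)
  assume ne: "~ ?thesis"
  define Ps where "Ps = (%v::complex \<times> complex \<times> complex. let a1 = fst v; a3 = fst (snd v); b = snd (snd v) in
    cnj (1 / (b - a3) - 1 / (a1 - a3)) / (1 / (b - a3) - 1 / (a1 - a3)) -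
    cnj (1 / (z - a3) - 1 / (a1 - a3)) / (1 / (z - a3) - 1 / (a1 - a3)))"
  define v0 where "v0 = (b1, b3, l)"
  have n0: "Ps v0 ~= 0" using ne by (simp add: Ps_def v0_def c_def)
  have nz: "1 / (z - b3) - 1 / (b1 - b3) ~= 0" using z b13 by simp
  have "isCont Ps v0" unfolding Ps_def Let_def
   by (intro continuous_intros) (use b13 z nz c0 in \<open>auto simp: v0_def c_def\<close>)
  moreover define ka where "ka = norm (Ps v0) / 2"
  have ka: "0 < ka" using n0 by (simp add: ka_def)
  ultimately obtain de0 where de0: "0 < de0" "!!v. dist v v0 < de0 ==> dist (Ps v) (Ps v0) < ka"
   unfolding continuous_at_eps_delta by blast
  have big: "ka < norm (Ps v)" if "dist v v0 < de0" for v proof -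
   have "norm (Ps v0) <= norm (Ps v) + dist (Ps v) (Ps v0)"
    using norm_triangle_sub[of "Ps v0" "Ps v"] by (simp add: dist_norm norm_minus_commute)
   thus ?thesis using de0(2)[OF that] by (simp add: ka_def)
  qed
  define de where "de = Min {de0, dist b1 b3, dist b1 l, dist b3 l, dist z b1, dist z b3} / 3"
  have de: "0 < de" unfolding de_def using de0(1) b13 z by auto
  have dele: "3 * de <= de0" "3 * de <= dist b1 b3" "3 * de <= dist b1 l" "3 * de <= dist b3 l" "3 * de <= dist z b1" "3 * de <= dist z b3"
   by (simp_all add: de_def)
  have near: "EX et>0. et <= 1/4 & (ALL s:{t..t+et}. dist (h (of_real s)) (h (of_real t)) < de)" if t: "t : {0..1/4}" for t
  proof -
   have "(of_real t :: complex) : ball 0 1" using t by simp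
   hence "isCont h (of_real t)" using hol_cont[OF h_hol] by (simp add: continuous_on_eq_continuous_at)
   then obtain d where d: "0 < d" "!!x. dist x (of_real t) < d ==> dist (h x) (h (of_real t)) < de"
    using de unfolding continuous_at_eps_delta by blast
   have "dist (h (of_real s)) (h (of_real t)) < de" if "s : {t..t + min (d/2) (1/4)}" for s proof (rule d(2))
    have "dist (of_real s :: complex) (of_real t) = \<bar>s - t\<bar>" by (simp add: dist_norm of_real_diff[symmetric] del: of_real_diff)
    also have "... < d" using that d(1) by auto
    finally show "dist (of_real s :: complex) (of_real t) < d" .
   qed
   thus ?thesis using d(1) by (intro exI[of _ "min (d/2) (1/4)"]) auto
  qed
  obtain et1 where e1: "0 < et1" "et1 <= 1/4" "!!s. s : {t1..t1+et1} ==> dist (h (of_real s)) b1 < de"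
   using near[OF t(1)] unfolding b1_def by blast
  obtain et3 where e3: "0 < et3" "et3 <= 1/4" "!!s. s : {t3..t3+et3} ==> dist (h (of_real s)) b3 < de"
   using near[OF t(2)] unfolding b3_def by blast
  define et where "et = min et1 et3"
  have et: "0 < et" "et <= 1/4" "et <= et1" "et <= et3" using e1 e3 by (auto simp: et_def)
  \<comment> \<open>K depends only on cc and the length et of the parameter intervals. So L, and
    then n with at least L preimages of z near h 0, can be chosen after it.\<close>
  define K where "K = 16 * (cc/2) powr (-1/2) / et"
  have K: "0 <= K" using et(1) by (simp add: K_def)
  obtain L where L: "(exp (16 * K) + 1) / ka < 3 ^ L" using real_arch_pow[of 3] by auto
  have "open (h ` ball 0 (1/16))"
   by (rule open_mapping_thm3[OF holomorphic_on_subset[OF h_hol] open_ball inj_on_subset[OF h_inj]]) auto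
  moreover have "h 0 : h ` ball 0 (1/16)" by simp
  ultimately obtain d where d: "0 < d" "ball (h 0) d <= h ` ball 0 (1/16)" by (metis open_contains_ball)
  obtain N where N: "!!n a. N <= n ==> a : J ==> EX X. finite X & card X = L & X <= {q:J Int ball (h 0) d. f n q = a}"
   by (rule many_preimages[OF h0 d(1)]) blast
  have "eventually (%j. dist (((%n. f n (h 0)) o r) j) l < de) sequentially" by (rule tendstoD[OF l(3) de])
  then obtain j where j: "N <= j" "dist (f (r j) (h 0)) l < de"
   unfolding eventually_sequentially by (metis comp_apply nat_le_linear)
  define n where "n = r j"
  have nN: "N <= n" using j(1) seq_suble[OF l(2), of j] by (simp add: n_def)
  have b: "dist (f n (h 0)) l < de" using j(2) by (simp add: n_def)
  obtain s1 where s1: "s1 : {t1..t1+et}" "h (of_real s1) : J - postcrit" "pot n (h (of_real s1)) <= ennreal K"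
   unfolding K_def by (rule good_arc_point[OF cc]) (use t(1) et in auto)
  obtain s3 where s3: "s3 : {t3..t3+et}" "h (of_real s3) : J - postcrit" "pot n (h (of_real s3)) <= ennreal K"
   unfolding K_def by (rule good_arc_point[OF cc]) (use t(2) et in auto)
  define a1 a3 where "a1 = h (of_real s1)" and "a3 = h (of_real s3)"
  have a: "dist a1 b1 < de" "dist a3 b3 < de" unfolding a1_def a3_def
   using e1(3)[of s1] e3(3)[of s3] s1(1) s3(1) et(3,4) by auto
  have sep: "x ~= x'" if "dist x y < de" "dist x' y' < de" "3 * de <= dist y y'" for x x' y y' :: complex
   using that dist_triangle2[of y y' x] de by (auto simp: dist_commute)
  have ds: "a1 ~= a3" "f n (h 0) ~= a1" "f n (h 0) ~= a3" "z ~= a1" "z ~= a3"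
   using sep[OF a dele(2)] sep[OF a(1) b dele(3)] sep[OF a(2) b dele(4)] sep[OF _ a(1) dele(5)] sep[OF _ a(2) dele(6)] de by auto
  obtain X where X: "finite X" "card X = L" "X <= {q:J Int ball (h 0) d. f n q = z}" using N[OF nN z(1)] by blast
  define X' where "X' = {x : ball 0 (1/16). h x : X}"
  have "X <= h ` ball 0 (1/16)" using X(3) d(2) by blast
  hence hX': "h ` X' = X" unfolding X'_def by blast
  have "inj_on h X'" by (rule inj_on_subset[OF h_inj]) (auto simp: X'_def)
  hence X': "finite X'" "card X' = L" using hX' X(1,2) card_image finite_image_iff by metis+
  have nm: "norm (Ps (a1, a3, f n (h 0))) <= (exp (16 * K) + 1) / 3 ^ card X'"
   unfolding Ps_def Let_def fst_conv snd_conv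
  proof (rule reflected_cross_ratio_bound[of a1 a3 n K z X' "%s. 1 / (s - a3) - 1 / (a1 - a3)"])
   show "a1 : J - postcrit" "a3 : J - postcrit" using s1(2) s3(2) by (simp_all add: a1_def a3_def)
   show "pot n a <= ennreal K" if "a : {a1, a3}" for a using that s1(3) s3(3) unfolding a1_def a3_def by blast
   show "X' <= {x : ball 0 (1/16). h x : J & f n (h x) = z}" using X(3) by (auto simp: X'_def)
  qed (use ds K z X' in auto)
  have "dist (a1, a3, f n (h 0)) v0 <= dist a1 b1 + (dist a3 b3 + dist (f n (h 0)) l)"
   unfolding v0_def using dist_Pair_le[of a1 "(a3, f n (h 0))" b1 "(b3, l)"] dist_Pair_le[of a3 "f n (h 0)" b3 l] by linarith
  also have "... < de0" using a b dele(1) by linarith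
  finally have "ka < norm (Ps (a1, a3, f n (h 0)))" by (rule big)
  hence "ka < (exp (16 * K) + 1) / 3 ^ L" using nm X'(2) by simp
  moreover have "exp (16 * K) + 1 < ka * 3 ^ L" using L ka by (simp add: field_simps)
  ultimately show False by (simp add: field_simps)
 qed
 show thesis proof (rule that[OF c0 b3J])
  fix z assume z: "z : J" "z ~= b3"
  show "EX t. 1 / (z - b3) = 1 / (b1 - b3) + of_real t * c" proof (cases "z = b1")
   case True
   thus ?thesis by (intro exI[of _ 0]) simp
  next
   case False
   hence "1 / (z - b3) - 1 / (b1 - b3) ~= 0" using z b13 by simp
   then obtain t where "1 / (z - b3) - 1 / (b1 - b3) = of_real t * c"
    by (rule unimodular_quotient_eq_imp_real[OF claim[OF z(1) False z(2)] c0])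
   thus ?thesis by (intro exI[of _ t]) (simp add: algebra_simps)
  qed
 qed
qed

end

section \<open>Radial points on the sphere and in the plane\<close>

context julia_plane
begin

text \<open>J is at positive distance from \<open>np\<close> on the sphere, and away from
  \<open>np\<close> the coordinate is uniformly continuous.\<close>

lemma zt_near_J: assumes e: "0 < e"
 obtains ep where "0 < ep" "!!w y. w : J ==> y : RS ==> dist y (sg w) < ep ==> y ~= np & dist (zt y) w < e" proof -
 have "closed (sg ` J)" using compact_Jul Jul_eq compact_imp_closed by metis
 then obtain d where d: "0 < d" "!!y. y : sg ` J ==> d <= dist np y"
  using separate_point_closed[of "sg ` J" np] by force
 define C where "C = RS Int {y. d/2 <= dist np y}"
 have "closed {y::complex*real. d/2 <= dist np y}" by (intro closed_Collect_le continuous_intros)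
 hence "compact C" unfolding C_def by (rule compact_Int_closed[OF compact_RS])
 moreover have "continuous_on C zt" by (rule continuous_on_subset[OF continuous_on_zt]) (use d(1) in \<open>auto simp: C_def\<close>)
 ultimately have "uniformly_continuous_on C zt" by (rule compact_uniformly_continuous[rotated])
 then obtain ep1 where ep1: "0 < ep1" "!!y y'. y : C ==> y' : C ==> dist y' y < ep1 ==> dist (zt y') (zt y) < e"
  unfolding uniformly_continuous_on_def using e by blast
 show thesis proof (rule that[of "min ep1 (d/2)"])
  show "0 < min ep1 (d/2)" using ep1(1) d(1) by simp
  fix w y assume w: "w : J" and y: "y : RS" "dist y (sg w) < min ep1 (d/2)"
  have dw: "d <= dist np (sg w)" by (rule d(2)[OF imageI[OF w]])
  hence "d/2 <= dist np y" using y(2) dist_triangle[of np "sg w" y] by simp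
  hence "y : C" "sg w : C" using y(1) dw d(1) by (auto simp: C_def)
  hence "dist (zt y) (zt (sg w)) < e" using y(2) by (intro ep1(2)) auto
  thus "y ~= np & dist (zt y) w < e" using `d/2 <= dist np y` d(1) by auto
 qed
qed

text \<open>\<open>sg\<close> is 2-Lipschitz, hence the scale ep/2. The branches become holomorphic
  by \<open>continuous_section_holomorphic\<close>.\<close>

lemma radial_imp_Lset: assumes z: "z : J" and r: "sg z : radial_julia_set T RS"
 shows "z : (UN k. Lset (1 / real (Suc k)))"
proof -
 obtain ep n ph where ep: "0 < ep" and br: "!!j. continuous_on (RS Int ball ((T ^^ n j) (sg z)) ep) (ph j) &
     ph j ` (RS Int ball ((T ^^ n j) (sg z)) ep) <= RS &
     (ALL y : RS Int ball ((T ^^ n j) (sg z)) ep. (T ^^ n j) (ph j y) = y) & ph j ((T ^^ n j) (sg z)) = sg z"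
  and lim: "(%j. diameter (ph j ` (RS Int ball ((T ^^ n j) (sg z)) ep))) \<longlonglongrightarrow> 0"
  using r unfolding radial_julia_set_def by blast
 have "z : Lset (ep/2)" unfolding Lset_def proof (intro CollectI conjI z allI impI)
  fix et :: real assume et: "0 < et"
  obtain de where de: "0 < de" "!!w y. w : J ==> y : RS ==> dist y (sg w) < de ==> y ~= np & dist (zt y) w < et"
   using zt_near_J[OF et] by blast
  have "eventually (%j. diameter (ph j ` (RS Int ball ((T ^^ n j) (sg z)) ep)) < de) sequentially"
   by (rule order_tendstoD(2)[OF lim de(1)])
  then obtain j where j: "diameter (ph j ` (RS Int ball ((T ^^ n j) (sg z)) ep)) < de" by (auto simp: eventually_sequentially)
  define w where "w = f (n j) z"
  have Tz: "(T ^^ n j) (sg z) = sg w" unfolding w_def using sg_f[OF J_dm[OF z]] by simp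
  let ?B = "RS Int ball (sg w) ep"
  have ph: "continuous_on ?B (ph j)" "ph j ` ?B <= RS" "!!y. y : ?B ==> (T ^^ n j) (ph j y) = y" "ph j (sg w) = sg z"
   using br[of j] unfolding Tz by blast+
  have sB: "sg v : ?B" if "v : ball w (ep/2)" for v using dist_sg_le[of w v] that by simp
  have near: "ph j y ~= np" "dist (zt (ph j y)) z < et" if y: "y : ?B" for y proof -
   have bd: "bounded (ph j ` ?B)" using ph(2) compact_RS compact_imp_bounded bounded_subset by blast
   have "sg w : ?B" using ep by simp
   hence "sg z : ph j ` ?B" using ph(4) by (metis imageI)
   hence "dist (ph j y) (sg z) <= diameter (ph j ` ?B)" using y by (intro diameter_bounded_bound[OF bd]) auto
   hence "dist (ph j y) (sg z) < de" using j unfolding Tz by linarith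
   thus "ph j y ~= np" "dist (zt (ph j y)) z < et" using de(2)[OF z] ph(2) y by blast+
  qed
  define ps where "ps v = zt (ph j (sg v))" for v
  have sgps: "sg (ps v) = ph j (sg v)" if v: "v : ball w (ep/2)" for v
   unfolding ps_def using near(1)[OF sB[OF v]] ph(2) sB[OF v] by (intro sg_zt) blast+
  have sec: "ps v : dm (n j)" "f (n j) (ps v) = v" if v: "v : ball w (ep/2)" for v
   using ph(3)[OF sB[OF v]] dm_iff[of "n j" "ps v" v] sgps[OF v] by auto
  have im: "sg ` ball w (ep/2) <= ?B" using sB by blast
  have c1: "continuous_on (ball w (ep/2)) (%v. ph j (sg v))"
   by (rule continuous_on_compose2[OF ph(1) continuous_on_sg[OF continuous_on_id] im])
  have "continuous_on (ball w (ep/2)) ps" unfolding ps_def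
  proof (rule continuous_on_compose2[OF continuous_on_zt c1], rule image_subsetI)
   fix v assume v: "v : ball w (ep/2)"
   have "ph j (sg v) : RS" using ph(2) sB[OF v] by blast
   thus "ph j (sg v) : RS - {np}" using near(1)[OF sB[OF v]] by simp
  qed
  hence "ps holomorphic_on ball w (ep/2)"
   by (rule continuous_section_holomorphic[OF hol_f open_dm _ open_ball]) (use sec in auto)
  hence "br (n j) (f (n j) z) (ep/2) ps" unfolding br_def w_def[symmetric] using sec by blast
  moreover have "ps (f (n j) z) = z" unfolding w_def[symmetric] ps_def ph(4) by simp
  moreover have "ps ` ball (f (n j) z) (ep/2) <= ball z et" unfolding w_def[symmetric] proof (rule image_subsetI)
   fix v assume "v : ball w (ep/2)"
   hence "dist (ps v) z < et" unfolding ps_def by (intro near(2) sB)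
   thus "ps v : ball z et" by (simp add: dist_commute)
  qed
  ultimately show "EX n ph. br n (f n z) (ep/2) ph & ph (f n z) = z & ph ` ball (f n z) (ep/2) <= ball z et" by blast
 qed
 moreover obtain k where "1 / real (Suc k) < ep/2" using ep nat_approx_posE[of "ep/2"] by auto
 ultimately show ?thesis using Lset_mono[of "1 / real (Suc k)" "ep/2"] by auto
qed

text \<open>Each of the iterates up to order N maps a small enough disc about z into a disc of
  radius e/2. A branch from the whole disc of radius e that lands there therefore has order above
  N.\<close>

lemma Lset_late_branch: assumes z: "z : Lset e" and e: "0 < e" and et: "0 < et"
 obtains n ph where "N < n" "br n (f n z) e ph" "ph (f n z) = z" "ph ` ball (f n z) e <= ball z et" proof -
 have zJ: "z : J" using z Lset_J by blast
 have "EX d>0. ALL x:ball z d. dist (f n x) (f n z) < e/2" for n proof -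
  have "isCont (f n) z" using hol_cont[OF hol_f] continuous_on_eq_continuous_at[OF open_dm] J_dm[OF zJ] by blast
  thus ?thesis using e unfolding continuous_at_eps_delta by (metis dist_commute half_gt_zero mem_ball)
 qed
 then obtain d where d: "!!n. 0 < d n" "!!n x. x : ball z (d n) ==> dist (f n x) (f n z) < e/2" by metis
 obtain d0 where d0: "0 < d0" "!!n. n : {..N} ==> d0 <= d n" using finite_pos_lower_bound[of "{..N}" d] d(1) by auto
 have m: "0 < min d0 et" using d0(1) et by simp
 obtain n ph where n: "br n (f n z) e ph" "ph (f n z) = z" "ph ` ball (f n z) e <= ball z (min d0 et)" by (rule LsetD[OF z m])
 have "N < n" proof (rule ccontr)
  assume "~ N < n"
  hence dn: "d0 <= d n" using d0(2) by simp
  define y where "y = f n z + of_real (e/2)"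
  have y: "y : ball (f n z) e" "dist y (f n z) = e/2" using e by (simp_all add: y_def dist_norm)
  have "ph y : ball z (min d0 et)" using n(3) y(1) by blast
  hence "dist (f n (ph y)) (f n z) < e/2" using dn by (intro d(2)) auto
  thus False using brD(3)[OF n(1) y(1)] y(2) by simp
 qed
 moreover have "ball z (min d0 et) <= ball z et" by auto
 ultimately show thesis using that n by blast
qed

lemma Lset_imp_radial: assumes z: "z : Lset e" and e: "0 < e" shows "sg z : radial_julia_set T RS"
proof -
 have zJ: "z : J" using z Lset_J by blast
 define P where "P j n <-> (EX ph. br n (f n z) e ph & ph (f n z) = z & ph ` ball (f n z) e <= ball z (1 / real (Suc j)))" for j n
 have late: "EX n. P j n & N < n" for j N proof -
  obtain n ph where "N < n" "br n (f n z) e ph" "ph (f n z) = z" "ph ` ball (f n z) e <= ball z (1 / real (Suc j))"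
   by (rule Lset_late_branch[OF z e, of "1 / real (Suc j)"]) simp
  thus ?thesis unfolding P_def by blast
 qed
 have "EX n. ALL j. P j (n j) & n j < n (Suc j)" by (rule dependent_nat_choice) (use late in blast)+
 then obtain n where n: "!!j. P j (n j)" "!!j. n j < n (Suc j)" by blast
 obtain ph where ph: "!!j. br (n j) (f (n j) z) e (ph j)" "!!j. ph j (f (n j) z) = z"
  "!!j. ph j ` ball (f (n j) z) e <= ball z (1 / real (Suc j))" using n(1) unfolding P_def by metis
 obtain ep where ep: "0 < ep" "!!w y. w : J ==> y : RS ==> dist y (sg w) < ep ==> y ~= np & dist (zt y) w < e"
  using zt_near_J[OF e] by blast
 define Fi where "Fi j y = sg (ph j (zt y))" for j y
 have w: "f m z : J" for m using f_in_J[OF zJ] .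
 have Tz: "(T ^^ m) (sg z) = sg (f m z)" for m using sg_f[OF J_dm[OF zJ]] by simp
 have zB: "y ~= np" "zt y : ball (f m z) e" if "y : RS Int ball (sg (f m z)) ep" for y m
  using ep(2)[OF w[of m], of y] that by (auto simp: dist_commute)
 show ?thesis unfolding radial_julia_set_def proof (intro CollectI conjI exI[of _ ep] exI[of _ n] exI[of _ Fi] allI)
  show "strict_mono n" using n(2) by (simp add: strict_mono_Suc_iff)
  fix j
  let ?B = "RS Int ball ((T ^^ n j) (sg z)) ep"
  have zB': "y : RS" "y ~= np" "zt y : ball (f (n j) z) e" if "y : ?B" for y using zB[of y "n j"] that unfolding Tz by blast+
  have "continuous_on ?B zt" by (rule continuous_on_subset[OF continuous_on_zt]) (use zB' in blast)
  hence "continuous_on ?B (%y. ph j (zt y))"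
   by (rule continuous_on_compose2[OF hol_cont[OF brD(1)[OF ph(1)]]]) (use zB' in blast)
  thus "continuous_on ?B (Fi j)" unfolding Fi_def by (rule continuous_on_sg)
  show "Fi j ` ?B <= RS" by (rule image_subsetI) (simp add: Fi_def)
  show "Fi j ((T ^^ n j) (sg z)) = sg z" by (simp add: Fi_def Tz ph(2))
  show "ALL y:?B. (T ^^ n j) (Fi j y) = y" proof
   fix y assume y: "y : ?B"
   have "(T ^^ n j) (Fi j y) = sg (f (n j) (ph j (zt y)))"
    unfolding Fi_def using brD(2)[OF ph(1) zB'(3)[OF y]] by (simp add: sg_f)
   also have "... = sg (zt y)" using brD(3)[OF ph(1) zB'(3)[OF y]] by simp
   also have "... = y" by (rule sg_zt[OF zB'(1,2)[OF y]])
   finally show "(T ^^ n j) (Fi j y) = y" .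
  qed
 next
  have dia: "0 <= diameter (Fi j ` (RS Int ball ((T ^^ n j) (sg z)) ep)) &
    diameter (Fi j ` (RS Int ball ((T ^^ n j) (sg z)) ep)) <= 4 * (1 / real (Suc j))" for j proof
   let ?A = "Fi j ` (RS Int ball ((T ^^ n j) (sg z)) ep)"
   have "?A <= RS" by (rule image_subsetI) (simp add: Fi_def)
   thus "0 <= diameter ?A" using compact_RS compact_imp_bounded bounded_subset diameter_ge_0 by blast
   show "diameter ?A <= 4 * (1 / real (Suc j))" proof (rule diameter_leI)
    fix x y assume "x : ?A" "y : ?A"
    then obtain u v where uv: "u : RS Int ball (sg (f (n j) z)) ep" "v : RS Int ball (sg (f (n j) z)) ep" "x = Fi j u" "y = Fi j v"
     unfolding Tz by (elim imageE)
    have "ph j (zt u) : ball z (1 / real (Suc j))" "ph j (zt v) : ball z (1 / real (Suc j))"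
     using ph(3) zB(2)[OF uv(1)] zB(2)[OF uv(2)] by blast+
    hence "dist (ph j (zt u)) (ph j (zt v)) <= 2 * (1 / real (Suc j))"
     using dist_triangle3[of "ph j (zt u)" "ph j (zt v)" z] by simp
    thus "dist x y <= 4 * (1 / real (Suc j))"
     using dist_sg_le[of "ph j (zt u)" "ph j (zt v)"] uv(3,4) by (simp add: Fi_def)
   qed simp
  qed
  show "(%j. diameter (Fi j ` (RS Int ball ((T ^^ n j) (sg z)) ep))) \<longlonglongrightarrow> 0"
  proof (rule tendsto_sandwich[OF always_eventually always_eventually tendsto_const])
   show "(%j. 4 * (1 / real (Suc j))) \<longlonglongrightarrow> 0"
    using tendsto_mult_right_zero[OF LIMSEQ_inverse_real_of_nat, of 4] by (simp add: inverse_eq_divide)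
  qed (use dia in auto)
 qed (use ep(1) in auto)
qed

text \<open>On the bounded set J chordal and planar distances are comparable, and
  \<open>hm_lipschitz\<close> also changes the ambient space.\<close>

lemma J_hausdorff_transfer: assumes "0 < s" "A <= J" "hm RS s (sg ` A) = 0" shows "hm UNIV s A = 0"
proof -
 obtain R where R: "!!x. x : J ==> norm x <= R" using compact_imp_bounded[OF compact_J] unfolding bounded_iff by blast
 have p: "0 < (1 + R^2) / 2" by (simp add: add_pos_nonneg)
 have "hm UNIV s (zt ` sg ` A) <= ennreal (((1 + R^2) / 2) powr s) * hm RS s (sg ` A)"
 proof (rule hm_lipschitz[OF p assms(1)])
  fix x y assume "x : sg ` A" "y : sg ` A"
  then obtain u v where uv: "u : A" "v : A" "x = sg u" "y = sg v" by (elim imageE)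
  have "2 * dist u v <= (1 + R^2) * dist (sg u) (sg v)" by (rule dist_sg_ge) (use uv assms(2) R in auto)
  thus "dist (zt x) (zt y) <= (1 + R^2) / 2 * dist x y" using uv by simp
 qed (auto simp: image_subset_iff)
 moreover have "zt ` sg ` A = A" by (simp add: image_image)
 ultimately show ?thesis using assms(3) by simp
qed

lemma julia_in_circle: assumes null: "!!s. 1 < s ==> hm RS s (radial_julia_set T RS) = 0"
  and full: "hm RS 1 (Jul - radial_julia_set T RS) = 0"
  and C: "compact C" "connected C" "C <= J" "a : C" "b : C" "a ~= b"
 shows "connected J & (EX k p c. c ~= 0 & (ALL z:J. z = k | (EX t. 1 / (z - k) = p + of_real t * c)))"
proof -
 have n1: "hm UNIV s (Lset e) = 0" if "1 < s" "0 < e" for s e proof (rule J_hausdorff_transfer[OF _ Lset_J])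
  have "sg ` Lset e <= radial_julia_set T RS" using Lset_imp_radial that(2) by blast
  thus "hm RS s (sg ` Lset e) = 0" using hm_mono[of "sg ` Lset e" "radial_julia_set T RS" RS s] null[OF that(1)] by simp
 qed (use that in simp)
 let ?U = "UN k. Lset (1 / real (Suc k))"
 have n2: "HM1 (J - ?U) = 0" proof (rule J_hausdorff_transfer)
  have "sg ` (J - ?U) <= Jul - radial_julia_set T RS" proof (rule image_subsetI)
   fix z assume z: "z : J - ?U"
   hence "sg z ~: radial_julia_set T RS" using radial_imp_Lset by blast
   moreover have "sg z : Jul" using z by (auto simp: J_def)
   ultimately show "sg z : Jul - radial_julia_set T RS" by blast
  qed
  thus "hm RS 1 (sg ` (J - ?U)) = 0" using hm_mono[of "sg ` (J - ?U)" "Jul - radial_julia_set T RS" RS 1] full by simp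
 qed auto
 have "ennreal (dist a b) <= HM1 (C Int cball a (dist a b))" by (rule connected_hausdorff_ge_radius[OF C(2,4,5)]) simp
 also have "... <= HM1 J" using C(3) by (intro hm_mono) blast
 finally have pos: "0 < HM1 J" using C(6) by (metis ennreal_less_zero_iff order_less_le_trans zero_less_dist_iff)
 obtain e where e: "0 < e" "HM1 (J - Lset e) = 0" "HM1 J < top" by (rule J_finite_length[OF n1 n2 pos])
 interpret rigid_plane T e using e pos by unfold_locales auto
 obtain h where h: "h holomorphic_on ball 0 1" "inj_on h (ball 0 1)" "!!z. z : ball 0 1 ==> h z : J <-> Im z = 0"
  by (rule straight_arc[OF C]) (assumption | rule that)+
 interpret straight_plane T e h using h by unfold_locales
 obtain k p c where "c ~= 0" "k : J" "!!z. z : J ==> z ~= k ==> EX t. 1 / (z - k) = p + of_real t * c" by (rule J_in_circle) blast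
 thus ?thesis using J_connected[OF h] by blast
qed

end

section \<open>Inductive dimension\<close>

lemma ind_le_Suc: "ind_le n X ==> ind_le (Suc n) X"
proof (induction n arbitrary: X)
 case (Suc n)
 show ?case unfolding ind_le.simps(2)[of "Suc n"] proof (intro ballI allI impI)
  fix x V assume "x : X" "openin (top_of_set X) V & x : V"
  then obtain U where "openin (top_of_set X) U" "x : U" "U <= V" "ind_le n (X Int closure U - U)"
   using Suc.prems unfolding ind_le.simps(2) by meson
  thus "EX U. openin (top_of_set X) U & x : U & U <= V & ind_le (Suc n) (X Int closure U - U)" using Suc.IH by blast
 qed
qed simp

lemma ind_le_mono: "n <= m ==> ind_le n X ==> ind_le m X"
 by (induction m rule: dec_induct) (auto intro: ind_le_Suc simp del: ind_le.simps)

text \<open>If all components are points, the Sura-Bura theorem gives relatively clopen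
  neighbourhoods inside every open set; their boundaries are empty, so the dimension is at most 0,
  which is \<open>ind_le 1\<close>.\<close>

lemma not_ind_le_1_imp_continuum: fixes K :: "'a::euclidean_space set" assumes K: "compact K" and n: "~ ind_le 1 K"
 obtains C a b where "compact C" "connected C" "C <= K" "a : C" "b : C" "a ~= b" proof (rule ccontr)
 assume "~ thesis"
 hence sing: "C <= {x}" if "C : components K" "x : C" for C x
  using that in_components_connected[OF that(1)] compact_components[OF K that(1)] in_components_subset[OF that(1)]
  by (metis `!!C a b. [|compact C; connected C; C <= K; a : C; b : C; a ~= b|] ==> thesis` singletonI subsetI)
 have "ind_le (Suc 0) K" unfolding ind_le.simps proof (intro ballI allI impI)
  fix x V assume x: "x : K" and V: "openin (top_of_set K) V & x : V"
  obtain W where W: "open W" "V = K Int W" using V by (auto simp: openin_open)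
  define C where "C = connected_component_set K x"
  have C: "C : components K" "x : C" using x by (auto simp: C_def components_def)
  have CW: "C <= W" using sing[OF C] V W(2) by blast
  obtain U where U: "openin (top_of_set K) U" "compact U" "C <= U" "U <= W"
   by (rule Sura_Bura_clopen_subset[OF closed_imp_locally_compact[OF compact_imp_closed[OF K]] C(1) compact_components[OF K C(1)] W(1) CW])
  have "K Int closure U - U = {}" using compact_imp_closed[OF U(2)] by (simp add: closure_closed)
  moreover have "U <= V" using U(1,4) W(2) openin_imp_subset by blast
  ultimately show "EX U. openin (top_of_set K) U & x : U & U <= V & K Int closure U - U = {}" using U(1,3) C(2) by blast
 qed
 thus False using n by simp
qed

text \<open>By Baire's theorem almost every vertical line meets a closed set without interior in a set
 containing no segment.\<close>

lemma good_vertical_line: assumes J: "closed J" "interior J = {}" and ab: "a < (b::real)"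
 obtains t where "a < t" "t < b" "!!c d. c < d ==> EX y:{c..d}. Complex t y ~: J" proof -
 define B where "B q = {t. EX y:{fst q..snd q}. Complex t y ~: J}" for q :: "real \<times> real"
 define Q where "Q = {q : \<rat> \<times> \<rat>. fst q < (snd q :: real)}"
 have Q: "countable Q" unfolding Q_def by (rule countable_subset[of _ "\<rat> \<times> \<rat>"]) (auto intro: countable_rat)
 have op: "open (B q)" for q proof -
  have "B q = (UN y:{fst q..snd q}. (%t. Complex t y) -` (- J))" by (auto simp: B_def)
  moreover have "open ((%t. Complex t y) -` (- J))" for y
   using J(1) by (intro open_vimage) (auto intro!: continuous_intros simp: Complex_eq)
  ultimately show ?thesis by auto
 qed
 \<comment> \<open>Otherwise J would contain a rectangle.\<close>
 have dense: "UNIV <= closure (B q)" if "q : Q" for q proof (rule ccontr)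
  assume "~ ?thesis"
  then obtain t where "t : - closure (B q)" by blast
  then obtain r where r: "0 < r" "ball t r <= - closure (B q)" by (meson open_Compl closed_closure open_contains_ball)
  have "box (Complex (t - r) (fst q)) (Complex (t + r) (snd q)) <= J" proof
   fix z assume z: "z : box (Complex (t - r) (fst q)) (Complex (t + r) (snd q))"
   hence "Re z : ball t r" by (auto simp: in_box_complex_iff dist_real_def abs_less_iff)
   hence "Re z ~: B q" using r(2) closure_subset by blast
   moreover have "Im z : {fst q..snd q}" using z by (auto simp: in_box_complex_iff)
   ultimately have "Complex (Re z) (Im z) : J" unfolding B_def by blast
   thus "z : J" by simp
  qed
  hence "box (Complex (t - r) (fst q)) (Complex (t + r) (snd q)) <= interior J" by (intro interior_maximal open_box)
  moreover have "Complex t ((fst q + snd q) / 2) : box (Complex (t - r) (fst q)) (Complex (t + r) (snd q))"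
   using r(1) that by (auto simp: in_box_complex_iff Q_def)
  ultimately show False using J(2) by blast
 qed
 have "UNIV <= closure (\<Inter>(B ` Q))" proof (rule Baire)
  fix T assume "T : B ` Q"
  then obtain q where "q : Q" "T = B q" by (elim imageE)
  thus "openin (top_of_set UNIV) T & UNIV <= closure T" using op dense by simp
 qed (use Q in auto)
 hence "(a + b) / 2 : closure (\<Inter>(B ` Q))" by blast
 then obtain t where t: "t : \<Inter>(B ` Q)" "dist t ((a + b) / 2) < (b - a) / 2"
  unfolding closure_approachable using ab by (metis diff_gt_0_iff_gt half_gt_zero)
 show thesis proof (rule that)
  show "a < t" "t < b" using t(2) ab by (auto simp: dist_real_def abs_less_iff field_simps)
  fix c d :: real assume cd: "c < d"
  obtain p where p: "p : \<rat>" "c < p" "p < d" using Rats_dense_in_real[OF cd] by blast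
  obtain p' where p': "p' : \<rat>" "p < p'" "p' < d" using Rats_dense_in_real[OF p(3)] by blast
  have "t : B (p, p')" using t(1) p p' by (auto simp: Q_def)
  thus "EX y:{c..d}. Complex t y ~: J" using p p' by (auto simp: B_def)
 qed
qed

lemma continuum_not_on_good_line: assumes C: "connected C" "C <= J" "x : C" "y : C" "x ~= y" "!!z. z : C ==> Re z = t"
  and t: "!!c d. c < d ==> EX y:{c..d}. Complex t y ~: J" shows False proof -
 have c: "connected (Im ` C)" by (intro connected_continuous_image continuous_intros C(1))
 have "Im x ~= Im y" using C(3-6) by (metis complex_eq_iff)
 then obtain c d where cd: "c < d" "c : Im ` C" "d : Im ` C" using C(3,4) by (metis imageI linorder_neqE_linordered_idom)
 obtain v where v: "v : {c..d}" "Complex t v ~: J" using t[OF cd(1)] by blast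
 have "v : Im ` C" using connected_contains_Icc[OF c cd(2,3)] v(1) by blast
 then obtain z where "z : C" "Im z = v" by blast
 hence "Complex t v : C" using C(6) by (metis complex.collapse)
 thus False using v(2) C(2) by blast
qed

text \<open>In logarithmic polar coordinates circles become vertical lines.\<close>

lemma good_circle: fixes z :: complex assumes J: "closed J" "interior J = {}" and d: "0 < (d::real)"
 obtains r where "0 < r" "r < d" "!!C x y. connected C ==> C <= J Int sphere z r ==> x : C ==> y : C ==> x = y" proof -
 define e where "e = (%w. z + exp w)"
 have ec: "continuous_on A e" for A unfolding e_def by (intro continuous_intros)
 have "e 0 ~= e (\<i> * of_real pi)" by (simp add: e_def)
 hence nc: "~ e constant_on UNIV" unfolding constant_on_def by (metis UNIV_I)
 have "open (e ` interior (e -` J))"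
  by (rule open_mapping_thm[OF _ open_UNIV connected_UNIV _ _ nc]) (auto simp: e_def intro!: holomorphic_intros)
 moreover have "e ` interior (e -` J) <= J" using interior_subset by fastforce
 ultimately have "e ` interior (e -` J) <= interior J" by (intro interior_maximal)
 hence i: "interior (e -` J) = {}" using J(2) by blast
 obtain t where t: "ln d - 1 < t" "t < ln d" "!!c d. c < d ==> EX y:{c..d}. Complex t y ~: e -` J"
  by (rule good_vertical_line[OF closed_vimage[OF J(1) ec] i, of "ln d - 1" "ln d"]) auto
 show thesis proof (rule that[of "exp t"])
  show "exp t < d" using t(2) d by (metis exp_less_mono exp_ln)
  fix C x y assume C: "connected C" "C <= J Int sphere z (exp t)" "x : C" "y : C"
  obtain v where v: "e (Complex t v) ~: J" using t(3)[of 0 1] by auto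
  \<comment> \<open>z - q is a point of the circle off J. The logarithm is cut exactly there, so it
    is continuous on C.\<close>
  define q where "q = - exp (Complex t v)"
  have q: "q ~= 0" "z - q ~: J" "cmod q = exp t" using v by (auto simp: q_def e_def)
  define g where "g w = Ln ((w - z) / q) + Ln q" for w
  have wz: "cmod (w - z) = exp t" "w : J" if "w : C" for w using that C(2) by (auto simp: dist_norm norm_minus_commute)
  have nz: "(w - z) / q ~: \<real>\<^sub>\<le>\<^sub>0" if w: "w : C" for w proof
   assume "(w - z) / q : \<real>\<^sub>\<le>\<^sub>0"
   moreover have "cmod ((w - z) / q) = 1" using wz[OF w] q(3) by (simp add: norm_divide)
   ultimately have "(w - z) / q = -1" by (auto elim!: nonpos_Reals_cases)
   hence "w = z - q" using q(1) by (simp add: field_simps)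
   thus False using q(2) wz[OF w] by simp
  qed
  have n1: "(w - z) / q ~= 0" "cmod ((w - z) / q) = 1" if "w : C" for w proof -
   show "cmod ((w - z) / q) = 1" using wz(1)[OF that] q(3) by (simp add: norm_divide)
   thus "(w - z) / q ~= 0" by (metis norm_zero zero_neq_one)
  qed
  have eg: "e (g w) = w" if "w : C" for w using n1(1)[OF that] q(1) by (simp add: e_def g_def exp_add)
  have "Re (g w) = t" if "w : C" for w
   unfolding g_def plus_complex.sel Re_Ln[OF n1(1)[OF that]] n1(2)[OF that] Re_Ln[OF q(1)] q(3) by simp
  moreover have "connected (g ` C)" unfolding g_def
   by (intro connected_continuous_image C(1) continuous_intros) (use nz q(1) in auto)
  moreover have "g ` C <= e -` J" using eg wz by auto
  ultimately have "g x = g y" using continuum_not_on_good_line[of "g ` C" "e -` J" "g x" "g y" t] C(3,4) t(3) by blast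
  thus "x = y" using eg C(3,4) by metis
 qed simp
qed

text \<open>Points of J have small neighbourhoods cut out by the circles of
  \<open>good_circle\<close>. Their boundaries lie on these circles, contain no nondegenerate
  continuum, and have dimension at most 0. The embedding ph makes the result available on the
  sphere.\<close>

lemma planar_ind_le_2: fixes ph :: "complex => 'b::euclidean_space"
 assumes J: "compact J" "interior J = {}" and ph: "continuous_on J ph" "inj_on ph J" shows "ind_le 2 (ph ` J)"
proof -
 have cJ: "closed J" by (rule compact_imp_closed[OF J(1)])
 have "ind_le (Suc 1) (ph ` J)" unfolding ind_le.simps(2) proof (intro ballI allI impI)
  fix x V assume x: "x : ph ` J" and V: "openin (top_of_set (ph ` J)) V & x : V"
  obtain z where z: "z : J" "x = ph z" using x by blast
  obtain W where W: "open W" "V = ph ` J Int W" using V by (auto simp: openin_open)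
  have "openin (top_of_set J) (J Int ph -` W)" by (rule continuous_openin_preimage_gen[OF ph(1) W(1)])
  then obtain O' where O': "open O'" "J Int ph -` W = J Int O'" by (auto simp: openin_open)
  have "z : O'" using O'(2) z V W(2) by blast
  then obtain d where d: "0 < d" "ball z d <= O'" using O'(1) open_contains_ball by blast
  obtain r where r: "0 < r" "r < d" "!!C x y. connected C ==> C <= J Int sphere z r ==> x : C ==> y : C ==> x = y"
   by (rule good_circle[OF cJ J(2) d(1)]) blast
  define U where "U = ph ` (J Int ball z r)"
  have "compact (J - ball z r)" by (rule compact_diff[OF J(1) open_ball])
  hence cB: "compact (ph ` (J - ball z r))" using ph(1) by (intro compact_image) (auto intro: continuous_on_subset)
  hence cl: "closed (ph ` (J - ball z r))" by (rule compact_imp_closed)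
  have Ueq: "U = ph ` J Int - ph ` (J - ball z r)" unfolding U_def using inj_onD[OF ph(2)] by blast
  hence oU: "openin (top_of_set (ph ` J)) U" using cl by (metis open_Compl openin_open)
  have xU: "x : U" using z r(1) by (simp add: U_def)
  have "J Int ball z r <= J Int O'" using d(2) r(2) by force
  hence UV: "U <= V" using O'(2) W(2) unfolding U_def by blast
  define F where "F = ph ` J Int closure U - U"
  have "compact (J Int cball z r)" using J(1) by (simp add: compact_Int)
  hence cD: "compact (ph ` (J Int cball z r))" using ph(1) by (intro compact_image) (auto intro: continuous_on_subset)
  have "closure U <= ph ` (J Int cball z r)" unfolding U_def by (intro closure_minimal compact_imp_closed[OF cD]) auto
  hence "F <= ph ` (J Int cball z r - ball z r)" unfolding F_def U_def by blast
  moreover have "J Int cball z r - ball z r <= J Int sphere z r" by auto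
  ultimately have Fsub: "F <= ph ` (J Int sphere z r)" by blast
  have "F = closure U Int ph ` (J - ball z r)" unfolding F_def Ueq using closure_subset by blast
  hence cF: "compact F" using cB by (metis closed_Int_compact closed_closure)
  have "ind_le 1 F" proof (rule ccontr)
   assume "~ ind_le 1 F"
   then obtain C a b where C: "connected C" "C <= F" "a : C" "b : C" "a ~= b"
    by (rule not_ind_le_1_imp_continuum[OF cF])
   define ps where "ps = the_inv_into J ph"
   have ps: "ps (ph w) = w" if "w : J" for w unfolding ps_def by (rule the_inv_into_f_f[OF ph(2) that])
   have "continuous_on (ph ` J) ps" unfolding ps_def by (rule continuous_on_inv_into[OF ph(1) J(1) ph(2)])
   moreover have CJ: "C <= ph ` J" using C(2) by (auto simp: F_def)
   ultimately have "connected (ps ` C)" by (intro connected_continuous_image C(1)) (rule continuous_on_subset)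
   moreover have "ps ` C <= J Int sphere z r" using C(2) Fsub ps by force
   ultimately have "ps a = ps b" by (rule r(3)) (use C(3,4) in auto)
   moreover obtain u v where "u : J" "a = ph u" "v : J" "b = ph v" using C(3,4) CJ by blast
   ultimately show False using C(5) ps by auto
  qed
  thus "EX U. openin (top_of_set (ph ` J)) U & x : U & U <= V & ind_le 1 (ph ` J Int closure U - U)"
   using oU xU UV unfolding F_def by blast
 qed
 thus ?thesis by (simp add: numeral_2_eq_2)
qed

section \<open>Generalized circles\<close>

text \<open>In the plane this is the Hermitian equation A |z|^2 + 2 Re (cnj B z) + D = 0.\<close>

definition cs :: "real => complex => real => (complex*real) set" where
 "cs A B D = {y:RS. A * (1 + snd y) + 2 * Re (cnj B * fst y) + D * (1 - snd y) = 0}"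

lemma sphere_set_eqI: assumes "A <= RS" "B <= RS" "np : A <-> np : B" "!!z. sg z : A <-> sg z : B" shows "A = B"
proof (rule set_eqI)
 fix y show "y : A <-> y : B" proof (cases "y : RS")
  case True
  thus ?thesis by (cases rule: sphere_cases) (use assms(3,4) in simp_all)
 qed (use assms(1,2) in blast)
qed

lemma sg_mem_image: "sg z : sg ` S <-> z : S" "np ~: sg ` S" by auto

lemma cs_RS: "cs A B D <= RS" by (auto simp: cs_def)

lemma cs_np: "np : cs A B D <-> A = 0" by (simp add: cs_def)

lemma cs_sg: "sg z : cs A B D <-> A * (cmod z)^2 + 2 * Re (cnj B * z) + D = 0"
proof -
 define m where "m = 1 + (cmod z)^2"
 have m: "m > 0" by (simp add: m_def)
 have s: "fst (sg z) = of_real (2 / m) * z" "1 + snd (sg z) = 2 / m * (cmod z)^2" "1 - snd (sg z) = 2 / m"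
  using m by (simp_all add: sg_eq m_def add.commute field_simps)
 have "Re (cnj B * fst (sg z)) = 2 / m * Re (cnj B * z)"
  unfolding s(1) by (simp add: mult.left_commute[of "cnj B"] del: complex_cnj_cnj)
 hence e: "A * (1 + snd (sg z)) + 2 * Re (cnj B * fst (sg z)) + D * (1 - snd (sg z)) =
  2 / m * (A * (cmod z)^2 + 2 * Re (cnj B * z) + D)" unfolding s(2,3) by (simp add: algebra_simps)
 have "x = 2 / m * u ==> x = 0 <-> u = 0" for x u using m by simp
 from this[OF e] show ?thesis by (simp add: cs_def)
qed

lemma cs_tr:
 assumes "y : RS" shows "tr k y : cs A B D <-> y : cs A (B + of_real A * k) (A * (cmod k)^2 + 2 * Re (cnj B * k) + D)"
 using assms proof (cases rule: sphere_cases)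
 case 1
 thus ?thesis by (simp add: cs_np)
next
 case (2 z)
 have "(cmod (z + k))^2 = (cmod z)^2 + 2 * Re (cnj k * z) + (cmod k)^2"
  unfolding cmod_power2 by (simp add: power2_eq_square algebra_simps)
 hence e: "A * (cmod (z + k))^2 + 2 * Re (cnj B * (z + k)) + D =
  A * (cmod z)^2 + 2 * Re (cnj (B + of_real A * k) * z) + (A * (cmod k)^2 + 2 * Re (cnj B * k) + D)"
  by (simp add: algebra_simps)
 show ?thesis unfolding 2 tr_sg cs_sg e ..
qed

text \<open>Inversion exchanges A and D and conjugates B. The discriminant |B|^2 - A * D, whose
  positivity excludes points and empty sets, is preserved.\<close>

lemma cs_mobi: assumes "A * D < (cmod B)^2"
 obtains A' B' D' where "A' * D' < (cmod B')^2" "mobi c ` cs A B D = cs A' B' D'" proof -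
 define B' where "B' = cnj B + of_real D * (- c)"
 define D' where "D' = D * (cmod (- c))^2 + 2 * Re (cnj (cnj B) * (- c)) + A"
 have iff: "mob c y : cs A B D <-> y : cs D B' D'" if y: "y : RS" for y proof -
  have "mob c y : cs A B D <-> tr (- c) y : cs D (cnj B) A" proof -
   have "fst (iv w) = cnj (fst w)" "snd (iv w) = - snd w" for w by (simp_all add: iv_def)
   thus ?thesis using y by (auto simp: mob_def cs_def)
  qed
  thus ?thesis unfolding B'_def D'_def cs_tr[OF y] .
 qed
 have "mobi c ` cs A B D = cs D B' D'" proof
  show "mobi c ` cs A B D <= cs D B' D'" proof (rule image_subsetI)
   fix y assume y: "y : cs A B D"
   hence "y : RS" by (simp add: cs_def)
   thus "mobi c y : cs D B' D'" using iff[of "mobi c y"] y by (simp add: mobi_mob)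
  qed
  show "cs D B' D' <= mobi c ` cs A B D" proof
   fix y assume y: "y : cs D B' D'"
   hence "y : RS" by (simp add: cs_def)
   thus "y : mobi c ` cs A B D" using iff[of y] y mobi_mob(1)[of y c] by (metis imageI)
  qed
 qed
 moreover have "(cmod B')^2 - D * D' = (cmod B)^2 - A * D"
  unfolding B'_def D'_def cmod_power2 by (simp add: power2_eq_square algebra_simps)
 hence "D * D' < (cmod B')^2" using assms by linarith
 ultimately show thesis using that by blast
qed

lemma cs_gen_circle: assumes d: "A * D < (cmod B)^2" obtains C where "gen_circle C" "cs A B D = stereo ` C"
proof (cases "A = 0")
 case False
 define a r where "a = - B / of_real A" and "r = sqrt ((cmod B)^2 - A * D) / \<bar>A\<bar>"
 have r: "0 < r" "r^2 = ((cmod B)^2 - A * D) / A^2" using d False by (simp_all add: r_def power_divide)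
 have "sg z : cs A B D <-> z : sphere a r" for z proof -
  have "A * (z - a) = A * z + B" using False by (simp add: a_def algebra_simps)
  hence "A^2 * (cmod (z - a))^2 = (cmod (of_real A * z + B))^2"
   by (metis norm_mult norm_of_real power2_abs power_mult_distrib)
  also have "... = A * (A * (cmod z)^2 + 2 * Re (cnj B * z) + D) + ((cmod B)^2 - A * D)"
   unfolding cmod_power2 by (simp add: power2_eq_square algebra_simps)
  finally have e: "A^2 * ((cmod (z - a))^2 - r^2) = A * (A * (cmod z)^2 + 2 * Re (cnj B * z) + D)"
   unfolding right_diff_distrib r(2) using False by simp
  have "z : sphere a r <-> (cmod (z - a))^2 = r^2"
   using r(1) by (simp add: dist_norm norm_minus_commute power2_eq_iff_nonneg)
  thus ?thesis unfolding cs_sg using e False by auto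
 qed
 note iff = this
 have "cs A B D = sg ` sphere a r" proof (rule sphere_set_eqI[OF cs_RS])
  show "sg ` sphere a r <= RS" by (rule image_subsetI) simp
 qed (simp_all only: cs_np sg_mem_image iff False simp_thms)
 hence "cs A B D = stereo ` Some ` sphere a r" unfolding image_image sg_def .
 moreover have "gen_circle (Some ` sphere a r)" unfolding gen_circle_def using r(1) by blast
 ultimately show thesis using that by blast
next
 case True
 hence B: "B ~= 0" using d by auto
 define a b where "a = of_real (- D / (2 * (cmod B)^2)) * B" and "b = \<i> * B"
 have "sg z : cs A B D <-> (EX t. z = a + of_real t * b)" for z proof -
  have "sg z : cs A B D <-> Re (cnj B * z) = - D / 2" unfolding cs_sg True by auto
  also have "... <-> (EX t. z = a + of_real t * b)" proof
   assume e: "Re (cnj B * z) = - D / 2"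
   have "of_real ((cmod B)^2) * z = B * (cnj B * z)" unfolding complex_norm_square by simp
   also have "cnj B * z = of_real (- D / 2) + \<i> * of_real (Im (cnj B * z))" using e by (simp add: complex_eq_iff)
   finally have e2: "of_real ((cmod B)^2) * z = B * (of_real (- D / 2) + \<i> * of_real (Im (cnj B * z)))" .
   define n t where "n = (cmod B)^2" and "t = Im (cnj B * z)"
   have n: "complex_of_real n ~= 0" using B by (simp add: n_def)
   have "z = of_real n * z / of_real n" using n by simp
   also have "... = B * (of_real (- D / 2) + \<i> * of_real t) / of_real n" unfolding n_def t_def e2 ..
   also have "... = a + of_real (t / n) * b" using n unfolding a_def b_def n_def[symmetric] by (simp add: field_simps)
   finally have "z = a + of_real (t / n) * b" .
   thus "EX t. z = a + of_real t * b" by blast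
  next
   assume "EX t. z = a + of_real t * b"
   then obtain t where t: "z = a + of_real t * b" by blast
   have "cnj B * z = of_real (- D / (2 * (cmod B)^2)) * (B * cnj B) + of_real t * \<i> * (B * cnj B)"
    unfolding t a_def b_def distrib_left by (simp only: mult_ac)
   thus "Re (cnj B * z) = - D / 2" unfolding complex_norm_square[symmetric] using B by simp
  qed
  finally show ?thesis .
 qed
 note iff = this
 have "cs A B D = insert np (sg ` {a + of_real t * b | t. True})" proof (rule sphere_set_eqI[OF cs_RS])
  show "insert np (sg ` {a + of_real t * b | t. True}) <= RS" by auto
 qed (simp_all only: cs_np sg_mem_image insert_iff sg_neq_np iff[unfolded True] True simp_thms mem_Collect_eq)
 hence "cs A B D = stereo ` insert None (Some ` {a + of_real t * b | t. True})"
  unfolding image_insert stereo_None image_image sg_def .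
 moreover have "gen_circle (insert None (Some ` {a + of_real t * b | t. True}))" unfolding gen_circle_def
  using B by (intro disjI2 exI[of _ a] exI[of _ b]) (simp add: b_def)
 ultimately show thesis using that by blast
qed

section \<open>Lines and arcs on the sphere\<close>

definition line :: "complex => complex => (complex*real) set" where "line p c = range (%t. sg (p + of_real t * c))"

lemma cs_line: assumes c: "c ~= 0" obtains B D where "0 * D < (cmod B)^2" "insert np (line p c) = cs 0 B D"
proof -
 define B where "B = \<i> * c"
 have "sg z : cs 0 B (- 2 * Re (cnj B * p)) <-> (EX t. z = p + of_real t * c)" for z proof -
  have "sg z : cs 0 B (- 2 * Re (cnj B * p)) <-> Im (cnj c * (z - p)) = 0"
   unfolding cs_sg by (auto simp: B_def algebra_simps)
  also have "... <-> (EX t. z = p + of_real t * c)" proof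
   assume "Im (cnj c * (z - p)) = 0"
   hence "cnj c * (z - p) = of_real (Re (cnj c * (z - p)))" by (simp add: complex_eq_iff)
   hence "of_real ((cmod c)^2) * (z - p) = of_real (Re (cnj c * (z - p))) * c"
    unfolding complex_norm_square by (metis mult.assoc mult.commute)
   hence "z - p = of_real (Re (cnj c * (z - p)) / (cmod c)^2) * c" using c by (simp add: field_simps)
   thus "EX t. z = p + of_real t * c" by (metis add_diff_cancel_left' diff_add_cancel add.commute)
  next
   assume "EX t. z = p + of_real t * c"
   then obtain t where "z = p + of_real t * c" by blast
   hence "z - p = of_real t * c" by simp
   hence "cnj c * (z - p) = of_real (t * (cmod c)^2)" by (simp add: complex_norm_square mult_ac del: of_real_power)
   thus "Im (cnj c * (z - p)) = 0" by (metis Im_complex_of_real)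
  qed
  finally show ?thesis .
 qed
 note iff = this
 have "insert np (line p c) = cs 0 B (- 2 * Re (cnj B * p))" proof (rule sphere_set_eqI[OF _ cs_RS])
  show "insert np (line p c) <= RS" by (auto simp: line_def)
  show "sg z : insert np (line p c) <-> sg z : cs 0 B (- 2 * Re (cnj B * p))" for z
   unfolding iff by (auto simp: line_def)
 qed (simp add: cs_np)
 thus thesis using that[of "- 2 * Re (cnj B * p)" B] c by (simp add: B_def)
qed

definition hom :: "(complex*real => complex*real) => (complex*real => complex*real) => bool" where
 "hom mu mu' <-> continuous_on RS mu & continuous_on RS mu' & mu ` RS <= RS & mu' ` RS <= RS &
   (ALL y:RS. mu' (mu y) = y & mu (mu' y) = y)"

lemma homD: assumes "hom mu mu'"
 shows "continuous_on RS mu" "continuous_on RS mu'" "!!y. y : RS ==> mu y : RS" "!!y. y : RS ==> mu' y : RS"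
  "!!y. y : RS ==> mu' (mu y) = y" "!!y. y : RS ==> mu (mu' y) = y" using assms unfolding hom_def by blast+

lemma hom_mobi: "hom (mobi c) (mob c)" unfolding hom_def image_subset_iff
 using rat_sphere.T_cont[OF rat_sphere_mob(1)] rat_sphere.T_cont[OF rat_sphere_mob(2)] by (simp add: mobi_mob del: split_paired_All)

lemma hom_comp: assumes "hom mu mu'" "hom nu nu'" shows "hom (%y. mu (nu y)) (%y. nu' (mu' y))"
 unfolding hom_def image_subset_iff proof (intro conjI ballI)
 note m = homD[OF assms(1)] and n = homD[OF assms(2)]
 show "continuous_on RS (%y. mu (nu y))" by (rule continuous_on_compose2[OF m(1) n(1)]) (use n(3) in blast)
 show "continuous_on RS (%y. nu' (mu' y))" by (rule continuous_on_compose2[OF n(2) m(2)]) (use m(4) in blast)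
qed (use homD[OF assms(1)] homD[OF assms(2)] in simp_all)

text \<open>K avoids the image of \<open>np\<close>, so the line parameter ta is continuous on K and
  identifies it with a compact interval.\<close>

lemma line_subset_arc: assumes h: "hom mu mu'" and K: "compact K" "connected K" "a : K" "b : K" "a ~= b"
  and sub: "K <= mu ` line p c" and c: "c ~= 0" obtains g where "arc g" "path_image g = K" proof -
 define ta where "ta y = Re ((zt (mu' y) - p) / c)" for y
 have lRS: "line p c <= RS" by (auto simp: line_def)
 have ta: "ta (mu (sg (p + of_real t * c))) = t" for t using homD(5)[OF h sg_in] c by (simp add: ta_def)
 have KRS: "K <= RS" using sub lRS homD(3)[OF h] by blast
 have "continuous_on K (%y. zt (mu' y))" proof (rule continuous_on_compose2[OF continuous_on_zt])
  show "continuous_on K mu'" by (rule continuous_on_subset[OF homD(2)[OF h] KRS])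
  show "mu' ` K <= RS - {np}" proof (rule image_subsetI)
   fix y assume "y : K"
   then obtain t where "y = mu (sg (p + of_real t * c))" using sub by (auto simp: line_def)
   hence "mu' y = sg (p + of_real t * c)" using homD(5)[OF h sg_in] by simp
   thus "mu' y : RS - {np}" by simp
  qed
 qed
 hence tac: "continuous_on K ta" unfolding ta_def using c by (intro continuous_intros) auto
 have "compact (ta ` K)" "connected (ta ` K)" using K(1,2) tac by (auto intro: compact_image connected_continuous_image)
 then obtain l u where lu: "ta ` K = {l..u}" using connected_compact_interval_1[of "ta ` K"] by auto
 have Kt: "y = mu (sg (p + of_real (ta y) * c))" if y: "y : K" for y proof -
  obtain t where "y = mu (sg (p + of_real t * c))" using sub y by (auto simp: line_def)
  thus ?thesis using ta[of t] by simp
 qed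
 have "ta a ~= ta b" using Kt[OF K(3)] Kt[OF K(4)] K(5) by metis
 moreover have "ta a : {l..u}" "ta b : {l..u}" using lu K(3,4) by blast+
 ultimately have l: "l < u" by auto
 define g where "g s = mu (sg (p + of_real (l + s * (u - l)) * c))" for s
 show thesis proof (rule that)
  have "continuous_on {0..1} g" unfolding g_def proof (rule continuous_on_compose2[of RS mu])
   show "continuous_on RS mu" by (rule homD(1)[OF h])
  qed (auto intro!: continuous_intros)
  moreover have "inj_on g {0..1}" proof (rule inj_onI)
   fix s t assume "g s = g t"
   hence "ta (g s) = ta (g t)" by simp
   thus "s = t" unfolding g_def ta using l by simp
  qed
  ultimately show "arc g" by (simp add: arc_def path_def)
  have "(%s. l + s * (u - l)) ` {0..1} = {l..u}"
   using image_affinity_atLeastAtMost[of "u - l" l 0 "1::real"] l by (simp add: mult.commute add.commute)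
  hence "path_image g = (%t. mu (sg (p + of_real t * c))) ` ta ` K"
   unfolding path_image_def lu g_def by (metis (no_types, lifting) image_cong image_image)
  also have "... = K" unfolding image_image using Kt by force
  finally show "path_image g = K" .
 qed
qed

text \<open>A point of the circle omitted by K can be moved to infinity.\<close>

lemma circle_or_arc: assumes h: "hom mu mu'" and K: "compact K" "connected K" "a : K" "b : K" "a ~= b"
  and sub: "K <= mu ` insert np (line p c)" and c: "c ~= 0"
 shows "K = mu ` insert np (line p c) | (EX g. arc g & path_image g = K)"
proof (cases "K = mu ` insert np (line p c)")
 case False
 then obtain y where y: "y : insert np (line p c)" "mu y ~: K" using sub by blast
 show ?thesis proof (cases "y = np")
  case True
  hence "K <= mu ` line p c" using sub y by auto
  thus ?thesis using line_subset_arc[OF h K _ c] by metis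
 next
  case False
  then obtain t0 where t0: "y = sg (p + of_real t0 * c)" using y(1) by (auto simp: line_def)
  define v where "v = p + of_real t0 * c"
  have m: "mobi v (sg w) = (if w = 0 then np else sg (1 / w + v))" for w by (simp add: mobi_def iv_sg)
  have "K <= (%y. mu (mobi v y)) ` line 0 (1 / c)" proof
   fix x assume x: "x : K"
   then obtain w where w: "w : insert np (line p c)" "x = mu w" using sub by blast
   have "w : mobi v ` line 0 (1 / c)" proof (cases "w = np")
    case True
    hence "w = mobi v (sg (0 + of_real 0 * (1 / c)))" by (simp add: m)
    thus ?thesis unfolding line_def by blast
   next
    case False
    then obtain t where t: "w = sg (p + of_real t * c)" using w(1) by (auto simp: line_def)
    hence "t ~= t0" using x w y(2) t0 by auto
    moreover have "p + of_real t * c = of_real (t - t0) * c + v" by (simp add: v_def algebra_simps)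
    ultimately have "w = mobi v (sg (0 + of_real (1 / (t - t0)) * (1 / c)))" unfolding m t using c by simp
    thus ?thesis unfolding line_def by blast
   qed
   thus "x : (%y. mu (mobi v y)) ` line 0 (1 / c)" using w(2) by blast
  qed
  thus ?thesis using line_subset_arc[OF hom_comp[OF h hom_mobi] K] c by (metis divide_eq_0_iff zero_neq_one)
 qed
qed simp

section \<open>Rational functions on the sphere\<close>

lemma inj_stereo: "inj stereo"
proof (rule injI)
 fix x y assume "stereo x = stereo y"
 thus "x = y" by (cases x; cases y) (auto simp: stereo_None sg_def[symmetric])
qed

lemma sphere_map_sg: "sphere_map p q (sg z) = stereo (rat_fun p q (Some z))"
 by (simp add: sphere_map_def sg_def inv_into_f_f[OF inj_stereo])

lemma sphere_map_np: "sphere_map p q np = stereo (rat_fun p q None)"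
 by (simp add: sphere_map_def stereo_None[symmetric] inv_into_f_f[OF inj_stereo])

locale rational = fixes p q :: "complex poly" assumes q0: "q ~= 0" and cop: "coprime p q"
begin

abbreviation "d \<equiv> max (degree p) (degree q)"
abbreviation "T \<equiv> sphere_map p q"

lemma no_common_root: "poly p z ~= 0 | poly q z ~= 0"
proof (rule ccontr)
 assume "~ ?thesis"
 hence "[:- z, 1:] dvd p" "[:- z, 1:] dvd q" by (simp_all add: poly_eq_0_iff_dvd)
 hence "[:- z, 1:] dvd 1" using cop coprime_common_divisor by blast
 thus False by (auto simp: is_unit_poly_iff)
qed

lemma T_sg: "T (sg z) = hst (poly p z) (poly q z)"
 using no_common_root[of z] by (auto simp: sphere_map_sg rat_fun_def hst_eq stereo_None sg_def[symmetric])

lemma coeff_d: "coeff p d ~= 0 | coeff q d ~= 0"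
proof (cases "degree p <= degree q")
 case True thus ?thesis using q0 by (simp add: max_def)
next
 case False thus ?thesis by (auto simp: max_def)
qed

lemma T_np: "T np = hst (coeff p d) (coeff q d)"
 using coeff_d q0 by (auto simp: sphere_map_np rat_fun_def hst_eq stereo_None sg_def[symmetric] max_def coeff_eq_0 le_antisym)

text \<open>The polynomial reversed with respect to the common degree d, which describes T in the
  coordinate 1/z at \<open>np\<close>.\<close>

definition H :: "complex poly => complex => complex" where "H r u = (SUM i<=d. coeff r i * u ^ (d - i))"

lemma H_eq: assumes "u ~= 0" "degree r <= d" shows "H r u = u ^ d * poly r (1 / u)"
proof -
 have "poly r (1 / u) = (SUM i<=d. coeff r i * (1 / u) ^ i)"
  unfolding poly_altdef using assms(2) by (intro sum.mono_neutral_left) (auto simp: coeff_eq_0)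
 thus ?thesis using assms(1) by (auto simp: H_def sum_distrib_left power_diff power_one_over intro!: sum.cong)
qed

lemma H_0: "H r 0 = coeff r d"
proof -
 have "H r 0 = (SUM i:{d}. coeff r i * 0 ^ (d - i))" unfolding H_def by (rule sum.mono_neutral_right) auto
 thus ?thesis by simp
qed

lemma T_iv: "T (iv (sg u)) = hst (H p u) (H q u)" and H_nonzero: "H p u ~= 0 | H q u ~= 0"
proof -
 have "T (iv (sg u)) = hst (H p u) (H q u) & (H p u ~= 0 | H q u ~= 0)" proof (cases "u = 0")
  case True thus ?thesis using T_np coeff_d by (simp add: H_0)
 next
  case False
  note e = H_eq[OF False, of p] H_eq[OF False, of q]
  show ?thesis using False e no_common_root[of "1 / u"] by (auto simp: iv_sg T_sg hst_eq)
 qed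
 thus "T (iv (sg u)) = hst (H p u) (H q u)" "H p u ~= 0 | H q u ~= 0" by blast+
qed

lemma T_sg_eq_sg: "T (sg z) = sg w <-> poly q z ~= 0 & poly p z = w * poly q z"
 using no_common_root[of z] by (auto simp: T_sg hst_eq)

lemma T_sg_eq_np: "T (sg z) = np <-> poly q z = 0" using no_common_root[of z] by (auto simp: T_sg hst_eq)

lemma T_RS: "y : RS ==> T y : RS"
proof (erule sphere_cases)
 assume "y = np"
 thus "T y : RS" unfolding T_np using hst_eq[OF coeff_d] by (simp only: np_in sg_in T_np simp_thms split: if_split)
next
 fix z assume "y = sg z"
 thus "T y : RS" using hst_eq[OF no_common_root[of z]] by (simp only: np_in sg_in T_sg simp_thms split: if_split)
qed

lemma not_multiple: assumes "1 <= d" shows "p ~= smult w q"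
proof
 assume "p = smult w q"
 hence "q dvd p" by (simp add: dvd_smult)
 hence "q dvd 1" by (rule coprime_common_divisor[OF cop]) simp
 hence "degree q = 0" using is_unit_iff_degree[OF q0] by simp
 moreover hence "degree p = 0" using `p = smult w q` by (auto simp: degree_smult_eq)
 ultimately show False using assms by simp
qed

lemma T_cont: "continuous_on RS T"
proof -
 have a: "continuous_on (RS - {np}) T" proof (rule continuous_on_eq)
  show "continuous_on (RS - {np}) (%y. hst (poly p (zt y)) (poly q (zt y)))"
   by (intro continuous_on_hst continuous_intros continuous_on_zt no_common_root)
  show "hst (poly p (zt y)) (poly q (zt y)) = T y" if "y : RS - {np}" for y
   using that T_sg[of "zt y"] sg_zt[of y] by simp
 qed
 have b: "continuous_on (RS - {sg 0}) T" proof (rule continuous_on_eq)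
  have "continuous_on (RS - {sg 0}) (%y. zt (iv y))"
  proof (rule continuous_on_compose2[OF continuous_on_zt continuous_on_iv[OF continuous_on_id]], rule image_subsetI)
   fix y assume "y : RS - {sg 0}"
   thus "iv y : RS - {np}" using iv_eq_np[of y] by simp
  qed
  thus "continuous_on (RS - {sg 0}) (%y. hst (H p (zt (iv y))) (H q (zt (iv y))))"
   unfolding H_def by (intro continuous_on_hst continuous_intros) (use H_nonzero in \<open>simp_all add: H_def\<close>)
  show "hst (H p (zt (iv y))) (H q (zt (iv y))) = T y" if "y : RS - {sg 0}" for y
   using that T_iv[of "zt (iv y)"] sg_zt[of "iv y"] by (simp add: iv_eq_np)
 qed
 show ?thesis unfolding continuous_on_eq_continuous_within proof
  fix x assume x: "x : RS"
  have nb: "at x within RS - {c} = at x within RS" if "x ~= c" for c :: "complex*real"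
   by (rule at_within_nhd[of x "- {c}"]) (use that in auto)
  show "continuous (at x within RS) T" proof (cases "x = np")
   case True
   hence "continuous (at x within RS - {sg 0}) T" using b x unfolding continuous_on_eq_continuous_within by simp
   thus ?thesis using nb[of "sg 0"] True by simp
  next
   case False
   hence "continuous (at x within RS - {np}) T" using a x unfolding continuous_on_eq_continuous_within by simp
   thus ?thesis using nb[of np] False by simp
  qed
 qed
qed

lemma rat_sphere_T: assumes "1 <= d" shows "rat_sphere T"
proof
 show "continuous_on RS T" by (rule T_cont)
 show "T np : RS" by (rule T_RS) simp
 show "fmero UNIV (%z. T (sg z))" unfolding fmero_def proof (intro conjI ballI)
  show "continuous_on UNIV (%z. T (sg z))" unfolding T_sg by (intro continuous_on_hst continuous_intros no_common_root)
  show "(%z. T (sg z)) ` UNIV <= RS" by (rule image_subsetI) (simp add: T_RS)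
  show "finite {z : UNIV. T (sg z) = y}" if "y : RS" for y using that proof (cases rule: sphere_cases)
   case 1 thus ?thesis using poly_roots_finite[OF q0] by (simp add: T_sg_eq_np)
  next
   case (2 w)
   have "p - smult w q ~= 0" using not_multiple[OF assms] by simp
   from poly_roots_finite[OF this] show ?thesis unfolding 2 T_sg_eq_sg by (rule rev_finite_subset) auto
  qed
  have "(%z. poly p z / poly q z) holomorphic_on {z : UNIV. T (sg z) ~= np}"
   unfolding T_sg_eq_np by (intro holomorphic_intros) auto
  thus "(%z. zt (T (sg z))) holomorphic_on {z : UNIV. T (sg z) ~= np}" proof (rule holomorphic_transform)
   fix z assume "z : {z : UNIV. T (sg z) ~= np}"
   hence "T (sg z) = sg (poly p z / poly q z)" unfolding T_sg_eq_sg by (simp add: T_sg_eq_np)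
   thus "poly p z / poly q z = zt (T (sg z))" by simp
  qed
 qed simp
qed

text \<open>A value with a single preimage in the plane is a critical value, i.e. comes from a zero of the Wronskian.\<close>

lemma generic_T: assumes d2: "2 <= d"
 shows "finite {y:RS. ~ (EX x1:RS. EX x2:RS. x1 ~= x2 & T x1 = y & T x2 = y)}" (is "finite ?S")
proof -
 define W where "W = pderiv p * q - p * pderiv q"
 \<comment> \<open>If the Wronskian vanished, coprimality would make p and q divide their
   derivatives, so both would be constant.\<close>
 have W: "W ~= 0" proof
  assume "W = 0"
  hence e: "pderiv p * q = p * pderiv q" by (simp add: W_def)
  hence "q dvd p * pderiv q" by (metis dvd_triv_right)
  hence "q dvd pderiv q" using cop by (metis coprime_commute coprime_dvd_mult_right_iff)
  moreover have "p dvd pderiv p * q" using e by simp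
  hence "p dvd pderiv p" using cop by (metis coprime_dvd_mult_left_iff)
  ultimately show False using d2 by simp
 qed
 \<comment> \<open>Besides the critical values, \<open>np\<close> is excluded, and so is the value
   of T at \<open>np\<close>, for which p - w q loses degree.\<close>
 define E where "E = insert np (insert (sg (coeff p d / coeff q d)) ((%a. sg (poly p a / poly q a)) ` {a. poly W a = 0}))"
 have "finite E" unfolding E_def using poly_roots_finite[OF W] by simp
 moreover have "?S <= E" proof
  fix y assume y: "y : ?S"
  hence "y : RS" by blast
  thus "y : E" proof (cases rule: sphere_cases)
   case 1 thus ?thesis by (simp add: E_def)
  next
   case (2 w)
   define g where "g = p - smult w q"
   show ?thesis proof (rule ccontr)
    assume nE: "y ~: E"
    have "coeff g d ~= 0" proof
     assume "coeff g d = 0"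
     hence "coeff p d = w * coeff q d" by (simp add: g_def)
     hence "w = coeff p d / coeff q d" using coeff_d by auto
     thus False using nE 2 by (simp add: E_def)
    qed
    hence dg: "2 <= degree g" using le_degree[of g d] d2 by linarith
    hence "~ constant (poly g)" by (simp add: constant_degree)
    then obtain a where a: "poly g a = 0" using fundamental_theorem_of_algebra by blast
    have root: "T (sg b) = y" if "poly g b = 0" for b
     using that no_common_root[of b] unfolding 2 T_sg_eq_sg by (auto simp: g_def)
    have uniq: "b = a" if "poly g b = 0" for b using y root[OF that] root[OF a] by (metis (mono_tags, lifting) inj_sg mem_Collect_eq sg_in)
    obtain r where r: "g = [:- a, 1:] * r" using a poly_eq_0_iff_dvd by (metis dvdE)
    have "r ~= 0" using r dg by auto
    hence "degree g = 1 + degree r" unfolding r by (subst degree_mult_eq) auto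
    hence "~ constant (poly r)" using dg by (simp add: constant_degree)
    then obtain b where "poly r b = 0" using fundamental_theorem_of_algebra by blast
    hence "poly r a = 0" using uniq[of b] r by simp
    hence "poly (pderiv g) a = 0" unfolding r pderiv_mult by (simp add: pderiv_pCons)
    hence e: "poly (pderiv p) a = w * poly (pderiv q) a" "poly p a = w * poly q a"
     using a by (simp_all add: g_def pderiv_diff pderiv_smult)
    have "poly W a = 0" using e by (simp add: W_def)
    moreover have "poly q a ~= 0" using e(2) no_common_root[of a] by auto
    hence "w = poly p a / poly q a" using e(2) by simp
    ultimately have "y : E" using 2 by (auto simp: E_def)
    thus False using nE by simp
   qed
  qed
 qed
 ultimately show ?thesis by (rule rev_finite_subset)
qed

lemma inj_T: assumes "d = 1" shows "inj_on T RS"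
proof -
 have two: "g = 0" if "degree g <= 1" "poly g z = 0" "poly g z' = 0" "z ~= z'" for g :: "complex poly" and z z'
 proof (rule ccontr)
  assume "g ~= 0"
  hence "card {z. poly g z = 0} <= 1" "finite {z. poly g z = 0}" using card_poly_roots_bound[of g] poly_roots_finite that(1) by auto
  thus False using that card_le_Suc0_iff_eq[of "{z. poly g z = 0}"] by auto
 qed
 have dg: "degree (p - smult w q) <= 1" for w
  using assms degree_diff_le[of p 1 "smult w q"] degree_smult_le[of w q] by simp
 have dr: "g = 0" if "degree g <= 1" "coeff g 1 = 0" "poly g z = 0" for g :: "complex poly" and z proof -
  have "degree g = 0" using that(1,2) by (metis One_nat_def degree_0 le_Suc_eq le_zero_eq leading_coeff_0_iff)
  thus ?thesis using that(3) by (auto elim!: degree_eq_zeroE)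
 qed
 have dq: "degree q <= 1" using assms by simp
 have nm: "p - smult w q ~= 0" for w using not_multiple[of w] assms by simp
 have sgsg: "z = z'" if "T (sg z) = T (sg z')" for z z' proof (rule ccontr)
  assume ne: "z ~= z'"
  have "T (sg z) : RS" by (simp add: T_RS)
  thus False proof (cases rule: sphere_cases)
   case 1
   hence "T (sg z') = np" using that by simp
   thus False using two[OF dq _ _ ne] 1 q0 by (simp add: T_sg_eq_np)
  next
   case (2 w)
   hence "T (sg z') = sg w" using that by simp
   thus False using two[OF dg _ _ ne, of w] 2 nm[of w] by (simp add: T_sg_eq_sg)
  qed
 qed
 have npsg: False if "T np = T (sg z)" for z proof -
  have e: "hst (coeff p 1) (coeff q 1) = T (sg z)" "coeff p 1 ~= 0 | coeff q 1 ~= 0" using that T_np coeff_d assms by simp_all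
  show False proof (cases "coeff q 1 = 0")
   case True
   hence "poly q z = 0" using e T_sg_eq_np[of z] by (simp add: hst_eq)
   thus False using dr[OF dq True] q0 by blast
  next
   case False
   define w where "w = coeff p 1 / coeff q 1"
   have "T (sg z) = sg w" using e False by (simp add: hst_eq w_def)
   hence "poly (p - smult w q) z = 0" by (simp add: T_sg_eq_sg)
   moreover have "coeff (p - smult w q) 1 = 0" using False by (simp add: w_def)
   ultimately show False using dr[OF dg] nm by blast
  qed
 qed
 show ?thesis proof (rule inj_onI)
  fix x y assume "x : RS" "y : RS" "T x = T y"
  thus "x = y" using sgsg npsg by (elim sphere_cases) metis+
 qed
qed

lemma const_T: assumes "d = 0" obtains a where "!!y. y : RS ==> T y = a"
proof -
 have "degree p = 0" "degree q = 0" using assms by simp_all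
 then obtain a b where pq: "p = [:a:]" "q = [:b:]" by (elim degree_eq_zeroE)
 have c1: "T np = hst a b" unfolding T_np assms unfolding pq by simp
 have c2: "T (sg z) = hst a b" for z unfolding T_sg unfolding pq by simp
 have "T y = hst a b" if y: "y : RS" for y by (rule sphere_cases[OF y]) (simp_all add: c1 c2)
 thus thesis by (rule that)
qed

end

section \<open>Degenerate maps and normalization\<close>

text \<open>A sequence taken from finitely many maps has a constant subsequence. This disposes of
  constant maps and of maps with an iterate equal to the identity.\<close>

lemma finite_iterates_julia_empty: assumes fin: "!!n. EX r<=N. ALL y:RS. (T ^^ n) y = (T ^^ r) y"
 shows "julia_set T RS = {}"
proof -
 obtain g where g: "!!n. g n <= N" "!!n y. y : RS ==> (T ^^ n) y = (T ^^ g n) y" using fin by metis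
 have "normal_iterates_on T RS" unfolding normal_iterates_on_def proof
  fix m :: "nat => nat"
  have "finite ((%j. g (m j)) ` UNIV)" by (rule finite_subset[of _ "{..N}"]) (use g(1) in auto)
  then obtain j0 where inf: "infinite {j : UNIV. g (m j) = g (m j0)}"
   using pigeonhole_infinite[of "UNIV :: nat set" "%j. g (m j)"] by auto
  define r where "r = enumerate {j : UNIV. g (m j) = g (m j0)}"
  have "strict_mono r" unfolding r_def by (rule strict_mono_enumerate[OF inf])
  moreover have "g (m (r j)) = g (m j0)" for j using enumerate_in_set[OF inf, of j] by (simp add: r_def)
  hence "(T ^^ m (r j)) y = (T ^^ g (m j0)) y" if "y : RS" for j y using g(2)[OF that] by metis
  hence "uniform_limit K (%j. T ^^ m (r j)) (T ^^ g (m j0)) sequentially" if "K <= RS" for K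
   by (intro uniform_limitI always_eventually allI ballI) (use that in \<open>metis dist_self subsetD\<close>)
  ultimately show "EX r h. strict_mono r & locunif RS (%j. T ^^ m (r j)) h" by blast
 qed
 hence "RS <= fatou_set T RS" unfolding fatou_set_def by (intro subsetI CollectI conjI exI[of _ RS]) auto
 thus ?thesis unfolding julia_set_def by blast
qed

context rat_sphere
begin

text \<open>Planar fixed points are zeros of a holomorphic function on the connected set D. If it
  vanished identically, density of D would make every point of the plane fixed, against
  \<open>ne\<close>.\<close>

lemma countable_fixed: assumes ne: "T (sg z0) ~= sg z0" shows "countable {y:RS. T y = y}"
proof -
 note fm = fmeroD[OF T_fm]
 define D where "D = {z:UNIV. T (sg z) ~= np}"
 have D: "open D" unfolding D_def by (rule open_neq[OF open_UNIV fm(2)])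
 have finD: "finite (- D)" using fm(4)[of np] by (simp add: D_def Collect_neg_eq)
 have cD: "connected D" using connected_open_delete_finite[OF open_UNIV connected_UNIV _ finD] by (simp add: Diff_eq)
 define g where "g = (%z. zt (T (sg z)) - z)"
 have gh: "g holomorphic_on D" unfolding g_def D_def by (intro holomorphic_intros fm(5))
 have fix_iff: "T (sg z) = sg z <-> g z = 0" if "z : D" for z
  using that sg_zt[of "T (sg z)"] T_in[of "sg z"] by (auto simp: g_def D_def)
 have "countable {z:D. g z = 0}" proof (cases "g constant_on D")
  case False
  obtain C where C: "!!n. compact (C n)" "!!n. C n <= D" "!!n. C n <= interior (C (Suc n))" "\<Union>(range C) = D"
   using open_Union_compact_subsets[OF D] by metis
  have "fsigma D" unfolding C(4)[symmetric] by (rule fsigma.intros) (rule compact_imp_closed[OF C(1)])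
  thus ?thesis by (rule holomorphic_countable_zeros[OF gh D cD _ False])
 next
  case True
  then obtain c where c: "!!z. z : D ==> g z = c" unfolding constant_on_def by blast
  have "c ~= 0" proof
   assume "c = 0"
   hence "D <= {z. T (sg z) = sg z}" using c fix_iff by blast
   moreover have "closed {z. T (sg z) = sg z}" using fm(2) by (intro closed_Collect_eq continuous_on_sg continuous_on_id)
   ultimately have "closure D <= {z. T (sg z) = sg z}" by (rule closure_minimal)
   moreover have "closure D = UNIV" using closure_complement[of "- D"] empty_interior_finite[OF finD] by simp
   ultimately show False using ne by blast
  qed
  hence "{z:D. g z = 0} = {}" using c by blast
  thus ?thesis by (simp only: countable_empty)
 qed
 moreover have "{y:RS. T y = y} <= insert np (sg ` {z:D. g z = 0})" proof
  fix y assume y: "y : {y:RS. T y = y}"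
  hence "y : RS" by blast
  thus "y : insert np (sg ` {z:D. g z = 0})" proof (cases rule: sphere_cases)
   case (2 z)
   hence "z : D" "T (sg z) = sg z" using y by (auto simp: D_def)
   thus ?thesis using fix_iff 2 by blast
  qed simp
 qed
 ultimately show ?thesis by (meson countable_image countable_insert countable_subset)
qed

text \<open>For injective T the iterates commute with branches. If u i and u i' lie in the domains
  of all late branches, these carry them to two points, the second being the image of the first
  under T ^^ m with m = n i' - n i. Both points tend to p.\<close>

lemma radial_periodic: assumes inj: "inj_on T RS" and p: "p : radial_julia_set T RS" shows "EX m>=1. (T ^^ m) p = p"
proof -
 have injn: "(T ^^ n) x = (T ^^ n) y ==> x : RS ==> y : RS ==> x = y" for n x y
  by (induction n) (auto dest!: inj_onD[OF inj] simp: funpow_in)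
 obtain ep n ph where pRS: "p : RS" and ep: "0 < ep" and n: "strict_mono n"
  and br: "!!j. continuous_on (RS Int ball ((T ^^ n j) p) ep) (ph j) & ph j ` (RS Int ball ((T ^^ n j) p) ep) <= RS &
     (ALL y : RS Int ball ((T ^^ n j) p) ep. (T ^^ n j) (ph j y) = y) & ph j ((T ^^ n j) p) = p"
  and lim: "(%j. diameter (ph j ` (RS Int ball ((T ^^ n j) p) ep))) \<longlonglongrightarrow> 0"
  using p unfolding radial_julia_set_def by blast
 define u where "u j = (T ^^ n j) p" for j
 let ?B = "%j. RS Int ball (u j) ep"
 have uRS: "u j : RS" for j unfolding u_def by (rule funpow_in[OF pRS])
 note br = br[folded u_def] and lim = lim[folded u_def]
 have sec: "ph j y : RS" "(T ^^ n j) (ph j y) = y" if "y : ?B j" for j y using br[of j] that by blast+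
 have near: "dist (ph j y) p <= diameter (ph j ` ?B j)" if "y : ?B j" for j y proof (rule diameter_bounded_bound)
  show "bounded (ph j ` ?B j)" using br[of j] compact_RS compact_imp_bounded bounded_subset by blast
  have "u j : ?B j" using uRS ep by simp
  moreover have "ph j (u j) = p" using br[of j] by blast
  ultimately show "p : ph j ` ?B j" by (metis imageI)
 qed (use that in blast)
 obtain w r where r: "strict_mono (r :: nat => nat)" "(u o r) \<longlonglongrightarrow> w"
  using compact_RS uRS unfolding compact_def by metis
 have "0 < ep/2" using ep by simp
 then obtain k where k: "!!l. k <= l ==> dist (u (r l)) w < ep/2"
  using tendstoD[OF r(2)] unfolding eventually_sequentially o_def by meson
 define i i' where "i = r k" and "i' = r (Suc k)"
 define m where "m = n i' - n i"
 have "n i < n i'" using n r(1) by (simp add: i_def i'_def strict_mono_less)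
 hence m: "1 <= m" "m + n i = n i'" by (auto simp: m_def)
 have Tu: "(T ^^ m) (u i) = u i'" unfolding u_def m(2)[symmetric] by (simp add: funpow_add)
 have uB: "u i : ?B (r l)" "u i' : ?B (r l)" if l: "k <= l" for l
  using uRS k[OF l] k[of k] k[of "Suc k"] dist_triangle2[of "u (r l)" "u i" w] dist_triangle2[of "u (r l)" "u i'" w]
  by (auto simp: i_def i'_def)
 have Tm: "(T ^^ m) (ph (r l) (u i)) = ph (r l) (u i')" if l: "k <= l" for l proof (rule injn[of "n (r l)"])
  have "(T ^^ n (r l)) ((T ^^ m) (ph (r l) (u i))) = (T ^^ m) ((T ^^ n (r l)) (ph (r l) (u i)))"
   by (metis add.commute comp_apply funpow_add)
  thus "(T ^^ n (r l)) ((T ^^ m) (ph (r l) (u i))) = (T ^^ n (r l)) (ph (r l) (u i'))"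
   using sec(2)[OF uB(1)[OF l]] sec(2)[OF uB(2)[OF l]] Tu by simp
 qed (use sec(1)[OF uB(1)[OF l]] sec(1)[OF uB(2)[OF l]] funpow_in in auto)
 have "((%j. diameter (ph j ` ?B j)) o r) \<longlonglongrightarrow> 0" by (rule LIMSEQ_subseq_LIMSEQ[OF lim r(1)])
 hence d0: "(%l. diameter (ph (r l) ` ?B (r l))) \<longlonglongrightarrow> 0" by (simp add: o_def)
 have conv: "(%l. ph (r l) v) \<longlonglongrightarrow> p" if v: "!!l. k <= l ==> v : ?B (r l)" for v
 proof (rule tendsto_dist_iff[THEN iffD2], rule tendsto_sandwich[OF _ _ tendsto_const d0])
  show "eventually (%l. dist (ph (r l) v) p <= diameter (ph (r l) ` ?B (r l))) sequentially"
   unfolding eventually_sequentially using near[OF v] by blast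
 qed simp
 have c1: "(%l. ph (r l) (u i)) \<longlonglongrightarrow> p" and c2: "(%l. ph (r l) (u i')) \<longlonglongrightarrow> p" by (rule conv, rule uB, assumption)+
 have cT: "continuous_on RS (T ^^ m)" using rat_sphere.T_cont[OF rat_sphere_funpow] rat_sphere_axioms by blast
 have ev: "eventually (%l. ph (r l) (u i) : RS) sequentially"
  unfolding eventually_sequentially using sec(1)[OF uB(1)] by blast
 have "(%l. (T ^^ m) (ph (r l) (u i))) \<longlonglongrightarrow> (T ^^ m) p"
  by (rule continuous_on_tendsto_compose[OF cT c1 pRS ev])
 hence "(%l. ph (r l) (u i')) \<longlonglongrightarrow> (T ^^ m) p"
  by (rule Lim_transform_eventually) (use Tm in \<open>auto simp: eventually_sequentially\<close>)
 hence "(T ^^ m) p = p" using c2 LIMSEQ_unique by blast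
 thus ?thesis using m(1) by blast
qed

text \<open>This covers degree one. Either an iterate is the identity, or every iterate has
  countably many fixed points, and radial points are periodic.\<close>

lemma injective_julia_or_radial: assumes inj: "inj_on T RS" shows "Jul = {} | countable (radial_julia_set T RS)"
proof (cases "EX m>=1. ALL z. (T ^^ m) (sg z) = sg z")
 case True
 then obtain m where m: "1 <= m" "!!z. (T ^^ m) (sg z) = sg z" by blast
 have injn: "(T ^^ n) x = (T ^^ n) y ==> x : RS ==> y : RS ==> x = y" for n x y
  by (induction n) (auto dest!: inj_onD[OF inj] simp: funpow_in)
 have "(T ^^ m) np : RS" by (rule funpow_in) simp
 hence "(T ^^ m) np = np" proof (cases rule: sphere_cases)
  case (2 w)
  thus ?thesis using injn[of m np "sg w"] m(2)[of w] by simp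
 qed
 hence id: "(T ^^ m) y = y" if "y : RS" for y using that m(2) sphere_cases by metis
 have per: "(T ^^ (m * j)) y = y" if "y : RS" for j y using that by (induction j) (simp_all add: funpow_add id)
 have "EX r<=m. ALL y:RS. (T ^^ n) y = (T ^^ r) y" for n proof (intro exI[of _ "n mod m"] conjI ballI)
  fix y assume "y : RS"
  have "n = n mod m + m * (n div m)" by simp
  thus "(T ^^ n) y = (T ^^ (n mod m)) y" using per[OF `y : RS`] by (metis comp_apply funpow_add)
 qed (use m(1) in \<open>simp add: order.strict_implies_order\<close>)
 thus ?thesis using finite_iterates_julia_empty by blast
next
 case False
 have "countable {y:RS. (T ^^ m) y = y}" if "m : {1..}" for m proof -
  obtain z where "(T ^^ m) (sg z) ~= sg z" using False `m : {1..}` by auto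
  thus ?thesis using rat_sphere.countable_fixed rat_sphere_funpow rat_sphere_axioms by blast
 qed
 hence "countable (UN m:{1..}. {y:RS. (T ^^ m) y = y})" by (intro countable_UN) auto
 moreover have "radial_julia_set T RS <= (UN m:{1..}. {y:RS. (T ^^ m) y = y})" proof
  fix p assume p: "p : radial_julia_set T RS"
  hence "p : RS" by (simp add: radial_julia_set_def)
  moreover obtain m where "1 <= m" "(T ^^ m) p = p" using radial_periodic[OF inj p] by blast
  ultimately show "p : (UN m:{1..}. {y:RS. (T ^^ m) y = y})" by (intro UN_I[of m]) auto
 qed
 ultimately show ?thesis using countable_subset by blast
qed

lemma conj_mob: assumes x: "x : RS" shows "mob c x : fatou_set (conj_by c T) RS <-> x : Fat"
  "mob c x : radial_julia_set (conj_by c T) RS <-> x : radial_julia_set T RS" proof -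
 define C where "C = 2 + 2 * (cmod c)^2"
 have C: "1 <= C" by (simp add: C_def)
 note ml = mob_lipschitz[of _ _ c, folded C_def]
 let ?S = "conj_by c T"
 have r: "rat_sphere ?S" by (rule rat_sphere_conj[OF rat_sphere_axioms])
 interpret A: conj_sphere T "mob c" "mobi c" C ?S
  by (rule conj_sphere.intro[OF rat_sphere_axioms rat_sphere_mob], rule conj_sphere_axioms.intro[OF _ mobi_mob ml C])
   (simp_all add: conj_by_def)
 interpret B: conj_sphere ?S "mobi c" "mob c" C T
  by (rule conj_sphere.intro[OF r rat_sphere_mob(2,1)], rule conj_sphere_axioms.intro[OF _ mobi_mob(2,1) ml(2,1) C])
   (simp_all add: conj_by_def mobi_mob T_in)
 show "mob c x : fatou_set ?S RS <-> x : Fat"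
  using A.fatou_image[of x] B.fatou_image[of "mob c x"] x by (auto simp: mobi_mob)
 show "mob c x : radial_julia_set ?S RS <-> x : radial_julia_set T RS"
  using A.radial_image[of x] B.radial_image[of "mob c x"] x by (auto simp: mobi_mob)
qed

text \<open>A nonperiodic point of the Fatou set is sent to \<open>np\<close>. It exists because
  periodic points are countable, no iterate being the identity by \<open>gen\<close>, whereas the
  nonempty open Fatou set is uncountable.\<close>

lemma normalize: assumes gen: "finite {y:RS. ~ (EX x1:RS. EX x2:RS. x1 ~= x2 & T x1 = y & T x2 = y)}" (is "finite ?E")
  and fat: "Fat ~= {}" and inf: "infinite Jul" obtains c where "julia_plane (conj_by c T)" proof -
 have nid: "EX z. (T ^^ n) (sg z) ~= sg z" if n: "1 <= n" for n proof (rule ccontr)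
  assume "~ ?thesis"
  hence id: "(T ^^ n) (sg z) = sg z" for z by blast
  have "Jul <= RS" by (auto simp: julia_set_def)
  hence "infinite RS" using inf finite_subset by blast
  hence "infinite (RS - insert (T np) ?E)" using gen by simp
  hence ne: "RS - insert (T np) ?E ~= {}" by (rule infinite_imp_nonempty)
  obtain y where y: "y : RS - insert (T np) ?E" by (rule exE[OF ex_in_conv[THEN iffD2, OF ne]])
  hence yE: "y : RS" "y ~: ?E" "y ~= T np" by blast+
  obtain x1 x2 where x: "x1 : RS" "x2 : RS" "x1 ~= x2" "T x1 = y" "T x2 = y" using yE(1,2) by blast
  hence "x1 ~= np" "x2 ~= np" using yE(3) by metis+
  then obtain z1 z2 where z: "x1 = sg z1" "x2 = sg z2" using x(1,2) sphere_cases by metis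
  obtain k where k: "n = Suc k" using n by (cases n) auto
  have "(T ^^ n) x1 = (T ^^ n) x2" unfolding k funpow_Suc_right o_apply x(4,5) ..
  thus False using id x(3) z by simp
 qed
 define Per where "Per = (UN n:{1..}. {y:RS. (T ^^ n) y = y})"
 have per: "countable Per" unfolding Per_def proof (rule countable_UN)
  fix n :: nat assume "n : {1..}"
  then obtain z where "(T ^^ n) (sg z) ~= sg z" using nid[of n] by auto
  thus "countable {y:RS. (T ^^ n) y = y}" using rat_sphere.countable_fixed rat_sphere_funpow rat_sphere_axioms by blast
 qed simp
 define O' where "O' = {z. sg z : Fat}"
 obtain U where U: "open U" "Fat = RS Int U" using openin_fatou_set[of RS T] by (auto simp: openin_open)
 have "O' = sg -` U" by (rule set_eqI) (simp add: O'_def U(2))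
 hence oO: "open O'" using U(1) by (simp add: open_vimage continuous_on_sg)
 have "O' ~= {}" proof -
  obtain x where x: "x : RS" "x : U" using fat U(2) by blast
  show ?thesis using x(1) proof (cases rule: sphere_cases)
   case 1
   then obtain d where d: "0 < d" "ball np d <= U" using U(1) x(2) open_contains_ball by blast
   define z where "z = complex_of_real (2 / d)"
   have nz: "cmod z = 2 / d" using d(1) by (simp add: z_def norm_divide)
   have p: "0 < (2 / d)^2" using d(1) by simp
   hence "4 / (1 + (2 / d)^2) < 4 / (2 / d)^2" by (intro divide_strict_left_mono) (simp_all add: add_pos_pos)
   also have "... = d^2" using d(1) by (simp add: power_divide)
   finally have "(dist (sg z) np)^2 < d^2" unfolding dist_sg_np nz .
   hence "dist (sg z) np < d" using d(1) by (rule power_less_imp_less_base[OF _ less_imp_le])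
   hence "z : O'" using d(2) U(2) by (auto simp: O'_def dist_commute)
   thus ?thesis by blast
  next
   case (2 z)
   thus ?thesis using x U(2) by (auto simp: O'_def)
  qed
 qed
 then obtain a r where "0 < r" "ball a r <= O'" using oO by (metis ex_in_conv open_contains_ball)
 hence "uncountable O'" using uncountable_ball[of r a] countable_subset by blast
 hence "uncountable (sg ` O')" using countable_image_inj_on[of sg O'] by (auto simp: inj_on_def)
 hence "~ sg ` O' <= Per" using countable_subset[OF _ per] by metis
 then obtain c where c0: "c : O'" "sg c ~: Per" by blast
 have c: "sg c : Fat" "!!n. 1 <= n ==> (T ^^ n) (sg c) ~= sg c" proof -
  show "sg c : Fat" using c0(1) by (simp add: O'_def)
  show "(T ^^ n) (sg c) ~= sg c" if n: "1 <= n" for n proof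
   assume "(T ^^ n) (sg c) = sg c"
   hence "sg c : {y:RS. (T ^^ n) y = y}" by simp
   hence "sg c : Per" unfolding Per_def using n by (intro UN_I[of n]) auto
   thus False using c0(2) by (rule notE[rotated])
  qed
 qed
 have mc: "mob c (sg c) = np" by (simp add: mob_def)
 let ?S = "conj_by c T"
 have S: "?S y = mob c (T (mobi c y))" for y by (simp add: conj_by_def)
 interpret S: rat_sphere ?S by (rule rat_sphere_conj[OF rat_sphere_axioms])
 have Sn: "(?S ^^ n) (mob c x) = mob c ((T ^^ n) x)" if "x : RS" for n x
  by (induction n) (use that in \<open>simp_all add: S mobi_mob funpow_in\<close>)
 have "julia_plane ?S" proof
  show "np : fatou_set ?S RS" using conj_mob(1)[of "sg c" c] c(1) mc by simp
  show "(?S ^^ n) np ~= np" if n: "1 <= n" for n proof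
   assume "(?S ^^ n) np = np"
   hence "mob c ((T ^^ n) (sg c)) = mob c (sg c)" using Sn[of "sg c" n] mc by simp
   hence "(T ^^ n) (sg c) = sg c" using mobi_mob(1)[of _ c] funpow_in[OF sg_in] by (metis sg_in)
   thus False using c(2)[OF n] by simp
  qed
  define gp where "gp R y <-> (EX x1:RS. EX x2:RS. x1 ~= x2 & R x1 = y & R x2 = y)" for R :: "complex*real => complex*real" and y
  have gpS: "gp ?S y" if y: "y : RS" "gp T (mobi c y)" for y proof -
   obtain x1 x2 where x: "x1 : RS" "x2 : RS" "x1 ~= x2" "T x1 = mobi c y" "T x2 = mobi c y" using y(2) unfolding gp_def by blast
   have "mob c x1 ~= mob c x2" using x(1-3) mobi_mob(1) by metis
   moreover have "?S (mob c x1) = y" "?S (mob c x2) = y" using x y(1) by (simp_all add: S mobi_mob)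
   ultimately show ?thesis unfolding gp_def using mob_in(1)[OF x(1), of c] mob_in(1)[OF x(2), of c] by blast
  qed
  have "{y:RS. ~ gp ?S y} <= mob c ` {y:RS. ~ gp T y}" proof
   fix y assume y: "y : {y:RS. ~ gp ?S y}"
   hence "mobi c y : {y:RS. ~ gp T y}" using gpS mob_in(2) by blast
   thus "y : mob c ` {y:RS. ~ gp T y}" using mobi_mob(2)[of y c] y by (intro image_eqI[of _ _ "mobi c y"]) auto
  qed
  thus "finite {y:RS. ~ (EX x1:RS. EX x2:RS. x1 ~= x2 & ?S x1 = y & ?S x2 = y)}"
   using finite_surj[of "{y:RS. ~ gp T y}"] gen unfolding gp_def by blast
  show "infinite (julia_set ?S RS)" proof
   assume f: "finite (julia_set ?S RS)"
   have "Jul <= mobi c ` julia_set ?S RS" proof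
    fix x assume "x : Jul"
    hence "x : RS" "x ~: Fat" by (auto simp: julia_set_def)
    hence "mob c x : julia_set ?S RS" using conj_mob(1) by (simp add: julia_set_def)
    thus "x : mobi c ` julia_set ?S RS" using mobi_mob(1)[OF `x : RS`, of c] by (metis imageI)
   qed
   thus False using f inf finite_surj by blast
  qed
 qed
 thus thesis by (rule that)
qed

end

section \<open>Hausdorff measures of the sphere\<close>

text \<open>Some exponent of measure 0 is needed to make the set in \<open>hausdorff_dim\<close>
  nonempty, so that its infimum has the usual meaning; 3 keeps the counting crude.\<close>

lemma hausdorff_3_sphere: "hm RS 3 RS = 0"
proof -
 define Q where "Q = {z. \<bar>Re z\<bar> <= 1 & \<bar>Im z\<bar> <= 1}"
 have Q0: "hm UNIV 3 Q <= 0" proof (rule hm_least)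
  fix e :: real assume e: "0 < e"
  show "haus_pre UNIV 3 e Q <= 0" proof (rule ennreal_le_epsilon)
   fix x :: real assume x: "0 < x"
   \<comment> \<open>At most 9 * n^2 discs of diameter 8 / n are used; their cubes add up to at most
     9 * 512 / n = 4608 / n.\<close>
   define n where "n = nat \<lceil>8 / e + 4608 / x\<rceil> + 1"
   have n: "1 <= n" "8 / e + 4608 / x <= real n" unfolding n_def by linarith+
   have "0 <= 8 / e" "0 <= 4608 / x" using e x by simp_all
   hence "8 / e <= real n" "4608 / x <= real n" using n(2) by linarith+
   hence n2: "8 / real n <= e" "4608 / real n <= x" using n(1) e x by (simp_all add: field_simps)
   define c where "c ij = Complex (of_int (fst ij) / real n) (of_int (snd ij) / real n)" for ij
   let ?I = "{- int n..int n} \<times> {- int n..int n}"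
   have r: "\<lfloor>s * n\<rfloor> : {- int n..int n} & \<bar>of_int \<lfloor>s * n\<rfloor> / n - s\<bar> <= 2 / n" if s: "\<bar>s\<bar> <= 1" for s :: real
   proof -
    have "- real n <= s * n" "s * n <= real n" using s mult_right_mono[of "-1" s n] mult_right_mono[of s 1 n] by auto
    moreover have "\<bar>of_int \<lfloor>s * n\<rfloor> / n - s\<bar> <= 2 / n" using n(1) by (simp add: abs_le_iff field_simps) linarith
    ultimately show ?thesis by (simp add: le_floor_iff) linarith
   qed
   have "haus_pre UNIV 3 e Q <= ennreal (4608 / real n)"
   proof (rule haus_pre_countable_index_le[where I = ?I and U = "%ij. cball (c ij) (4 / real n)"])
    show "Q <= (UN ij:?I. cball (c ij) (4 / real n))" proof
     fix z assume "z : Q"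
     hence z: "\<bar>Re z\<bar> <= 1" "\<bar>Im z\<bar> <= 1" by (auto simp: Q_def)
     let ?p = "(\<lfloor>Re z * n\<rfloor>, \<lfloor>Im z * n\<rfloor>)"
     have "dist (c ?p) z <= \<bar>Re (c ?p - z)\<bar> + \<bar>Im (c ?p - z)\<bar>" unfolding dist_norm by (rule cmod_le)
     hence "z : cball (c ?p) (4 / real n)" using r[OF z(1)] r[OF z(2)] by (simp add: c_def)
     thus "z : (UN ij:?I. cball (c ij) (4 / real n))" using r[OF z(1)] r[OF z(2)] by blast
    qed
    show "diameter (cball (c ij) (4 / real n)) <= e" for ij using n2(1) by (simp add: diameter_cball)
    fix F assume F: "finite F" "F <= ?I"
    have "(SUM i:F. haus_term 3 (cball (c i) (4 / real n))) = (SUM i:F. ennreal ((8 / real n) ^ 3))"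
     by (intro sum.cong refl) (simp add: haus_term_def diameter_cball powr_numeral)
    also have "... = ennreal (real (card F) * (8 / real n) ^ 3)" by (simp add: ennreal_of_nat_eq_real_of_nat ennreal_mult)
    also have "... <= ennreal (4608 / real n)" proof (rule ennreal_leI)
     have "card F <= card ?I" using F by (intro card_mono) auto
     also have "... = (2 * n + 1) * (2 * n + 1)" by (simp add: card_cartesian_product nat_add_distrib nat_mult_distrib)
     also have "... <= (3 * n) * (3 * n)" using n(1) by (intro mult_le_mono) auto
     finally have "real (card F) <= real ((3 * n) * (3 * n))" by (simp only: of_nat_le_iff)
     hence "real (card F) * (8 / real n) ^ 3 <= real ((3 * n) * (3 * n)) * (8 / real n) ^ 3" by (rule mult_right_mono) simp
     also have "... = 4608 / real n" using n(1) by (simp add: power3_eq_cube field_simps)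
     finally show "real (card F) * (8 / real n) ^ 3 <= 4608 / real n" .
    qed
    finally show "(SUM i:F. haus_term 3 (cball (c i) (4 / real n))) <= ennreal (4608 / real n)" .
   qed (use e in auto)
   also have "... <= ennreal x" using n2(2) by (rule ennreal_leI)
   finally show "haus_pre UNIV 3 e Q <= 0 + ennreal x" by simp
  qed
 qed
 have "hm RS 3 (sg ` Q) <= ennreal (2 powr 3) * hm UNIV 3 Q" by (rule hm_lipschitz) (auto intro: dist_sg_le)
 hence A: "hm RS 3 (sg ` Q) = 0" using Q0 by simp
 have "hm RS 3 (iv ` sg ` Q) <= ennreal (1 powr 3) * hm RS 3 (sg ` Q)" by (rule hm_lipschitz) (auto simp: iv_isometry)
 hence B: "hm RS 3 (iv ` sg ` Q) = 0" using A by simp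
 have "RS <= sg ` Q Un iv ` sg ` Q" proof
  fix y assume "y : RS"
  thus "y : sg ` Q Un iv ` sg ` Q" proof (cases rule: sphere_cases)
   case 1
   have "0 : Q" by (simp add: Q_def)
   thus ?thesis using 1 iv_sg0(1) by (metis UnI2 imageI)
  next
   case (2 z)
   have Qi: "w : Q" if "norm w <= 1" for w using that abs_Re_le_cmod[of w] abs_Im_le_cmod[of w] by (simp add: Q_def)
   show ?thesis proof (cases "norm z <= 1")
    case False
    hence "z ~= 0" "norm (1 / z) <= 1" by (auto simp: norm_divide divide_le_eq_1)
    hence "y = iv (sg (1 / z))" "1 / z : Q" using 2 Qi by (simp_all add: iv_sg)
    thus ?thesis by blast
   qed (use 2 Qi in blast)
  qed
 qed
 hence "hm RS 3 RS <= hm RS 3 (sg ` Q Un iv ` sg ` Q)" by (rule hm_mono)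
 also have "... <= hm RS 3 (sg ` Q) + hm RS 3 (iv ` sg ` Q)" by (rule hm_Un)
 finally show ?thesis using A B by simp
qed

section \<open>Rigidity\<close>

text \<open>Excludes that K is the whole sphere when k = 1: then both L and K - L would be null in
  dimension 2.\<close>

lemma hausdorff_2_sphere: "hm RS 2 RS ~= 0"
proof
 assume 0: "hm RS 2 RS = 0"
 let ?B = "ball (0::complex) 1"
 have "hm UNIV 2 (zt ` sg ` ?B) <= ennreal (1 powr 2) * hm RS 2 (sg ` ?B)" proof (rule hm_lipschitz)
  fix x y assume "x : sg ` ?B" "y : sg ` ?B"
  then obtain u v where uv: "u : ?B" "v : ?B" "x = sg u" "y = sg v" by (elim imageE)
  have "2 * dist u v <= (1 + 1^2) * dist (sg u) (sg v)" by (rule dist_sg_ge) (use uv in auto)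
  thus "dist (zt x) (zt y) <= 1 * dist x y" using uv by simp
 qed (auto simp: image_subset_iff)
 also have "... <= ennreal (1 powr 2) * hm RS 2 RS" by (intro mult_left_mono hm_mono) auto
 finally have "hm UNIV 2 ?B = 0" using 0 by (simp add: image_image)
 hence "emeasure lborel ?B = 0" by (rule hausdorff_2_null_imp_lebesgue_null) simp
 hence "measure lborel ?B = 0" by (simp add: measure_def)
 thus False using content_ball_pos[of 1 "0::complex"] by simp
qed

lemma hausdorff_null_above_dim: assumes L: "L <= RS"
 shows "0 <= hausdorff_dim RS L" "hausdorff_dim RS L < s ==> hm RS s L = 0"
  "countable L ==> hausdorff_dim RS L = 0" proof -
 let ?A = "{s. 0 <= s & hm RS s L = 0}"
 have "hm RS 3 L = 0" using hm_mono[OF L, of RS 3] hausdorff_3_sphere by simp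
 hence ne: "?A ~= {}" by force
 show p: "0 <= hausdorff_dim RS L" unfolding hausdorff_dim_def by (rule cInf_greatest[OF ne]) simp
 have bd: "bdd_below ?A" by (rule bdd_belowI[of _ 0]) simp
 show "hm RS s L = 0" if "hausdorff_dim RS L < s" proof -
  have "Inf ?A < s" using that unfolding hausdorff_dim_def .
  then obtain s' where "s' : ?A" "s' < s" using cInf_lessD[OF ne] by blast
  thus ?thesis using hm_null_exponent_mono[of s' s RS L] by simp
 qed
 assume c: "countable L"
 have "hausdorff_dim RS L <= s" if "0 < s" for s
  unfolding hausdorff_dim_def using hm_countable_null[OF c that L] that by (intro cInf_lower bd) simp
 thus "hausdorff_dim RS L = 0" using p by (meson dense_ge order_antisym)
qed

lemma (in julia_plane) circle_or_arc_conj: assumes c: "connected J" "a : J" "b : J" "a ~= b" "c ~= 0"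
  and sub: "ALL z:J. z = k | (EX t. 1 / (z - k) = p + of_real t * c)" and h: "hom mu mu'"
 shows "mu ` Jul <= mu ` mobi k ` insert np (line p c) &
  (mu ` Jul = mu ` mobi k ` insert np (line p c) | (EX g. arc g & path_image g = mu ` Jul))" proof -
 have JR: "Jul <= RS" by (auto simp: julia_set_def)
 have s: "Jul <= mobi k ` insert np (line p c)" proof
  fix x assume "x : Jul"
  then obtain z where z: "z : J" "x = sg z" using Jul_eq by blast
  show "x : mobi k ` insert np (line p c)" proof (cases "z = k")
   case True
   hence "x = mobi k np" using z by (simp add: mobi_def)
   thus ?thesis by blast
  next
   case False
   then obtain t where t: "1 / (z - k) = p + of_real t * c" using sub z(1) by blast
   have "x = mobi k (sg (1 / (z - k)))" using z False by (simp add: mobi_def iv_sg)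
   thus ?thesis unfolding t line_def by blast
  qed
 qed
 let ?m = "%y. mu (mobi k y)"
 have h2: "hom ?m (%y. mob k (mu' y))" by (rule hom_comp[OF h hom_mobi])
 have cmu: "continuous_on Jul mu" by (rule continuous_on_subset[OF homD(1)[OF h] JR])
 have "connected Jul" unfolding Jul_eq by (intro connected_continuous_image continuous_on_sg continuous_on_id c(1))
 hence K: "compact (mu ` Jul)" "connected (mu ` Jul)"
  using cmu compact_Jul by (auto intro: compact_image connected_continuous_image)
 have ab: "mu (sg a) : mu ` Jul" "mu (sg b) : mu ` Jul" using c(2,3) Jul_eq by blast+
 have ne: "mu (sg a) ~= mu (sg b)" proof
  assume e: "mu (sg a) = mu (sg b)"
  have "sg a = sg b" using arg_cong[OF e, of mu'] unfolding homD(5)[OF h sg_in] .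
  thus False using c(4) by simp
 qed
 have sub2: "mu ` Jul <= ?m ` insert np (line p c)" using s by blast
 from circle_or_arc[OF h2 K ab ne sub2 c(5)] show ?thesis using sub2 unfolding image_image by blast
qed

text \<open>In degree 0 the Julia set is empty, in degree 1 empty or countable, by
  \<open>injective_julia_or_radial\<close> and \<open>hm_0_imp_empty\<close>; this contradicts k >=
  1. In higher degree a Julia set other than the sphere is moved into the plane. For k = 2 this
  contradicts its dimension, and for k = 1 the line found there is carried back by two Moebius
  maps.\<close>

lemma (in rational) rigidity: fixes k :: int defines "K \<equiv> julia_set T RS" and "L \<equiv> radial_julia_set T RS"
 assumes td: "has_top_dim K k" and k: "1 <= k" and full: "hm RS (hausdorff_dim RS L) (K - L) = 0"
  and dim: "hausdorff_dim RS L <= k"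
 shows "(k = 1 --> (EX C. gen_circle C & (K = stereo ` C | (EX g. arc g & path_image g <= stereo ` C & K = path_image g))))
  & (k = 2 --> K = RS)" proof -
 have ni: "~ ind_le (nat k) K" using td k by (simp add: has_top_dim_def)
 moreover have "1 <= nat k" using k by simp
 ultimately have n1: "~ ind_le 1 K" using ind_le_mono by blast
 hence Kne: "K ~= {}" using ind_le_mono[of 0 1 K] by auto
 have LRS: "L <= RS" by (auto simp: L_def radial_julia_set_def)
 have KRS: "K <= RS" by (auto simp: K_def julia_set_def)
 note dimL = hausdorff_null_above_dim[OF LRS]
 have d1: "1 <= d" proof (rule ccontr)
  assume "~ 1 <= d"
  hence "d = 0" by linarith
  then obtain a where a: "!!y. y : RS ==> T y = a" by (rule const_T) blast
  have it: "(T ^^ n) y : RS" if "y : RS" for n y using that by (induction n) (auto simp: T_RS)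
  have "EX r<=1. ALL y:RS. (T ^^ n) y = (T ^^ r) y" for n proof (cases n)
   case (Suc m)
   thus ?thesis using a it by (intro exI[of _ 1]) simp
  qed (auto intro!: exI[of _ 0])
  hence "julia_set T RS = {}" by (rule finite_iterates_julia_empty)
  thus False using Kne by (simp add: K_def)
 qed
 interpret rat_sphere T by (rule rat_sphere_T[OF d1])
 obtain C a b where C: "compact C" "connected C" "C <= K" "a : C" "b : C" "a ~= b"
  using not_ind_le_1_imp_continuum[OF compact_Jul] n1 unfolding K_def by metis
 have uK: "uncountable K" using connected_uncountable[OF C(2,4,5,6)] C(3) countable_subset by blast
 have d2: "2 <= d" proof (rule ccontr)
  assume "~ 2 <= d"
  hence "d = 1" using d1 by linarith
  hence "countable L" using injective_julia_or_radial[OF inj_T] Kne unfolding K_def L_def by blast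
  hence "hm RS 0 (K - L) = 0" using full dimL(3) by simp
  hence "K - L = {}" by (rule hm_0_imp_empty)
  thus False using uK `countable L` countable_subset by (metis Diff_eq_empty_iff)
 qed
 have null: "hm RS s L = 0" if "of_int k < s" for s using dimL(2) dim that by simp
 have fullk: "hm RS (of_int k) (K - L) = 0" using hm_null_exponent_mono[OF dimL(1) dim full] .
 show ?thesis proof (cases "K = RS")
  case True
  have "k ~= 1" proof
   assume k1: "k = 1"
   have "hm RS 2 (K - L) = 0" by (rule hm_null_exponent_mono[OF _ _ fullk]) (use k1 in auto)
   moreover have "hm RS 2 L = 0" by (rule null) (use k1 in simp)
   moreover have "hm RS 2 RS <= hm RS 2 ((K - L) Un L)" using True by (intro hm_mono) blast
   ultimately show False using order_trans[OF _ hm_Un] hausdorff_2_sphere by (metis add_0 le_zero_eq)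
  qed
  thus ?thesis using True by blast
 next
  case False
  hence "Fat ~= {}" by (auto simp: K_def julia_set_def)
  moreover have "infinite Jul" using uK countable_finite unfolding K_def by blast
  ultimately obtain c where "julia_plane (conj_by c T)" by (rule normalize[OF generic_T[OF d2]])
  then interpret S: julia_plane "conj_by c T" .
  have JS: "mob c x : S.Jul <-> x : K" if "x : RS" for x using conj_mob(1)[OF that, of c] that by (simp add: K_def julia_set_def)
  have SJR: "S.Jul <= RS" by (auto simp: julia_set_def)
  have KJ: "K = mobi c ` S.Jul" proof
   show "K <= mobi c ` S.Jul" proof
    fix x assume x: "x : K"
    hence "x : RS" using KRS by blast
    thus "x : mobi c ` S.Jul" using JS x mobi_mob(1)[of x c] by (intro image_eqI[of _ _ "mob c x"]) auto
   qed
   show "mobi c ` S.Jul <= K" proof (rule image_subsetI)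
    fix y assume y: "y : S.Jul"
    hence "y : RS" using SJR by blast
    thus "mobi c y : K" using JS[of "mobi c y"] y by (simp add: mobi_mob)
   qed
  qed
  have inj: "inj_on (mobi c) RS" by (rule inj_on_inverseI[where g = "mob c"]) (rule mobi_mob(2))
  show ?thesis proof (intro conjI impI)
   assume k2: "k = 2"
   have "ind_le 2 ((%z. mobi c (sg z)) ` S.J)" proof (rule planar_ind_le_2[OF S.compact_J S.interior_J_empty])
    show "continuous_on S.J (%z. mobi c (sg z))"
     by (rule continuous_on_compose2[OF homD(1)[OF hom_mobi] continuous_on_sg[OF continuous_on_id]]) auto
    show "inj_on (%z. mobi c (sg z)) S.J" by (rule inj_onI) (auto dest: inj_onD[OF inj])
   qed
   hence "ind_le 2 K" unfolding KJ S.Jul_eq image_image .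
   thus "K = RS" using ni k2 by simp
  next
   assume k1: "k = 1"
   define C' where "C' = (%y. zt (mob c y)) ` C"
   have CR: "C <= RS" using C(3) KRS by blast
   have mC: "mob c ` C <= sg ` S.J" proof (rule image_subsetI)
    fix y assume "y : C"
    hence "mob c y : S.Jul" using JS C(3) CR by blast
    thus "mob c y : sg ` S.J" unfolding S.Jul_eq .
   qed
   have cC: "continuous_on C (%y. zt (mob c y))"
    by (rule continuous_on_compose2[OF continuous_on_zt continuous_on_subset[OF homD(2)[OF hom_mobi] CR]]) (use mC in auto)
   have C1: "compact C'" "connected C'" unfolding C'_def using C(1,2) cC by (auto intro: compact_image connected_continuous_image)
   have C2: "C' <= S.J" unfolding C'_def using mC by force
   have C3: "zt (mob c a) : C'" "zt (mob c b) : C'" unfolding C'_def using C(4,5) by blast+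
   have C4: "zt (mob c a) ~= zt (mob c b)" proof
    assume e: "zt (mob c a) = zt (mob c b)"
    obtain u v where "mob c a = sg u" "mob c b = sg v" using mC C(4,5) by blast
    hence "mob c a = mob c b" using e by simp
    thus False using C(4-6) CR mobi_mob(1) by (metis subsetD)
   qed
   have lip: "hm RS s (mob c ` A) = 0" if "0 < s" "A <= RS" "hm RS s A = 0" for s A proof -
    have "hm RS s (mob c ` A) <= ennreal ((2 + 2 * (cmod c)^2) powr s) * hm RS s A"
     using that(1,2) by (intro hm_lipschitz mob_lipschitz(1)) (auto simp: add_pos_nonneg subset_iff simp del: split_paired_All)
    thus ?thesis using that(3) by simp
   qed
   have img: "A' <= mob c ` A" if "A' <= RS" "!!x. x : RS ==> mob c x : A' ==> x : A" for A A' proof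
    fix y assume y: "y : A'"
    hence "y : RS" using that(1) by blast
   hence "y = mob c (mobi c y)" "mobi c y : RS" by (simp_all add: mobi_mob)
    thus "y : mob c ` A" using that(2)[of "mobi c y"] y by (metis imageI)
   qed
   let ?LS = "radial_julia_set (conj_by c T) RS"
   have nS: "hm RS s ?LS = 0" if "1 < s" for s proof -
    have "?LS <= mob c ` L" by (rule img) (use conj_mob(2) in \<open>auto simp: L_def radial_julia_set_def\<close>)
    moreover have "hm RS s (mob c ` L) = 0" using null[of s] k1 that by (intro lip LRS) auto
    ultimately show ?thesis using hm_mono[of ?LS "mob c ` L" RS s] by simp
   qed
   have fS: "hm RS 1 (S.Jul - ?LS) = 0" proof -
    have "S.Jul - ?LS <= mob c ` (K - L)" by (rule img) (use SJR JS conj_mob(2) in \<open>auto simp: L_def\<close>)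
    moreover have "hm RS 1 (mob c ` (K - L)) = 0" by (rule lip) (use KRS fullk k1 in auto)
    ultimately show ?thesis using hm_mono[of "S.Jul - ?LS" "mob c ` (K - L)" RS 1] by simp
   qed
   obtain k' p' c' where r: "connected S.J" "c' ~= 0" "ALL z:S.J. z = k' | (EX t. 1 / (z - k') = p' + of_real t * c')"
    using S.julia_in_circle[OF nS fS C1 C2 C3 C4] by blast
   have f: "K <= mobi c ` mobi k' ` insert np (line p' c') &
     (K = mobi c ` mobi k' ` insert np (line p' c') | (EX g. arc g & path_image g = K))"
    unfolding KJ by (rule S.circle_or_arc_conj[OF r(1) _ _ C4 r(2,3) hom_mobi]) (use C2 C3 in blast)+
   obtain B D where 1: "0 * D < (cmod B)^2" "insert np (line p' c') = cs 0 B D" by (rule cs_line[OF r(2)])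
   obtain A2 B2 D2 where 2: "A2 * D2 < (cmod B2)^2" "mobi k' ` cs 0 B D = cs A2 B2 D2" by (rule cs_mobi[OF 1(1)])
   obtain A3 B3 D3 where 3: "A3 * D3 < (cmod B3)^2" "mobi c ` cs A2 B2 D2 = cs A3 B3 D3" by (rule cs_mobi[OF 2(1)])
   obtain G where G: "gen_circle G" "cs A3 B3 D3 = stereo ` G" by (rule cs_gen_circle[OF 3(1)])
   show "EX C. gen_circle C & (K = stereo ` C | (EX g. arc g & path_image g <= stereo ` C & K = path_image g))"
    using f G(1) unfolding 1(2) 2(2) 3(2) G(2) by blast
  qed
 qed
qed

theorem theorem3:
  fixes p q :: "complex poly" and k :: int
  assumes "q \<noteq> 0" and "coprime p q"
    and "has_top_dim (julia_set (sphere_map p q) riemann_sphere) k"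
    and "k \<ge> 1"
    and "hausdorff_measure riemann_sphere
           (hausdorff_dim riemann_sphere (radial_julia_set (sphere_map p q) riemann_sphere))
           (julia_set (sphere_map p q) riemann_sphere - radial_julia_set (sphere_map p q) riemann_sphere) = 0"
  shows "hausdorff_dim riemann_sphere (radial_julia_set (sphere_map p q) riemann_sphere) > k
       \<or> ((k = 1 \<longrightarrow> (\<exists>C. gen_circle C \<and>
              (julia_set (sphere_map p q) riemann_sphere = stereo ` C
               \<or> (\<exists>g. arc g \<and> path_image g \<subseteq> stereo ` C
                      \<and> julia_set (sphere_map p q) riemann_sphere = path_image g))))
          \<and> (k = 2 \<longrightarrow> julia_set (sphere_map p q) riemann_sphere = riemann_sphere))"
proof (rule ccontr)
 interpret rational p q using assms(1,2) by unfold_locales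
 assume n: "~ ?thesis"
 hence "hausdorff_dim riemann_sphere (radial_julia_set (sphere_map p q) riemann_sphere) <= k" by linarith
 thus False using n rigidity[unfolded RS_def, OF assms(3-5)] by blast
qed

end
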